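(* There exist a polynomial $f$ and a randomized algorithm that solves the shortest perfect $(A+B)$-path packing problem in $O(f(|V|)^{|A|+|B|})$ time. That is, given a simple undirected graph $G=(V,E)$ and disjoint node subsets $A,B\subseteq V$ with $|A|$ and $|B|$ even, the algorithm finds, in time $O(f(|V|)^{|A|+|B|})$, a perfect $(A+B)$-path packing of minimum size.
   Context: Let $G=(V,E)$ be a simple undirected graph. For $T\subseteq V$, a $T$-path is a path in $G$ connecting two distinct nodes of $T$. For disjoint $A,B\subseteq V$ of even cardinalities, a perfect $(A+B)$-path packing is a set $\mathcal{P}$ of pairwise node-disjoint paths such that each path is an $A$-path or a $B$-path and $|\mathcal{P}|=|A|/2+|B|/2$. The length of a path is its number of edges, and the size of a packing is the sum of the lengths of its paths. The shortest perfect $(A+B)$-path packing problem asks to find a perfect $(A+B)$-path packing of minimum size (or to report that none exists). A randomized algorithm solves the problem if on every input it gives a correct answer with probability at least $1/2$ over its internal random choices. *)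

theory Defs
  imports
    "HOL-Probability.Probability_Mass_Function"
    "HOL-Computational_Algebra.Polynomial"
begin

section \<open>Path packings\<close>

definition simple_graph :: "'a set \<Rightarrow> 'a set set \<Rightarrow> bool" where
  "simple_graph V E \<longleftrightarrow> finite V \<and> (\<forall>e\<in>E. \<exists>u\<in>V. \<exists>v\<in>V. u \<noteq> v \<and> e = {u, v})"

definition graph_path :: "'a set \<Rightarrow> 'a set set \<Rightarrow> 'a list \<Rightarrow> bool" where
  "graph_path V E p \<longleftrightarrow>
     p \<noteq> [] \<and> distinct p \<and> set p \<subseteq> V \<and> successively (\<lambda>u v. {u, v} \<in> E) p"

definition path_length :: "'a list \<Rightarrow> nat" where
  "path_length p = length p - 1"

definition T_path :: "'a set \<Rightarrow> 'a set set \<Rightarrow> 'a set \<Rightarrow> 'a list \<Rightarrow> bool" where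
  "T_path V E T p \<longleftrightarrow>
     graph_path V E p \<and> hd p \<in> T \<and> last p \<in> T \<and> hd p \<noteq> last p"

text \<open>
  A path is given by the list of its nodes in one of the two directions. A packing never contains
  both directions of the same path, since these are not node-disjoint.
\<close>

definition perfect_packing ::
    "'a set \<Rightarrow> 'a set set \<Rightarrow> 'a set \<Rightarrow> 'a set \<Rightarrow> 'a list set \<Rightarrow> bool" where
  "perfect_packing V E A B Ps \<longleftrightarrow>
     finite Ps \<and>
     (\<forall>p\<in>Ps. T_path V E A p \<or> T_path V E B p) \<and>
     pairwise (\<lambda>p q. disjnt (set p) (set q)) Ps \<and>
     card Ps = card A div 2 + card B div 2"

definition packing_size :: "'a list set \<Rightarrow> nat" where
  "packing_size Ps = (\<Sum>p\<in>Ps. path_length p)"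

definition shortest_perfect_packing ::
    "'a set \<Rightarrow> 'a set set \<Rightarrow> 'a set \<Rightarrow> 'a set \<Rightarrow> 'a list set \<Rightarrow> bool" where
  "shortest_perfect_packing V E A B = is_arg_min packing_size (perfect_packing V E A B)"

text \<open>The answer \<open>None\<close> reports that there is no perfect packing.\<close>

definition correct_answer ::
    "'a set \<Rightarrow> 'a set set \<Rightarrow> 'a set \<Rightarrow> 'a set \<Rightarrow> 'a list list option \<Rightarrow> bool" where
  "correct_answer V E A B ans =
     (case ans of
        None \<Rightarrow> \<nexists>Ps. perfect_packing V E A B Ps
      | Some ps \<Rightarrow> distinct ps \<and> shortest_perfect_packing V E A B (set ps))"


section \<open>Randomized programs\<close>

text \<open>
  Algorithms are programs of Jones' WHILE language (N. D. Jones, \<open>Computability and Complexity from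
  a Programming Perspective\<close>, MIT Press 1997) extended by a fair coin. Variables hold binary trees,
  which a program can only build, take apart, and compare with the atom, so that every operation
  takes constant time when trees are represented by pointers. Time in this model is
  polynomially related to time on Turing machines and on random access machines.
\<close>

datatype sexp = Atom | Dot sexp sexp

datatype expr = Var nat | Quote_Atom | Cons_of expr expr | Hd_of expr | Tl_of expr

type_synonym store = "nat \<Rightarrow> sexp"

fun hd_sexp :: "sexp \<Rightarrow> sexp" where
  "hd_sexp Atom = Atom"
| "hd_sexp (Dot x y) = x"

fun tl_sexp :: "sexp \<Rightarrow> sexp" where
  "tl_sexp Atom = Atom"
| "tl_sexp (Dot x y) = y"

fun value_of :: "expr \<Rightarrow> store \<Rightarrow> sexp" where
  "value_of (Var x) s = s x"
| "value_of Quote_Atom s = Atom"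
| "value_of (Cons_of e1 e2) s = Dot (value_of e1 s) (value_of e2 s)"
| "value_of (Hd_of e) s = hd_sexp (value_of e s)"
| "value_of (Tl_of e) s = tl_sexp (value_of e s)"

datatype com =
    Assign nat expr
  | Flip nat
  | Seq com com
  | If_Dot expr com com
  | While_Dot expr com

text \<open>
  A configuration consists of the commands still to be executed, in order, and the store; it is
  final if no command is left. Evaluating an expression counts as a single step: it takes a number
  of primitive operations that is bounded by a constant depending only on the program.
\<close>

type_synonym config = "com list \<times> store"

fun step :: "config \<Rightarrow> config pmf" where
  "step ([], s) = return_pmf ([], s)"
| "step (Assign x e # cs, s) = return_pmf (cs, s(x := value_of e s))"
| "step (Flip x # cs, s) =
     map_pmf (\<lambda>b. (cs, s(x := (if b then Dot Atom Atom else Atom)))) (bernoulli_pmf (1 / 2))"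
| "step (Seq c1 c2 # cs, s) = return_pmf (c1 # c2 # cs, s)"
| "step (If_Dot e c1 c2 # cs, s) =
     return_pmf ((if value_of e s \<noteq> Atom then c1 else c2) # cs, s)"
| "step (While_Dot e c # cs, s) =
     return_pmf (if value_of e s \<noteq> Atom then c # While_Dot e c # cs else cs, s)"

text \<open>Variable 0 holds the input at the beginning and the output at the end.\<close>

definition initial_config :: "com \<Rightarrow> sexp \<Rightarrow> config" where
  "initial_config prog x = ([prog], (\<lambda>_. Atom)(0 := x))"

definition run :: "com \<Rightarrow> sexp \<Rightarrow> nat \<Rightarrow> config pmf" where
  "run prog x t = ((\<lambda>D. bind_pmf D step) ^^ t) (return_pmf (initial_config prog x))"

definition halts_within :: "com \<Rightarrow> sexp \<Rightarrow> nat \<Rightarrow> bool" where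
  "halts_within prog x t \<longleftrightarrow> (\<forall>cfg \<in> set_pmf (run prog x t). fst cfg = [])"

definition prob_output_within :: "com \<Rightarrow> sexp \<Rightarrow> nat \<Rightarrow> sexp set \<Rightarrow> real" where
  "prob_output_within prog x t Y =
     measure_pmf.prob (run prog x t) {(cs, s). cs = [] \<and> s 0 \<in> Y}"


section \<open>Inputs and outputs\<close>

text \<open>
  Numbers are encoded in unary. As nodes are numbered from 0 to \<open>n - 1\<close>, the size of an encoded
  graph is still polynomial in \<open>n\<close>.
\<close>

fun encode_nat :: "nat \<Rightarrow> sexp" where
  "encode_nat 0 = Atom"
| "encode_nat (Suc n) = Dot Atom (encode_nat n)"

fun encode_list :: "('a \<Rightarrow> sexp) \<Rightarrow> 'a list \<Rightarrow> sexp" where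
  "encode_list enc [] = Atom"
| "encode_list enc (x # xs) = Dot (enc x) (encode_list enc xs)"

fun encode_option :: "('a \<Rightarrow> sexp) \<Rightarrow> 'a option \<Rightarrow> sexp" where
  "encode_option enc None = Atom"
| "encode_option enc (Some x) = Dot Atom (enc x)"

definition adjacency_lists :: "nat \<Rightarrow> nat set set \<Rightarrow> nat list list" where
  "adjacency_lists n E = map (\<lambda>u. sorted_list_of_set {v. {u, v} \<in> E}) [0..<n]"

definition encode_instance :: "nat \<Rightarrow> nat set set \<Rightarrow> nat set \<Rightarrow> nat set \<Rightarrow> sexp" where
  "encode_instance n E A B =
     Dot (encode_list encode_nat (sorted_list_of_set A))
    (Dot (encode_list encode_nat (sorted_list_of_set B))
         (encode_list (encode_list encode_nat) (adjacency_lists n E)))"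

definition encode_answer :: "nat list list option \<Rightarrow> sexp" where
  "encode_answer = encode_option (encode_list (encode_list encode_nat))"

end

theory Submission
  imports Defs
begin

text \<open>
  Let \<open>T = A \<union> B\<close>, \<open>K = |A| + |B|\<close>, and give every edge a positive weight. Consider the matrix with ones on the
  diagonal and with the entry \<open>x ^ w\<close> for every edge of weight \<open>w\<close>, and let \<open>Z\<close> be the sum of
  \<open>(- 1) ^ |S \<inter> B|\<close> times the permanent of the rows \<open>V - (T - S)\<close> and the columns \<open>V - S\<close>, over all
  \<open>S \<subseteq> T\<close> with \<open>2 |S| = |T|\<close>. Expanding the permanents gives systems of directed cycles and of directed
  paths that match the terminals. Reversing the path of the least node of \<open>A\<close> that is joined to \<open>B\<close>
  changes the sign, so these systems cancel and only packings survive. If a single packing has minimum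
  weight, then its \<open>2 ^ (K / 2)\<close> orientations have equal signs, so the lowest coefficient of \<open>Z\<close> is nonzero
  modulo \<open>2 ^ K\<close>, and an edge belongs to the packing iff that coefficient vanishes once the edge is
  deleted. By the isolation lemma, random weights on top of a large constant make a shortest packing the
  unique lightest one with probability at least 1/2.

  The permanents are computed modulo \<open>2 ^ K\<close> by Gaussian elimination. A row operation changes a
  permanent by a multiple of a permanent with two equal rows, which is twice a sum of smaller permanents;
  so these are needed modulo half the previous modulus only. The recursion has depth \<open>K\<close>, which bounds
  the number of subproblems by \<open>n ^ O(K)\<close>.
\<close>

section \<open>Polynomial-time programs\<close>

text \<open>A permanent counts every system with coefficient 1, so the factor for \<open>S\<close>
  is the only sign and the cancellation can be arranged by hand. The price is that permanents are
  accessible only modulo powers of 2. The orientations of one packing add up to plus or minus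
  \<open>2 ^ (K / 2)\<close>, which is nonzero modulo \<open>2 ^ K\<close>. Elimination needs pivots
  that are units. Since all weights are positive, the matrix is the identity modulo 2 and x, and row
  operations preserve this. Rows lose their pivots only by deletion of their columns: at the start
  for the terminals in \<open>S\<close>, later for the two columns deleted in an error term. Only
  O(K) rows are affected along any branch, and these are left to Laplace expansion. Exponents and
  multiplicities are written in unary, which suits a bound that is polynomial in
  \<open>P ^ K\<close> for a polynomial P in n. The program computes this number as fuel and hands
  it to a polynomial-time function as part of its input. The coins are fair, so a random weight is a
  number of heads, and isolation has to work with binomial weights.\<close>

definition reaches :: "config \<Rightarrow> nat \<Rightarrow> config \<Rightarrow> bool" where
  "reaches k t k' \<longleftrightarrow> ((\<lambda>D. bind_pmf D step) ^^ t) (return_pmf k) = return_pmf k'"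

lemma reaches_trans [trans]:
  assumes "reaches k t k'" "reaches k' u k''"
  shows "reaches k (t + u) k''"
  using assms unfolding reaches_def by (subst add.commute) (simp add: funpow_add)

lemma reaches_step: "step k = return_pmf k' \<Longrightarrow> reaches k 1 k'"
  by (simp add: reaches_def bind_return_pmf)

lemmas reaches_Suc_0 = reaches_step[unfolded One_nat_def]

text \<open>Ranging over all continuations \<open>cs\<close> and all values of the other variables
  lets programs compose without conditions on scratch variables.\<close>

definition runs :: "com \<Rightarrow> sexp \<Rightarrow> sexp \<Rightarrow> nat \<Rightarrow> bool" where
  "runs c x y t \<longleftrightarrow> (\<forall>s cs. s 0 = x \<longrightarrow>
     (\<exists>s' t'. t' \<le> t \<and> reaches (c # cs, s) t' (cs, s') \<and> s' 0 = y \<and> s' 1 = s 1))"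

lemma runsE:
  assumes "runs c x y t" "s 0 = x"
  obtains s' t' where "t' \<le> t" "reaches (c # cs, s) t' (cs, s')" "s' 0 = y" "s' 1 = s 1"
  using assms unfolding runs_def by blast

lemma runs_witness:
  "reaches (c # cs, s) t' (cs, s') \<Longrightarrow> t' \<le> t \<Longrightarrow> s' 0 = y \<Longrightarrow> s' 1 = s 1 \<Longrightarrow>
   \<exists>s' t'. t' \<le> t \<and> reaches (c # cs, s) t' (cs, s') \<and> s' 0 = y \<and> s' 1 = s 1"
  by blast

lemma runs_mono: "runs c x y t \<Longrightarrow> t \<le> u \<Longrightarrow> runs c x y u"
  unfolding runs_def by (metis order_trans)

lemma runs_Assign:
  assumes "\<And>s. s 0 = x \<Longrightarrow> value_of e s = y"
  shows "runs (Assign 0 e) x y 1"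
  unfolding runs_def
proof (intro allI impI)
  fix s :: store and cs assume "s 0 = x"
  then show "\<exists>s' t'. t' \<le> 1 \<and> reaches (Assign 0 e # cs, s) t' (cs, s') \<and> s' 0 = y \<and> s' 1 = s 1"
    using assms by (intro exI[of _ "s(0 := y)"] exI[of _ 1]) (auto intro!: reaches_Suc_0)
qed

lemma runs_Seq:
  assumes "runs c1 x y t" "runs c2 y z u"
  shows "runs (Seq c1 c2) x z (t + u + 1)"
  unfolding runs_def
proof (intro allI impI)
  fix s :: store and cs assume s: "s 0 = x"
  obtain s1 t1 where 1: "t1 \<le> t" "reaches (c1 # c2 # cs, s) t1 (c2 # cs, s1)" "s1 0 = y" "s1 1 = s 1"
    using runsE[OF assms(1), where s = s and cs = "c2 # cs"] s by blast
  obtain s2 t2 where 2: "t2 \<le> u" "reaches (c2 # cs, s1) t2 (cs, s2)" "s2 0 = z" "s2 1 = s1 1"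
    using runsE[OF assms(2), where s = s1 and cs = cs] 1(3) by blast
  have "reaches (Seq c1 c2 # cs, s) 1 (c1 # c2 # cs, s)" by (intro reaches_step) simp
  also note 1(2) also note 2(2)
  finally show "\<exists>s' t'. t' \<le> t + u + 1 \<and> reaches (Seq c1 c2 # cs, s) t' (cs, s') \<and> s' 0 = z \<and> s' 1 = s 1"
    by (rule runs_witness) (use 1(1,4) 2(1,3,4) in simp_all)
qed

text \<open>Variable 1 serves as a stack that every program leaves as it found it.\<close>

definition pair_com :: "com \<Rightarrow> com \<Rightarrow> com" where
  "pair_com c1 c2 =
     Seq (Assign 1 (Cons_of (Var 0) (Var 1))) (Seq c1
    (Seq (Assign 1 (Cons_of (Var 0) (Var 1))) (Seq (Assign 0 (Hd_of (Tl_of (Var 1)))) (Seq c2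
    (Seq (Assign 0 (Cons_of (Hd_of (Var 1)) (Var 0))) (Assign 1 (Tl_of (Tl_of (Var 1)))))))))"

text \<open>The constant 11 counts five assignments and six unfoldings of \<open>Seq\<close>. The
  input stays on the stack during \<open>c1\<close>, and the result of \<open>c1\<close> lies on top
  of it during \<open>c2\<close>.\<close>

lemma runs_pair_com:
  assumes "runs c1 x y t" "runs c2 x z u"
  shows "runs (pair_com c1 c2) x (Dot y z) (t + u + 11)"
  unfolding runs_def
proof (intro allI impI)
  fix s :: store and cs assume s: "s 0 = x"
  let ?r3 = "Seq (Assign 0 (Cons_of (Hd_of (Var 1)) (Var 0))) (Assign 1 (Tl_of (Tl_of (Var 1))))"
  let ?r2 = "Seq (Assign 1 (Cons_of (Var 0) (Var 1))) (Seq (Assign 0 (Hd_of (Tl_of (Var 1)))) (Seq c2 ?r3))"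
  let ?s1 = "s(1 := Dot x (s 1))"
  have *: "?s1 0 = x" using s by simp
  obtain s2 t2 where 2: "t2 \<le> t" "reaches (c1 # ?r2 # cs, ?s1) t2 (?r2 # cs, s2)" "s2 0 = y" "s2 1 = ?s1 1"
    using runsE[OF assms(1), where s = ?s1 and cs = "?r2 # cs"] * by blast
  let ?s3 = "s2(1 := Dot y (Dot x (s 1)))"
  let ?s4 = "?s3(0 := x)"
  have **: "?s4 0 = x" by simp
  obtain s5 t5 where 5: "t5 \<le> u" "reaches (c2 # ?r3 # cs, ?s4) t5 (?r3 # cs, s5)" "s5 0 = z" "s5 1 = ?s4 1"
    using runsE[OF assms(2), where s = ?s4 and cs = "?r3 # cs"] ** by blast
  let ?s6 = "s5(0 := Dot y z)"
  let ?s7 = "?s6(1 := s 1)"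
  have "reaches (pair_com c1 c2 # cs, s) 1 (Assign 1 (Cons_of (Var 0) (Var 1)) # Seq c1 ?r2 # cs, s)"
    by (intro reaches_step) (simp add: pair_com_def)
  also have "reaches \<dots> 1 (Seq c1 ?r2 # cs, ?s1)" using s by (intro reaches_step) simp
  also have "reaches \<dots> 1 (c1 # ?r2 # cs, ?s1)" by (intro reaches_step) simp
  also note 2(2)
  also have "reaches (?r2 # cs, s2) 1 (Assign 1 (Cons_of (Var 0) (Var 1)) #
      Seq (Assign 0 (Hd_of (Tl_of (Var 1)))) (Seq c2 ?r3) # cs, s2)" by (intro reaches_step) simp
  also have "reaches \<dots> 1 (Seq (Assign 0 (Hd_of (Tl_of (Var 1)))) (Seq c2 ?r3) # cs, ?s3)"
    using 2 by (intro reaches_step) simp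
  also have "reaches \<dots> 1 (Assign 0 (Hd_of (Tl_of (Var 1))) # Seq c2 ?r3 # cs, ?s3)"
    by (intro reaches_step) simp
  also have "reaches \<dots> 1 (Seq c2 ?r3 # cs, ?s4)" by (intro reaches_step) simp
  also have "reaches \<dots> 1 (c2 # ?r3 # cs, ?s4)" by (intro reaches_step) simp
  also note 5(2)
  also have "reaches (?r3 # cs, s5) 1 (Assign 0 (Cons_of (Hd_of (Var 1)) (Var 0)) #
      Assign 1 (Tl_of (Tl_of (Var 1))) # cs, s5)" by (intro reaches_step) simp
  also have "reaches \<dots> 1 (Assign 1 (Tl_of (Tl_of (Var 1))) # cs, ?s6)" using 5 by (intro reaches_step) simp
  also have "reaches \<dots> 1 (cs, ?s7)" using 5 by (intro reaches_step) simp
  finally show "\<exists>s' t'. t' \<le> t + u + 11 \<and> reaches (pair_com c1 c2 # cs, s) t' (cs, s') \<and>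
      s' 0 = Dot y z \<and> s' 1 = s 1"
    by (rule runs_witness) (use 2(1,4) 5(1,4) in simp_all)
qed

lemma runs_If_Dot:
  assumes "hd_sexp x \<noteq> Atom \<Longrightarrow> runs c1 x y t" "hd_sexp x = Atom \<Longrightarrow> runs c2 x y t"
  shows "runs (If_Dot (Hd_of (Var 0)) c1 c2) x y (t + 1)"
  unfolding runs_def
proof (intro allI impI)
  fix s :: store and cs assume s: "s 0 = x"
  define c where "c = (if hd_sexp x \<noteq> Atom then c1 else c2)"
  have "runs c x y t" using assms by (simp add: c_def)
  then obtain s1 t1 where 1: "t1 \<le> t" "reaches (c # cs, s) t1 (cs, s1)" "s1 0 = y" "s1 1 = s 1"
    using runsE[where s = s and cs = cs] s by blast
  have "reaches (If_Dot (Hd_of (Var 0)) c1 c2 # cs, s) 1 (c # cs, s)"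
    using s by (intro reaches_step) (simp add: c_def)
  also note 1(2)
  finally show "\<exists>s' t'. t' \<le> t + 1 \<and> reaches (If_Dot (Hd_of (Var 0)) c1 c2 # cs, s) t' (cs, s') \<and>
      s' 0 = y \<and> s' 1 = s 1"
    by (rule runs_witness) (use 1(1,3,4) in simp_all)
qed

text \<open>Computing the condition overwrites variable 0. It is therefore paired with a copy of the
  input, and each branch starts by stripping off the value of the condition.\<close>

definition if_com :: "com \<Rightarrow> com \<Rightarrow> com \<Rightarrow> com" where
  "if_com c0 c1 c2 = Seq (pair_com c0 (Assign 0 (Var 0)))
     (If_Dot (Hd_of (Var 0)) (Seq (Assign 0 (Tl_of (Var 0))) c1) (Seq (Assign 0 (Tl_of (Var 0))) c2))"

lemma runs_if_com:
  assumes "runs c0 x b t0" "b \<noteq> Atom \<Longrightarrow> runs c1 x y t" "b = Atom \<Longrightarrow> runs c2 x y t"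
  shows "runs (if_com c0 c1 c2) x y (t0 + t + 16)"
proof -
  have tl: "runs (Assign 0 (Tl_of (Var 0))) (Dot b x) x 1" by (rule runs_Assign) simp
  have id: "runs (Assign 0 (Var 0)) x x 1" by (rule runs_Assign) simp
  have p: "runs (pair_com c0 (Assign 0 (Var 0))) x (Dot b x) (t0 + 1 + 11)"
    using runs_pair_com[OF assms(1) id] .
  have i: "runs (If_Dot (Hd_of (Var 0)) (Seq (Assign 0 (Tl_of (Var 0))) c1)
      (Seq (Assign 0 (Tl_of (Var 0))) c2)) (Dot b x) y (1 + t + 1 + 1)"
  proof (rule runs_If_Dot)
    show "runs (Seq (Assign 0 (Tl_of (Var 0))) c1) (Dot b x) y (1 + t + 1)" if "hd_sexp (Dot b x) \<noteq> Atom"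
      using that by (intro runs_Seq[OF tl] assms(2)) simp
    show "runs (Seq (Assign 0 (Tl_of (Var 0))) c2) (Dot b x) y (1 + t + 1)" if "hd_sexp (Dot b x) = Atom"
      using that by (intro runs_Seq[OF tl] assms(3)) simp
  qed
  show ?thesis
    unfolding if_com_def
  proof (rule runs_mono[OF runs_Seq[OF p i]])
    show "t0 + 1 + 11 + (1 + t + 1 + 1) + 1 \<le> t0 + t + 16" by linarith
  qed
qed

text \<open>The sequence \<open>x\<close> lists the values of variable 0 before the successive
  iterations. Each iteration costs its body and one test; the final 1 is the test that ends the
  loop.\<close>

lemma runs_While_Dot:
  assumes "\<And>i. i < k \<Longrightarrow> hd_sexp (x i) \<noteq> Atom" "\<And>i. i < k \<Longrightarrow> runs c (x i) (x (Suc i)) t"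
    and "hd_sexp (x k) = Atom"
  shows "runs (While_Dot (Hd_of (Var 0)) c) (x 0) (x k) (k * (t + 1) + 1)"
  using assms
proof (induction k arbitrary: x)
  case 0
  show ?case unfolding runs_def
  proof (intro allI impI)
    fix s :: store and cs assume "s 0 = x 0"
    then show "\<exists>s' t'. t' \<le> 0 * (t + 1) + 1 \<and>
        reaches (While_Dot (Hd_of (Var 0)) c # cs, s) t' (cs, s') \<and> s' 0 = x 0 \<and> s' 1 = s 1"
      using 0 by (intro exI[of _ s] exI[of _ 1]) (auto intro!: reaches_Suc_0)
  qed
next
  case (Suc k)
  let ?w = "While_Dot (Hd_of (Var 0)) c"
  have IH: "runs ?w (x 1) (x (Suc k)) (k * (t + 1) + 1)"
  proof -
    have "runs ?w (x (Suc 0)) (x (Suc k)) (k * (t + 1) + 1)"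
      by (rule Suc.IH) (use Suc.prems in auto)
    then show ?thesis by simp
  qed
  show ?case unfolding runs_def
  proof (intro allI impI)
    fix s :: store and cs assume s: "s 0 = x 0"
    have c: "runs c (x 0) (x 1) t" unfolding One_nat_def by (rule Suc.prems(2)) simp
    obtain s1 t1 where 1: "t1 \<le> t" "reaches (c # ?w # cs, s) t1 (?w # cs, s1)" "s1 0 = x 1" "s1 1 = s 1"
      using runsE[OF c, where s = s and cs = "?w # cs"] s by blast
    obtain s2 t2 where 2: "t2 \<le> k * (t + 1) + 1" "reaches (?w # cs, s1) t2 (cs, s2)" "s2 0 = x (Suc k)" "s2 1 = s1 1"
      using runsE[OF IH, where s = s1 and cs = cs] 1(3) by blast
    have "reaches (?w # cs, s) 1 (c # ?w # cs, s)"
    proof (rule reaches_step)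
      have "hd_sexp (x 0) \<noteq> Atom" by (rule Suc.prems(1)) simp
      then show "step (?w # cs, s) = return_pmf (c # ?w # cs, s)" using s by simp
    qed
    also note 1(2) also note 2(2)
    finally show "\<exists>s' t'. t' \<le> Suc k * (t + 1) + 1 \<and> reaches (?w # cs, s) t' (cs, s') \<and>
        s' 0 = x (Suc k) \<and> s' 1 = s 1"
    by (rule runs_witness) (use 1(1,4) 2(1,3,4) in simp_all)
  qed
qed

text \<open>The prescribed formats of inputs and outputs become instances of one type class, so that
  computability can be stated for HOL functions. Among lists, numbers and truth values only
  \<open>[]\<close>, 0 and \<open>False\<close> become \<open>Atom\<close>, which makes them
  testable by a program.\<close>

class enc = fixes enc :: "'a \<Rightarrow> sexp"

instantiation nat :: enc begin
definition enc_nat_def: "enc = encode_nat"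
instance ..
end

instantiation unit :: enc begin
definition enc_unit_def: "enc (u :: unit) = Atom"
instance ..
end

instantiation bool :: enc begin
definition enc_bool_def: "enc b = (if b then Dot Atom Atom else Atom)"
instance ..
end

instantiation prod :: (enc, enc) enc begin
definition enc_prod_def: "enc p = Dot (enc (fst p)) (enc (snd p))"
instance ..
end

instantiation list :: (enc) enc begin
definition enc_list_def: "enc = encode_list enc"
instance ..
end

instantiation option :: (enc) enc begin
definition enc_option_def: "enc = encode_option enc"
instance ..
end

lemma enc_simps [simp]:
  "enc (0::nat) = Atom" "enc (Suc n) = Dot Atom (enc n)" "enc () = Atom"
  "enc True = Dot Atom Atom" "enc False = Atom" "enc (a, b) = Dot (enc a) (enc b)"
  "enc [] = Atom" "enc (x # xs) = Dot (enc x) (enc xs)" "enc None = Atom"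
  "enc (Some x) = Dot Atom (enc x)"
  by (simp_all add: enc_nat_def enc_unit_def enc_bool_def enc_prod_def enc_list_def enc_option_def)

section \<open>Sizes of encodings and polynomial bounds\<close>

definition sz :: "'a::enc \<Rightarrow> nat" where "sz a = size (enc a)"

lemma sz_simps [simp]:
  "sz (a, b) = Suc (sz a + sz b)" "sz [] = 0" "sz (x # xs) = Suc (sz x + sz xs)" "sz () = 0"
  "sz True = 1" "sz False = 0"
  by (simp_all add: sz_def)

lemma sz_nat [simp]: "sz (n::nat) = n"
  by (induction n) (simp_all add: sz_def)

lemma sz_list: "sz xs = (\<Sum>x\<leftarrow>xs. Suc (sz x))"
  by (induction xs) simp_all

lemma length_le_sz: "length xs \<le> sz xs"
  by (induction xs) simp_all

lemma sz_append [simp]: "sz (xs @ ys) = sz xs + sz ys"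
  by (simp add: sz_list)

lemma sz_rev [simp]: "sz (rev xs) = sz xs"
  by (induction xs) simp_all

lemma sz_elem: "x \<in> set xs \<Longrightarrow> sz x < sz xs"
  by (induction xs) auto

lemma sz_list_le: "(\<And>x. x \<in> set xs \<Longrightarrow> sz x \<le> b) \<Longrightarrow> sz xs \<le> length xs * Suc b"
proof (induction xs)
  case (Cons x xs)
  have "sz x \<le> b" "sz xs \<le> length xs * Suc b" using Cons by auto
  then show ?case by simp
qed simp

text \<open>The base is at least 2 even for arguments of size 0, so constants, sums and products are
  absorbed by a larger exponent and a single power suffices. The set \<open>D\<close> carries
  preconditions on the arguments.\<close>

definition pbounded :: "'a::enc set \<Rightarrow> ('a \<Rightarrow> nat) \<Rightarrow> bool" where
  "pbounded D g \<longleftrightarrow> (\<exists>d. \<forall>a\<in>D. g a \<le> (sz a + 2) ^ d)"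

lemma pbounded_mono: "pbounded D g \<Longrightarrow> (\<And>a. a \<in> D \<Longrightarrow> h a \<le> g a) \<Longrightarrow> pbounded D h"
  unfolding pbounded_def by (meson order_trans)

lemma pbounded_subset: "pbounded D g \<Longrightarrow> D' \<subseteq> D \<Longrightarrow> pbounded D' g"
  unfolding pbounded_def by blast

lemma pbounded_const: "pbounded D (\<lambda>a. c)"
  unfolding pbounded_def
proof (intro exI ballI)
  fix a
  have "c \<le> 2 ^ c" by (simp add: less_imp_le_nat)
  also have "\<dots> \<le> (sz a + 2) ^ c" by (rule power_mono) auto
  finally show "c \<le> (sz a + 2) ^ c" .
qed

lemma pbounded_sz: "pbounded D sz"
  unfolding pbounded_def by (rule exI[of _ 1]) auto

lemma pbounded_add:
  assumes "pbounded D g" "pbounded D h"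
  shows "pbounded D (\<lambda>a. g a + h a)"
proof -
  obtain d e where d: "\<And>a. a \<in> D \<Longrightarrow> g a \<le> (sz a + 2) ^ d" and e: "\<And>a. a \<in> D \<Longrightarrow> h a \<le> (sz a + 2) ^ e"
    using assms unfolding pbounded_def by blast
  have "g a + h a \<le> (sz a + 2) ^ (d + e + 1)" if "a \<in> D" for a
  proof -
    let ?x = "sz a + 2"
    have "?x ^ d \<le> ?x ^ (d + e)" "?x ^ e \<le> ?x ^ (d + e)" by (auto intro!: power_increasing)
    then have "g a + h a \<le> 2 * ?x ^ (d + e)" using d[OF that] e[OF that] by linarith
    also have "\<dots> \<le> ?x * ?x ^ (d + e)" by (rule mult_right_mono) auto
    finally show ?thesis by simp
  qed
  then show ?thesis unfolding pbounded_def by blast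
qed

lemma pbounded_mult:
  assumes "pbounded D g" "pbounded D h"
  shows "pbounded D (\<lambda>a. g a * h a)"
proof -
  obtain d e where d: "\<And>a. a \<in> D \<Longrightarrow> g a \<le> (sz a + 2) ^ d" and e: "\<And>a. a \<in> D \<Longrightarrow> h a \<le> (sz a + 2) ^ e"
    using assms unfolding pbounded_def by blast
  have "g a * h a \<le> (sz a + 2) ^ (d + e)" if "a \<in> D" for a
    unfolding power_add by (rule mult_mono) (use d e that in auto)
  then show ?thesis unfolding pbounded_def by blast
qed

lemma pbounded_power: "pbounded D g \<Longrightarrow> pbounded D (\<lambda>a. g a ^ k)"
  by (induction k) (auto intro: pbounded_const[of _ "Suc 0"] pbounded_mult)

lemmas pbounded_intros = pbounded_const pbounded_sz pbounded_add pbounded_mult pbounded_power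

lemma pbounded_comp:
  assumes "pbounded D' g" "pbounded D (\<lambda>a. sz (f a))" "\<And>a. a \<in> D \<Longrightarrow> f a \<in> D'"
  shows "pbounded D (\<lambda>a. g (f a))"
proof -
  obtain d where d: "\<And>a. a \<in> D' \<Longrightarrow> g a \<le> (sz a + 2) ^ d"
    using assms(1) unfolding pbounded_def by blast
  have "pbounded D (\<lambda>a. (sz (f a) + 2) ^ d)" by (intro pbounded_intros assms)
  then show ?thesis by (rule pbounded_mono) (use d assms(3) in auto)
qed

lemma pbounded_if:
  assumes "pbounded {a \<in> D. b a} g" "pbounded {a \<in> D. \<not> b a} h"
  shows "pbounded D (\<lambda>a. if b a then g a else h a)"
proof -
  obtain d e where d: "\<And>a. a \<in> D \<Longrightarrow> b a \<Longrightarrow> g a \<le> (sz a + 2) ^ d"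
    and e: "\<And>a. a \<in> D \<Longrightarrow> \<not> b a \<Longrightarrow> h a \<le> (sz a + 2) ^ e"
    using assms unfolding pbounded_def by blast
  have "pbounded D (\<lambda>a. (sz a + 2) ^ d + (sz a + 2) ^ e)" by (intro pbounded_intros)
  then show ?thesis
    by (rule pbounded_mono) (use d e in \<open>auto intro: trans_le_add1 trans_le_add2\<close>)
qed

text \<open>The function \<open>f\<close> is computable in polynomial time on the arguments in \<open>D\<close>.\<close>

definition ptime :: "'a::enc set \<Rightarrow> ('a \<Rightarrow> 'b::enc) \<Rightarrow> bool" where
  "ptime D f \<longleftrightarrow> pbounded D (\<lambda>a. sz (f a)) \<and>
     (\<exists>c g. pbounded D g \<and> (\<forall>a\<in>D. runs c (enc a) (enc (f a)) (g a)))"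

section \<open>Closure properties of polynomial-time functions\<close>

named_theorems ptime_intros

text \<open>The size of the result is an obligation of its own: with shared subtrees,
  \<open>Cons_of (Var 0) (Var 0)\<close> doubles a tree in a single step, so a short running time
  does not bound sizes.\<close>

lemma ptimeI:
  "pbounded D (\<lambda>a. sz (f a)) \<Longrightarrow> pbounded D g \<Longrightarrow> (\<And>a. a \<in> D \<Longrightarrow> runs c (enc a) (enc (f a)) (g a)) \<Longrightarrow> ptime D f"
  unfolding ptime_def by blast

lemma ptime_pbounded: "ptime D f \<Longrightarrow> pbounded D (\<lambda>a. sz (f a))"
  unfolding ptime_def by blast

lemma ptime_subset: "ptime D f \<Longrightarrow> D' \<subseteq> D \<Longrightarrow> ptime D' f"
  unfolding ptime_def by (metis pbounded_subset subsetD)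

lemma ptime_id [ptime_intros]: "ptime D (\<lambda>a. a)"
  by (rule ptimeI[OF pbounded_sz pbounded_const runs_Assign[where e = "Var 0"]]) simp

fun quote_expr :: "sexp \<Rightarrow> expr" where
  "quote_expr Atom = Quote_Atom"
| "quote_expr (Dot x y) = Cons_of (quote_expr x) (quote_expr y)"

lemma value_of_quote_expr [simp]: "value_of (quote_expr x) s = x"
  by (induction x) simp_all

lemma ptime_const [ptime_intros]: "ptime D (\<lambda>a. b)"
  by (rule ptimeI[OF pbounded_const pbounded_const runs_Assign[where e = "quote_expr (enc b)"]]) simp

lemma ptime_comp:
  assumes "ptime D f" "ptime D' h" "\<And>a. a \<in> D \<Longrightarrow> f a \<in> D'"
  shows "ptime D (\<lambda>a. h (f a))"
proof -
  obtain c g where f: "pbounded D (\<lambda>a. sz (f a))" "pbounded D g" "\<And>a. a \<in> D \<Longrightarrow> runs c (enc a) (enc (f a)) (g a)"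
    using assms(1) unfolding ptime_def by blast
  obtain c' g' where h: "pbounded D' (\<lambda>a. sz (h a))" "pbounded D' g'"
    "\<And>a. a \<in> D' \<Longrightarrow> runs c' (enc a) (enc (h a)) (g' a)"
    using assms(2) unfolding ptime_def by blast
  show ?thesis
  proof (rule ptimeI)
    show "pbounded D (\<lambda>a. sz (h (f a)))" by (rule pbounded_comp[OF h(1) f(1) assms(3)])
    show "pbounded D (\<lambda>a. g a + g' (f a) + 1)"
      by (intro pbounded_add f(2) pbounded_comp[OF h(2) f(1) assms(3)] pbounded_const)
    show "runs (Seq c c') (enc a) (enc (h (f a))) (g a + g' (f a) + 1)" if "a \<in> D" for a
      by (rule runs_Seq[OF f(3)[OF that] h(3)[OF assms(3)[OF that]]])
  qed
qed

text \<open>Programs see encodings only. This yields list cells, \<open>Some\<close> and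
  \<open>Suc\<close> from pairing, and allows a function to be replaced by one that agrees with it
  on \<open>D\<close>.\<close>

lemma ptime_coerce:
  assumes "ptime D f" "\<And>a. a \<in> D \<Longrightarrow> enc (h a) = enc (f a)"
  shows "ptime D h"
proof -
  obtain c g where f: "pbounded D (\<lambda>a. sz (f a))" "pbounded D g" "\<And>a. a \<in> D \<Longrightarrow> runs c (enc a) (enc (f a)) (g a)"
    using assms(1) unfolding ptime_def by blast
  show ?thesis
    by (rule ptimeI[of _ _ g c]) (use f assms(2) in \<open>auto simp: sz_def elim!: pbounded_mono\<close>)
qed

lemma ptime_expr:
  assumes "ptime D f" "\<And>a s. a \<in> D \<Longrightarrow> s 0 = enc (f a) \<Longrightarrow> value_of e s = enc (h a)"
    "\<And>a. a \<in> D \<Longrightarrow> sz (h a) \<le> sz (f a)"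
  shows "ptime D h"
proof -
  obtain c g where f: "pbounded D (\<lambda>a. sz (f a))" "pbounded D g" "\<And>a. a \<in> D \<Longrightarrow> runs c (enc a) (enc (f a)) (g a)"
    using assms(1) unfolding ptime_def by blast
  show ?thesis
  proof (rule ptimeI[of _ _ "\<lambda>a. g a + 1 + 1" "Seq c (Assign 0 e)"])
    show "pbounded D (\<lambda>a. sz (h a))" using f(1) assms(3) by (rule pbounded_mono)
    show "pbounded D (\<lambda>a. g a + 1 + 1)" by (intro pbounded_intros f)
    show "runs (Seq c (Assign 0 e)) (enc a) (enc (h a)) (g a + 1 + 1)" if "a \<in> D" for a
      by (intro runs_Seq runs_Assign) (use f that assms in auto)
  qed
qed

lemma ptime_fst [ptime_intros]: "ptime D f \<Longrightarrow> ptime D (\<lambda>a. fst (f a))"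
  by (rule ptime_expr[where e = "Hd_of (Var 0)"]) (auto simp: enc_prod_def sz_def)

lemma ptime_snd [ptime_intros]: "ptime D f \<Longrightarrow> ptime D (\<lambda>a. snd (f a))"
  by (rule ptime_expr[where e = "Tl_of (Var 0)"]) (auto simp: enc_prod_def sz_def)

lemma ptime_case_prod [ptime_intros]:
  "ptime D (\<lambda>a. F a (fst (f a)) (snd (f a))) \<Longrightarrow> ptime D (\<lambda>a. case f a of (x, y) \<Rightarrow> F a x y)"
  by (simp add: case_prod_beta)

lemma ptime_Pair [ptime_intros]:
  assumes "ptime D f" "ptime D h"
  shows "ptime D (\<lambda>a. (f a, h a))"
proof -
  obtain c g where f: "pbounded D (\<lambda>a. sz (f a))" "pbounded D g" "\<And>a. a \<in> D \<Longrightarrow> runs c (enc a) (enc (f a)) (g a)"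
    using assms(1) unfolding ptime_def by blast
  obtain c' g' where h: "pbounded D (\<lambda>a. sz (h a))" "pbounded D g'"
    "\<And>a. a \<in> D \<Longrightarrow> runs c' (enc a) (enc (h a)) (g' a)"
    using assms(2) unfolding ptime_def by blast
  show ?thesis
  proof (rule ptimeI[of _ _ "\<lambda>a. g a + g' a + 11" "pair_com c c'"])
    have "pbounded D (\<lambda>a. 1 + (sz (f a) + sz (h a)))" by (intro pbounded_intros f h)
    then show "pbounded D (\<lambda>a. sz (f a, h a))" by simp
    show "pbounded D (\<lambda>a. g a + g' a + 11)" by (intro pbounded_intros f h)
    show "runs (pair_com c c') (enc a) (enc (f a, h a)) (g a + g' a + 11)" if "a \<in> D" for a
      using runs_pair_com[OF f(3)[OF that] h(3)[OF that]] by simp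
  qed
qed

lemma ptime_Cons [ptime_intros]: "ptime D f \<Longrightarrow> ptime D h \<Longrightarrow> ptime D (\<lambda>a. f a # h a)"
  by (rule ptime_coerce[OF ptime_Pair]) auto

lemma ptime_Some [ptime_intros]: "ptime D f \<Longrightarrow> ptime D (\<lambda>a. Some (f a))"
  by (rule ptime_coerce[OF ptime_Pair[OF ptime_const[of _ "()"]]]) auto

lemma ptime_Suc [ptime_intros]: "ptime D f \<Longrightarrow> ptime D (\<lambda>a. Suc (f a))"
  by (rule ptime_coerce[OF ptime_Pair[OF ptime_const[of _ "()"]]]) auto

lemma ptime_tl [ptime_intros]: "ptime D f \<Longrightarrow> ptime D (\<lambda>a. tl (f a))"
proof (rule ptime_expr[where e = "Tl_of (Var 0)"])
  fix a and s :: store assume "s 0 = enc (f a)"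
  then show "value_of (Tl_of (Var 0)) s = enc (tl (f a))" by (cases "f a") auto
next
  fix a show "sz (tl (f a)) \<le> sz (f a)" by (cases "f a") auto
qed

lemma ptime_pred [ptime_intros]: "ptime D f \<Longrightarrow> ptime D (\<lambda>a. f a - Suc 0)"
proof (rule ptime_expr[where e = "Tl_of (Var 0)"])
  fix a and s :: store assume "s 0 = enc (f a)"
  then show "value_of (Tl_of (Var 0)) s = enc (f a - Suc 0)" by (cases "f a") auto
qed auto

text \<open>Numbers in unary are lists of units, so arithmetic reduces to list programs.\<close>

lemma enc_replicate [simp]: "enc (replicate n ()) = enc n"
  by (induction n) auto

lemma ptime_replicate_unit [ptime_intros]: "ptime D f \<Longrightarrow> ptime D (\<lambda>a. replicate (f a) ())"
  by (rule ptime_coerce) auto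

lemma ptime_length_unit: 
  assumes "ptime D f" shows "ptime D (\<lambda>a. length (f a :: unit list))"
  using assms
proof (rule ptime_coerce)
  fix a
  have "f a = replicate (length (f a)) ()" by (rule replicate_eqI) auto
  then show "enc (length (f a)) = enc (f a)" by (metis enc_replicate)
qed

text \<open>A branch has to be polynomial only where it is chosen, because the two parts of
  \<open>D\<close> are treated by separate bounds.\<close>

lemma ptime_If:
  assumes "ptime D b" "ptime {a \<in> D. b a} f" "ptime {a \<in> D. \<not> b a} h"
  shows "ptime D (\<lambda>a. if b a then f a else h a)"
proof -
  obtain c0 g0 where b: "pbounded D g0" "\<And>a. a \<in> D \<Longrightarrow> runs c0 (enc a) (enc (b a)) (g0 a)"
    using assms(1) unfolding ptime_def by blast
  obtain c g where f: "pbounded {a \<in> D. b a} (\<lambda>a. sz (f a))" "pbounded {a \<in> D. b a} g"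
    "\<And>a. a \<in> {a \<in> D. b a} \<Longrightarrow> runs c (enc a) (enc (f a)) (g a)"
    using assms(2) unfolding ptime_def by blast
  obtain c' g' where h: "pbounded {a \<in> D. \<not> b a} (\<lambda>a. sz (h a))" "pbounded {a \<in> D. \<not> b a} g'"
    "\<And>a. a \<in> {a \<in> D. \<not> b a} \<Longrightarrow> runs c' (enc a) (enc (h a)) (g' a)"
    using assms(3) unfolding ptime_def by blast
  show ?thesis
  proof (rule ptimeI[of _ _ "\<lambda>a. g0 a + (if b a then g a else g' a) + 16" "if_com c0 c c'"])
    show "pbounded D (\<lambda>a. sz (if b a then f a else h a))"
      unfolding if_distrib[of sz] by (rule pbounded_if[OF f(1) h(1)])
    show "pbounded D (\<lambda>a. g0 a + (if b a then g a else g' a) + 16)"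
      by (intro pbounded_add b pbounded_if f h pbounded_const)
    show "runs (if_com c0 c c') (enc a) (enc (if b a then f a else h a))
        (g0 a + (if b a then g a else g' a) + 16)" if "a \<in> D" for a
      by (rule runs_if_com[OF b(2)[OF that]]) (use that f h in \<open>auto simp: enc_bool_def split: if_splits\<close>)
  qed
qed

lemma ptime_if [ptime_intros]:
  "ptime D b \<Longrightarrow> ptime D f \<Longrightarrow> ptime D h \<Longrightarrow> ptime D (\<lambda>a. if b a then f a else h a)"
  by (rule ptime_If) (auto elim: ptime_subset)

lemma ptime_test:
  assumes "ptime D f" "\<And>a. a \<in> D \<Longrightarrow> b a \<longleftrightarrow> enc (f a) \<noteq> Atom"
  shows "ptime D b"
proof -
  obtain c0 g0 where f: "pbounded D g0" "\<And>a. a \<in> D \<Longrightarrow> runs c0 (enc a) (enc (f a)) (g0 a)"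
    using assms(1) unfolding ptime_def by blast
  show ?thesis
  proof (rule ptimeI[of _ _ "\<lambda>a. g0 a + 1 + 16" "if_com c0 (Assign 0 (quote_expr (enc True))) (Assign 0 (quote_expr (enc False)))"])
    show "pbounded D (\<lambda>a. sz (b a))"
      by (rule pbounded_mono[OF pbounded_const[of _ 1]]) (auto simp: sz_def enc_bool_def)
    show "pbounded D (\<lambda>a. g0 a + 1 + 16)" by (intro pbounded_intros f)
    show "runs (if_com c0 (Assign 0 (quote_expr (enc True))) (Assign 0 (quote_expr (enc False))))
        (enc a) (enc (b a)) (g0 a + 1 + 16)" if "a \<in> D" for a
      by (rule runs_if_com[OF f(2)[OF that] runs_Assign runs_Assign])
        (use assms(2)[OF that] in \<open>auto simp: enc_bool_def\<close>)
  qed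
qed

lemma ptime_nonempty [ptime_intros]: "ptime D f \<Longrightarrow> ptime D (\<lambda>a. f a \<noteq> [])"
  by (erule ptime_test) (metis enc_simps(7,8) list.exhaust sexp.distinct(1))

lemma ptime_nonzero: "ptime D f \<Longrightarrow> ptime D (\<lambda>a. f a \<noteq> (0::nat))"
  by (erule ptime_test) (metis enc_simps(1,2) nat.exhaust sexp.distinct(1))

lemma ptime_not [ptime_intros]: "ptime D f \<Longrightarrow> ptime D (\<lambda>a. \<not> f a)"
proof -
  assume "ptime D f"
  then have "ptime D (\<lambda>a. if f a then False else True)" by (intro ptime_intros)
  then show ?thesis by (rule ptime_coerce) auto
qed

lemma ptime_conj [ptime_intros]: "ptime D f \<Longrightarrow> ptime D g \<Longrightarrow> ptime D (\<lambda>a. f a \<and> g a)"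
proof -
  assume "ptime D f" "ptime D g"
  then have "ptime D (\<lambda>a. if f a then g a else False)" by (intro ptime_intros)
  then show ?thesis by (rule ptime_coerce) auto
qed

lemma ptime_disj [ptime_intros]: "ptime D f \<Longrightarrow> ptime D g \<Longrightarrow> ptime D (\<lambda>a. f a \<or> g a)"
proof -
  assume "ptime D f" "ptime D g"
  then have "ptime D (\<lambda>a. if f a then True else g a)" by (intro ptime_intros)
  then show ?thesis by (rule ptime_coerce) auto
qed

text \<open>A nonempty list is encoded like the pair of its head and its tail, so the arguments of
  the second branch are available without further computation. The domain of that branch remembers
  that they come from \<open>xs\<close>.\<close>

lemma ptime_case_list [ptime_intros]:
  assumes "ptime D xs" "ptime D f"
    "ptime {p. fst p \<in> D \<and> xs (fst p) = fst (snd p) # snd (snd p)} (\<lambda>p. F (fst p) (fst (snd p)) (snd (snd p)))"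
  shows "ptime D (\<lambda>a. case xs a of [] \<Rightarrow> f a | y # ys \<Rightarrow> F a y ys)"
proof -
  let ?D = "{p. fst p \<in> D \<and> xs (fst p) = fst (snd p) # snd (snd p)}"
  let ?D1 = "{a \<in> D. xs a \<noteq> []}"
  have "ptime ?D1 (\<lambda>a. (a, (hd (xs a), tl (xs a))))"
  proof (rule ptime_coerce)
    show "ptime ?D1 (\<lambda>a. (a, xs a))" by (intro ptime_intros ptime_subset[OF assms(1)]) auto
    fix a assume "a \<in> ?D1"
    then show "enc (a, (hd (xs a), tl (xs a))) = enc (a, xs a)" by (cases "xs a") auto
  qed
  from ptime_comp[OF this assms(3)]
  have "ptime ?D1 (\<lambda>a. F a (hd (xs a)) (tl (xs a)))" by simp
  then have "ptime D (\<lambda>a. if xs a \<noteq> [] then F a (hd (xs a)) (tl (xs a)) else f a)"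
    by (intro ptime_If ptime_nonempty assms(1)) (auto intro: ptime_subset[OF assms(2)])
  then show ?thesis by (rule ptime_coerce) (auto split: list.splits)
qed

lemma nth_in_foldl_take:
  assumes "i < length xs"
  shows "foldl f a (take (Suc i) xs) = f (foldl f a (take i xs)) (xs ! i)"
  using assms by (simp add: take_Suc_conv_app_nth)

text \<open>Iterating a polynomial-time step may square the size every time, hence the separate
  premise that bounds all intermediate accumulators. In return, the step has to be polynomial only
  on accumulators that occur in the computation.\<close>

lemma ptime_foldl:
  fixes xs :: "'a::enc \<Rightarrow> 'b::enc list" and init :: "'a \<Rightarrow> 'c::enc"
  assumes xs: "ptime D xs" and init: "ptime D init"
    and bnd: "pbounded D b" "\<And>a i. a \<in> D \<Longrightarrow> i \<le> length (xs a) \<Longrightarrow> sz (foldl (G a) (init a) (take i (xs a))) \<le> b a"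
    and G: "ptime {p. fst p \<in> D \<and> (\<exists>i<length (xs (fst p)). fst (snd p) = foldl (G (fst p)) (init (fst p)) (take i (xs (fst p))) \<and>
               snd (snd p) = xs (fst p) ! i)} (\<lambda>p. G (fst p) (fst (snd p)) (snd (snd p)))"
      (is "ptime ?DG _")
  shows "ptime D (\<lambda>a. foldl (G a) (init a) (xs a))"
proof -
  define acc where "acc a i = foldl (G a) (init a) (take i (xs a))" for a i
  \<comment> \<open>A loop state consists of the remaining list, the accumulator and the argument.
    The list stands first because the loop tests the head of variable 0.\<close>
  let ?DS = "{q :: ('b \<times> 'b list) \<times> ('c \<times> 'a). (snd (snd q), (fst (snd q), fst (fst q))) \<in> ?DG}"
  have "ptime ?DS (\<lambda>q. (snd (snd q), (fst (snd q), fst (fst q))))" by (intro ptime_intros)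
  from ptime_comp[OF this G]
  have "ptime ?DS (\<lambda>q. G (snd (snd q)) (fst (snd q)) (fst (fst q)))" by simp
  then have "ptime ?DS (\<lambda>q. (snd (fst q), (G (snd (snd q)) (fst (snd q)) (fst (fst q)), snd (snd q))))"
    by (intro ptime_intros)
  then obtain c g where g: "pbounded ?DS g" and
    c: "\<And>q. q \<in> ?DS \<Longrightarrow> runs c (enc q) (enc (snd (fst q), (G (snd (snd q)) (fst (snd q)) (fst (fst q)), snd (snd q)))) (g q)"
    unfolding ptime_def by blast
  obtain d where d: "\<And>q. q \<in> ?DS \<Longrightarrow> g q \<le> (sz q + 2) ^ d"
    using g unfolding pbounded_def by blast
  \<comment> \<open>Bounds the time of one iteration uniformly: list, accumulator and argument
    together bound the size of every loop state.\<close>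
  let ?T = "\<lambda>a. (sz (xs a) + b a + sz a + 2 + 2) ^ d"
  have "ptime D (\<lambda>a. (xs a, (init a, a)))" by (intro ptime_intros xs init)
  then obtain c0 g0 where 0: "pbounded D g0" "\<And>a. a \<in> D \<Longrightarrow> runs c0 (enc a) (enc (xs a, (init a, a))) (g0 a)"
    unfolding ptime_def by blast
  let ?W = "While_Dot (Hd_of (Var 0)) c"
  let ?e = "Assign 0 (Hd_of (Tl_of (Var 0)))"
  have loop: "runs ?W (enc (xs a, (init a, a))) (enc ([]::'b list, (acc a (length (xs a)), a)))
      (sz (xs a) * (?T a + 1) + 1)" if a: "a \<in> D" for a
  proof -
    let ?x = "\<lambda>i. enc (drop i (xs a), (acc a i, a))"
    have "runs ?W (?x 0) (?x (length (xs a))) (length (xs a) * (?T a + 1) + 1)"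
    proof (rule runs_While_Dot)
      fix i assume i: "i < length (xs a)"
      have drop: "drop i (xs a) = xs a ! i # drop (Suc i) (xs a)"
        using i by (simp add: Cons_nth_drop_Suc)
      show "hd_sexp (?x i) \<noteq> Atom" by (simp add: drop)
      let ?q = "((xs a ! i, drop (Suc i) (xs a)), (acc a i, a))"
      have q: "?q \<in> ?DS" using a i unfolding acc_def mem_Collect_eq fst_conv snd_conv by blast
      have "runs c (enc ?q) (?x (Suc i)) (g ?q)"
        using c[OF q] by (simp only: fst_conv snd_conv acc_def nth_in_foldl_take[OF i])
      moreover have "enc ?q = ?x i" by (simp add: drop)
      moreover have "g ?q \<le> ?T a"
      proof (rule order_trans[OF d[OF q]], rule power_mono)
        have "sz (xs a) = sz (take i (xs a)) + sz (drop i (xs a))"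
          by (metis append_take_drop_id sz_append)
        then have "sz (xs a ! i, drop (Suc i) (xs a)) \<le> sz (xs a)"
          by (simp add: drop)
        moreover have "sz (acc a i) \<le> b a" unfolding acc_def using bnd(2)[OF a] i by simp
        ultimately show "sz ?q + 2 \<le> sz (xs a) + b a + sz a + 2 + 2" by simp
      qed simp
      ultimately show "runs c (?x i) (?x (Suc i)) (?T a)" using runs_mono by simp
    qed simp
    then have "runs ?W (enc (xs a, (init a, a))) (enc ([]::'b list, (acc a (length (xs a)), a)))
        (length (xs a) * (?T a + 1) + 1)" by (simp add: acc_def)
    then show ?thesis by (rule runs_mono) (intro add_right_mono mult_right_mono length_le_sz, simp)
  qed
  have fin: "runs ?e (enc ([]::'b list, (acc a (length (xs a)), a))) (enc (foldl (G a) (init a) (xs a))) 1" for a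
    by (rule runs_Assign) (simp add: acc_def)
  show ?thesis
  proof (rule ptimeI)
    show "pbounded D (\<lambda>a. sz (foldl (G a) (init a) (xs a)))"
    proof (rule pbounded_mono[OF bnd(1)])
      show "sz (foldl (G a) (init a) (xs a)) \<le> b a" if "a \<in> D" for a
        using bnd(2)[OF that order_refl] by simp
    qed
    show "pbounded D (\<lambda>a. g0 a + ((sz (xs a) * (?T a + 1) + 1) + 1 + 1) + 1)"
      by (intro pbounded_intros 0(1) ptime_pbounded[OF xs] bnd(1))
    show "runs (Seq c0 (Seq ?W ?e)) (enc a) (enc (foldl (G a) (init a) (xs a)))
        (g0 a + ((sz (xs a) * (?T a + 1) + 1) + 1 + 1) + 1)" if "a \<in> D" for a
      by (intro runs_Seq[OF 0(2)] runs_Seq[OF loop] fin that)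
  qed
qed

text \<open>Growth by a bounded amount per iteration adds up to the length of the list times this
  amount, which is still polynomial.\<close>

lemma ptime_foldl_additive:
  assumes xs: "ptime D xs" and init: "ptime D init"
    and G: "ptime {p. fst p \<in> D \<and> snd (snd p) \<in> set (xs (fst p))} (\<lambda>p. G (fst p) (fst (snd p)) (snd (snd p)))"
    and bnd: "pbounded D b"
      "\<And>a y x. a \<in> D \<Longrightarrow> x \<in> set (xs a) \<Longrightarrow> sz (G a y x) \<le> sz y + b a"
  shows "ptime D (\<lambda>a. foldl (G a) (init a) (xs a))"
proof (rule ptime_foldl[OF xs init])
  show "pbounded D (\<lambda>a. sz (init a) + sz (xs a) * b a)"
    by (intro pbounded_intros ptime_pbounded[OF init] ptime_pbounded[OF xs] bnd(1))
  fix a i assume a: "a \<in> D" and i: "i \<le> length (xs a)"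
  have "sz (foldl (G a) (init a) (take i (xs a))) \<le> sz (init a) + i * b a"
    using i
  proof (induction i)
    case (Suc i)
    then have i: "i < length (xs a)" by simp
    show ?case using bnd(2)[OF a nth_mem[OF i], of "foldl (G a) (init a) (take i (xs a))"] Suc
      by (simp add: nth_in_foldl_take[OF i])
  qed simp
  also have "i * b a \<le> sz (xs a) * b a"
    using i length_le_sz[of "xs a"] by (intro mult_right_mono) auto
  finally show "sz (foldl (G a) (init a) (take i (xs a))) \<le> sz (init a) + sz (xs a) * b a" by simp
qed (rule ptime_subset[OF G], auto)

lemma ptime_rev [ptime_intros]:
  assumes "ptime D xs" shows "ptime D (\<lambda>a. rev (xs a))"
proof -
  have "ptime D (\<lambda>a. foldl (\<lambda>ys x. x # ys) [] (xs a))"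
  proof (rule ptime_foldl_additive[where b = "\<lambda>a. Suc (sz (xs a))"])
    show "pbounded D (\<lambda>a. Suc (sz (xs a)))"
      using pbounded_add[OF pbounded_const[of _ 1] ptime_pbounded[OF assms]] by simp
    show "\<And>a y x. x \<in> set (xs a) \<Longrightarrow> sz (x # y) \<le> sz y + Suc (sz (xs a))"
      using sz_elem by (fastforce intro: less_imp_le)
  qed (intro ptime_intros assms)+
  then show ?thesis by (simp add: rev_conv_fold foldl_conv_fold)
qed

lemma ptime_append [ptime_intros]:
  assumes "ptime D xs" "ptime D ys" shows "ptime D (\<lambda>a. xs a @ ys a)"
proof -
  have *: "ptime D (\<lambda>a. rev (xs a))" by (intro ptime_intros assms)
  have "ptime D (\<lambda>a. foldl (\<lambda>ys x. x # ys) (ys a) (rev (xs a)))"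
  proof (rule ptime_foldl_additive[where b = "\<lambda>a. Suc (sz (xs a))"])
    show "pbounded D (\<lambda>a. Suc (sz (xs a)))"
      using pbounded_add[OF pbounded_const[of _ 1] ptime_pbounded[OF assms(1)]] by simp
    show "\<And>a y x. x \<in> set (rev (xs a)) \<Longrightarrow> sz (x # y) \<le> sz y + Suc (sz (xs a))"
      using sz_elem by (fastforce intro: less_imp_le)
  qed (intro ptime_intros * assms)+
  moreover have "foldl (\<lambda>ys x. x # ys) ys (rev xs) = xs @ ys" for xs ys :: "'b list"
    by (induction xs arbitrary: ys) simp_all
  ultimately show ?thesis by simp
qed

lemma ptime_map [ptime_intros]:
  assumes xs: "ptime D xs"
    and F: "ptime {p. fst p \<in> D \<and> snd p \<in> set (xs (fst p))} (\<lambda>p. F (fst p) (snd p))"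
  shows "ptime D (\<lambda>a. map (F a) (xs a))"
proof -
  let ?D = "{p. fst p \<in> D \<and> snd (snd p) \<in> set (xs (fst p))}"
  have "ptime ?D (\<lambda>p. (fst p, snd (snd p)))" by (intro ptime_intros)
  from ptime_comp[OF this F] have F': "ptime ?D (\<lambda>p. F (fst p) (snd (snd p)))" by simp
  obtain d where d: "\<And>a x. a \<in> D \<Longrightarrow> x \<in> set (xs a) \<Longrightarrow> sz (F a x) \<le> (sz (a, x) + 2) ^ d"
    using ptime_pbounded[OF F] unfolding pbounded_def by fastforce
  have "ptime D (\<lambda>a. foldl (\<lambda>ys x. F a x # ys) [] (xs a))"
  proof (rule ptime_foldl_additive[where b = "\<lambda>a. (1 + sz a + sz (xs a) + 2) ^ d + 1"])
    show "pbounded D (\<lambda>a. (1 + sz a + sz (xs a) + 2) ^ d + 1)"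
      by (intro pbounded_intros ptime_pbounded[OF xs])
    fix a y x assume *: "a \<in> D" "x \<in> set (xs a)"
    have "sz (F a x) \<le> (sz (a, x) + 2) ^ d" using d * by blast
    also have "\<dots> \<le> (1 + sz a + sz (xs a) + 2) ^ d"
      using sz_elem[OF *(2)] by (intro power_mono) auto
    finally show "sz (F a x # y) \<le> sz y + ((1 + sz a + sz (xs a) + 2) ^ d + 1)" by simp
  qed (intro ptime_intros xs F')+
  then have "ptime D (\<lambda>a. rev (foldl (\<lambda>ys x. F a x # ys) [] (xs a)))" by (intro ptime_intros)
  moreover have "rev (foldl (\<lambda>ys x. F a x # ys) [] zs) = map (F a) zs" for a zs
    by (induction zs rule: rev_induct) simp_all
  ultimately show ?thesis by simp
qed

lemma ptime_concat [ptime_intros]: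
  assumes xs: "ptime D xs"
  shows "ptime D (\<lambda>a. concat (xs a))"
proof -
  have "ptime D (\<lambda>a. foldl (\<lambda>ys x. ys @ x) [] (xs a))"
  proof (rule ptime_foldl_additive[where b = "\<lambda>a. sz (xs a)"])
    show "\<And>a y x. x \<in> set (xs a) \<Longrightarrow> sz (y @ x) \<le> sz y + sz (xs a)"
      using sz_elem by (fastforce intro: less_imp_le)
  qed (intro ptime_intros xs ptime_pbounded[OF xs])+
  moreover have "foldl (\<lambda>ys x. ys @ x) [] zs = concat zs" for zs :: "'b list list"
    by (induction zs rule: rev_induct) simp_all
  ultimately show ?thesis by simp
qed

lemma ptime_filter [ptime_intros]:
  assumes "ptime D xs" "ptime {p. fst p \<in> D \<and> snd p \<in> set (xs (fst p))} (\<lambda>p. P (fst p) (snd p))"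
  shows "ptime D (\<lambda>a. filter (P a) (xs a))"
proof -
  have "ptime D (\<lambda>a. concat (map (\<lambda>x. if P a x then [x] else []) (xs a)))"
    by (intro ptime_intros assms)
  moreover have "concat (map (\<lambda>x. if P a x then [x] else []) zs) = filter (P a) zs" for a zs
    by (induction zs) simp_all
  ultimately show ?thesis by simp
qed

lemma ptime_length [ptime_intros]:
  assumes "ptime D xs" shows "ptime D (\<lambda>a. length (xs a))"
proof -
  have "ptime D (\<lambda>a. length (map (\<lambda>x. ()) (xs a)))" by (intro ptime_length_unit ptime_intros assms)
  then show ?thesis by simp
qed

lemma ptime_replicate [ptime_intros]:
  assumes "ptime D k" "ptime D x" shows "ptime D (\<lambda>a. replicate (k a) (x a))"
proof -
  have *: "ptime {p. fst p \<in> D \<and> snd p \<in> set (replicate (k (fst p)) ())} (\<lambda>p. x (fst p))"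
    by (rule ptime_comp[OF _ assms(2)]) (intro ptime_intros, auto)
  have "ptime D (\<lambda>a. map (\<lambda>u. x a) (replicate (k a) ()))"
    by (intro ptime_intros assms * ptime_map)
  then show ?thesis by (simp add: map_replicate_const)
qed

lemma ptime_diff [ptime_intros]:
  assumes "ptime D f" "ptime D g" shows "ptime D (\<lambda>a. f a - (g a :: nat))"
proof -
  have "ptime D (\<lambda>a. foldl (\<lambda>n u. n - Suc 0) (f a) (replicate (g a) ()))"
    by (rule ptime_foldl_additive[where b = "\<lambda>a. 0"]) ((intro ptime_intros assms pbounded_const)+, simp)
  moreover have "foldl (\<lambda>n u. n - Suc 0) m (replicate k ()) = m - k" for m k
    by (induction k arbitrary: m) simp_all
  ultimately show ?thesis by simp
qed

lemma ptime_add [ptime_intros]: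
  assumes "ptime D f" "ptime D g" shows "ptime D (\<lambda>a. f a + (g a :: nat))"
proof -
  have "ptime D (\<lambda>a. length (replicate (f a) () @ replicate (g a) ()))"
    by (intro ptime_length_unit ptime_append ptime_replicate_unit assms)
  then show ?thesis by simp
qed

lemma ptime_mult [ptime_intros]:
  assumes "ptime D f" "ptime D g" shows "ptime D (\<lambda>a. f a * (g a :: nat))"
proof -
  have *: "ptime {p. fst p \<in> D \<and> snd p \<in> set (replicate (f (fst p)) ())} (\<lambda>p. g (fst p))"
    by (rule ptime_comp[OF _ assms(2)]) (intro ptime_intros, auto)
  have "ptime D (\<lambda>a. length (concat (map (\<lambda>u. replicate (g a) ()) (replicate (f a) ()))))"
    by (intro ptime_length_unit ptime_concat ptime_map ptime_replicate_unit assms *)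
  then show ?thesis by (rule ptime_coerce) (simp add: length_concat sum_list_replicate)
qed

lemma ptime_less [ptime_intros]:
  assumes "ptime D f" "ptime D g" shows "ptime D (\<lambda>a. f a < (g a :: nat))"
proof -
  have "ptime D (\<lambda>a. g a - f a \<noteq> 0)" by (intro ptime_nonzero ptime_diff assms)
  then show ?thesis by (rule ptime_coerce) (simp add: not_le)
qed

lemma ptime_eq_nat [ptime_intros]:
  assumes "ptime D f" "ptime D g" shows "ptime D (\<lambda>a. f a = (g a :: nat))"
proof -
  have "ptime D (\<lambda>a. \<not> (f a < g a) \<and> \<not> (g a < f a))" by (intro ptime_intros assms)
  then show ?thesis by (rule ptime_coerce) (simp add: not_less eq_iff conj_commute)
qed

lemma ptime_eq_Nil [ptime_intros]:
  assumes "ptime D f" shows "ptime D (\<lambda>a. f a = [])"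
proof -
  have "ptime D (\<lambda>a. \<not> f a \<noteq> [])" by (intro ptime_intros assms)
  then show ?thesis by simp
qed

lemma ptime_mod [ptime_intros]:
  assumes "ptime D f" "ptime D g" shows "ptime D (\<lambda>a. f a mod (g a :: nat))"
proof -
  have *: "ptime {p. fst p \<in> D \<and> snd (snd p) \<in> set (replicate (f (fst p)) ())} (\<lambda>p. g (fst p))"
    by (rule ptime_comp[OF _ assms(2)]) (intro ptime_intros, auto)
  have "ptime D (\<lambda>a. foldl (\<lambda>n u. if Suc n = g a then 0 else Suc n) 0 (replicate (f a) ()))"
    by (rule ptime_foldl_additive[where b = "\<lambda>a. 1"]) ((intro ptime_intros assms * pbounded_const)+, simp)
  \<comment> \<open>For \<open>k = 0\<close> the counter is never reset, in agreement with
    \<open>m mod 0 = m\<close>.\<close>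
  moreover have "foldl (\<lambda>n u. if Suc n = k then 0 else Suc n) (m mod k) (replicate l ()) = (m + l) mod k" for k l m
  proof (induction l arbitrary: m)
    case (Suc l)
    show ?case using Suc[of "Suc m"] by (simp add: mod_Suc)
  qed simp
  from this[of _ 0] have "foldl (\<lambda>n u. if Suc n = k then 0 else Suc n) 0 (replicate l ()) = l mod k" for k l
    by simp
  ultimately show ?thesis by simp
qed

lemma foldl_snoc_length: "foldl (\<lambda>l u. l @ [length l]) [] (replicate i ()) = [0..<i]"
proof (induction i)
  case (Suc i)
  have "replicate (Suc i) () = replicate i () @ [()]" by (simp add: replicate_append_same)
  then show ?case using Suc by (simp del: replicate_Suc)
qed simp

lemma ptime_upt [ptime_intros]:
  assumes "ptime D f" shows "ptime D (\<lambda>a. [0..<f a])"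
proof -
  have "ptime D (\<lambda>a. foldl (\<lambda>l u. l @ [length l]) [] (replicate (f a) ()))"
  proof (rule ptime_foldl[where b = "\<lambda>a. f a * (f a + 1)"])
    show "pbounded D (\<lambda>a. f a * (f a + 1))"
      using ptime_pbounded[OF assms] by (intro pbounded_intros) simp_all
    fix a i assume "i \<le> length (replicate (f a) ())"
    then have i: "i \<le> f a" by simp
    then have "sz (foldl (\<lambda>l u. l @ [length l]) [] (take i (replicate (f a) ()))) = sz [0..<i]"
      by (simp add: min_def foldl_snoc_length)
    also have "\<dots> \<le> length [0..<i] * Suc i" by (rule sz_list_le) auto
    also have "\<dots> \<le> f a * (f a + 1)" using i by (intro mult_mono) auto
    finally show "sz (foldl (\<lambda>l u. l @ [length l]) [] (take i (replicate (f a) ()))) \<le> f a * (f a + 1)" .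
  qed (intro ptime_intros assms)+
  then show ?thesis by (simp add: foldl_snoc_length)
qed

lemma ptime_mem [ptime_intros]:
  assumes "ptime D f" "ptime D xs" shows "ptime D (\<lambda>a. (f a :: nat) \<in> set (xs a))"
proof -
  have *: "ptime {p. fst p \<in> D \<and> snd p \<in> set (xs (fst p))} (\<lambda>p. f (fst p))"
    by (rule ptime_comp[OF _ assms(1)]) (intro ptime_intros, auto)
  have "ptime D (\<lambda>a. filter (\<lambda>x. f a = x) (xs a) \<noteq> [])" by (intro ptime_intros assms *)
  then show ?thesis by (rule ptime_coerce) (auto simp: filter_empty_conv)
qed

section \<open>Permanents\<close>

text \<open>Rows form a list and columns a set, as the elimination replaces rows by position and
  deletes columns by name. If a finite \<open>C\<close> has more elements than there are rows, the
  sum ranges over the injective choices of columns.\<close>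

fun per :: "nat set \<Rightarrow> (nat \<Rightarrow> 'r::comm_ring_1) list \<Rightarrow> 'r" where
  "per C [] = 1"
| "per C (r # rs) = (\<Sum>c\<in>C. r c * per (C - {c}) rs)"

lemma per_Cons_Cons:
  assumes "finite C"
  shows "per C (r # s # rs) = (\<Sum>p\<in>C. \<Sum>q\<in>C. if q = p then 0 else r p * s q * per (C - {p, q}) rs)"
proof -
  have "r p * per (C - {p}) (s # rs) = (\<Sum>q\<in>C. if q = p then 0 else r p * s q * per (C - {p, q}) rs)" for p
  proof -
    have "r p * per (C - {p}) (s # rs) = (\<Sum>q\<in>C - {p}. r p * s q * per (C - {p} - {q}) rs)"
      by (simp add: sum_distrib_left mult.assoc)
    also have "\<dots> = (\<Sum>q\<in>C - {p}. if q = p then 0 else r p * s q * per (C - {p, q}) rs)"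
      by (intro sum.cong refl) (simp add: Diff_insert2[symmetric])
    also have "\<dots> = (\<Sum>q\<in>C. if q = p then 0 else r p * s q * per (C - {p, q}) rs)"
      by (intro sum.mono_neutral_left) (use assms in auto)
    finally show ?thesis .
  qed
  then show ?thesis by (subst per.simps) simp
qed

lemma per_swap:
  assumes "finite C" shows "per C (r # s # rs) = per C (s # r # rs)"
  unfolding per_Cons_Cons[OF assms]
  by (subst sum.swap) (intro sum.cong refl, simp add: insert_commute mult_ac)

lemma per_move: "finite C \<Longrightarrow> per C (xs @ r # ys) = per C (r # xs @ ys)"
proof (induction xs arbitrary: C)
  case (Cons x xs)
  have "per C ((x # xs) @ r # ys) = per C (x # r # xs @ ys)"
    using Cons.IH[of "C - {c}" for c] Cons.prems by simp
  then show ?case using per_swap[OF Cons.prems] by simp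
qed simp

lemma per_add_mult: "per C ((\<lambda>c. r c + k * s c) # rs) = per C (r # rs) + k * per C (s # rs)"
  by (simp add: sum.distrib sum_distrib_left algebra_simps)

text \<open>The columns \<open>p\<close> and \<open>q\<close> chosen by the two equal rows can be
  exchanged without changing the term. The resulting factor 2 is what allows the smaller permanents
  to be computed modulo half the modulus.\<close>

lemma per_dup:
  assumes "finite C"
  shows "per C (r # r # rs) = 2 * (\<Sum>p\<in>C. \<Sum>q\<in>C. if p < q then r p * r q * per (C - {p, q}) rs else 0)"
proof -
  let ?F = "\<lambda>p q. r p * r q * per (C - {p, q}) rs"
  have "per C (r # r # rs) = (\<Sum>p\<in>C. \<Sum>q\<in>C. if q = p then 0 else ?F p q)"
    by (rule per_Cons_Cons[OF assms])
  also have "\<dots> = (\<Sum>p\<in>C. \<Sum>q\<in>C. (if p < q then ?F p q else 0) + (if q < p then ?F p q else 0))"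
    by (intro sum.cong refl) auto
  also have "\<dots> = (\<Sum>p\<in>C. \<Sum>q\<in>C. if p < q then ?F p q else 0) + (\<Sum>p\<in>C. \<Sum>q\<in>C. if q < p then ?F p q else 0)"
    by (simp add: sum.distrib)
  also have "(\<Sum>p\<in>C. \<Sum>q\<in>C. if q < p then ?F p q else 0) = (\<Sum>p\<in>C. \<Sum>q\<in>C. if p < q then ?F p q else 0)"
    by (subst sum.swap) (intro sum.cong refl if_cong, simp_all add: insert_commute mult_ac)
  finally show ?thesis by simp
qed

text \<open>By linearity in the row \<open>s\<close>; the error is a permanent that contains
  \<open>r\<close> twice. In the elimination, \<open>D\<close> holds the rows already cleared and
  \<open>T\<close> those still to come.\<close>

lemma per_row_operation:
  assumes "finite C"
  shows "per C (r # D @ s # T) = per C (r # D @ (\<lambda>c. s c - k * r c) # T) +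
    2 * k * (\<Sum>p\<in>C. \<Sum>q\<in>C. if p < q then r p * r q * per (C - {p, q}) (D @ T) else 0)"
proof -
  have m: "per C (r # D @ x # T) = per C (x # r # D @ T)" for x
    using per_move[OF assms, of "r # D" x T] by simp
  have "per C (s # r # D @ T) = per C ((\<lambda>c. (s c - k * r c) + k * r c) # r # D @ T)" by simp
  also have "\<dots> = per C ((\<lambda>c. s c - k * r c) # r # D @ T) + k * per C (r # r # D @ T)"
    by (rule per_add_mult)
  finally show ?thesis unfolding m per_dup[OF assms] by (simp add: mult_ac)
qed

text \<open>There are as many rows as columns, so every term contains an entry of the column
  \<open>j\<close>.\<close>

lemma per_zero_column:
  assumes "finite C" "card C = length rs" "j \<in> C" "\<And>r. r \<in> set rs \<Longrightarrow> r j = 0"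
  shows "per C rs = 0"
  using assms
proof (induction rs arbitrary: C)
  case (Cons r rs)
  have "r c * per (C - {c}) rs = 0" if c: "c \<in> C" for c
  proof (cases "c = j")
    case False
    have "card (C - {c}) = length rs" using Cons.prems(1,2) c by simp
    then have "per (C - {c}) rs = 0"
      by (intro Cons.IH) (use Cons.prems False in auto)
    then show ?thesis by simp
  qed (use Cons.prems(4)[of r] in simp)
  then show ?case by simp
qed auto

lemma per_pivot_column:
  assumes "finite C" "card C = Suc (length rs)" "j \<in> C" "\<And>r. r \<in> set rs \<Longrightarrow> r j = 0"
  shows "per C (r # rs) = r j * per (C - {j}) rs"
proof -
  have "r c * per (C - {c}) rs = (if c = j then r j * per (C - {j}) rs else 0)" if c: "c \<in> C" for c
  proof (cases "c = j")
    case False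
    then have "per (C - {c}) rs = 0"
      by (intro per_zero_column[of _ _ j]) (use assms c in auto)
    then show ?thesis using False by simp
  qed simp
  then have "per C (r # rs) = (\<Sum>c\<in>C. if c = j then r j * per (C - {j}) rs else 0)"
    unfolding per.simps by (intro sum.cong refl)
  then show ?thesis using assms(1,3) by simp
qed

section \<open>Polynomials modulo \<open>M\<close> and \<open>x ^ N\<close>\<close>

definition eqm :: "nat \<Rightarrow> nat \<Rightarrow> int poly \<Rightarrow> int poly \<Rightarrow> bool" where
  "eqm N M f g \<longleftrightarrow> (\<forall>j<N. int M dvd coeff (f - g) j)"

lemma eqm_refl [simp]: "eqm N M f f" by (simp add: eqm_def)

lemma eqm_sym: "eqm N M f g \<Longrightarrow> eqm N M g f"
  by (simp add: eqm_def dvd_diff_commute)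

lemma eqm_add:
  assumes "eqm N M f g" "eqm N M f' g'" shows "eqm N M (f + f') (g + g')"
  unfolding eqm_def
proof (intro allI impI)
  fix j assume "j < N"
  then have "int M dvd coeff (f - g) j + coeff (f' - g') j" using assms by (intro dvd_add) (auto simp: eqm_def)
  also have "coeff (f - g) j + coeff (f' - g') j = coeff (f + f' - (g + g')) j" by simp
  finally show "int M dvd coeff (f + f' - (g + g')) j" .
qed

lemma eqm_trans [trans]:
  assumes "eqm N M f g" "eqm N M g h" shows "eqm N M f h"
  unfolding eqm_def
proof (intro allI impI)
  fix j assume "j < N"
  then have "int M dvd coeff (f - g) j + coeff (g - h) j" using assms by (intro dvd_add) (auto simp: eqm_def)
  also have "coeff (f - g) j + coeff (g - h) j = coeff (f - h) j" by simp
  finally show "int M dvd coeff (f - h) j" .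
qed

lemma eqm_mult_right:
  assumes "eqm N M f g" shows "eqm N M (f * h) (g * h)"
  unfolding eqm_def
proof (intro allI impI)
  fix j assume j: "j < N"
  have "coeff (f * h - g * h) j = (\<Sum>i\<le>j. coeff (f - g) i * coeff h (j - i))"
    by (simp add: coeff_mult flip: left_diff_distrib)
  also have "int M dvd \<dots>"
    using assms j by (intro dvd_sum dvd_mult2) (auto simp: eqm_def)
  finally show "int M dvd coeff (f * h - g * h) j" .
qed

lemma eqm_mult:
  assumes "eqm N M f g" "eqm N M f' g'" shows "eqm N M (f * f') (g * g')"
  using eqm_trans[OF eqm_mult_right[OF assms(1), of f'], of "g * g'"] eqm_mult_right[OF assms(2), of g]
  by (simp add: mult.commute)

lemma eqm_uminus: "eqm N M f g \<Longrightarrow> eqm N M (- f) (- g)"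
  using eqm_mult[of N M "- 1" "- 1" f g] by simp

lemma eqm_diff: "eqm N M f g \<Longrightarrow> eqm N M f' g' \<Longrightarrow> eqm N M (f - f') (g - g')"
  using eqm_add[of N M f g "- f'" "- g'"] eqm_uminus by simp

lemma eqm_sum: "(\<And>a. a \<in> A \<Longrightarrow> eqm N M (f a) (g a)) \<Longrightarrow> eqm N M (sum f A) (sum g A)"
  by (induction A rule: infinite_finite_induct) (auto intro: eqm_add)

lemma eqm_modulus: "eqm N M (of_nat M * f) 0"
  by (simp add: eqm_def of_nat_poly)

text \<open>The parity of the constant coefficient is the residue modulo 2 and x. Its invariance
  under the coarser computations modulo \<open>M\<close> and \<open>x ^ N\<close> keeps units
  recognisable.\<close>

lemma eqm_parity:
  assumes "eqm N M f g" "even M" "N > 0"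
  shows "odd (coeff f 0) \<longleftrightarrow> odd (coeff g 0)"
proof -
  have "2 dvd int M" using assms(2) by simp
  then have "2 dvd coeff (f - g) 0" using assms(1,3) unfolding eqm_def by (meson dvd_trans)
  then show ?thesis by simp
qed

lemma eqm_per:
  assumes "list_all2 (\<lambda>r s. \<forall>c\<in>C. eqm N M (r c) (s c)) rs ss"
  shows "eqm N M (per C rs) (per C ss)"
  using assms
proof (induction rs arbitrary: C ss)
  case (Cons r rs)
  then obtain s ss' where ss: "ss = s # ss'" "\<forall>c\<in>C. eqm N M (r c) (s c)"
    "list_all2 (\<lambda>r s. \<forall>c\<in>C. eqm N M (r c) (s c)) rs ss'"
    by (auto simp: list_all2_Cons1)
  show ?case unfolding ss(1) per.simps
  proof (intro eqm_sum eqm_mult)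
    fix c assume "c \<in> C"
    then show "eqm N M (r c) (s c)" using ss(2) by blast
    show "eqm N M (per (C - {c}) rs) (per (C - {c}) ss')"
      by (rule Cons.IH) (use ss(3) in \<open>auto elim: list_all2_mono\<close>)
  qed
qed simp

text \<open>The polynomial \<open>y\<close> lies in the ideal generated by 2 and x. Of the
  \<open>L\<close> factors, at most \<open>j\<close> can contribute a power of x to the coefficient
  at \<open>j\<close>; each of the others contributes a 2.\<close>

lemma dvd_coeff_power:
  assumes "even (coeff y 0)"
  shows "j \<le> L \<Longrightarrow> (2::int) ^ (L - j) dvd coeff (y ^ L) j"
proof (induction L arbitrary: j)
  case (Suc L)
  have "2 ^ (Suc L - j) dvd coeff y i * coeff (y ^ L) (j - i)" if i: "i \<le> j" for i
  proof (cases "i = 0")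
    case True
    show ?thesis
    proof (cases "j = Suc L")
      case False
      then have "2 ^ (L - j) dvd coeff (y ^ L) j" using Suc by simp
      with assms have "2 * 2 ^ (L - j) dvd coeff y 0 * coeff (y ^ L) j" by (rule mult_dvd_mono)
      moreover have "Suc L - j = Suc (L - j)" using False Suc.prems by simp
      ultimately show ?thesis using True by simp
    qed simp
  next
    case False
    then have "2 ^ (L - (j - i)) dvd coeff (y ^ L) (j - i)" using i Suc.prems by (intro Suc.IH) simp
    moreover have "(2::int) ^ (Suc L - j) dvd 2 ^ (L - (j - i))"
      using False i Suc.prems by (intro le_imp_power_dvd) auto
    ultimately show ?thesis by (meson dvd_mult dvd_trans)
  qed
  then show ?case by (auto simp: coeff_mult intro!: dvd_sum)
qed simp

lemma eqm_power_zero: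
  assumes "even (coeff y 0)" "N + K \<le> L"
  shows "eqm N (2 ^ K) (y ^ L) 0"
  unfolding eqm_def
proof (intro allI impI)
  fix j assume "j < N"
  then have "(2::int) ^ K dvd 2 ^ (L - j)" using assms(2) by (intro le_imp_power_dvd) auto
  also have "2 ^ (L - j) dvd coeff (y ^ L) j"
    using \<open>j < N\<close> assms by (intro dvd_coeff_power) auto
  finally show "int (2 ^ K) dvd coeff (y ^ L - 0) j" by simp
qed

text \<open>A polynomial is represented by the list of the exponents of its monomials; a row of a matrix of
  polynomials by a list of pairs of a column and an exponent.\<close>

definition poly_of :: "nat list \<Rightarrow> int poly" where
  "poly_of p = (\<Sum>e\<leftarrow>p. monom 1 e)"

definition pmul :: "nat list \<Rightarrow> nat list \<Rightarrow> nat list" where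
  "pmul p q = concat (map (\<lambda>i. map (\<lambda>j. i + j) q) p)"

text \<open>A list of exponents has nonnegative coefficients only, so -1 is represented by the
  constant \<open>M - 1\<close>.\<close>

definition pneg1 :: "nat \<Rightarrow> nat list" where
  "pneg1 M = replicate (M - Suc 0) 0"

text \<open>Coefficients are multiplicities in the list. Reducing them modulo \<open>M\<close> and
  truncating at \<open>N\<close> bounds the length of all polynomials by \<open>N * M\<close> during
  the whole computation.\<close>

definition pnorm :: "nat \<Rightarrow> nat \<Rightarrow> nat list \<Rightarrow> nat list" where
  "pnorm N M p = concat (map (\<lambda>e. replicate (length (filter (\<lambda>x. x = e) p) mod M) e) [0..<N])"

text \<open>The inverse of \<open>u\<close> as a geometric series: \<open>1 - u\<close> is nilpotent if \<open>u\<close> is 1 modulo 2 and \<open>x\<close>.\<close>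

definition pinv :: "nat \<Rightarrow> nat \<Rightarrow> nat list \<Rightarrow> nat list" where
  "pinv N M u = foldl (\<lambda>acc i. pnorm N M (0 # pmul (pnorm N M (0 # pmul (pneg1 M) u)) acc)) [0] [0..<N + M]"

lemma poly_of_simps [simp]:
  "poly_of [] = 0" "poly_of (e # p) = monom 1 e + poly_of p" "poly_of (p @ q) = poly_of p + poly_of q"
  by (simp_all add: poly_of_def)

lemma poly_of_map_add: "poly_of (map (\<lambda>j. i + j) q) = monom 1 i * poly_of q"
  by (induction q) (simp_all add: mult_monom distrib_left)

lemma poly_of_pmul [simp]: "poly_of (pmul p q) = poly_of p * poly_of q"
  by (induction p) (simp_all add: pmul_def poly_of_map_add distrib_right)

lemma poly_of_pneg1:
  assumes "M > 0" shows "eqm N M (poly_of (pneg1 M)) (- 1)"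
proof -
  have "poly_of (replicate k 0) = of_nat k" for k
    by (induction k) (simp_all add: monom_0 one_pCons[symmetric])
  then have "poly_of (pneg1 M) - - 1 = of_nat M" using assms by (simp add: pneg1_def of_nat_diff)
  then show ?thesis using eqm_modulus[of N M 1] by (simp add: eqm_def)
qed

lemma coeff_poly_of: "coeff (poly_of p) j = int (length (filter (\<lambda>x. x = j) p))"
  by (induction p) auto

lemma length_filter_concat_replicate:
  "length (filter (\<lambda>x. x = j) (concat (map (\<lambda>e. replicate (k e) e) [0..<N]))) = (if j < N then k j else 0)"
  by (induction N) (auto simp: less_Suc_eq)

lemma coeff_pnorm: "coeff (poly_of (pnorm N M p)) j = (if j < N then coeff (poly_of p) j mod int M else 0)"
  by (simp add: coeff_poly_of pnorm_def length_filter_concat_replicate zmod_int)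

lemma eqm_pnorm [simp]: "eqm N M (poly_of (pnorm N M p)) (poly_of p)"
  unfolding eqm_def by (auto simp: coeff_pnorm mod_eq_dvd_iff[symmetric])

lemma mem_pnorm: "e \<in> set (pnorm N M p) \<longleftrightarrow> e < N \<and> \<not> int M dvd coeff (poly_of p) e"
  by (auto simp: pnorm_def coeff_poly_of mod_eq_0_iff_dvd intro: gr0I)

lemma eqm_pinv:
  assumes M: "M = 2 ^ K" "K > 0" and u: "odd (coeff (poly_of u) 0)"
  shows "eqm N M (poly_of (pinv N M u) * poly_of u) 1"
proof -
  define y where "y = 1 - poly_of u"
  let ?y = "pnorm N M (0 # pmul (pneg1 M) u)"
  have y: "eqm N M (poly_of ?y) y"
  proof -
    have "eqm N M (1 + poly_of (pneg1 M) * poly_of u) (1 + - 1 * poly_of u)"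
      using M by (intro eqm_add eqm_mult poly_of_pneg1) auto
    moreover have "eqm N M (poly_of ?y) (1 + poly_of (pneg1 M) * poly_of u)"
      using eqm_pnorm[of N M "0 # pmul (pneg1 M) u"] by (simp add: monom_0 one_pCons)
    ultimately show ?thesis unfolding y_def using eqm_trans by fastforce
  qed
  \<comment> \<open>The accumulator stands for \<open>1 + y + ... + y ^ L\<close>, and
    multiplication by \<open>u = 1 - y\<close> makes the sum telescope.\<close>
  have "eqm N M (poly_of (foldl (\<lambda>acc i. pnorm N M (0 # pmul ?y acc)) [0] [0..<L]) * poly_of u) (1 - y ^ Suc L)" for L
  proof (induction L)
    case 0
    then show ?case by (simp add: y_def monom_0 one_pCons[symmetric])
  next
    case (Suc L)
    let ?a = "foldl (\<lambda>acc i. pnorm N M (0 # pmul ?y acc)) [0] [0..<L]"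
    have "eqm N M (poly_of (pnorm N M (0 # pmul ?y ?a)) * poly_of u) ((1 + poly_of ?y * poly_of ?a) * poly_of u)"
      using eqm_mult_right[OF eqm_pnorm[of N M "0 # pmul ?y ?a"]] by (simp add: monom_0 one_pCons[symmetric])
    also have "(1 + poly_of ?y * poly_of ?a) * poly_of u = poly_of u + poly_of ?y * (poly_of ?a * poly_of u)"
      by (simp add: algebra_simps)
    also have "eqm N M \<dots> (poly_of u + y * (1 - y ^ Suc L))"
      by (intro eqm_add eqm_mult y Suc eqm_refl)
    also have "poly_of u + y * (1 - y ^ Suc L) = 1 - y ^ Suc (Suc L)"
      by (simp add: y_def algebra_simps)
    finally show ?case by simp
  qed
  from this[of "N + M"] have "eqm N M (poly_of (pinv N M u) * poly_of u) (1 - y ^ Suc (N + M))"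
    by (simp add: pinv_def)
  also have "eqm N M (1 - y ^ Suc (N + M)) (1 - 0)"
  proof (intro eqm_diff eqm_refl)
    \<comment> \<open>\<open>pinv\<close> is given \<open>M\<close> instead of its logarithm
      \<open>K\<close>. The exponent has to reach \<open>N + K\<close>, and \<open>N + M\<close>
      iterations guarantee this.\<close>
    have "K < 2 ^ K" by (rule less_exp)
    then have "N + K \<le> Suc (N + 2 ^ K)" by linarith
    moreover have "even (coeff y 0)" using u by (simp add: y_def)
    ultimately show "eqm N M (y ^ Suc (N + M)) 0"
      unfolding M(1) by (intro eqm_power_zero)
  qed
  finally show ?thesis by simp
qed

section \<open>Sparse rows and items of the elimination\<close>

type_synonym row = "(nat \<times> nat) list"

definition look :: "row \<Rightarrow> nat \<Rightarrow> nat list" where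
  "look r c = map snd (filter (\<lambda>m. fst m = c) r)"

definition entry :: "row \<Rightarrow> nat \<Rightarrow> int poly" where
  "entry r c = poly_of (look r c)"

definition rscale :: "nat list \<Rightarrow> row \<Rightarrow> row" where
  "rscale p r = concat (map (\<lambda>i. map (\<lambda>m. (fst m, i + snd m)) r) p)"

text \<open>Normalising also discards the columns outside \<open>C\<close>. Together with the
  reduced coefficients this bounds the size of a row regardless of how many row operations it has
  undergone.\<close>

definition rnorm :: "nat \<Rightarrow> nat \<Rightarrow> nat list \<Rightarrow> row \<Rightarrow> row" where
  "rnorm N M C r = concat (map (\<lambda>c. map (\<lambda>e. (c, e)) (pnorm N M (look r c))) C)"

lemma look_append [simp]: "look (r @ s) c = look r c @ look s c"
  by (simp add: look_def)

lemma entry_append [simp]: "entry (r @ s) c = entry r c + entry s c"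
  by (simp add: entry_def)

lemma entry_rscale [simp]: "entry (rscale p r) c = poly_of p * entry r c"
proof -
  have "look (map (\<lambda>m. (fst m, i + snd m)) r) c = map (\<lambda>j. i + j) (look r c)" for i
    by (simp add: look_def filter_map o_def)
  then have "look (rscale p r) c = pmul p (look r c)"
    by (induction p) (simp_all add: rscale_def pmul_def, simp add: look_def)
  then show ?thesis by (simp add: entry_def)
qed

lemma look_rnorm: "distinct C \<Longrightarrow> look (rnorm N M C r) c = (if c \<in> set C then pnorm N M (look r c) else [])"
proof (induction C)
  case (Cons a C)
  have "look (map (\<lambda>e. (a, e)) p) c = (if a = c then p else [])" for p
    by (simp add: look_def filter_map o_def)
  then show ?case using Cons by (auto simp: rnorm_def)
qed (simp add: rnorm_def look_def)

lemma eqm_entry_rnorm: "distinct C \<Longrightarrow> c \<in> set C \<Longrightarrow> eqm N M (entry (rnorm N M C r) c) (entry r c)"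
  by (simp add: entry_def look_rnorm)

text \<open>
  The item \<open>(l, w, C, rws)\<close> stands for \<open>w\<close> times the permanent of the rows \<open>rws\<close> at the columns \<open>C\<close>, where
  \<open>w\<close> is a multiple of \<open>2 ^ (K - 1 - l)\<close>. Every row carries the node that it belongs to: modulo 2 and \<open>x\<close>,
  its entries are 1 in the column of that node and 0 elsewhere. This guarantees pivots that are units.
\<close>

type_synonym item = "nat \<times> nat list \<times> nat list \<times> (nat \<times> row) list"

definition item_value :: "item \<Rightarrow> int poly" where
  "item_value it = poly_of (fst (snd it)) *
     per (set (fst (snd (snd it)))) (map (\<lambda>x. entry (snd x)) (snd (snd (snd it))))"

text \<open>
  Subtracting \<open>k\<close> times the row \<open>r\<close> from another row changes the permanent by \<open>k\<close> times a permanent that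
  contains \<open>r\<close> twice. The Laplace expansion along these two rows yields every pair of columns twice; the
  factor \<open>[0, 0]\<close> represents the number 2.
\<close>

definition dup_items :: "nat \<Rightarrow> nat \<Rightarrow> row \<Rightarrow> nat \<Rightarrow> nat list \<Rightarrow> nat list \<Rightarrow> nat list \<Rightarrow>
    (nat \<times> row) list \<Rightarrow> item list" where
  "dup_items N M r l w k C rws = concat (map (\<lambda>p. concat (map (\<lambda>q.
     if p < q then [(l - Suc 0, pnorm N M (pmul w (pmul [0, 0] (pmul k (pmul (look r p) (look r q))))),
       filter (\<lambda>c. c \<noteq> p \<and> c \<noteq> q) C, rws)] else []) C)) C)"

text \<open>The state consists of the cleared rows, the pending rows beginning with the current row
  \<open>s\<close>, and the collected error items; \<open>u\<close> is the inverse of the pivot. At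
  level 0 the errors are multiples of \<open>2 ^ K\<close> and are dropped.\<close>

definition elim_step :: "nat \<Rightarrow> nat \<Rightarrow> nat \<Rightarrow> row \<Rightarrow> nat list \<Rightarrow> nat \<Rightarrow> nat list \<Rightarrow> nat list \<Rightarrow>
    ((nat \<times> row) list \<times> (nat \<times> row) list) \<times> item list \<Rightarrow> nat \<times> row \<Rightarrow>
    ((nat \<times> row) list \<times> (nat \<times> row) list) \<times> item list" where
  "elim_step N M v r u l w C st s =
     ((fst (fst st) @
         [(fst s, rnorm N M C (snd s @ rscale (pmul (pneg1 M) (pnorm N M (pmul (look (snd s) v) u))) r))],
       tl (snd (fst st))),
      if l = 0 then snd st
      else snd st @ dup_items N M r l w (pnorm N M (pmul (look (snd s) v) u)) C
             (fst (fst st) @ tl (snd (fst st))))"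

text \<open>Once the column of the pivot is cleared, a single smaller permanent remains, whose
  weight absorbs the pivot entry. Rows are told apart by their nodes, which are distinct.\<close>

definition pivot :: "nat \<Rightarrow> nat \<Rightarrow> item \<Rightarrow> nat \<times> row \<Rightarrow> item list" where
  "pivot N M it x =
    (case foldl (elim_step N M (fst x) (snd x) (pinv N M (look (snd x) (fst x))) (fst it) (fst (snd it)) (fst (snd (snd it))))
            (([], filter (\<lambda>y. fst y \<noteq> fst x) (snd (snd (snd it)))), [])
            (filter (\<lambda>y. fst y \<noteq> fst x) (snd (snd (snd it)))) of (p, errs) \<Rightarrow>
       (fst it, pnorm N M (pmul (fst (snd it)) (look (snd x) (fst x))),
        filter (\<lambda>c. c \<noteq> fst x) (fst (snd (snd it))), fst p) # errs)"

definition laplace :: "nat \<Rightarrow> nat \<Rightarrow> item \<Rightarrow> row \<Rightarrow> (nat \<times> row) list \<Rightarrow> item list" where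
  "laplace N M it r rws = map (\<lambda>c. (fst it, pnorm N M (pmul (fst (snd it)) (look r c)),
     filter (\<lambda>d. d \<noteq> c) (fst (snd (snd it))), rws)) (fst (snd (snd it)))"

text \<open>A row whose node is among the columns has a unit there and can serve as pivot. If there
  is no such row, all entries have even constant coefficients and none is a unit; Laplace expansion
  is affordable then because few rows have lost their columns.\<close>

definition expand :: "nat \<Rightarrow> nat \<Rightarrow> item \<Rightarrow> item list" where
  "expand N M it =
    (case snd (snd (snd it)) of [] \<Rightarrow> []
     | x # xs \<Rightarrow> (case filter (\<lambda>x. fst x \<in> set (fst (snd (snd it)))) (snd (snd (snd it))) of
         [] \<Rightarrow> laplace N M it (snd x) xs
       | y # ys \<Rightarrow> pivot N M it y))"

definition leaf :: "item \<Rightarrow> nat list" where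
  "leaf it = (if snd (snd (snd it)) = [] then fst (snd it) else [])"

definition work_step :: "nat \<Rightarrow> nat \<Rightarrow> nat list \<times> item list \<Rightarrow> nat list \<times> item list" where
  "work_step N M st = (case snd st of [] \<Rightarrow> st
     | it # its \<Rightarrow> (pnorm N M (fst st @ leaf it), expand N M it @ its))"

section \<open>Correctness of pivoting and expansion\<close>

definition unital :: "nat set \<Rightarrow> (nat \<times> row) list \<Rightarrow> bool" where
  "unital C rws \<longleftrightarrow> (\<forall>x\<in>set rws. \<forall>c\<in>C. odd (coeff (entry (snd x) c) 0) \<longleftrightarrow> fst x = c)"

definition level_ok :: "nat \<Rightarrow> nat \<Rightarrow> nat \<Rightarrow> nat list \<Rightarrow> bool" where
  "level_ok N K l w \<longleftrightarrow> l < K \<and> (\<exists>h. eqm N (2 ^ K) (poly_of w) (2 ^ (K - Suc l) * h))"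

definition item_ok :: "nat \<Rightarrow> nat \<Rightarrow> nat \<Rightarrow> item \<Rightarrow> bool" where
  "item_ok n N K it \<longleftrightarrow> (case it of (l, w, C, rws) \<Rightarrow>
     level_ok N K l w \<and> distinct C \<and> set C \<subseteq> {..<n} \<and> distinct (map fst rws) \<and>
     length rws = length C \<and> unital (set C) rws)"

lemma level_ok_mult:
  assumes "level_ok N K l w" shows "level_ok N K l (pnorm N (2 ^ K) (pmul w p))"
proof -
  obtain h where "eqm N (2 ^ K) (poly_of w) (2 ^ (K - Suc l) * h)"
    using assms by (auto simp: level_ok_def)
  then have "eqm N (2 ^ K) (poly_of w * poly_of p) (2 ^ (K - Suc l) * h * poly_of p)"
    by (rule eqm_mult_right)
  then have "eqm N (2 ^ K) (poly_of (pnorm N (2 ^ K) (pmul w p))) (2 ^ (K - Suc l) * (h * poly_of p))"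
    using eqm_trans[OF eqm_pnorm[of N "2 ^ K" "pmul w p"]] by (simp add: mult.assoc)
  then show ?thesis using assms by (auto simp: level_ok_def)
qed

text \<open>The additional factor 2 in the weight pays for the lower level.\<close>

lemma level_ok_double:
  assumes "level_ok N K l w" "l > 0"
  shows "level_ok N K (l - Suc 0) (pnorm N (2 ^ K) (pmul w (pmul [0, 0] p)))"
proof -
  obtain h where "eqm N (2 ^ K) (poly_of w) (2 ^ (K - Suc l) * h)"
    using assms by (auto simp: level_ok_def)
  then have "eqm N (2 ^ K) (poly_of w * (2 * poly_of p)) (2 ^ (K - Suc l) * h * (2 * poly_of p))"
    by (rule eqm_mult_right)
  moreover have "poly_of (pmul [0, 0] p) = 2 * poly_of p" by (simp add: monom_0 one_pCons[symmetric])
  ultimately have "eqm N (2 ^ K) (poly_of (pnorm N (2 ^ K) (pmul w (pmul [0, 0] p))))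
      (2 ^ (K - Suc l) * h * (2 * poly_of p))"
    using eqm_trans[OF eqm_pnorm[of N "2 ^ K" "pmul w (pmul [0, 0] p)"]] by simp
  moreover have "K - Suc (l - Suc 0) = Suc (K - Suc l)" using assms by (auto simp: level_ok_def)
  then have "2 ^ (K - Suc l) * h * (2 * poly_of p) = 2 ^ (K - Suc (l - Suc 0)) * (h * poly_of p)"
    by (simp only: power_Suc mult_ac)
  ultimately have "eqm N (2 ^ K) (poly_of (pnorm N (2 ^ K) (pmul w (pmul [0, 0] p))))
      (2 ^ (K - Suc (l - Suc 0)) * (h * poly_of p))" by simp
  then show ?thesis using assms unfolding level_ok_def by auto
qed

text \<open>The weight is already a multiple of \<open>2 ^ (K - 1)\<close>, so doubling reaches the
  modulus. This ends the recursion.\<close>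

lemma level_0_double:
  assumes "level_ok N K 0 w"
  shows "eqm N (2 ^ K) (poly_of w * (2 * f)) 0"
proof -
  obtain h where "eqm N (2 ^ K) (poly_of w) (2 ^ (K - 1) * h)" and K: "K > 0"
    using assms by (auto simp: level_ok_def)
  then have "eqm N (2 ^ K) (poly_of w * (2 * f)) (2 ^ (K - 1) * h * (2 * f))"
    by (intro eqm_mult_right)
  also have "2 ^ (K - 1) * h * (2 * f) = of_nat (2 ^ K) * (h * f)"
    using K by (cases K) (simp_all add: mult_ac)
  also have "eqm N (2 ^ K) \<dots> 0" by (rule eqm_modulus)
  finally show ?thesis .
qed

text \<open>The right-hand side is the error term of \<open>per_row_operation\<close> for the
  multiplier \<open>k\<close>, weighted by \<open>w\<close>.\<close>

lemma sum_list_dup_items: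
  assumes "distinct C"
  shows "eqm N M (\<Sum>it\<leftarrow>dup_items N M r l w k C rws. item_value it)
    (poly_of w * (2 * (poly_of k * (\<Sum>p\<in>set C. \<Sum>q\<in>set C. if p < q then entry r p * entry r q *
        per (set C - {p, q}) (map (\<lambda>x. entry (snd x)) rws) else 0))))"
proof -
  let ?P = "\<lambda>p q. per (set C - {p, q}) (map (\<lambda>x. entry (snd x)) rws)"
  let ?w = "\<lambda>p q. pnorm N M (pmul w (pmul [0, 0] (pmul k (pmul (look r p) (look r q)))))"
  have set: "set C - {p, q} = set (filter (\<lambda>c. c \<noteq> p \<and> c \<noteq> q) C)" for p q by auto
  have 1: "sum_list (map f (concat (map g xs))) = (\<Sum>x\<leftarrow>xs. sum_list (map f (g x)))" for f :: "item \<Rightarrow> int poly" and g and xs :: "nat list"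
    by (induction xs) simp_all
  have "(\<Sum>it\<leftarrow>dup_items N M r l w k C rws. item_value it) =
      (\<Sum>p\<leftarrow>C. \<Sum>q\<leftarrow>C. if p < q then poly_of (?w p q) * ?P p q else 0)"
    unfolding dup_items_def 1
    by (intro arg_cong[where f = sum_list] map_cong refl) (simp add: item_value_def set if_distrib cong: if_cong)
  also have "\<dots> = (\<Sum>p\<in>set C. \<Sum>q\<in>set C. if p < q then poly_of (?w p q) * ?P p q else 0)"
    using assms by (simp add: sum_list_distinct_conv_sum_set)
  also have "eqm N M \<dots> (\<Sum>p\<in>set C. \<Sum>q\<in>set C. if p < q then
      poly_of w * (2 * (poly_of k * (entry r p * entry r q * ?P p q))) else 0)"
  proof (intro eqm_sum)
    fix p q
    have "eqm N M (poly_of (?w p q) * ?P p q) (poly_of (pmul w (pmul [0, 0] (pmul k (pmul (look r p) (look r q))))) * ?P p q)"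
      by (intro eqm_mult_right eqm_pnorm)
    then show "eqm N M (if p < q then poly_of (?w p q) * ?P p q else 0)
      (if p < q then poly_of w * (2 * (poly_of k * (entry r p * entry r q * ?P p q))) else 0)"
      by (simp add: entry_def monom_0 one_pCons[symmetric] mult_ac)
  qed
  also have "\<dots> = poly_of w * (2 * (poly_of k * (\<Sum>p\<in>set C. \<Sum>q\<in>set C. if p < q then entry r p * entry r q * ?P p q else 0)))"
    by (simp add: sum_distrib_left if_distrib cong: if_cong)
  finally show ?thesis .
qed

lemma item_ok_dup_items:
  assumes "it \<in> set (dup_items N (2 ^ K) r l w k C rws)" "level_ok N K l w" "l > 0"
    "distinct C" "set C \<subseteq> {..<n}" "distinct (map fst rws)" "Suc (Suc (length rws)) = length C" "unital (set C) rws"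
  shows "item_ok n N K it"
proof -
  obtain p q where pq: "p \<in> set C" "q \<in> set C" "p < q" and
    it: "it = (l - Suc 0, pnorm N (2 ^ K) (pmul w (pmul [0, 0] (pmul k (pmul (look r p) (look r q))))),
       filter (\<lambda>c. c \<noteq> p \<and> c \<noteq> q) C, rws)"
    using assms(1) by (auto simp: dup_items_def split: if_splits)
  have "card (set C) = length C" using assms(4) by (rule distinct_card)
  moreover have "set (filter (\<lambda>c. c \<noteq> p \<and> c \<noteq> q) C) = set C - {p, q}" by auto
  moreover have "card (set C - {p, q}) = card (set C) - 2"
    using pq by (subst card_Diff_subset) auto
  ultimately have "length (filter (\<lambda>c. c \<noteq> p \<and> c \<noteq> q) C) = length C - 2"
    using assms(4) by (metis distinct_card distinct_filter)
  then show ?thesis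
    using assms level_ok_double[OF assms(2,3)] by (auto simp: item_ok_def it unital_def)
qed

lemma length_dup_items: "length (dup_items N M r l w k C rws) \<le> length C ^ 2"
proof -
  have "length (dup_items N M r l w k C rws) = (\<Sum>p\<leftarrow>C. length (concat (map (\<lambda>q.
     if p < q then [(l - Suc 0, pnorm N M (pmul w (pmul [0, 0] (pmul k (pmul (look r p) (look r q))))),
       filter (\<lambda>c. c \<noteq> p \<and> c \<noteq> q) C, rws)] else []) C)))"
    by (simp add: dup_items_def length_concat o_def)
  also have "\<dots> \<le> (\<Sum>p\<leftarrow>C. length C)"
  proof (rule sum_list_mono)
    fix p
    show "length (concat (map (\<lambda>q. if p < q then [(l - Suc 0, pnorm N M (pmul w (pmul [0, 0] (pmul k (pmul (look r p) (look r q))))),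
       filter (\<lambda>c. c \<noteq> p \<and> c \<noteq> q) C, rws)] else []) D)) \<le> length D" for D
      by (induction D) auto
  qed
  also have "\<dots> = length C ^ 2" by (simp add: sum_list_triv power2_eq_square)
  finally show ?thesis .
qed

text \<open>What the potential argument has to know about an error item. \<open>L\<close> is the set
  of nodes of the rows of its parent, and the summand 2 stems from the two deleted columns.\<close>

definition err_ok :: "nat \<Rightarrow> nat list \<Rightarrow> nat set \<Rightarrow> item \<Rightarrow> bool" where
  "err_ok l C L it \<longleftrightarrow> l > 0 \<and> fst it = l - Suc 0 \<and> Suc (Suc (length (snd (snd (snd it))))) = length C \<and>
     card (fst ` set (snd (snd (snd it))) - set (fst (snd (snd it)))) \<le> card (L - set C) + 2"

lemma err_ok_dup_items:
  assumes "it \<in> set (dup_items N M r l w k C rws)" "l > 0" "Suc (Suc (length rws)) = length C"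
    "fst ` set rws \<subseteq> L" "finite L"
  shows "err_ok l C L it"
proof -
  obtain p q e where it: "it = (l - Suc 0, e, filter (\<lambda>c. c \<noteq> p \<and> c \<noteq> q) C, rws)"
    using assms(1) by (auto simp: dup_items_def split: if_splits)
  have "card (fst ` set rws - set (filter (\<lambda>c. c \<noteq> p \<and> c \<noteq> q) C)) \<le> card ((L - set C) \<union> {p, q})"
    using assms(4,5) by (intro card_mono) auto
  also have "\<dots> \<le> card (L - set C) + card {p, q}" by (rule card_Un_le)
  also have "\<dots> \<le> card (L - set C) + 2" by (simp add: card_insert_if)
  finally show ?thesis using assms by (simp add: err_ok_def it)
qed

lemma eqm_elim_row:
  assumes "M > 0" "distinct C" "c \<in> set C"
  shows "eqm N M (entry (rnorm N M C (s @ rscale (pmul (pneg1 M) k) r)) c) (entry s c - poly_of k * entry r c)"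
proof -
  have "eqm N M (entry (rnorm N M C (s @ rscale (pmul (pneg1 M) k) r)) c)
      (entry s c + poly_of (pneg1 M) * poly_of k * entry r c)"
    using eqm_entry_rnorm[OF assms(2,3), of N M "s @ rscale (pmul (pneg1 M) k) r"] by simp
  also have "eqm N M \<dots> (entry s c + - 1 * poly_of k * entry r c)"
    by (intro eqm_add eqm_refl eqm_mult_right poly_of_pneg1 assms)
  finally show ?thesis by simp
qed

text \<open>The assumptions describe a state in the middle of the elimination, with \<open>D\<close>
  cleared, \<open>T\<close> pending and \<open>E\<close> collected, which makes the induction on
  \<open>T\<close> possible. Invariant is the weighted permanent of the pivot row with
  \<open>D @ T\<close> plus the values of the items in \<open>E\<close>.\<close>

lemma elim_step_foldl:
  fixes N K n :: nat
  defines "M \<equiv> 2 ^ K"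
  assumes K: "K > 0" "N > 0" and C: "distinct C" "set C \<subseteq> {..<n}" "v \<in> set C"
    and u: "eqm N M (poly_of u * entry r v) 1" and w: "level_ok N K l w" and L: "finite L"
  assumes "\<And>x. x \<in> set D \<Longrightarrow> eqm N M (entry (snd x) v) 0" "unital (set C) (D @ T)" "distinct (map fst (D @ T))"
    "v \<notin> fst ` set (D @ T)" "Suc (length (D @ T)) = length C"
    "fst ` set (D @ T) \<subseteq> L" "\<And>it. it \<in> set E \<Longrightarrow> item_ok n N K it \<and> err_ok l C L it"
  shows "\<exists>D' E'. foldl (elim_step N M v r u l w C) ((D, T), E) T = ((D', []), E') \<and>
    eqm N M (poly_of w * per (set C) (entry r # map (\<lambda>x. entry (snd x)) (D @ T)) + (\<Sum>it\<leftarrow>E. item_value it))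
      (poly_of w * per (set C) (entry r # map (\<lambda>x. entry (snd x)) D') + (\<Sum>it\<leftarrow>E'. item_value it)) \<and>
    (\<forall>x\<in>set D'. eqm N M (entry (snd x) v) 0) \<and> unital (set C) D' \<and> map fst D' = map fst (D @ T) \<and>
    (\<forall>it\<in>set E'. item_ok n N K it \<and> err_ok l C L it) \<and> length E' \<le> length E + length T * length C ^ 2"
  using assms(10-)
proof (induction T arbitrary: D E)
  case Nil
  then show ?case by (intro exI[of _ D] exI[of _ E]) auto
next
  case (Cons s T)
  define k where "k = pnorm N M (pmul (look (snd s) v) u)"
  define s' where "s' = (fst s, rnorm N M C (snd s @ rscale (pmul (pneg1 M) k) r))"
  define E1 where "E1 = (if l = 0 then E else E @ dup_items N M r l w k C (D @ T))"
  let ?e = "map (\<lambda>x. entry (snd x))"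
  let ?S = "\<Sum>p\<in>set C. \<Sum>q\<in>set C. if p < q then entry r p * entry r q * per (set C - {p, q}) (?e (D @ T)) else 0"
  have M: "M > 0" "even M" using K by (auto simp: M_def)
  have step: "elim_step N M v r u l w C ((D, s # T), E) s = ((D @ [s'], T), E1)"
    by (simp add: elim_step_def k_def s'_def E1_def)
  have s': "eqm N M (entry (snd s') c) (entry (snd s) c - poly_of k * entry r c)" if "c \<in> set C" for c
    unfolding s'_def snd_conv by (rule eqm_elim_row[OF M(1) C(1) that])
  have k: "eqm N M (poly_of k) (entry (snd s) v * poly_of u)"
    unfolding k_def using eqm_pnorm[of N M "pmul (look (snd s) v) u"] by (simp add: entry_def)
  have zero: "eqm N M (entry (snd s') v) 0"
  proof -
    note s'[OF C(3)]
    also have "eqm N M (entry (snd s) v - poly_of k * entry r v) (entry (snd s) v - entry (snd s) v * poly_of u * entry r v)"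
      by (intro eqm_diff eqm_refl eqm_mult_right k)
    also have "entry (snd s) v - entry (snd s) v * poly_of u * entry r v = entry (snd s) v - entry (snd s) v * (poly_of u * entry r v)"
      by (simp add: mult.assoc)
    also have "eqm N M \<dots> (entry (snd s) v - entry (snd s) v * 1)"
      by (intro eqm_diff eqm_refl eqm_mult u)
    finally show ?thesis by simp
  qed
  have un_s: "odd (coeff (entry (snd s) c) 0) \<longleftrightarrow> fst s = c" if "c \<in> set C" for c
    using Cons.prems(2) that by (auto simp: unital_def)
  have "fst s \<noteq> v" using Cons.prems(4) by auto
  then have "even (coeff (entry (snd s) v) 0)" using un_s C(3) by blast
  then have "even (coeff (entry (snd s) v * poly_of u) 0)" by (simp add: coeff_mult)
  \<comment> \<open>The multiplier vanishes modulo 2 and x because \<open>s\<close> has no unit in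
    the column of the pivot. Hence the row operation does not disturb the units of
    \<open>s\<close>.\<close>
  then have k_even: "even (coeff (poly_of k) 0)" using eqm_parity[OF k M(2) K(2)] by blast
  have un_s': "odd (coeff (entry (snd s') c) 0) \<longleftrightarrow> fst s' = c" if "c \<in> set C" for c
  proof -
    have "odd (coeff (entry (snd s') c) 0) \<longleftrightarrow> odd (coeff (entry (snd s) c - poly_of k * entry r c) 0)"
      by (rule eqm_parity[OF s'[OF that] M(2) K(2)])
    also have "\<dots> \<longleftrightarrow> odd (coeff (entry (snd s) c) 0)" using k_even by (simp add: coeff_mult)
    finally show ?thesis using un_s[OF that] by (simp add: s'_def)
  qed
  have unital: "unital (set C) ((D @ [s']) @ T)"
    using Cons.prems(2) un_s' by (auto simp: unital_def)
  have err: "item_ok n N K it \<and> err_ok l C L it" if "it \<in> set (dup_items N M r l w k C (D @ T))" "l > 0" for it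
  proof
    show "item_ok n N K it"
      by (rule item_ok_dup_items[OF that(1)[unfolded M_def] w that(2) C(1,2)]) (use Cons.prems in \<open>auto simp: unital_def\<close>)
    show "err_ok l C L it"
      by (rule err_ok_dup_items[OF that]) (use Cons.prems L in auto)
  qed
  have E1: "length E1 \<le> length E + length C ^ 2" by (simp add: E1_def length_dup_items)
  have "\<exists>D' E'. foldl (elim_step N M v r u l w C) ((D @ [s'], T), E1) T = ((D', []), E') \<and>
    eqm N M (poly_of w * per (set C) (entry r # ?e ((D @ [s']) @ T)) + (\<Sum>it\<leftarrow>E1. item_value it))
      (poly_of w * per (set C) (entry r # ?e D') + (\<Sum>it\<leftarrow>E'. item_value it)) \<and>
    (\<forall>x\<in>set D'. eqm N M (entry (snd x) v) 0) \<and> unital (set C) D' \<and> map fst D' = map fst ((D @ [s']) @ T) \<and>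
    (\<forall>it\<in>set E'. item_ok n N K it \<and> err_ok l C L it) \<and> length E' \<le> length E1 + length T * length C ^ 2"
  proof (rule Cons.IH)
    show "eqm N M (entry (snd x) v) 0" if "x \<in> set (D @ [s'])" for x
      using that zero Cons.prems(1)[of x] by (cases "x = s'") auto
    show "item_ok n N K it \<and> err_ok l C L it" if "it \<in> set E1" for it
      using that Cons.prems(7)[of it] err[of it] unfolding E1_def by (cases "l = 0") auto
  qed (use Cons.prems unital in \<open>auto simp: s'_def\<close>)
  then obtain D' E' where IH: "foldl (elim_step N M v r u l w C) ((D @ [s'], T), E1) T = ((D', []), E')"
    "eqm N M (poly_of w * per (set C) (entry r # ?e ((D @ [s']) @ T)) + (\<Sum>it\<leftarrow>E1. item_value it))
      (poly_of w * per (set C) (entry r # ?e D') + (\<Sum>it\<leftarrow>E'. item_value it))"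
    "\<forall>x\<in>set D'. eqm N M (entry (snd x) v) 0" "unital (set C) D'" "map fst D' = map fst ((D @ [s']) @ T)"
    "\<forall>it\<in>set E'. item_ok n N K it \<and> err_ok l C L it" "length E' \<le> length E1 + length T * length C ^ 2"
    by blast
  have rowop: "per (set C) (entry r # ?e (D @ s # T)) =
      per (set C) (entry r # ?e D @ (\<lambda>c. entry (snd s) c - poly_of k * entry r c) # ?e T) + 2 * poly_of k * ?S"
    using per_row_operation[of "set C" "entry r" "?e D" "entry (snd s)" "?e T" "poly_of k"]
    by (simp only: map_append list.map finite_set simp_thms True_implies_equals)
  have "eqm N M (per (set C) (entry r # ?e D @ (\<lambda>c. entry (snd s) c - poly_of k * entry r c) # ?e T))
      (per (set C) (entry r # ?e ((D @ [s']) @ T)))"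
  proof (rule eqm_per)
    have "list_all2 (\<lambda>r s. \<forall>c\<in>set C. eqm N M (r c) (s c))
        (entry r # ?e D @ (\<lambda>c. entry (snd s) c - poly_of k * entry r c) # ?e T)
        (entry r # ?e D @ entry (snd s') # ?e T)"
      by (intro list_all2_Cons[THEN iffD2] conjI list_all2_appendI list.rel_refl) (auto intro: eqm_sym[OF s'])
    then show "list_all2 (\<lambda>r s. \<forall>c\<in>set C. eqm N M (r c) (s c))
        (entry r # ?e D @ (\<lambda>c. entry (snd s) c - poly_of k * entry r c) # ?e T)
        (entry r # ?e ((D @ [s']) @ T))" by simp
  qed
  then have "eqm N M (poly_of w * (per (set C) (entry r # ?e D @ (\<lambda>c. entry (snd s) c - poly_of k * entry r c) # ?e T) +
        2 * poly_of k * ?S) + (\<Sum>it\<leftarrow>E. item_value it))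
      (poly_of w * (per (set C) (entry r # ?e ((D @ [s']) @ T)) + 2 * poly_of k * ?S) + (\<Sum>it\<leftarrow>E. item_value it))"
    by (intro eqm_add eqm_mult eqm_refl)
  also have "\<dots> = poly_of w * per (set C) (entry r # ?e ((D @ [s']) @ T)) + ((\<Sum>it\<leftarrow>E. item_value it) +
      poly_of w * (2 * (poly_of k * ?S)))"
    by (simp add: distrib_left mult.assoc)
  also have "eqm N M \<dots> (poly_of w * per (set C) (entry r # ?e ((D @ [s']) @ T)) + (\<Sum>it\<leftarrow>E1. item_value it))"
  proof (intro eqm_add eqm_refl)
    show "eqm N M ((\<Sum>it\<leftarrow>E. item_value it) + poly_of w * (2 * (poly_of k * ?S))) (\<Sum>it\<leftarrow>E1. item_value it)"
    proof (cases "l = 0")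
      case True
      have "eqm N M ((\<Sum>it\<leftarrow>E. item_value it) + poly_of w * (2 * (poly_of k * ?S))) ((\<Sum>it\<leftarrow>E. item_value it) + 0)"
        unfolding M_def by (intro eqm_add eqm_refl level_0_double) (use w True in simp)
      then show ?thesis using True by (simp add: E1_def)
    next
      case False
      have "eqm N M ((\<Sum>it\<leftarrow>E. item_value it) + poly_of w * (2 * (poly_of k * ?S)))
          ((\<Sum>it\<leftarrow>E. item_value it) + (\<Sum>it\<leftarrow>dup_items N M r l w k C (D @ T). item_value it))"
        by (intro eqm_add eqm_refl eqm_sym[OF sum_list_dup_items] C(1))
      then show ?thesis using False by (simp add: E1_def)
    qed
  qed
  also note IH(2)
  finally have "eqm N M (poly_of w * per (set C) (entry r # ?e (D @ s # T)) + (\<Sum>it\<leftarrow>E. item_value it))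
      (poly_of w * per (set C) (entry r # ?e D') + (\<Sum>it\<leftarrow>E'. item_value it))"
    unfolding rowop .
  moreover have "map fst D' = map fst (D @ s # T)" using IH(5) by (simp add: s'_def)
  moreover have "length E' \<le> length E + length (s # T) * length C ^ 2" using IH(7) E1 by simp
  ultimately show ?case using IH(1,3,4,6) step by (intro exI[of _ D'] exI[of _ E']) simp
qed

text \<open>
  Bounds the number of remaining steps. A pivot step removes a row and adds polynomially many items of lower
  level, whose potential is smaller by the factor \<open>(n + 2) ^ 6\<close> up to changes of the other factors. A Laplace
  expansion yields up to \<open>n\<close> items, each with one row less whose node is not among the columns.
\<close>

definition potential :: "nat \<Rightarrow> item \<Rightarrow> nat" where
  "potential n it = (length (snd (snd (snd it))) + 1) * (n + 2) ^ (6 * fst it) *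
     (n + 2) ^ card (fst ` set (snd (snd (snd it))) - set (fst (snd (snd it))))"

lemma per_rest:
  assumes "finite C" "y \<in> set rws" "distinct (map fst rws)"
  shows "per C (map f rws) = per C (f y # map f (filter (\<lambda>x. fst x \<noteq> fst y) rws))"
proof -
  obtain xs ys where rws: "rws = xs @ y # ys" using split_list[OF assms(2)] by blast
  have "filter (\<lambda>x. fst x \<noteq> fst y) xs = xs" "filter (\<lambda>x. fst x \<noteq> fst y) ys = ys"
    using assms(3) by (auto simp: rws filter_id_conv) (metis image_eqI fst_conv)+
  then show ?thesis by (simp add: rws per_move[OF assms(1)])
qed

lemma length_rest:
  assumes "y \<in> set rws" "distinct (map fst rws)"
  shows "Suc (length (filter (\<lambda>x. fst x \<noteq> fst y) rws)) = length rws"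
proof -
  obtain xs ys where rws: "rws = xs @ y # ys" using split_list[OF assms(1)] by blast
  have "filter (\<lambda>x. fst x \<noteq> fst y) xs = xs" "filter (\<lambda>x. fst x \<noteq> fst y) ys = ys"
    using assms(2) by (auto simp: rws filter_id_conv) (metis image_eqI fst_conv)+
  then show ?thesis by (simp add: rws)
qed

lemma length_remove: "distinct C \<Longrightarrow> v \<in> set C \<Longrightarrow> Suc (length (filter (\<lambda>c. c \<noteq> v) C)) = length C"
proof (induction C)
  case (Cons c C)
  show ?case
  proof (cases "c = v")
    case True
    then have "filter (\<lambda>c. c \<noteq> v) C = C" using Cons.prems by (auto simp: filter_id_conv)
    then show ?thesis using True by simp
  qed (use Cons in auto)
qed simp

lemma per_cong:
  "(\<And>x c. x \<in> set xs \<Longrightarrow> c \<in> A \<Longrightarrow> f x c = g x c) \<Longrightarrow> per A (map f xs) = per A (map g xs)"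
proof (induction xs arbitrary: A)
  case (Cons x xs)
  have "per (A - {c}) (map f xs) = per (A - {c}) (map g xs)" for c
    by (rule Cons.IH) (use Cons.prems in auto)
  then show ?case unfolding list.map per.simps using Cons.prems by (intro sum.cong refl) simp
qed simp

text \<open>The value is preserved since the cleared column contributes only the pivot entry and the
  error items compensate for the row operations. The potential drops because the main item loses a
  row and the errors lose a level.\<close>

lemma pivot_ok:
  fixes N K n :: nat
  defines "M \<equiv> 2 ^ K"
  assumes K: "K > 0" "N > 0" and it: "item_ok n N K (l, w, C, rws)" and y: "y \<in> set rws" "fst y \<in> set C"
  shows "(\<forall>it'\<in>set (pivot N M (l, w, C, rws) y). item_ok n N K it') \<and>
    eqm N M (\<Sum>it'\<leftarrow>pivot N M (l, w, C, rws) y. item_value it') (item_value (l, w, C, rws)) \<and>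
    1 + (\<Sum>it'\<leftarrow>pivot N M (l, w, C, rws) y. potential n it') \<le> potential n (l, w, C, rws)"
proof -
  obtain v r where vr: "y = (v, r)" by fastforce
  let ?e = "map (\<lambda>x. entry (snd x))"
  define R where "R = filter (\<lambda>x. fst x \<noteq> v) rws"
  define L where "L = fst ` set rws"
  have w: "level_ok N K l w" and C: "distinct C" "set C \<subseteq> {..<n}" and dist: "distinct (map fst rws)"
    and len: "length rws = length C" and un: "unital (set C) rws"
    using it by (auto simp: item_ok_def)
  have "odd (coeff (entry r v) 0)" using un y unfolding unital_def vr by fastforce
  then have u: "eqm N M (poly_of (pinv N M (look r v)) * entry r v) 1"
    unfolding entry_def by (intro eqm_pinv[of M K]) (use K in \<open>auto simp: M_def\<close>)
  have lenR: "Suc (length R) = length C" using length_rest[OF y(1) dist] len by (simp add: R_def vr)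
  have "\<exists>D' E'. foldl (elim_step N M v r (pinv N M (look r v)) l w C) (([], R), []) R = ((D', []), E') \<and>
    eqm N M (poly_of w * per (set C) (entry r # ?e ([] @ R)) + (\<Sum>it\<leftarrow>[]. item_value it))
      (poly_of w * per (set C) (entry r # ?e D') + (\<Sum>it\<leftarrow>E'. item_value it)) \<and>
    (\<forall>x\<in>set D'. eqm N M (entry (snd x) v) 0) \<and> unital (set C) D' \<and> map fst D' = map fst ([] @ R) \<and>
    (\<forall>it\<in>set E'. item_ok n N K it \<and> err_ok l C L it) \<and> length E' \<le> length ([]::item list) + length R * length C ^ 2"
    unfolding M_def
  proof (rule elim_step_foldl[OF K C])
    show "unital (set C) ([] @ R)" using un by (auto simp: unital_def R_def)
    show "distinct (map fst ([] @ R))" using dist by (auto simp: R_def distinct_map inj_on_def)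
    show "v \<in> set C" using y vr by simp
    show "eqm N (2 ^ K) (poly_of (pinv N (2 ^ K) (look r v)) * entry r v) 1" using u by (simp add: M_def)
  qed (use w lenR in \<open>auto simp: L_def R_def\<close>)
  then obtain D E where DE: "foldl (elim_step N M v r (pinv N M (look r v)) l w C) (([], R), []) R = ((D, []), E)"
    "eqm N M (poly_of w * per (set C) (entry r # ?e R)) (poly_of w * per (set C) (entry r # ?e D) + (\<Sum>it\<leftarrow>E. item_value it))"
    "\<forall>x\<in>set D. eqm N M (entry (snd x) v) 0" "unital (set C) D" "map fst D = map fst R"
    "\<forall>it\<in>set E. item_ok n N K it \<and> err_ok l C L it" "length E \<le> length R * length C ^ 2"
    by auto
  define main where "main = (l, pnorm N M (pmul w (look r v)), filter (\<lambda>c. c \<noteq> v) C, D)"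
  have piv: "pivot N M (l, w, C, rws) y = main # E"
    using DE(1) by (simp add: pivot_def vr main_def R_def)
  have lenD: "length D = length R" using DE(5) by (metis length_map)
  have setC: "set (filter (\<lambda>c. c \<noteq> v) C) = set C - {v}" by auto
  have vC: "v \<in> set C" using y vr by simp
  have "item_ok n N K main"
  proof -
    have "distinct (map fst D)" unfolding DE(5) R_def using dist by (rule distinct_map_filter)
    then show ?thesis
      unfolding item_ok_def main_def using DE(4) level_ok_mult[OF w] C lenR lenD length_remove[OF C(1) vC]
      by (auto simp: M_def unital_def simp del: distinct_map)
  qed
  moreover have "eqm N M (\<Sum>it'\<leftarrow>main # E. item_value it') (item_value (l, w, C, rws))"
  proof -
    \<comment> \<open>The cleared column vanishes only as a congruence, whereas
      \<open>per_pivot_column\<close> asks for exact zeros; \<open>?z\<close> replaces it by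
      zeros.\<close>
    let ?z = "map (\<lambda>x c. if c = v then 0 else entry (snd x) c) D"
    have "eqm N M (item_value main) (poly_of w * (entry r v * per (set C - {v}) (?e D)))"
      unfolding item_value_def main_def using eqm_mult_right[OF eqm_pnorm[of N M "pmul w (look r v)"]]
      by (simp add: setC entry_def mult.assoc del: set_filter)
    also have "per (set C - {v}) (?e D) = per (set C - {v}) ?z"
    proof -
      have "per (set C - {v}) (map (\<lambda>x. entry (snd x)) D) = per (set C - {v}) ?z" by (rule per_cong) simp
      then show ?thesis by simp
    qed
    also have "entry r v * per (set C - {v}) ?z = per (set C) (entry r # ?z)"
      by (rule per_pivot_column[symmetric]) (use vC C lenR lenD distinct_card[OF C(1)] in auto)
    also have "eqm N M (poly_of w * per (set C) (entry r # ?z)) (poly_of w * per (set C) (entry r # ?e D))"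
    proof (intro eqm_mult eqm_refl eqm_per)
      have "eqm N M (if c = v then 0 else entry (snd x) c) (entry (snd x) c)" if "x \<in> set D" for x c
        using eqm_sym[OF DE(3)[rule_format, OF that]] by (cases "c = v") simp_all
      then have "list_all2 (\<lambda>r s. \<forall>c\<in>set C. eqm N M (r c) (s c)) ?z (?e D)"
        unfolding list_all2_map1 list_all2_map2 list_all2_same by blast
      then show "list_all2 (\<lambda>r s. \<forall>c\<in>set C. eqm N M (r c) (s c)) (entry r # ?z) (entry r # ?e D)"
        unfolding list_all2_Cons by (intro conjI ballI eqm_refl)
    qed
    finally have "eqm N M (item_value main + (\<Sum>it\<leftarrow>E. item_value it))
        (poly_of w * per (set C) (entry r # ?e D) + (\<Sum>it\<leftarrow>E. item_value it))"
      by (intro eqm_add eqm_refl)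
    also have "eqm N M \<dots> (poly_of w * per (set C) (entry r # ?e R))" by (rule eqm_sym[OF DE(2)])
    also have "poly_of w * per (set C) (entry r # ?e R) = item_value (l, w, C, rws)"
      unfolding item_value_def using per_rest[OF finite_set[of C] y(1) dist, of "\<lambda>x. entry (snd x)"]
      by (simp add: vr R_def)
    finally show ?thesis by simp
  qed
  moreover have "1 + (\<Sum>it'\<leftarrow>main # E. potential n it') \<le> potential n (l, w, C, rws)"
  proof -
    define d m q where "d = card (L - set C)" and "m = length C" and "q = (n + 2 :: nat)"
    have m: "m \<le> n" using C card_mono[OF _ C(2)] by (simp add: m_def distinct_card)
    have "fst ` set D = fst ` set R" using DE(5) by (metis list.set_map)
    also have "fst ` set R = L - {v}" by (auto simp: R_def L_def)
    finally have "fst ` set D - set (filter (\<lambda>c. c \<noteq> v) C) = L - set C" using vC by auto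
    then have pm: "potential n main = m * (q ^ (6 * l) * q ^ d)"
      using lenD lenR by (simp add: potential_def main_def d_def q_def m_def mult.assoc)
    have pe: "potential n it' \<le> m * (q ^ (6 * (l - 1)) * q ^ (d + 2))" if "it' \<in> set E" for it'
    proof -
      have e: "fst it' = l - 1" "Suc (Suc (length (snd (snd (snd it'))))) = length C"
        "card (fst ` set (snd (snd (snd it'))) - set (fst (snd (snd it')))) \<le> d + 2"
        using DE(6)[rule_format, OF that] by (auto simp: err_ok_def d_def)
      have "(n + 2) ^ card (fst ` set (snd (snd (snd it'))) - set (fst (snd (snd it')))) \<le> q ^ (d + 2)"
        unfolding q_def by (rule power_increasing[OF e(3)]) simp
      then show ?thesis
        unfolding potential_def mult.assoc by (intro mult_mono) (use e(1,2) in \<open>auto simp: q_def m_def\<close>)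
    qed
    \<comment> \<open>The main item has one row less than its parent. The potential set free by this
      has to pay for the step and for all error items.\<close>
    have "1 + (\<Sum>it'\<leftarrow>E. potential n it') \<le> q ^ (6 * l) * q ^ d"
    proof (cases "l = 0")
      case True
      then have "E = []" using DE(6) by (cases E) (auto simp: err_ok_def)
      then show ?thesis by (simp add: q_def)
    next
      case False
      let ?X = "q ^ (6 * (l - 1)) * q ^ d"
      have X: "?X > 0" by (simp add: q_def)
      have "(\<Sum>it'\<leftarrow>E. potential n it') \<le> (\<Sum>it'\<leftarrow>E. m * (q ^ (6 * (l - 1)) * q ^ (d + 2)))"
        by (rule sum_list_mono) (rule pe)
      also have "\<dots> = length E * (m * (q ^ (6 * (l - 1)) * q ^ (d + 2)))" by (simp add: sum_list_triv)
      also have "\<dots> \<le> (n * n ^ 2) * (n * (q ^ (6 * (l - 1)) * q ^ (d + 2)))"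
      proof (intro mult_mono m order_refl)
        have "length E \<le> length R * length C ^ 2" by (rule DE(7))
        also have "\<dots> \<le> n * n ^ 2" using m lenR by (intro mult_mono power_mono) (auto simp: m_def)
        finally show "length E \<le> n * n ^ 2" .
      qed auto
      also have "\<dots> = n ^ 4 * q ^ 2 * ?X" by (simp add: power_add power_eq_if algebra_simps)
      finally have "(\<Sum>it'\<leftarrow>E. potential n it') \<le> n ^ 4 * q ^ 2 * ?X" .
      with X have "1 + (\<Sum>it'\<leftarrow>E. potential n it') \<le> n ^ 4 * q ^ 2 * ?X + ?X" by linarith
      also have "\<dots> = (n ^ 4 * q ^ 2 + 1) * ?X" by (simp only: distrib_right mult_1)
      \<comment> \<open>Origin of the exponent 6: there are at most \<open>n ^ 3\<close> error
        items, their number of rows gives another factor \<open>n\<close>, and \<open>q ^ 2\<close>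
        stems from the two deleted columns.\<close>
      also have "n ^ 4 * q ^ 2 + 1 \<le> q ^ 6"
      proof -
        have "n ^ 4 * q ^ 2 + 1 \<le> (n ^ 4 + 1) * q ^ 2" by (simp add: q_def)
        also have "n ^ 4 + 1 \<le> (n + 1) ^ 4" by (simp add: power_eq_if algebra_simps)
        also have "(n + 1) ^ 4 \<le> q ^ 4" by (intro power_mono) (auto simp: q_def)
        also have "q ^ 4 * q ^ 2 = q ^ 6" by (simp flip: power_add)
        finally show ?thesis by simp
      qed
      also have "q ^ 6 * ?X = q ^ (6 * l) * q ^ d"
      proof -
        have "6 * l = 6 + 6 * (l - 1)" using False by simp
        then show ?thesis by (metis mult.assoc power_add)
      qed
      finally show ?thesis by simp
    qed
    moreover have "potential n (l, w, C, rws) = (m + 1) * (q ^ (6 * l) * q ^ d)"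
      by (simp add: potential_def m_def q_def d_def L_def len algebra_simps)
    ultimately show ?thesis using pm by simp
  qed
  ultimately show ?thesis unfolding piv using DE(6) by simp
qed

text \<open>None of the \<open>m\<close> rows has its node among the columns, so the last factor of
  the potential is the m-th power of \<open>n + 2\<close>. Each of the \<open>m\<close> new items
  has only \<open>m - 1\<close> rows, and the factor \<open>n + 2\<close> gained thereby outweighs
  the number of items.\<close>

lemma laplace_ok:
  fixes N K n :: nat
  defines "M \<equiv> 2 ^ K"
  assumes it: "item_ok n N K (l, w, C, x # xs)" and disj: "\<And>y. y \<in> set (x # xs) \<Longrightarrow> fst y \<notin> set C"
  shows "(\<forall>it'\<in>set (laplace N M (l, w, C, x # xs) (snd x) xs). item_ok n N K it') \<and>
    eqm N M (\<Sum>it'\<leftarrow>laplace N M (l, w, C, x # xs) (snd x) xs. item_value it') (item_value (l, w, C, x # xs)) \<and>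
    1 + (\<Sum>it'\<leftarrow>laplace N M (l, w, C, x # xs) (snd x) xs. potential n it') \<le> potential n (l, w, C, x # xs)"
proof -
  let ?it = "\<lambda>c. (l, pnorm N M (pmul w (look (snd x) c)), filter (\<lambda>d. d \<noteq> c) C, xs)"
  have w: "level_ok N K l w" and C: "distinct C" "set C \<subseteq> {..<n}" and dist: "distinct (map fst (x # xs))"
    and len: "length (x # xs) = length C" and un: "unital (set C) (x # xs)"
    using it by (auto simp: item_ok_def)
  have lap: "laplace N M (l, w, C, x # xs) (snd x) xs = map ?it C" by (simp add: laplace_def)
  have "item_ok n N K (?it c)" if "c \<in> set C" for c
    unfolding item_ok_def using level_ok_mult[OF w] C dist len un length_remove[OF C(1) that]
    by (auto simp: M_def unital_def)
  moreover have "eqm N M (\<Sum>it'\<leftarrow>map ?it C. item_value it') (item_value (l, w, C, x # xs))"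
  proof -
    have "(\<Sum>it'\<leftarrow>map ?it C. item_value it') = (\<Sum>c\<in>set C. item_value (?it c))"
      using C(1) by (simp add: sum_list_distinct_conv_sum_set o_def)
    also have "eqm N M \<dots> (\<Sum>c\<in>set C. poly_of w * (entry (snd x) c * per (set C - {c}) (map (\<lambda>x. entry (snd x)) xs)))"
    proof (intro eqm_sum)
      fix c
      have "set (filter (\<lambda>d. d \<noteq> c) C) = set C - {c}" by auto
      then show "eqm N M (item_value (?it c)) (poly_of w * (entry (snd x) c * per (set C - {c}) (map (\<lambda>x. entry (snd x)) xs)))"
        unfolding item_value_def using eqm_mult_right[OF eqm_pnorm[of N M "pmul w (look (snd x) c)"]]
        by (simp add: entry_def mult.assoc)
    qed
    also have "\<dots> = item_value (l, w, C, x # xs)" by (simp add: item_value_def sum_distrib_left)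
    finally show ?thesis .
  qed
  moreover have "1 + (\<Sum>it'\<leftarrow>map ?it C. potential n it') \<le> potential n (l, w, C, x # xs)"
  proof -
    define m q where "m = length C" and "q = (n + 2 :: nat)"
    have m: "m \<le> n" "m > 0" using C card_mono[OF _ C(2)] len by (auto simp: m_def distinct_card)
    have "potential n (?it c) \<le> m * (q ^ (6 * l) * q ^ (m - 1))" for c
    proof -
      have "card (fst ` set xs - set (filter (\<lambda>d. d \<noteq> c) C)) \<le> card (fst ` set xs)" by (intro card_mono) auto
      also have "\<dots> \<le> length xs" using card_image_le[of "set xs" fst] card_length[of xs] by simp
      also have "\<dots> = m - 1" using len by (simp add: m_def)
      finally show ?thesis
        using len by (auto simp: potential_def m_def q_def mult.assoc intro!: power_increasing)
    qed
    then have "(\<Sum>it'\<leftarrow>map ?it C. potential n it') \<le> (\<Sum>c\<leftarrow>C. m * (q ^ (6 * l) * q ^ (m - 1)))"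
      unfolding list.map_comp o_def by (rule sum_list_mono)
    also have "\<dots> = m * m * (q ^ (6 * l) * q ^ (m - 1))" by (simp add: sum_list_triv m_def)
    also have "\<dots> \<le> m * q * (q ^ (6 * l) * q ^ (m - 1))"
      using m by (intro mult_right_mono mult_left_mono) (auto simp: q_def)
    also have "\<dots> = m * (q ^ (6 * l) * q ^ m)" 
    proof -
      have "q ^ m = q * q ^ (m - 1)" using m(2) by (simp add: power_eq_if)
      then show ?thesis by (simp only: mult_ac)
    qed
    finally have "(\<Sum>it'\<leftarrow>map ?it C. potential n it') \<le> m * (q ^ (6 * l) * q ^ m)" .
    moreover have "q ^ (6 * l) * q ^ m > 0" by (simp add: q_def)
    ultimately have "1 + (\<Sum>it'\<leftarrow>map ?it C. potential n it') \<le> q ^ (6 * l) * q ^ m + m * (q ^ (6 * l) * q ^ m)"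
      by linarith
    then have "1 + (\<Sum>it'\<leftarrow>map ?it C. potential n it') \<le> (m + 1) * (q ^ (6 * l) * q ^ m)" by simp
    also have "\<dots> = potential n (l, w, C, x # xs)"
    proof -
      have "fst ` set (x # xs) \<inter> set C = {}" using disj by blast
      then have "fst ` set (x # xs) - set C = fst ` set (x # xs)" by (rule Diff_triv)
      moreover have "card (fst ` set (x # xs)) = m"
        using distinct_card[OF dist] len unfolding list.set_map m_def by simp
      ultimately show ?thesis using len by (simp add: potential_def m_def q_def algebra_simps)
    qed
    finally show ?thesis .
  qed
  ultimately show ?thesis unfolding lap by auto
qed

lemma expand_ok:
  fixes N K n :: nat
  defines "M \<equiv> 2 ^ K"
  assumes K: "K > 0" "N > 0" and it: "item_ok n N K it"
  shows "\<forall>it'\<in>set (expand N M it). item_ok n N K it'"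
    and "eqm N M (poly_of (leaf it) + (\<Sum>it'\<leftarrow>expand N M it. item_value it')) (item_value it)"
    and "1 + (\<Sum>it'\<leftarrow>expand N M it. potential n it') \<le> potential n it"
proof -
  obtain l w C rws where itd: "it = (l, w, C, rws)" by (metis prod.collapse)
  have "(\<forall>it'\<in>set (expand N M it). item_ok n N K it') \<and>
    eqm N M (poly_of (leaf it) + (\<Sum>it'\<leftarrow>expand N M it. item_value it')) (item_value it) \<and>
    1 + (\<Sum>it'\<leftarrow>expand N M it. potential n it') \<le> potential n it"
  proof (cases rws)
    case Nil
    then show ?thesis using it by (auto simp: itd expand_def leaf_def item_value_def potential_def item_ok_def)
  next
    case (Cons x xs)
    show ?thesis
    proof (cases "filter (\<lambda>x. fst x \<in> set C) rws")
      case Nil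
      then have "fst y \<notin> set C" if "y \<in> set (x # xs)" for y
        using that Cons by (metis filter_empty_conv)
      from laplace_ok[OF it[unfolded itd Cons] this] show ?thesis
        using Nil by (simp add: itd Cons expand_def leaf_def M_def)
    next
      case (Cons y ys)
      then have "y \<in> set rws" "fst y \<in> set C" by (metis (no_types, lifting) filter_set list.set_intros(1) mem_Collect_eq set_filter)+
      from pivot_ok[OF K it[unfolded itd] this] show ?thesis
        using \<open>rws = x # xs\<close> Cons by (simp add: itd expand_def leaf_def M_def split: list.splits)
    qed
  qed
  then show "\<forall>it'\<in>set (expand N M it). item_ok n N K it'"
    "eqm N M (poly_of (leaf it) + (\<Sum>it'\<leftarrow>expand N M it. item_value it')) (item_value it)"
    "1 + (\<Sum>it'\<leftarrow>expand N M it. potential n it') \<le> potential n it" by auto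
qed

text \<open>A loop of prescribed length is a fold, to which the closure properties of polynomial
  time apply. Further iterations leave an empty worklist unchanged.\<close>

definition work :: "nat \<Rightarrow> nat \<Rightarrow> nat \<Rightarrow> item list \<Rightarrow> nat list" where
  "work fuel N M its = fst (foldl (\<lambda>st u. work_step N M st) ([], its) (replicate fuel ()))"

definition state_ok :: "nat \<Rightarrow> nat \<Rightarrow> nat \<Rightarrow> int poly \<Rightarrow> nat \<Rightarrow> nat list \<times> item list \<Rightarrow> bool" where
  "state_ok n N K f k st \<longleftrightarrow> (\<forall>it\<in>set (snd st). item_ok n N K it) \<and>
     eqm N (2 ^ K) (poly_of (fst st) + (\<Sum>it\<leftarrow>snd st. item_value it)) f \<and>
     (\<Sum>it\<leftarrow>snd st. potential n it) \<le> k"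

lemma work_step_ok:
  assumes "K > 0" "N > 0" "state_ok n N K f k st"
  shows "state_ok n N K f (k - 1) (work_step N (2 ^ K) st)"
proof (cases "snd st")
  case Nil
  then show ?thesis using assms by (simp add: work_step_def state_ok_def)
next
  case (Cons it its)
  let ?M = "2 ^ K"
  have it: "item_ok n N K it" using assms(3) Cons by (auto simp: state_ok_def)
  note e = expand_ok[OF assms(1,2) it]
  have "eqm N ?M (poly_of (pnorm N ?M (fst st @ leaf it)) + ((\<Sum>it'\<leftarrow>expand N ?M it. item_value it') + (\<Sum>it\<leftarrow>its. item_value it)))
      ((poly_of (fst st) + poly_of (leaf it)) + ((\<Sum>it'\<leftarrow>expand N ?M it. item_value it') + (\<Sum>it\<leftarrow>its. item_value it)))"
    using eqm_pnorm[of N ?M "fst st @ leaf it"] by (intro eqm_add eqm_refl) simp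
  also have "\<dots> = (poly_of (leaf it) + (\<Sum>it'\<leftarrow>expand N ?M it. item_value it')) + (poly_of (fst st) + (\<Sum>it\<leftarrow>its. item_value it))"
    by simp
  also have "eqm N ?M \<dots> (item_value it + (poly_of (fst st) + (\<Sum>it\<leftarrow>its. item_value it)))"
    by (intro eqm_add e eqm_refl)
  also have "\<dots> = poly_of (fst st) + (\<Sum>it\<leftarrow>snd st. item_value it)" by (simp add: Cons)
  also have "eqm N ?M \<dots> f" using assms(3) by (simp add: state_ok_def)
  finally have "eqm N ?M (poly_of (fst (work_step N ?M st)) + (\<Sum>it\<leftarrow>snd (work_step N ?M st). item_value it)) f"
    by (simp add: work_step_def Cons)
  moreover have "\<forall>it\<in>set (snd (work_step N ?M st)). item_ok n N K it"
    using e(1) assms(3) unfolding state_ok_def work_step_def Cons by (simp add: ball_Un)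
  moreover have "(\<Sum>it\<leftarrow>snd (work_step N ?M st). potential n it) \<le> k - 1"
  proof -
    have "potential n it + (\<Sum>it\<leftarrow>its. potential n it) \<le> k"
      using assms(3) unfolding state_ok_def Cons by simp
    then have "Suc ((\<Sum>it'\<leftarrow>expand N ?M it. potential n it') + (\<Sum>it\<leftarrow>its. potential n it)) \<le> k"
      using e(3) by linarith
    then show ?thesis by (simp add: work_step_def Cons)
  qed
  ultimately show ?thesis unfolding state_ok_def by blast
qed

lemma foldl_work_step_ok:
  assumes "K > 0" "N > 0" "state_ok n N K f k st"
  shows "state_ok n N K f (k - j) (foldl (\<lambda>st u. work_step N (2 ^ K) st) st (replicate j ()))"
  using assms(3)
proof (induction j arbitrary: st k)
  case (Suc j)
  from Suc.IH[OF work_step_ok[OF assms(1,2) Suc.prems]] show ?case by simp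
qed simp

lemma potential_pos: "potential n it > 0"
  by (simp add: potential_def)

text \<open>Every step lowers the total potential by at least 1 while items have positive potential.
  So the worklist is empty when the fuel is used up, and the accumulator holds the full
  value.\<close>

lemma work_correct:
  assumes "K > 0" "N > 0" "\<And>it. it \<in> set its \<Longrightarrow> item_ok n N K it" "(\<Sum>it\<leftarrow>its. potential n it) \<le> fuel"
  shows "eqm N (2 ^ K) (poly_of (work fuel N (2 ^ K) its)) (\<Sum>it\<leftarrow>its. item_value it)"
proof -
  let ?f = "\<Sum>it\<leftarrow>its. item_value it"
  let ?st = "foldl (\<lambda>st u. work_step N (2 ^ K) st) ([], its) (replicate fuel ())"
  have "state_ok n N K ?f fuel ([], its)" using assms by (simp add: state_ok_def)
  from foldl_work_step_ok[OF assms(1,2) this, of fuel] have ok: "state_ok n N K ?f 0 ?st" by simp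
  have "snd ?st = []"
  proof (rule ccontr)
    assume "snd ?st \<noteq> []"
    then obtain it its' where "snd ?st = it # its'" by (meson list.exhaust)
    then have "potential n it = 0" using ok unfolding state_ok_def by simp
    then show False using potential_pos[of n it] by simp
  qed
  then show ?thesis using ok by (simp add: state_ok_def work_def)
qed

section \<open>Path systems\<close>

text \<open>The graphs of the bijections from \<open>U\<close> to \<open>C\<close>. Writing them as
  sets of pairs makes a term of a permanent a directed graph, loops included.\<close>

definition graphs :: "nat set \<Rightarrow> nat set \<Rightarrow> (nat \<times> nat) set set" where
  "graphs U C = {D. D \<subseteq> U \<times> C \<and> (\<forall>u\<in>U. \<exists>!c. (u, c) \<in> D) \<and> (\<forall>c\<in>C. \<exists>!u. (u, c) \<in> D)}"

lemma graphs_empty: "graphs {} C = (if C = {} then {{}} else {})"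
  by (auto simp: graphs_def)

text \<open>Bijections are sorted by the image \<open>c\<close> of \<open>u\<close>, which mirrors
  Laplace expansion along the row of \<open>u\<close>.\<close>

lemma sum_graphs_insert:
  assumes fin: "finite C" "finite U" and u: "u \<notin> U"
  shows "(\<Sum>D\<in>graphs (insert u U) C. F D) = (\<Sum>c\<in>C. \<Sum>D\<in>graphs U (C - {c}). F (insert (u, c) D))"
proof -
  have fing: "finite (graphs U (C - {c}))" for c
    by (rule finite_subset[of _ "Pow (U \<times> C)"]) (use fin in \<open>auto simp: graphs_def\<close>)
  have "(\<Sum>c\<in>C. \<Sum>D\<in>graphs U (C - {c}). F (insert (u, c) D)) =
      (\<Sum>(c, D)\<in>Sigma C (\<lambda>c. graphs U (C - {c})). F (insert (u, c) D))"
    by (intro sum.Sigma fin ballI fing)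
  also have "\<dots> = (\<Sum>D\<in>graphs (insert u U) C. F D)"
  proof (rule sum.reindex_bij_witness[where i = "\<lambda>D. (THE c. (u, c) \<in> D, {p \<in> D. fst p \<noteq> u})"
        and j = "\<lambda>(c, D). insert (u, c) D"])
    fix a assume "a \<in> Sigma C (\<lambda>c. graphs U (C - {c}))"
    then obtain c D where a: "a = (c, D)" "c \<in> C" "D \<in> graphs U (C - {c})" by auto
    then have D: "D \<subseteq> U \<times> (C - {c})" "\<And>v. v \<in> U \<Longrightarrow> \<exists>!c. (v, c) \<in> D" "\<And>d. d \<in> C - {c} \<Longrightarrow> \<exists>!v. (v, d) \<in> D"
      by (auto simp: graphs_def)
    have the: "(THE d. (u, d) \<in> insert (u, c) D) = c" using D(1) u by (intro the_equality) auto
    show "(THE d. (u, d) \<in> (case a of (c, D) \<Rightarrow> insert (u, c) D), {p \<in> (case a of (c, D) \<Rightarrow> insert (u, c) D). fst p \<noteq> u}) = a"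
      using the D(1) u by (auto simp: a)
    have e1: "\<exists>!d. (v, d) \<in> insert (u, c) D" if v: "v \<in> insert u U" for v
    proof (cases "v = u")
      case True
      then show ?thesis using D(1) u by (intro ex1I[of _ c]) auto
    next
      case False
      then show ?thesis using D(2)[of v] v by simp
    qed
    have e2: "\<exists>!v. (v, d) \<in> insert (u, c) D" if d: "d \<in> C" for d
    proof (cases "d = c")
      case True
      then show ?thesis using D(1) by (intro ex1I[of _ u]) auto
    next
      case False
      then show ?thesis using D(3)[of d] d by simp
    qed
    have "insert (u, c) D \<subseteq> insert u U \<times> C" using D(1) a(2) by auto
    then have "insert (u, c) D \<in> graphs (insert u U) C"
      unfolding graphs_def mem_Collect_eq by (intro conjI ballI e1 e2)
    then show "(case a of (c, D) \<Rightarrow> insert (u, c) D) \<in> graphs (insert u U) C" by (simp add: a)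
    show "F (case a of (c, D) \<Rightarrow> insert (u, c) D) = (case a of (c, D) \<Rightarrow> F (insert (u, c) D))"
      by (simp add: a)
  next
    fix D assume "D \<in> graphs (insert u U) C"
    then have D: "D \<subseteq> insert u U \<times> C" "\<And>v. v \<in> insert u U \<Longrightarrow> \<exists>!c. (v, c) \<in> D" "\<And>d. d \<in> C \<Longrightarrow> \<exists>!v. (v, d) \<in> D"
      by (auto simp: graphs_def)
    have ex1: "\<exists>!c. (u, c) \<in> D" by (rule D(2)) simp
    define c where "c = (THE c. (u, c) \<in> D)"
    have c: "(u, c) \<in> D" unfolding c_def by (rule theI'[OF ex1])
    have c': "d = c" if "(u, d) \<in> D" for d unfolding c_def by (rule the1_equality[OF ex1 that, symmetric])
    have the: "(THE d. (u, d) \<in> D) = c" by (simp add: c_def)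
    have cC: "c \<in> C" using c D(1) by auto
    have e0: "{p \<in> D. fst p \<noteq> u} \<subseteq> U \<times> (C - {c})"
    proof
      fix p assume p: "p \<in> {p \<in> D. fst p \<noteq> u}"
      obtain v d where pv: "p = (v, d)" by fastforce
      have "v = u" if "d = c" using ex1E[OF D(3)[OF cC]] c p that unfolding pv by (metis (no_types, lifting) mem_Collect_eq)
      moreover have "v \<noteq> u" using p pv by simp
      ultimately have "d \<noteq> c" by blast
      then show "p \<in> U \<times> (C - {c})" using p pv D(1) by auto
    qed
    have e1: "\<exists>!d. (v, d) \<in> {p \<in> D. fst p \<noteq> u}" if v: "v \<in> U" for v
    proof -
      have "v \<noteq> u" using v u by auto
      then show ?thesis using D(2)[of v] v by simp
    qed
    have e2: "\<exists>!v. (v, d) \<in> {p \<in> D. fst p \<noteq> u}" if d: "d \<in> C - {c}" for d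
    proof -
      have "(v, d) \<in> {p \<in> D. fst p \<noteq> u} \<longleftrightarrow> (v, d) \<in> D" for v using c'[of d] d by auto
      then show ?thesis using D(3)[of d] d by simp
    qed
    have "{p \<in> D. fst p \<noteq> u} \<in> graphs U (C - {c})"
      unfolding graphs_def by (rule CollectI) (intro conjI ballI e0 e1 e2)
    then show "(THE c. (u, c) \<in> D, {p \<in> D. fst p \<noteq> u}) \<in> Sigma C (\<lambda>c. graphs U (C - {c}))"
      using cC by (simp add: the)
    show "(case (THE c. (u, c) \<in> D, {p \<in> D. fst p \<noteq> u}) of (c, D) \<Rightarrow> insert (u, c) D) = D"
    proof -
      have "p \<in> D \<longleftrightarrow> p = (u, c) \<or> p \<in> D \<and> fst p \<noteq> u" for p
        using c c'[of "snd p"] by (cases p) fastforce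
      then show ?thesis unfolding the prod.case by blast
    qed
  qed
  finally show ?thesis ..
qed

text \<open>The Leibniz formula, obtained by unfolding the Laplace expansions row by row.\<close>

lemma per_eq_sum_graphs:
  fixes f :: "nat \<Rightarrow> nat \<Rightarrow> 'r::comm_ring_1"
  assumes "finite C" "distinct us" "card C = length us"
  shows "per C (map f us) = (\<Sum>D\<in>graphs (set us) C. \<Prod>p\<in>D. f (fst p) (snd p))"
  using assms
proof (induction us arbitrary: C)
  case (Cons u us)
  have "per C (map f (u # us)) = (\<Sum>c\<in>C. f u c * (\<Sum>D\<in>graphs (set us) (C - {c}). \<Prod>p\<in>D. f (fst p) (snd p)))"
    unfolding list.map per.simps by (intro sum.cong refl arg_cong2[where f = "(*)"] Cons.IH) (use Cons.prems in auto)
  also have "\<dots> = (\<Sum>c\<in>C. \<Sum>D\<in>graphs (set us) (C - {c}). \<Prod>p\<in>insert (u, c) D. f (fst p) (snd p))"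
    unfolding sum_distrib_left
  proof (intro sum.cong refl)
    fix c D assume "D \<in> graphs (set us) (C - {c})"
    then have "D \<subseteq> set us \<times> (C - {c})" by (simp add: graphs_def)
    moreover from this have "finite D" by (rule finite_subset) (use Cons.prems in simp)
    moreover have "(u, c) \<notin> D" using calculation Cons.prems by auto
    ultimately show "f u c * (\<Prod>p\<in>D. f (fst p) (snd p)) = (\<Prod>p\<in>insert (u, c) D. f (fst p) (snd p))" by simp
  qed
  also have "\<dots> = (\<Sum>D\<in>graphs (insert u (set us)) C. \<Prod>p\<in>D. f (fst p) (snd p))"
    by (rule sum_graphs_insert[symmetric]) (use Cons.prems in auto)
  finally show ?case by simp
qed (simp add: graphs_empty)

section \<open>Components and reversal of arcs\<close>

definition parcs :: "'a list \<Rightarrow> ('a \<times> 'a) set" where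
  "parcs p = {(p ! i, p ! Suc i) |i. Suc i < length p}"

definition component :: "('a \<times> 'a) set \<Rightarrow> 'a \<Rightarrow> 'a set" where
  "component D t = {x. (t, x) \<in> (D \<union> D\<inverse>)\<^sup>*}"

definition closed_in :: "('a \<times> 'a) set \<Rightarrow> 'a set \<Rightarrow> bool" where
  "closed_in D C \<longleftrightarrow> (\<forall>(u, v)\<in>D. u \<in> C \<longleftrightarrow> v \<in> C)"

text \<open>Testing the tail of an arc is enough for the sets \<open>C\<close> of interest, which
  contain either both ends of an arc or none.\<close>

definition reverse_on :: "'a set \<Rightarrow> ('a \<times> 'a) set \<Rightarrow> ('a \<times> 'a) set" where
  "reverse_on C D = (\<lambda>p. if fst p \<in> C then (snd p, fst p) else p) ` D"

lemma mem_reverse_on: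
  assumes "closed_in D C"
  shows "(u, v) \<in> reverse_on C D \<longleftrightarrow> (if u \<in> C then (v, u) \<in> D else (u, v) \<in> D)"
proof
  assume "(u, v) \<in> reverse_on C D"
  then obtain x y where xy: "(x, y) \<in> D" "(u, v) = (if x \<in> C then (y, x) else (x, y))"
    by (auto simp: reverse_on_def)
  have "x \<in> C \<longleftrightarrow> y \<in> C" using xy(1) assms by (auto simp: closed_in_def)
  then show "if u \<in> C then (v, u) \<in> D else (u, v) \<in> D" using xy by (cases "x \<in> C") auto
next
  assume *: "if u \<in> C then (v, u) \<in> D else (u, v) \<in> D"
  show "(u, v) \<in> reverse_on C D"
  proof (cases "u \<in> C")
    case True
    then have "(v, u) \<in> D" using * by simp
    moreover from this True have "v \<in> C" using assms by (auto simp: closed_in_def)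
    ultimately show ?thesis unfolding reverse_on_def by (intro image_eqI[of _ _ "(v, u)"]) auto
  next
    case False
    then show ?thesis unfolding reverse_on_def using * by (intro image_eqI[of _ _ "(u, v)"]) auto
  qed
qed

lemma sym_reverse_on:
  assumes "closed_in D C"
  shows "reverse_on C D \<union> (reverse_on C D)\<inverse> = D \<union> D\<inverse>"
proof -
  have "(u, v) \<in> reverse_on C D \<union> (reverse_on C D)\<inverse> \<longleftrightarrow> (u, v) \<in> D \<union> D\<inverse>" for u v
    using assms by (auto simp: mem_reverse_on[OF assms] closed_in_def split: if_splits)
  then show ?thesis by auto
qed

lemma component_reverse_on: "closed_in D C \<Longrightarrow> component (reverse_on C D) t = component D t"
  by (simp add: component_def sym_reverse_on)

lemma closed_in_sym: "D \<union> D\<inverse> = D' \<union> D'\<inverse> \<Longrightarrow> closed_in D C \<Longrightarrow> closed_in D' C"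
proof -
  assume *: "D \<union> D\<inverse> = D' \<union> D'\<inverse>" "closed_in D C"
  have "u \<in> C \<longleftrightarrow> v \<in> C" if "(u, v) \<in> D'" for u v
  proof -
    have "(u, v) \<in> D \<union> D\<inverse>" using * that by auto
    then show ?thesis using *(2) by (auto simp: closed_in_def)
  qed
  then show ?thesis by (auto simp: closed_in_def)
qed

lemma closed_in_reverse_on: "closed_in D C \<Longrightarrow> closed_in D C' \<Longrightarrow> closed_in (reverse_on C D) C'"
  using closed_in_sym[of D "reverse_on C D" C'] sym_reverse_on[of D C] by metis

lemma reverse_on_reverse_on: "closed_in D C \<Longrightarrow> reverse_on C (reverse_on C D) = D"
proof -
  assume *: "closed_in D C"
  have cl: "a \<in> C \<longleftrightarrow> b \<in> C" if "(a, b) \<in> D" for a b using * that by (auto simp: closed_in_def)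
  have "(u, v) \<in> reverse_on C (reverse_on C D) \<longleftrightarrow> (u, v) \<in> D" for u v
    unfolding mem_reverse_on[OF closed_in_reverse_on[OF * *]] mem_reverse_on[OF *] using cl[of u v] cl[of v u] by auto
  then show ?thesis by auto
qed

lemma closed_in_component: "closed_in D (component D t)"
proof -
  have "u \<in> component D t \<longleftrightarrow> v \<in> component D t" if "(u, v) \<in> D" for u v
    using that unfolding component_def by (auto intro: rtrancl_into_rtrancl)
  then show ?thesis by (auto simp: closed_in_def)
qed

lemma component_subset: "closed_in D C \<Longrightarrow> t \<in> C \<Longrightarrow> component D t \<subseteq> C"
proof
  fix x assume *: "closed_in D C" "t \<in> C" "x \<in> component D t"
  from *(3) have "(t, x) \<in> (D \<union> D\<inverse>)\<^sup>*" by (simp add: component_def)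
  then show "x \<in> C" by induction (use * in \<open>auto simp: closed_in_def\<close>)
qed

lemma component_self: "t \<in> component D t"
  by (simp add: component_def)

lemma component_eq: "x \<in> component D t \<Longrightarrow> component D x = component D t"
proof -
  assume x: "x \<in> component D t"
  have "sym ((D \<union> D\<inverse>)\<^sup>*)" by (intro sym_rtrancl) (auto simp: sym_def)
  then have "t \<in> component D x" using x by (auto simp: component_def dest: symD)
  then show ?thesis using x component_subset[OF closed_in_component] by (metis subset_antisym)
qed

lemma closed_in_UN: "(\<And>i. i \<in> I \<Longrightarrow> closed_in D (f i)) \<Longrightarrow> closed_in D (\<Union>i\<in>I. f i)"
  by (auto simp: closed_in_def; blast)

text \<open>The node-disjoint systems of directed cycles and directed paths: a terminal is either
  the source or the sink of a path, and every other node lies inside a path or on a cycle. A node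
  that is not visited carries a loop.\<close>

definition config :: "nat set \<Rightarrow> nat set \<Rightarrow> (nat \<times> nat) set \<Rightarrow> bool" where
  "config V T D \<longleftrightarrow> D \<subseteq> V \<times> V \<and> (\<forall>u v v'. (u, v) \<in> D \<longrightarrow> (u, v') \<in> D \<longrightarrow> v = v') \<and>
     (\<forall>u u' v. (u, v) \<in> D \<longrightarrow> (u', v) \<in> D \<longrightarrow> u = u') \<and>
     (\<forall>v\<in>V - T. v \<in> Domain D \<and> v \<in> Range D) \<and> (\<forall>t\<in>T. t \<in> Domain D \<longleftrightarrow> t \<notin> Range D)"

lemma configD:
  assumes "config V T D"
  shows "D \<subseteq> V \<times> V" "(u, v) \<in> D \<Longrightarrow> (u, v') \<in> D \<Longrightarrow> v = v'" "(u, v) \<in> D \<Longrightarrow> (u', v) \<in> D \<Longrightarrow> u = u'"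
    "v \<in> V - T \<Longrightarrow> v \<in> Domain D" "v \<in> V - T \<Longrightarrow> v \<in> Range D" "t \<in> T \<Longrightarrow> t \<in> Domain D \<longleftrightarrow> t \<notin> Range D"
  using assms[unfolded config_def, THEN conjunct1]
    assms[unfolded config_def, THEN conjunct2, THEN conjunct1, rule_format, of u v v']
    assms[unfolded config_def, THEN conjunct2, THEN conjunct2, THEN conjunct1, rule_format, of u v u']
    assms[unfolded config_def, THEN conjunct2, THEN conjunct2, THEN conjunct2, THEN conjunct1, rule_format, of v]
    assms[unfolded config_def, THEN conjunct2, THEN conjunct2, THEN conjunct2, THEN conjunct2, rule_format, of t]
  by simp_all

lemma config_converse: "config V T D \<Longrightarrow> config V T (D\<inverse>)"
  unfolding config_def by (auto; blast)

lemma config_reverse_on: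
  assumes D: "config V T D" and C: "closed_in D C"
  shows "config V T (reverse_on C D)"
proof -
  have dom: "v \<in> Domain (reverse_on C D) \<longleftrightarrow> (if v \<in> C then v \<in> Range D else v \<in> Domain D)" for v
    by (auto simp: Domain_iff Range_iff mem_reverse_on[OF C])
  have ran: "v \<in> Range (reverse_on C D) \<longleftrightarrow> (if v \<in> C then v \<in> Domain D else v \<in> Range D)" for v
    using C by (auto simp: Domain_iff Range_iff mem_reverse_on[OF C] closed_in_def)
  have cl: "u \<in> C \<longleftrightarrow> v \<in> C" if "(u, v) \<in> D" for u v using C that by (auto simp: closed_in_def)
  have "reverse_on C D \<subseteq> V \<times> V" using D by (auto simp: config_def mem_reverse_on[OF C] split: if_splits)
  moreover have "v = v'" if "(u, v) \<in> reverse_on C D" "(u, v') \<in> reverse_on C D" for u v v'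
    using that D by (auto simp: mem_reverse_on[OF C] config_def split: if_splits)
  moreover have "u = u'" if "(u, v) \<in> reverse_on C D" "(u', v) \<in> reverse_on C D" for u u' v
    using that D cl by (auto simp: mem_reverse_on[OF C] config_def split: if_splits)
  ultimately show ?thesis
    using D unfolding config_def dom ran by auto
qed

lemma Domain_reverse_on: "closed_in D C \<Longrightarrow> v \<in> Domain (reverse_on C D) \<longleftrightarrow> (if v \<in> C then v \<in> Range D else v \<in> Domain D)"
  by (auto simp: Domain_iff Range_iff mem_reverse_on)

text \<open>Take a longest path from \<open>s\<close> along arcs. Its end has no outgoing arc: by
  maximality such an arc does not reach a new node, the later nodes of the path have their incoming
  arc already, and \<open>s\<close> has none. So the end is a terminal, and the nodes of the path
  are closed under arcs and form the component of \<open>s\<close>.\<close>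

lemma config_path:
  assumes fin: "finite V" and T: "T \<subseteq> V" and D: "config V T D" and s: "s \<in> T" "s \<in> Domain D"
  obtains p where "p \<noteq> []" "distinct p" "set p \<subseteq> V" "hd p = s" "parcs p \<subseteq> D" "last p \<in> T" "last p \<notin> Domain D"
    "last p \<noteq> s" "set p = component D s" "set p \<inter> T = {s, last p}"
proof -
  let ?P = "\<lambda>p. p \<noteq> [] \<and> distinct p \<and> set p \<subseteq> V \<and> hd p = s \<and> parcs p \<subseteq> D"
  have "?P [s]" using s T by (auto simp: parcs_def)
  moreover have "length p \<le> card V" if "?P p" for p
    using that fin by (metis card_mono distinct_card)
  ultimately have "\<exists>p. ?P p \<and> (\<forall>q. ?P q \<longrightarrow> length q \<le> length p)"
    by (intro ex_has_greatest_nat[of ?P "[s]" length "Suc (card V)"]) (simp_all add: le_imp_less_Suc)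
  then obtain p where p: "?P p" and max: "\<And>q. ?P q \<Longrightarrow> length q \<le> length p" by metis
  have sv: "\<And>u v v'. (u, v) \<in> D \<Longrightarrow> (u, v') \<in> D \<Longrightarrow> v = v'" and inj: "\<And>u u' v. (u, v) \<in> D \<Longrightarrow> (u', v) \<in> D \<Longrightarrow> u = u'"
    and DV: "D \<subseteq> V \<times> V" and endp: "\<And>t. t \<in> T \<Longrightarrow> t \<in> Domain D \<longleftrightarrow> t \<notin> Range D"
    and nonterm: "\<And>v. v \<in> V - T \<Longrightarrow> v \<in> Domain D \<and> v \<in> Range D"
    by (fact configD(2)[OF D] configD(3)[OF D] configD(1)[OF D] configD(6)[OF D] | blast intro: configD(4,5)[OF D])+
  have arc: "(p ! i, p ! Suc i) \<in> D" if "Suc i < length p" for i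
    using p that by (auto simp: parcs_def)
  have hd: "p ! 0 = s" using p by (metis hd_conv_nth)
  have s_notin: "s \<notin> Range D" using s endp by blast
  have last_dom: "last p \<notin> Domain D"
  proof
    assume "last p \<in> Domain D"
    then obtain y where y: "(last p, y) \<in> D" by auto
    have "y \<notin> set p"
    proof
      assume "y \<in> set p"
      then obtain i where i: "i < length p" "p ! i = y" by (auto simp: in_set_conv_nth)
      show False
      proof (cases i)
        case 0
        then show False using i hd y s_notin by (auto simp: Range_iff)
      next
        case (Suc j)
        then have "p ! j = last p" using inj[OF arc[of j]] i y by auto
        then have "j = length p - 1" using p i Suc by (metis Suc_lessD diff_less last_conv_nth length_greater_0_conv nth_eq_iff_index_eq zero_less_one)
        then show False using i Suc by simp
      qed
    qed
    moreover have "parcs (p @ [y]) \<subseteq> D"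
    proof
      fix a assume "a \<in> parcs (p @ [y])"
      then obtain i where i: "a = ((p @ [y]) ! i, (p @ [y]) ! Suc i)" "Suc i < length (p @ [y])"
        by (auto simp: parcs_def)
      show "a \<in> D"
      proof (cases "Suc i < length p")
        case True
        then show ?thesis using i arc[of i] by (simp add: nth_append)
      next
        case False
        then have "i = length p - 1" "Suc i = length p" using i(2) by auto
        then show ?thesis using i y p by (simp add: nth_append last_conv_nth)
      qed
    qed
    ultimately have "?P (p @ [y])" using p y DV by auto
    from max[OF this] show False by simp
  qed
  have "last p \<in> V" using p by (meson last_in_set subsetD)
  then have last_T: "last p \<in> T" using nonterm last_dom by blast
  have "last p \<noteq> s" using last_dom s by auto
  have cl: "closed_in D (set p)"
  proof -
    have "u \<in> set p \<longleftrightarrow> v \<in> set p" if uv: "(u, v) \<in> D" for u v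
    proof
      assume "u \<in> set p"
      then obtain i where i: "i < length p" "p ! i = u" by (auto simp: in_set_conv_nth)
      have "Suc i \<noteq> length p" using uv last_dom i p by (metis DomainI diff_Suc_1 last_conv_nth)
      then have "Suc i < length p" using i by simp
      with sv[OF arc[OF this]] uv i show "v \<in> set p" by (metis nth_mem)
    next
      assume "v \<in> set p"
      then obtain i where i: "i < length p" "p ! i = v" by (auto simp: in_set_conv_nth)
      obtain j where j: "i = Suc j" using i hd uv s_notin by (cases i) auto
      with inj[OF arc[of j]] uv i show "u \<in> set p" by (metis Suc_lessD nth_mem)
    qed
    then show ?thesis by (auto simp: closed_in_def)
  qed
  have "set p \<subseteq> component D s"
  proof -
    have "p ! i \<in> component D s" if "i < length p" for i
      using that
    proof (induction i)
      case (Suc i)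
      then show ?case using arc[of i] closed_in_component[of D s] by (auto simp: closed_in_def)
    qed (simp add: hd component_self)
    then show ?thesis by (auto simp: in_set_conv_nth)
  qed
  moreover have "s \<in> set p" using p by (metis list.set_sel(1))
  ultimately have comp: "set p = component D s" using component_subset[OF cl] by blast
  have "x = s \<or> x = last p" if x: "x \<in> set p" "x \<in> T" for x
  proof -
    obtain i where i: "i < length p" "p ! i = x" using x by (auto simp: in_set_conv_nth)
    show ?thesis
    proof (cases "i = 0 \<or> Suc i = length p")
      case True
      then show ?thesis using i hd p by (metis diff_Suc_1 last_conv_nth)
    next
      case False
      then obtain j where j: "i = Suc j" by (cases i) auto
      have "x \<in> Range D" "x \<in> Domain D" using arc[of j] arc[of i] i j False by auto
      then show ?thesis using endp x by blast
    qed
  qed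
  then have "set p \<inter> T = {s, last p}" using \<open>s \<in> set p\<close> s last_T p by auto
  then show ?thesis using that p last_T last_dom \<open>last p \<noteq> s\<close> comp by blast
qed

text \<open>For a source this is the end of its path; for a sink the same path is followed in the
  converse system.\<close>

lemma config_partner:
  assumes fin: "finite V" and T: "T \<subseteq> V" and D: "config V T D" and t: "t \<in> T"
  shows "\<exists>t'. t' \<noteq> t \<and> component D t \<inter> T = {t, t'} \<and> (t' \<in> Domain D \<longleftrightarrow> t \<notin> Domain D)"
proof (cases "t \<in> Domain D")
  case True
  obtain p where "last p \<in> T" "last p \<notin> Domain D" "last p \<noteq> t" "set p \<inter> T = {t, last p}" "set p = component D t"
    by (rule config_path[OF fin T D t True]) blast
  then show ?thesis using True by metis
next
  case False
  have D': "config V T (D\<inverse>)" by (rule config_converse[OF D])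
  have "t \<in> Domain (D\<inverse>)" using False D t by (auto simp: config_def)
  from this obtain p where p: "last p \<in> T" "last p \<notin> Domain (D\<inverse>)"
    "last p \<noteq> t" "set p = component (D\<inverse>) t" "set p \<inter> T = {t, last p}"
    by (rule config_path[OF fin T D' t]) blast
  moreover have "component (D\<inverse>) t = component D t" by (simp add: component_def Un_commute)
  moreover have "last p \<in> Domain D" using D p(1,2) by (auto simp: config_def)
  ultimately show ?thesis using False by metis
qed

section \<open>The signed sum over all path systems\<close>

definition edges_of :: "'a list set \<Rightarrow> 'a set set" where
  "edges_of Ps = (\<lambda>a. {fst a, snd a}) ` (\<Union>p\<in>Ps. parcs p)"

lemma ex1_eq: "\<exists>!x. P x \<Longrightarrow> P a \<Longrightarrow> P b \<Longrightarrow> a = b"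
  by (elim ex1E) metis

text \<open>Positive weights serve two purposes: they make the matrix the identity modulo x, and
  they make a system strictly heavier if it contains a cycle of at least two nodes.\<close>

locale path_instance =
  fixes V :: "nat set" and E :: "nat set set" and A B :: "nat set" and we :: "nat set \<Rightarrow> nat"
  assumes graph: "simple_graph V E" and sub: "A \<subseteq> V" "B \<subseteq> V" and disj: "A \<inter> B = {}"
    and ev: "even (card A)" "even (card B)" and we_pos: "\<And>e. e \<in> E \<Longrightarrow> we e > 0"
begin

abbreviation "T \<equiv> A \<union> B"

definition adm :: "(nat \<times> nat) set \<Rightarrow> bool" where
  "adm D \<longleftrightarrow> config V T D \<and> (\<forall>(u, v)\<in>D. u = v \<or> {u, v} \<in> E)"

definition weight :: "(nat \<times> nat) set \<Rightarrow> nat" where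
  "weight D = (\<Sum>p\<in>D. if fst p = snd p then 0 else we {fst p, snd p})"

definition sgn :: "(nat \<times> nat) set \<Rightarrow> int" where
  "sgn D = (- 1) ^ card (B \<inter> Domain D)"

definition mat :: "nat \<Rightarrow> nat \<Rightarrow> int poly" where
  "mat u c = (if u = c then 1 else if {u, c} \<in> E then monom 1 (we {u, c}) else 0)"

text \<open>\<open>S\<close> is the set of sources. A sink has no outgoing arc and a source no
  incoming one, so the rows omit \<open>T - S\<close> and the columns omit \<open>S\<close>. The
  inner sum is the permanent in Leibniz form.\<close>

definition Zpoly :: "int poly" where
  "Zpoly = (\<Sum>S\<in>{S. S \<subseteq> T \<and> 2 * card S = card T}.
     (- 1) ^ card (S \<inter> B) * (\<Sum>D\<in>graphs (V - (T - S)) (V - S). \<Prod>p\<in>D. mat (fst p) (snd p)))"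

lemma finV: "finite V" using graph by (simp add: simple_graph_def)

lemma TV: "T \<subseteq> V" using sub by auto

lemma finT: "finite A" "finite B" "finite T" using finV sub finite_subset by auto

lemma finite_config: "config V T D \<Longrightarrow> finite D"
  using finV by (metis configD(1) finite_SigmaI finite_subset)

lemma finite_configs: "finite {D. config V T D \<and> Q D}"
  by (rule finite_subset[of _ "Pow (V \<times> V)"]) (use finV in \<open>auto simp: config_def\<close>)

text \<open>A system is the graph of a bijection from its domain to its range. The nodes outside
  \<open>T\<close> belong to both, which leaves as many sources as sinks.\<close>

lemma card_sources:
  assumes D: "config V T D" shows "2 * card (T \<inter> Domain D) = card T"
proof -
  have fin: "finite D" by (rule finite_config[OF D])
  have "inj_on fst D" "inj_on snd D"
    by (auto simp: inj_on_def dest: configD(2,3)[OF D])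
  then have "card (Domain D) = card (Range D)"
    by (simp add: Domain_fst Range_snd card_image)
  moreover have d: "Domain D = (V - T) \<union> (T \<inter> Domain D)" and r: "Range D = (V - T) \<union> (T - Domain D)"
    using configD(1,4,5,6)[OF D] by (auto simp: Domain_iff Range_iff; blast)+
  moreover have "card ((V - T) \<union> (T \<inter> Domain D)) = card (V - T) + card (T \<inter> Domain D)"
    "card ((V - T) \<union> (T - Domain D)) = card (V - T) + card (T - Domain D)"
    using finV finT by (auto intro!: card_Un_disjoint)
  ultimately have "card (T \<inter> Domain D) = card (T - Domain D)"
    using arg_cong[OF d, of card] arg_cong[OF r, of card] by linarith
  moreover have "card (T \<inter> Domain D) + card (T - Domain D) = card T"
    using finT(3) by (metis card_Int_Diff)
  ultimately show ?thesis by simp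
qed

lemma graphs_iff_config:
  assumes S: "S \<subseteq> T"
  shows "D \<in> graphs (V - (T - S)) (V - S) \<longleftrightarrow> config V T D \<and> T \<inter> Domain D = S"
proof
  assume "D \<in> graphs (V - (T - S)) (V - S)"
  then have sub: "D \<subseteq> (V - (T - S)) \<times> (V - S)" and e1: "\<And>u. u \<in> V - (T - S) \<Longrightarrow> \<exists>!c. (u, c) \<in> D"
    and e2: "\<And>c. c \<in> V - S \<Longrightarrow> \<exists>!u. (u, c) \<in> D" by (simp_all add: graphs_def)
  have sv: "v = v'" if "(u, v) \<in> D" "(u, v') \<in> D" for u v v'
  proof -
    have "u \<in> V - (T - S)" using sub that by blast
    from ex1_eq[OF e1[OF this] that] show ?thesis .
  qed
  have inj: "u = u'" if "(u, v) \<in> D" "(u', v) \<in> D" for u u' v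
  proof -
    have "v \<in> V - S" using sub that by blast
    from ex1_eq[OF e2[OF this] that] show ?thesis .
  qed
  have dom: "Domain D = V - (T - S)"
    using sub ex1_implies_ex[OF e1] by blast
  have ran: "Range D = V - S"
    using sub ex1_implies_ex[OF e2] by blast
  have "config V T D"
    unfolding config_def dom ran
  proof (intro conjI allI impI ballI)
    show "D \<subseteq> V \<times> V" using sub by blast
    fix t assume "t \<in> T"
    then show "(t \<in> V - (T - S)) = (t \<notin> V - S)" using S TV by blast
  next
    fix v assume "v \<in> V - T"
    then show "v \<in> V - (T - S)" "v \<in> V - S" using S by blast+
  qed (rule sv inj; assumption)+
  moreover have "T \<inter> Domain D = S" unfolding dom using S TV by blast
  ultimately show "config V T D \<and> T \<inter> Domain D = S" by blast
next
  assume "config V T D \<and> T \<inter> Domain D = S"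
  then have D: "config V T D" and SD: "T \<inter> Domain D = S" by auto
  have dom: "u \<in> Domain D \<longleftrightarrow> u \<in> V - (T - S)" for u
  proof -
    have "u \<in> V" if "u \<in> Domain D" using configD(1)[OF D] that by blast
    moreover have "u \<in> S" if "u \<in> T" "u \<in> Domain D" using that SD by blast
    moreover have "u \<in> Domain D" if "u \<in> S" using that SD by blast
    moreover have "u \<in> Domain D" if "u \<in> V" "u \<notin> T" using that configD(4)[OF D] by blast
    ultimately show ?thesis by (metis Diff_iff)
  qed
  have ran: "u \<in> Range D \<longleftrightarrow> u \<in> V - S" for u
  proof -
    have "u \<in> V" if "u \<in> Range D" using configD(1)[OF D] that by blast
    moreover have "u \<in> S \<longleftrightarrow> u \<notin> Range D" if "u \<in> T" using that SD configD(6)[OF D that] by blast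
    moreover have "u \<in> Range D" if "u \<in> V" "u \<notin> T" using that configD(5)[OF D] by blast
    moreover have "S \<subseteq> T" "T \<subseteq> V" using S TV by auto
    ultimately show ?thesis by (metis Diff_iff subsetD)
  qed
  show "D \<in> graphs (V - (T - S)) (V - S)"
    unfolding graphs_def
  proof (rule CollectI, intro conjI ballI)
    show "D \<subseteq> (V - (T - S)) \<times> (V - S)" using dom ran by auto
    show "\<exists>!c. (u, c) \<in> D" if "u \<in> V - (T - S)" for u
      using that dom configD(2)[OF D] by (metis Domain_iff)
    show "\<exists>!u. (u, c) \<in> D" if "c \<in> V - S" for c
      using that ran configD(3)[OF D] by (metis Range_iff)
  qed
qed

lemma prod_mat:
  assumes "config V T D"
  shows "(\<Prod>p\<in>D. mat (fst p) (snd p)) = (if adm D then monom 1 (weight D) else 0)"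
proof (cases "adm D")
  case True
  have "(\<Prod>p\<in>D. mat (fst p) (snd p)) = (\<Prod>p\<in>D. monom 1 (if fst p = snd p then 0 else we {fst p, snd p}))"
    using True by (intro prod.cong refl) (auto simp: mat_def adm_def monom_0 one_pCons)
  also have "\<dots> = monom 1 (weight D)"
    unfolding weight_def using finite_config[OF assms]
    by (induction D rule: finite_induct) (simp_all add: mult_monom monom_0 one_pCons)
  finally show ?thesis using True by simp
next
  case False
  then obtain u v where "(u, v) \<in> D" "u \<noteq> v" "{u, v} \<notin> E" using assms by (auto simp: adm_def)
  then have "\<exists>p\<in>D. mat (fst p) (snd p) = 0" by (intro bexI[of _ "(u, v)"]) (auto simp: mat_def)
  then show ?thesis using False finite_config[OF assms] by (simp add: prod_zero)
qed

text \<open>A system determines \<open>S\<close> as the set of its terminal sources, so the double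
  sum runs over every system once. The terms that use a pair outside \<open>E\<close>
  vanish.\<close>

lemma Zpoly_configs: "Zpoly = (\<Sum>D\<in>{D. adm D}. monom (sgn D) (weight D))"
proof -
  have finS: "finite {S. S \<subseteq> T \<and> 2 * card S = card T}" using finT(3) by simp
  have fing: "finite (graphs (V - (T - S)) (V - S))" for S
    by (rule finite_subset[of _ "Pow (V \<times> V)"]) (use finV in \<open>auto simp: graphs_def\<close>)
  have "Zpoly = (\<Sum>(S, D)\<in>Sigma {S. S \<subseteq> T \<and> 2 * card S = card T} (\<lambda>S. graphs (V - (T - S)) (V - S)).
      (- 1) ^ card (S \<inter> B) * (\<Prod>p\<in>D. mat (fst p) (snd p)))"
    unfolding Zpoly_def sum_distrib_left by (rule sum.Sigma) (use finS fing in auto)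
  also have "\<dots> = (\<Sum>D\<in>{D. config V T D}. of_int (sgn D) * (\<Prod>p\<in>D. mat (fst p) (snd p)))"
  proof (rule sum.reindex_bij_witness[where i = "\<lambda>D. (T \<inter> Domain D, D)" and j = snd])
    fix a assume "a \<in> Sigma {S. S \<subseteq> T \<and> 2 * card S = card T} (\<lambda>S. graphs (V - (T - S)) (V - S))"
    then obtain S D where a: "a = (S, D)" and S: "S \<subseteq> T" and D: "D \<in> graphs (V - (T - S)) (V - S)" by auto
    note c = D[unfolded graphs_iff_config[OF S]]
    show "(T \<inter> Domain (snd a), snd a) = a" using c by (simp add: a)
    show "snd a \<in> {D. config V T D}" using c by (simp add: a)
    have "B \<inter> Domain D = S \<inter> B" using c by auto
    then show "of_int (sgn (snd a)) * (\<Prod>p\<in>snd a. mat (fst p) (snd p)) =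
      (case a of (S, D) \<Rightarrow> (- 1) ^ card (S \<inter> B) * (\<Prod>p\<in>D. mat (fst p) (snd p)))"
      by (simp add: a sgn_def)
  next
    fix D assume "D \<in> {D. config V T D}"
    then have D: "config V T D" by simp
    have "D \<in> graphs (V - (T - T \<inter> Domain D)) (V - T \<inter> Domain D)"
      using graphs_iff_config[of "T \<inter> Domain D" D] D by simp
    then show "(T \<inter> Domain D, D) \<in> Sigma {S. S \<subseteq> T \<and> 2 * card S = card T} (\<lambda>S. graphs (V - (T - S)) (V - S))"
      using card_sources[OF D] by simp
  qed simp
  also have "\<dots> = (\<Sum>D\<in>{D. config V T D}. if adm D then monom (sgn D) (weight D) else 0)"
    by (intro sum.cong refl) (simp add: prod_mat of_int_poly smult_monom)
  also have "\<dots> = (\<Sum>D\<in>{D. adm D}. monom (sgn D) (weight D))"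
    using finite_configs[of "\<lambda>D. True"] by (subst sum.inter_filter[symmetric]) (auto simp: adm_def intro!: sum.cong)
  finally show ?thesis .
qed

definition good :: "(nat \<times> nat) set \<Rightarrow> bool" where
  "good D \<longleftrightarrow> (\<forall>t\<in>A. component D t \<inter> B = {})"

lemma weight_reverse_on:
  assumes "closed_in D C" shows "weight (reverse_on C D) = weight D"
proof -
  let ?f = "\<lambda>p. if fst p \<in> C then (snd p, fst p) else p"
  have "inj_on ?f D"
  proof (rule inj_onI)
    fix p q assume pq: "p \<in> D" "q \<in> D" "?f p = ?f q"
    have "fst p \<in> C \<longleftrightarrow> snd p \<in> C" "fst q \<in> C \<longleftrightarrow> snd q \<in> C"
      using assms pq by (auto simp: closed_in_def)
    then show "p = q" using pq(3) by (cases p, cases q) (auto split: if_splits)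
  qed
  then have "weight (reverse_on C D) =
      (\<Sum>p\<in>D. if fst (?f p) = snd (?f p) then 0 else we {fst (?f p), snd (?f p)})"
    unfolding weight_def reverse_on_def by (subst sum.reindex) (simp_all add: o_def)
  also have "\<dots> = weight D"
    unfolding weight_def by (intro sum.cong refl) (auto simp: insert_commute)
  finally show ?thesis .
qed

lemma adm_reverse_on:
  assumes "adm D" "closed_in D C" shows "adm (reverse_on C D)"
proof -
  have "u = v \<or> {u, v} \<in> E" if "(u, v) \<in> reverse_on C D" for u v
    using that assms(1) unfolding adm_def mem_reverse_on[OF assms(2)] by (auto simp: insert_commute split: if_splits)
  then show ?thesis using assms config_reverse_on by (auto simp: adm_def)
qed

lemma good_reverse_on: "closed_in D C \<Longrightarrow> good (reverse_on C D) \<longleftrightarrow> good D"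
  by (simp add: good_def component_reverse_on)

text \<open>The node \<open>t0\<close> depends on the components alone, which reversal preserves;
  therefore \<open>\<phi>\<close> is an involution. The reversed component contains exactly two
  terminals, one in \<open>A\<close> and one in \<open>B\<close>, so exactly one node of
  \<open>B\<close> changes between source and sink.\<close>

lemma Zpoly_good: "Zpoly = (\<Sum>D\<in>{D. adm D \<and> good D}. monom (sgn D) (weight D))"
proof -
  define t0 where "t0 D = Min {t\<in>A. component D t \<inter> B \<noteq> {}}" for D
  define \<phi> where "\<phi> D = reverse_on (component D (t0 D)) D" for D
  let ?f = "\<lambda>D. monom (sgn D) (weight D)"
  let ?Bad = "{D. adm D \<and> \<not> good D}"
  have \<phi>_\<phi>: "\<phi> (\<phi> D) = D" for D
  proof -
    note cl = closed_in_component[of D "t0 D"]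
    have comp: "component (\<phi> D) t = component D t" for t by (simp add: \<phi>_def component_reverse_on[OF cl])
    then have "t0 (\<phi> D) = t0 D" by (simp add: t0_def)
    then show ?thesis using comp reverse_on_reverse_on[OF cl] by (metis \<phi>_def)
  qed
  have \<phi>_bad: "\<phi> D \<in> ?Bad" if "D \<in> ?Bad" for D
    using that adm_reverse_on[OF _ closed_in_component] good_reverse_on[OF closed_in_component, of D] by (simp add: \<phi>_def)
  have flip: "?f (\<phi> D) = - ?f D" if "D \<in> ?Bad" for D
  proof -
    have D: "config V T D" using that by (simp add: adm_def)
    have cl: "closed_in D (component D (t0 D))" by (rule closed_in_component)
    have "{t\<in>A. component D t \<inter> B \<noteq> {}} \<noteq> {}" using that by (auto simp: good_def)
    then have "t0 D \<in> {t\<in>A. component D t \<inter> B \<noteq> {}}" unfolding t0_def using finT by (intro Min_in) auto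
    then have t0: "t0 D \<in> A" "component D (t0 D) \<inter> B \<noteq> {}" by auto
    obtain t' where t': "t' \<noteq> t0 D" "component D (t0 D) \<inter> T = {t0 D, t'}"
      using config_partner[OF finV TV D, of "t0 D"] t0 by auto
    have t'B: "t' \<in> B" and CB: "\<And>b. b \<in> B \<Longrightarrow> b \<in> component D (t0 D) \<longleftrightarrow> b = t'"
      using t' t0 disj by (auto; blast)+
    have dom: "b \<in> Domain (\<phi> D) \<longleftrightarrow> (if b = t' then b \<notin> Domain D else b \<in> Domain D)" if "b \<in> B" for b
      unfolding \<phi>_def Domain_reverse_on[OF cl] using CB[OF that] configD(6)[OF D, of b] that by auto
    have fin: "finite (B \<inter> Domain D)" using finT by simp
    have "sgn (\<phi> D) = - sgn D"
    proof (cases "t' \<in> Domain D")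
      case True
      have "x \<in> B \<inter> Domain D \<longleftrightarrow> x \<in> insert t' (B \<inter> Domain (\<phi> D))" for x
        using dom[of x] t'B True by (cases "x = t'"; cases "x \<in> B") simp_all
      moreover have "t' \<notin> B \<inter> Domain (\<phi> D)" using dom[OF t'B] True by simp
      ultimately have "B \<inter> Domain D = insert t' (B \<inter> Domain (\<phi> D))" "t' \<notin> B \<inter> Domain (\<phi> D)" by blast+
      then show ?thesis using finT by (simp add: sgn_def)
    next
      case False
      have "x \<in> B \<inter> Domain (\<phi> D) \<longleftrightarrow> x \<in> insert t' (B \<inter> Domain D)" for x
        using dom[of x] t'B False by (cases "x = t'"; cases "x \<in> B") simp_all
      then have "B \<inter> Domain (\<phi> D) = insert t' (B \<inter> Domain D)" "t' \<notin> B \<inter> Domain D"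
        using False by blast+
      then show ?thesis using finT by (simp add: sgn_def)
    qed
    moreover have "weight (\<phi> D) = weight D" unfolding \<phi>_def by (rule weight_reverse_on[OF cl])
    ultimately show ?thesis by (simp only: minus_monom)
  qed
  have "(\<Sum>D\<in>?Bad. ?f D) = (\<Sum>D\<in>?Bad. ?f (\<phi> D))"
    by (rule sum.reindex_bij_witness[where i = \<phi> and j = \<phi>]) (use \<phi>_\<phi> \<phi>_bad in auto)
  also have "\<dots> = (\<Sum>D\<in>?Bad. - ?f D)" by (intro sum.cong refl flip)
  also have "\<dots> = - (\<Sum>D\<in>?Bad. ?f D)" by (rule sum_negf)
  \<comment> \<open>A polynomial over the integers that equals its own negative is zero.\<close>
  finally have "(\<Sum>D\<in>?Bad. ?f D) = 0" unfolding equal_neg_zero .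
  moreover have all: "{D. adm D} = {D. adm D \<and> good D} \<union> ?Bad" by auto
  moreover have "(\<Sum>D\<in>{D. adm D \<and> good D} \<union> ?Bad. ?f D) = (\<Sum>D\<in>{D. adm D \<and> good D}. ?f D) + (\<Sum>D\<in>?Bad. ?f D)"
    by (intro sum.union_disjoint) (auto simp: adm_def intro: finite_subset[OF _ finite_configs[of "\<lambda>D. True"]])
  ultimately show ?thesis unfolding Zpoly_configs all by simp
qed

text \<open>Every source starts one path of the packing, and half of the terminals are sources. As
  no component meets both \<open>A\<close> and \<open>B\<close>, the ends of a path lie in the same
  set. Cycles and loops are discarded, hence the mere inclusion of arcs.\<close>

lemma packing_of_config:
  assumes D: "adm D" "good D"
  obtains Ps where "perfect_packing V E A B Ps" "(\<Union>p\<in>Ps. parcs p) \<subseteq> D"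
proof -
  have cf: "config V T D" using D by (simp add: adm_def)
  let ?S = "T \<inter> Domain D"
  have "\<exists>p. p \<noteq> [] \<and> distinct p \<and> set p \<subseteq> V \<and> hd p = s \<and> parcs p \<subseteq> D \<and> last p \<in> T \<and> last p \<notin> Domain D \<and>
      last p \<noteq> s \<and> set p = component D s" if "s \<in> ?S" for s
  proof -
    have s: "s \<in> T" "s \<in> Domain D" using that by auto
    obtain p where "p \<noteq> []" "distinct p" "set p \<subseteq> V" "hd p = s" "parcs p \<subseteq> D" "last p \<in> T" "last p \<notin> Domain D"
      "last p \<noteq> s" "set p = component D s" by (rule config_path[OF finV TV cf s]) blast
    then show ?thesis by blast
  qed
  then obtain P where P: "\<And>s. s \<in> ?S \<Longrightarrow> P s \<noteq> [] \<and> distinct (P s) \<and> set (P s) \<subseteq> V \<and> hd (P s) = s \<and> parcs (P s) \<subseteq> D \<and>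
      last (P s) \<in> T \<and> last (P s) \<notin> Domain D \<and> last (P s) \<noteq> s \<and> set (P s) = component D s" by metis
  have Tpath: "T_path V E A (P s) \<or> T_path V E B (P s)" if s: "s \<in> ?S" for s
  proof -
    have "successively (\<lambda>u v. {u, v} \<in> E) (P s)"
      unfolding successively_conv_nth
    proof (intro allI impI)
      fix i assume i: "Suc i < length (P s)"
      then have "(P s ! i, P s ! Suc i) \<in> D" using P[OF s] by (auto simp: parcs_def)
      moreover have "P s ! i \<noteq> P s ! Suc i" using P[OF s] i by (simp add: nth_eq_iff_index_eq)
      ultimately show "{P s ! i, P s ! Suc i} \<in> E" using D(1) by (auto simp: adm_def)
    qed
    then have gp: "graph_path V E (P s)" using P[OF s] unfolding graph_path_def by blast
    have l: "last (P s) \<in> component D s" using P[OF s] by (metis last_in_set)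
    show ?thesis
    proof (cases "s \<in> A")
      case True
      then have "last (P s) \<notin> B" using D(2) l by (auto simp: good_def)
      then show ?thesis using gp P[OF s] True by (auto simp: T_path_def)
    next
      case False
      then have sB: "s \<in> B" using s by auto
      have "last (P s) \<notin> A"
      proof
        assume "last (P s) \<in> A"
        then have "s \<notin> component D (last (P s))" using D(2) sB by (auto simp: good_def)
        then show False using component_eq[OF l] component_self[of s D] by simp
      qed
      then show ?thesis using gp P[OF s] sB by (auto simp: T_path_def)
    qed
  qed
  have inj: "s = s'" if s: "s \<in> ?S" "s' \<in> ?S" and x: "x \<in> set (P s)" "x \<in> set (P s')" for s s' x
  proof -
    have "component D s = component D s'" using x P s component_eq by metis
    then have "s' \<in> component D s" using component_self[of s' D] by simp
    obtain t' where t': "component D s \<inter> T = {s, t'}" "t' \<in> Domain D \<longleftrightarrow> s \<notin> Domain D"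
      using config_partner[OF finV TV cf, of s] s by auto
    then show ?thesis using \<open>s' \<in> component D s\<close> s by auto
  qed
  have "inj_on P ?S" using P by (metis inj_onI)
  then have "card (P ` ?S) = card ?S" by (rule card_image)
  moreover have "card T = card A + card B" using finT disj by (intro card_Un_disjoint)
  moreover note card_sources[OF cf]
  ultimately have card: "card (P ` ?S) = card A div 2 + card B div 2" using ev by auto
  have "perfect_packing V E A B (P ` ?S)"
    unfolding perfect_packing_def
  proof (intro conjI card ballI)
    show "finite (P ` ?S)" using finT by simp
    show "pairwise (\<lambda>p q. disjnt (set p) (set q)) (P ` ?S)"
      unfolding pairwise_def disjnt_iff using inj by blast
  qed (use Tpath in auto)
  moreover have "(\<Union>p\<in>P ` ?S. parcs p) \<subseteq> D" using P by blast
  ultimately show thesis by (rule that)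
qed


section \<open>The path systems that come from one packing\<close>

lemma parcs_mem: "(u, v) \<in> parcs p \<Longrightarrow> u \<in> set p \<and> v \<in> set p"
  by (auto simp: parcs_def)

lemma parcs_right: "distinct p \<Longrightarrow> (u, v) \<in> parcs p \<Longrightarrow> (u, v') \<in> parcs p \<Longrightarrow> v = v'"
  by (auto simp: parcs_def nth_eq_iff_index_eq)

lemma parcs_left: "distinct p \<Longrightarrow> (u, v) \<in> parcs p \<Longrightarrow> (u', v) \<in> parcs p \<Longrightarrow> u = u'"
  by (auto simp: parcs_def nth_eq_iff_index_eq)

lemma parcs_antisym: "distinct p \<Longrightarrow> (u, v) \<in> parcs p \<Longrightarrow> (v, u) \<notin> parcs p"
  by (auto simp: parcs_def nth_eq_iff_index_eq)

lemma parcs_neq: "distinct p \<Longrightarrow> (u, v) \<in> parcs p \<Longrightarrow> u \<noteq> v"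
  by (auto simp: parcs_def nth_eq_iff_index_eq)

lemma parcs_Domain: "distinct p \<Longrightarrow> x \<in> set p \<Longrightarrow> x \<in> Domain (parcs p) \<longleftrightarrow> x \<noteq> last p"
proof -
  assume d: "distinct p" and x: "x \<in> set p"
  obtain i where i: "i < length p" "p ! i = x" using x by (auto simp: in_set_conv_nth)
  have l: "last p = p ! (length p - 1)" using x last_conv_nth[of p] by force
  have "x \<in> Domain (parcs p) \<longleftrightarrow> Suc i < length p"
    using d i by (auto simp: parcs_def Domain_iff nth_eq_iff_index_eq)
  also have "\<dots> \<longleftrightarrow> x \<noteq> last p" using d i unfolding l by (auto simp: nth_eq_iff_index_eq)
  finally show ?thesis .
qed

lemma parcs_Range: "distinct p \<Longrightarrow> x \<in> set p \<Longrightarrow> x \<in> Range (parcs p) \<longleftrightarrow> x \<noteq> hd p"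
proof -
  assume d: "distinct p" and x: "x \<in> set p"
  obtain i where i: "i < length p" "p ! i = x" using x by (auto simp: in_set_conv_nth)
  have h: "hd p = p ! 0" using x hd_conv_nth[of p] by force
  have "x \<in> Range (parcs p) \<longleftrightarrow> (\<exists>j. i = Suc j)"
    using d i by (auto simp: parcs_def Range_iff nth_eq_iff_index_eq)
  also have "\<dots> \<longleftrightarrow> x \<noteq> hd p" using nth_eq_iff_index_eq[OF d, of i 0] i unfolding h by (cases i) force+
  finally show ?thesis .
qed

context
  fixes Ps assumes Ps: "perfect_packing V E A B Ps"
begin

lemma pack_path: "p \<in> Ps \<Longrightarrow> graph_path V E p \<and> hd p \<noteq> last p \<and> (hd p \<in> A \<and> last p \<in> A \<or> hd p \<in> B \<and> last p \<in> B)"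
  using Ps by (auto simp: perfect_packing_def T_path_def)

lemma pack_set: "p \<in> Ps \<Longrightarrow> p \<noteq> [] \<and> distinct p \<and> set p \<subseteq> V \<and> hd p \<in> set p \<and> last p \<in> set p"
  using pack_path[of p] by (auto simp: graph_path_def)

lemma pack_eq: "p \<in> Ps \<Longrightarrow> q \<in> Ps \<Longrightarrow> x \<in> set p \<Longrightarrow> x \<in> set q \<Longrightarrow> p = q"
  using Ps unfolding perfect_packing_def pairwise_def disjnt_iff by blast

lemma pack_finite: "finite Ps"
  using Ps by (simp add: perfect_packing_def)

lemma pack_edge: "p \<in> Ps \<Longrightarrow> (u, v) \<in> parcs p \<Longrightarrow> {u, v} \<in> E"
  using pack_path[of p] unfolding graph_path_def successively_conv_nth by (auto simp: parcs_def)

text \<open>The paths are disjoint and have two distinct ends each, so their ends are as many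
  terminals as \<open>T\<close> has elements.\<close>

lemma pack_ends: "t \<in> T \<longleftrightarrow> (\<exists>p\<in>Ps. t = hd p \<or> t = last p)"
proof -
  let ?X = "\<Union>p\<in>Ps. {hd p, last p}"
  have "?X \<subseteq> T" using pack_path by auto
  moreover have "card ?X = (\<Sum>p\<in>Ps. card {hd p, last p})"
  proof (rule card_UN_disjoint)
    show "\<forall>p\<in>Ps. \<forall>q\<in>Ps. p \<noteq> q \<longrightarrow> {hd p, last p} \<inter> {hd q, last q} = {}"
    proof (intro ballI impI)
      fix p q assume pq: "p \<in> Ps" "q \<in> Ps" "p \<noteq> q"
      have "set p \<inter> set q = {}" using pack_eq[OF pq(1,2)] pq(3) by auto
      moreover have "{hd p, last p} \<subseteq> set p" "{hd q, last q} \<subseteq> set q" using pack_set pq by auto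
      ultimately show "{hd p, last p} \<inter> {hd q, last q} = {}" by blast
    qed
  qed (simp_all add: pack_finite)
  moreover have "(\<Sum>p\<in>Ps. card {hd p, last p}) = (\<Sum>p\<in>Ps. 2)"
    using pack_path by (intro sum.cong refl) auto
  moreover have "card T = card A + card B" using finT disj by (intro card_Un_disjoint)
  moreover have "card Ps = card A div 2 + card B div 2" using Ps by (simp add: perfect_packing_def)
  ultimately have "?X = T" using ev finT(3) by (intro card_subset_eq) auto
  then show ?thesis by auto
qed

text \<open>A T-path may pass through terminals in its interior. In a perfect packing, however,
  every terminal is already an end of some path, and disjointness excludes a second
  occurrence.\<close>

lemma pack_interior: "p \<in> Ps \<Longrightarrow> x \<in> set p \<Longrightarrow> x \<in> T \<longleftrightarrow> x = hd p \<or> x = last p"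
  using pack_ends pack_eq pack_set by metis

text \<open>The packing as a path system: every path runs in the direction of its list, and loops of
  weight 0 at the remaining nodes fill up rows and columns.\<close>

definition base :: "(nat \<times> nat) set" where
  "base = (\<Union>p\<in>Ps. parcs p) \<union> {(v, v) |v. v \<in> V - (\<Union>p\<in>Ps. set p)}"

lemma mem_base: "(u, v) \<in> base \<longleftrightarrow> (\<exists>p\<in>Ps. (u, v) \<in> parcs p) \<or> (u = v \<and> v \<in> V \<and> (\<forall>p\<in>Ps. v \<notin> set p))"
  by (auto simp: base_def)

lemma base_path: "p \<in> Ps \<Longrightarrow> u \<in> set p \<or> v \<in> set p \<Longrightarrow> (u, v) \<in> base \<longleftrightarrow> (u, v) \<in> parcs p"
  using pack_eq parcs_mem unfolding mem_base by metis

lemma base_loop: "\<forall>p\<in>Ps. u \<notin> set p \<Longrightarrow> (u, v) \<in> base \<longleftrightarrow> u = v \<and> u \<in> V"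
  using parcs_mem unfolding mem_base by metis

lemma closed_in_base: "p \<in> Ps \<Longrightarrow> closed_in base (set p)"
  unfolding closed_in_def
proof (intro ballI)
  fix a assume p: "p \<in> Ps" and a: "a \<in> base"
  obtain u v where uv: "a = (u, v)" by fastforce
  have "u \<in> set p \<longleftrightarrow> v \<in> set p" using base_path[OF p, of u v] parcs_mem[of u v p] a uv by blast
  then show "case a of (u, v) \<Rightarrow> u \<in> set p \<longleftrightarrow> v \<in> set p" by (simp add: uv)
qed

lemma Domain_base: "p \<in> Ps \<Longrightarrow> x \<in> set p \<Longrightarrow> x \<in> Domain base \<longleftrightarrow> x \<noteq> last p"
  using parcs_Domain[of p x] pack_set[of p] base_path[of p x] by (metis Domain_iff)

lemma Range_base: "p \<in> Ps \<Longrightarrow> x \<in> set p \<Longrightarrow> x \<in> Range base \<longleftrightarrow> x \<noteq> hd p"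
  using parcs_Range[of p x] pack_set[of p] base_path[of p _ x] by (metis Range_iff)

lemma adm_base: "adm base"
proof -
  have "config V T base"
    unfolding config_def
  proof (intro conjI allI impI ballI)
    show "base \<subseteq> V \<times> V" 
    proof (rule subrelI)
      fix u v assume "(u, v) \<in> base"
      then consider p where "p \<in> Ps" "(u, v) \<in> parcs p" | "u = v" "v \<in> V" unfolding mem_base by blast
      then show "(u, v) \<in> V \<times> V"
      proof cases
        case 1
        then show ?thesis using parcs_mem[OF 1(2)] pack_set[OF 1(1)] by auto
      qed simp
    qed
  next
    fix u v v' assume "(u, v) \<in> base" "(u, v') \<in> base"
    then show "v = v'"
      by (metis base_path base_loop pack_set parcs_right)
  next
    fix u u' v assume *: "(u, v) \<in> base" "(u', v) \<in> base"
    then show "u = u'"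
    proof (cases "\<exists>p\<in>Ps. v \<in> set p")
      case True
      then show ?thesis using * by (metis base_path pack_set parcs_left)
    next
      case False
      then show ?thesis using * parcs_mem unfolding mem_base by metis
    qed
  next
    fix v assume v: "v \<in> V - T"
    have "v \<in> Domain base \<and> v \<in> Range base"
    proof (cases "\<exists>p\<in>Ps. v \<in> set p")
      case True
      then obtain p where p: "p \<in> Ps" "v \<in> set p" by blast
      then have "v \<noteq> hd p" "v \<noteq> last p" using pack_interior v by blast+
      then show ?thesis using Domain_base Range_base p by blast
    next
      case False
      then have "(v, v) \<in> base" using v by (auto simp: mem_base)
      then show ?thesis by blast
    qed
    then show "v \<in> Domain base" "v \<in> Range base" by simp_all
  next
    fix t assume "t \<in> T"
    then obtain p where p: "p \<in> Ps" "t = hd p \<or> t = last p" using pack_ends by blast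
    then have "t \<in> set p" using pack_set by blast
    then show "t \<in> Domain base \<longleftrightarrow> t \<notin> Range base"
      using Domain_base Range_base p pack_path[OF p(1)] by metis
  qed
  moreover have "u = v \<or> {u, v} \<in> E" if "(u, v) \<in> base" for u v
    using that pack_edge unfolding mem_base by blast
  ultimately show ?thesis by (auto simp: adm_def)
qed

lemma good_base: "good base"
  unfolding good_def
proof
  fix t assume t: "t \<in> A"
  then obtain p where p: "p \<in> Ps" "t = hd p \<or> t = last p" using pack_ends by blast
  then have "component base t \<subseteq> set p" using pack_set component_subset[OF closed_in_base] by blast
  moreover have "set p \<inter> B = {}"
  proof -
    have "hd p \<notin> B" "last p \<notin> B" using pack_path[OF p(1)] p(2) t disj by auto
    then show ?thesis using pack_interior[OF p(1)] by blast
  qed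
  ultimately show "component base t \<inter> B = {}" by blast
qed

lemma inj_edges: "inj_on (\<lambda>a. {fst a, snd a}) (\<Union>p\<in>Ps. parcs p)"
proof (rule inj_onI)
  fix a b assume a: "a \<in> (\<Union>p\<in>Ps. parcs p)" and b: "b \<in> (\<Union>p\<in>Ps. parcs p)" and eq: "{fst a, snd a} = {fst b, snd b}"
  obtain p q where p: "p \<in> Ps" "a \<in> parcs p" and q: "q \<in> Ps" "b \<in> parcs q" using a b by blast
  have "fst a \<in> set p" "fst b \<in> set q" "snd b \<in> set q" using p q parcs_mem by (metis prod.collapse)+
  then have "p = q" using pack_eq[OF p(1) q(1)] eq by (metis doubleton_eq_iff)
  then show "a = b" using eq p q parcs_antisym pack_set by (metis doubleton_eq_iff prod.collapse)
qed

lemma sum_edges_of: "(\<Sum>e\<in>edges_of Ps. we e) = (\<Sum>a\<in>(\<Union>p\<in>Ps. parcs p). if fst a = snd a then 0 else we {fst a, snd a})"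
proof -
  have "(\<Sum>e\<in>edges_of Ps. we e) = (\<Sum>a\<in>(\<Union>p\<in>Ps. parcs p). we {fst a, snd a})"
    unfolding edges_of_def using sum.reindex[OF inj_edges, of we] by (simp add: o_def)
  also have "\<dots> = (\<Sum>a\<in>(\<Union>p\<in>Ps. parcs p). if fst a = snd a then 0 else we {fst a, snd a})"
  proof (intro sum.cong refl)
    fix a assume "a \<in> (\<Union>p\<in>Ps. parcs p)"
    then obtain p where "p \<in> Ps" "a \<in> parcs p" by blast
    then have "fst a \<noteq> snd a" using parcs_neq[of p "fst a" "snd a"] pack_set by simp
    then show "we {fst a, snd a} = (if fst a = snd a then 0 else we {fst a, snd a})" by simp
  qed
  finally show ?thesis .
qed

text \<open>The surplus is the weight of the arcs outside the packing. It is zero only if all of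
  these are loops, since edges have positive weight.\<close>

lemma weight_ge:
  assumes "adm D" "(\<Union>p\<in>Ps. parcs p) \<subseteq> D"
  shows "(\<Sum>e\<in>edges_of Ps. we e) \<le> weight D"
    and "weight D = (\<Sum>e\<in>edges_of Ps. we e) \<Longrightarrow> (u, v) \<in> D \<Longrightarrow> u \<noteq> v \<Longrightarrow> (u, v) \<in> (\<Union>p\<in>Ps. parcs p)"
proof -
  let ?h = "\<lambda>a. if fst a = snd a then 0 else we {fst a, snd a}"
  have fin: "finite D" using assms finite_config by (auto simp: adm_def)
  have s: "weight D = (\<Sum>a\<in>D - (\<Union>p\<in>Ps. parcs p). ?h a) + (\<Sum>e\<in>edges_of Ps. we e)"
    unfolding weight_def sum_edges_of by (rule sum.subset_diff[OF assms(2) fin])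
  then show "(\<Sum>e\<in>edges_of Ps. we e) \<le> weight D" by simp
  assume w: "weight D = (\<Sum>e\<in>edges_of Ps. we e)" and uv: "(u, v) \<in> D" "u \<noteq> v"
  show "(u, v) \<in> (\<Union>p\<in>Ps. parcs p)"
  proof (rule ccontr)
    assume "(u, v) \<notin> (\<Union>p\<in>Ps. parcs p)"
    then have m: "(u, v) \<in> D - (\<Union>p\<in>Ps. parcs p)" using uv by blast
    have "(\<Sum>a\<in>D - (\<Union>p\<in>Ps. parcs p). ?h a) = 0" using s w by simp
    moreover have "finite (D - (\<Union>p\<in>Ps. parcs p))" using fin by simp
    ultimately have "?h (u, v) = 0" using m sum_eq_0_iff[of "D - (\<Union>p\<in>Ps. parcs p)" ?h] by blast
    moreover have "{u, v} \<in> E" using uv assms(1) by (auto simp: adm_def)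
    ultimately show False using uv we_pos by fastforce
  qed
qed

lemma weight_base: "weight base = (\<Sum>e\<in>edges_of Ps. we e)"
proof -
  have fin: "finite base" using adm_base finite_config by (auto simp: adm_def)
  have "weight base = (\<Sum>a\<in>(\<Union>p\<in>Ps. parcs p). if fst a = snd a then 0 else we {fst a, snd a})"
    unfolding weight_def by (rule sum.mono_neutral_right[OF fin]) (auto simp: base_def)
  then show ?thesis by (simp add: sum_edges_of)
qed

lemma edges_of_iff: "{u, v} \<in> edges_of Ps \<longleftrightarrow> (\<exists>q\<in>Ps. (u, v) \<in> parcs q \<or> (v, u) \<in> parcs q)"
proof -
  have "{u, v} = {fst a, snd a} \<longleftrightarrow> a = (u, v) \<or> a = (v, u)" for a :: "nat \<times> nat"
    by (cases a) (auto simp: doubleton_eq_iff)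
  then have "{u, v} \<in> edges_of Ps \<longleftrightarrow> (\<exists>a\<in>(\<Union>p\<in>Ps. parcs p). a = (u, v) \<or> a = (v, u))"
    unfolding edges_of_def image_iff by simp
  then show ?thesis by blast
qed

lemma edges_of_path:
  assumes "p \<in> Ps" "u \<in> set p \<or> v \<in> set p" "{u, v} \<in> edges_of Ps"
  shows "(u, v) \<in> parcs p \<or> (v, u) \<in> parcs p"
proof -
  obtain q where q: "q \<in> Ps" "(u, v) \<in> parcs q \<or> (v, u) \<in> parcs q" using assms(3) edges_of_iff by blast
  then have "u \<in> set q" "v \<in> set q" using parcs_mem[of u v q] parcs_mem[of v u q] by blast+
  then have "p = q" using pack_eq assms(1,2) q(1) by blast
  then show ?thesis using q by simp
qed

lemma edges_of_nth:
  assumes "p \<in> Ps" "i < length p" "{p ! i, y} \<in> edges_of Ps"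
  shows "y = p ! Suc i \<or> (\<exists>j. i = Suc j \<and> y = p ! j)"
proof -
  have d: "distinct p" using pack_set[OF assms(1)] by simp
  have "(p ! i, y) \<in> parcs p \<or> (y, p ! i) \<in> parcs p"
    by (rule edges_of_path[OF assms(1) _ assms(3)]) (use assms(2) in simp)
  then show ?thesis
  proof
    assume "(p ! i, y) \<in> parcs p"
    then obtain k where k: "Suc k < length p" "p ! i = p ! k" "y = p ! Suc k" by (auto simp: parcs_def)
    then have "i = k" using nth_eq_iff_index_eq[OF d assms(2), of k] by simp
    then show ?thesis using k by simp
  next
    assume "(y, p ! i) \<in> parcs p"
    then obtain k where k: "Suc k < length p" "p ! i = p ! Suc k" "y = p ! k" by (auto simp: parcs_def)
    then have "i = Suc k" using nth_eq_iff_index_eq[OF d assms(2), of "Suc k"] by simp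
    then show ?thesis using k by simp
  qed
qed

text \<open>The system is forced to run along each path from its first node. A loop at a node of the
  path would give that node a second incoming arc, or an incoming arc to the source; a step
  backwards would do the same to its predecessor. Outside the paths only loops are left.\<close>

lemma config_eq_base:
  assumes D: "adm D" and edges: "\<And>u v. (u, v) \<in> D \<Longrightarrow> u \<noteq> v \<Longrightarrow> {u, v} \<in> edges_of Ps"
    and src: "\<And>p. p \<in> Ps \<Longrightarrow> hd p \<in> Domain D"
  shows "D = base"
proof -
  have cf: "config V T D" using D by (simp add: adm_def)
  note sv = configD(2)[OF cf] and inj = configD(3)[OF cf] and endp = configD(6)[OF cf]
  have hd_T: "hd p \<in> T" "last p \<in> T" if "p \<in> Ps" for p using pack_ends that by blast+
  have arc: "(p ! i, p ! Suc i) \<in> D" if p: "p \<in> Ps" "Suc i < length p" for p i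
    using p(2)
  proof (induction i rule: less_induct)
    case (less i)
    have d: "distinct p" and h: "hd p = p ! 0" and l: "last p = p ! (length p - 1)"
      using pack_set[OF p(1)] by (auto simp: hd_conv_nth last_conv_nth)
    have hd_ran: "hd p \<notin> Range D" using endp[OF hd_T(1)[OF p(1)]] src[OF p(1)] by blast
    have i: "i < length p" using less.prems by simp
    have "p ! i \<in> Domain D"
    proof (cases "i = 0")
      case True
      then show ?thesis using src[OF p(1)] h by simp
    next
      case False
      have "p ! i \<noteq> hd p" "p ! i \<noteq> last p"
      proof -
        have "0 < length p" "length p - 1 < length p" using i by linarith+
        then show "p ! i \<noteq> hd p" "p ! i \<noteq> last p"
          using nth_eq_iff_index_eq[OF d i, of 0] nth_eq_iff_index_eq[OF d i, of "length p - 1"] False less.prems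
          unfolding h l by linarith+
      qed
      then have "p ! i \<in> V - T" using pack_interior[OF p(1), of "p ! i"] pack_set[OF p(1)] i by auto
      then show ?thesis using configD(4)[OF cf] by blast
    qed
    then obtain y where y: "(p ! i, y) \<in> D" by blast
    show ?case
    proof (cases i)
      case 0
      then have "y \<noteq> p ! i" using hd_ran h y by auto
      then have "{p ! i, y} \<in> edges_of Ps" using edges[OF y] by simp
      then have "y = p ! Suc i" using edges_of_nth[OF p(1) i] 0 by auto
      then show ?thesis using y by simp
    next
      case (Suc j)
      have j: "(p ! j, p ! i) \<in> D" using less.IH[of j] less.prems Suc by simp
      have "y \<noteq> p ! i"
      proof
        assume "y = p ! i"
        then have "p ! j = p ! i" using inj[OF j] y by simp
        then show False using d i Suc by (simp add: nth_eq_iff_index_eq)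
      qed
      then have "{p ! i, y} \<in> edges_of Ps" using edges[OF y] by simp
      then consider "y = p ! Suc i" | "y = p ! j" using edges_of_nth[OF p(1) i] Suc by auto
      then show ?thesis
      proof cases
        case 1
        then show ?thesis using y by simp
      next
        case 2
        show ?thesis
        proof (cases j)
          case 0
          then show ?thesis using 2 y h hd_ran by auto
        next
          case (Suc k)
          have k: "(p ! k, p ! j) \<in> D" using less.IH[of k] less.prems Suc \<open>i = Suc j\<close> by simp
          then have "p ! k = p ! i" using inj[OF k] y 2 by simp
          then show ?thesis using d i Suc \<open>i = Suc j\<close> by (simp add: nth_eq_iff_index_eq)
        qed
      qed
    qed
  qed
  have sub: "base \<subseteq> D"
  proof (rule subrelI)
    fix u v assume "(u, v) \<in> base"
    then consider p where "p \<in> Ps" "(u, v) \<in> parcs p" | "u = v" "v \<in> V" "\<forall>p\<in>Ps. v \<notin> set p" unfolding mem_base by blast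
    then show "(u, v) \<in> D"
    proof cases
      case 1
      then show ?thesis using arc by (auto simp: parcs_def)
    next
      case 2
      have "v \<notin> T"
      proof
        assume "v \<in> T"
        then obtain p where p: "p \<in> Ps" "v = hd p \<or> v = last p" using pack_ends[of v] by blast
        then show False using pack_set[OF p(1)] 2(3) by auto
      qed
      then have "v \<in> Domain D" using configD(4)[OF cf, of v] 2(2) by simp
      then obtain y where y: "(v, y) \<in> D" by blast
      have "y = v"
      proof (rule ccontr)
        assume "y \<noteq> v"
        then have "{v, y} \<in> edges_of Ps" using edges[OF y] by simp
        then obtain q where "q \<in> Ps" "(v, y) \<in> parcs q \<or> (y, v) \<in> parcs q" unfolding edges_of_iff by blast
        then show False using 2(3) parcs_mem[of v y q] parcs_mem[of y v q] by blast
      qed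
      then show ?thesis using y 2 by simp
    qed
  qed
  moreover have "D \<subseteq> base"
  proof (rule subrelI)
    fix u v assume uv: "(u, v) \<in> D"
    have "u \<in> Domain base"
    proof (cases "\<exists>p\<in>Ps. u \<in> set p")
      case True
      then obtain p where p: "p \<in> Ps" "u \<in> set p" by blast
      have "last p \<in> Range base" using Range_base[OF p(1), of "last p"] pack_set[OF p(1)] pack_path[OF p(1)] by auto
      then have "last p \<in> Range D" using sub by blast
      then have "last p \<notin> Domain D" using endp[OF hd_T(2)[OF p(1)]] by blast
      then have "u \<noteq> last p" using uv by auto
      then show ?thesis using Domain_base[OF p] by simp
    next
      case False
      moreover have "u \<in> V" using configD(1)[OF cf] uv by auto
      ultimately have "(u, u) \<in> base" unfolding mem_base by simp
      then show ?thesis by blast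
    qed
    then obtain v' where "(u, v') \<in> base" by blast
    then show "(u, v) \<in> base" using sv[OF uv] sub by blast
  qed
  ultimately show ?thesis by blast
qed

definition flip_of :: "nat list set \<Rightarrow> (nat \<times> nat) set" where
  "flip_of Q = reverse_on (\<Union>p\<in>Q. set p) base"

lemma closed_in_flip: "Q \<subseteq> Ps \<Longrightarrow> closed_in base (\<Union>p\<in>Q. set p)"
  using closed_in_base by (intro closed_in_UN) blast

text \<open>\<open>Q\<close> collects the paths that are traversed backwards, recognised by their
  first node not being a source. Turning these round yields a system to which
  \<open>config_eq_base\<close> applies.\<close>

lemma config_is_flip:
  assumes D: "adm D" and edges: "\<And>u v. (u, v) \<in> D \<Longrightarrow> u \<noteq> v \<Longrightarrow> {u, v} \<in> edges_of Ps"
  shows "\<exists>Q\<subseteq>Ps. D = flip_of Q"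
proof -
  have cf: "config V T D" using D by (simp add: adm_def)
  define Q where "Q = {p \<in> Ps. hd p \<notin> Domain D}"
  let ?C = "\<Union>p\<in>Q. set p"
  have clp: "closed_in D (set p)" if p: "p \<in> Ps" for p
  proof -
    have "u \<in> set p \<longleftrightarrow> v \<in> set p" if uv: "(u, v) \<in> D" for u v
    proof (cases "u = v")
      case False
      from edges[OF uv this] have "u \<in> set p \<or> v \<in> set p \<Longrightarrow> (u, v) \<in> parcs p \<or> (v, u) \<in> parcs p"
        using edges_of_path[OF p] by blast
      then show ?thesis using parcs_mem[of u v p] parcs_mem[of v u p] by blast
    qed simp
    then show ?thesis by (auto simp: closed_in_def)
  qed
  have cl: "closed_in D ?C" using clp by (intro closed_in_UN) (auto simp: Q_def)
  have "reverse_on ?C D = base"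
  proof (rule config_eq_base)
    show "adm (reverse_on ?C D)" by (rule adm_reverse_on[OF D cl])
    show "{u, v} \<in> edges_of Ps" if "(u, v) \<in> reverse_on ?C D" "u \<noteq> v" for u v
    proof (cases "u \<in> ?C")
      case True
      then have "(v, u) \<in> D" using that(1) unfolding mem_reverse_on[OF cl] by simp
      then show ?thesis using edges[of v u] that(2) by (simp add: insert_commute)
    next
      case False
      then have "(u, v) \<in> D" using that(1) unfolding mem_reverse_on[OF cl] by (simp split: if_splits)
      then show ?thesis using edges[of u v] that(2) by simp
    qed
    show "hd p \<in> Domain (reverse_on ?C D)" if p: "p \<in> Ps" for p
    proof -
      have "hd p \<in> ?C \<longleftrightarrow> p \<in> Q"
        using pack_set[OF p] pack_eq[OF p] p unfolding Q_def by blast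
      moreover have "hd p \<in> Range D" if "p \<in> Q"
        using configD(6)[OF cf, of "hd p"] pack_ends p that unfolding Q_def by blast
      moreover have "hd p \<in> Domain D" if "p \<notin> Q" using that p by (simp add: Q_def)
      ultimately show ?thesis unfolding Domain_reverse_on[OF cl] by (cases "p \<in> Q") simp_all
    qed
  qed
  then have "D = flip_of Q" unfolding flip_of_def using reverse_on_reverse_on[OF cl] by simp
  then show ?thesis by (intro exI[of _ Q]) (auto simp: Q_def)
qed

text \<open>The set \<open>Q\<close> can be recovered: a path belongs to it iff its first node has
  become a sink. This gives the full number \<open>2 ^ card Ps\<close> of orientations.\<close>

lemma inj_flip: "inj_on flip_of (Pow Ps)"
proof (rule inj_onI)
  have *: "p \<in> Q \<longleftrightarrow> hd p \<notin> Domain (flip_of Q)" if Q: "Q \<subseteq> Ps" and p: "p \<in> Ps" for Q p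
  proof -
    have C: "hd p \<in> (\<Union>p\<in>Q. set p) \<longleftrightarrow> p \<in> Q" using pack_set[OF p] pack_eq[OF p] Q by blast
    have "hd p \<in> Domain base" "hd p \<notin> Range base"
      using Domain_base[OF p] Range_base[OF p] pack_set[OF p] pack_path[OF p] by blast+
    then show ?thesis unfolding flip_of_def Domain_reverse_on[OF closed_in_flip[OF Q]] using C by simp
  qed
  fix Q Q' assume "Q \<in> Pow Ps" "Q' \<in> Pow Ps" "flip_of Q = flip_of Q'"
  then have "p \<in> Q \<longleftrightarrow> p \<in> Q'" if "p \<in> Ps" for p using *[of Q p] *[of Q' p] that by simp
  then show "Q = Q'" using \<open>Q \<in> Pow Ps\<close> \<open>Q' \<in> Pow Ps\<close> by blast
qed

lemma flip_ok: "Q \<subseteq> Ps \<Longrightarrow> adm (flip_of Q) \<and> good (flip_of Q) \<and> weight (flip_of Q) = (\<Sum>e\<in>edges_of Ps. we e)"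
  using closed_in_flip[of Q] adm_reverse_on[OF adm_base] good_reverse_on[of base] good_base
    weight_reverse_on[of base] weight_base by (simp add: flip_of_def)

end

text \<open>Sending a node of \<open>B\<close> to the other terminal of its component is an
  involution on \<open>B\<close> that exchanges sources and sinks. As a consequence, all good
  systems have the same sign.\<close>

lemma card_good_sources:
  assumes D: "adm D" "good D" shows "2 * card (B \<inter> Domain D) = card B"
proof -
  have cf: "config V T D" using D by (simp add: adm_def)
  have "\<exists>t. t \<in> B \<and> t \<noteq> b \<and> component D b \<inter> T = {b, t} \<and> (t \<in> Domain D \<longleftrightarrow> b \<notin> Domain D)" if b: "b \<in> B" for b
  proof -
    obtain t where t: "t \<noteq> b" "component D b \<inter> T = {b, t}" "t \<in> Domain D \<longleftrightarrow> b \<notin> Domain D"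
      using config_partner[OF finV TV cf, of b] b by auto
    have tc: "t \<in> component D b" using t(2) by blast
    have "t \<notin> A"
    proof
      assume "t \<in> A"
      then have "b \<notin> component D t" using D(2) b by (auto simp: good_def)
      then show False using component_eq[OF tc] component_self[of b D] by simp
    qed
    then show ?thesis using t by auto
  qed
  then obtain f where f: "\<And>b. b \<in> B \<Longrightarrow> f b \<in> B \<and> f b \<noteq> b \<and> component D b \<inter> T = {b, f b} \<and> (f b \<in> Domain D \<longleftrightarrow> b \<notin> Domain D)"
    by metis
  have ff: "f (f b) = b" if b: "b \<in> B" for b
  proof -
    have "f b \<in> component D b" using f[OF b] by blast
    then have "component D (f b) = component D b" by (rule component_eq)
    then have "{f b, f (f b)} = {b, f b}" using f[OF b] f[of "f b"] by simp
    then show ?thesis using f[OF b] f[of "f b"] by (auto simp: doubleton_eq_iff)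
  qed
  have "bij_betw f (B \<inter> Domain D) (B - Domain D)"
    by (rule bij_betw_byWitness[where f' = f]) (use f ff in auto)
  then have "card (B \<inter> Domain D) = card (B - Domain D)" by (rule bij_betw_same_card)
  moreover have "card (B \<inter> Domain D) + card (B - Domain D) = card B" using finT(2) by (metis card_Int_Diff)
  ultimately show ?thesis by simp
qed

lemma coeff_Zpoly: "coeff Zpoly j = (- 1) ^ (card B div 2) * int (card {D. adm D \<and> good D \<and> weight D = j})"
proof -
  have fin: "finite {D. adm D \<and> good D}"
    by (rule finite_subset[OF _ finite_configs[of "\<lambda>D. True"]]) (auto simp: adm_def)
  have "sgn D = (- 1) ^ (card B div 2)" if "adm D" "good D" for D
  proof -
    have "card (B \<inter> Domain D) = card B div 2" using card_good_sources[OF that] by linarith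
    then show ?thesis by (simp add: sgn_def)
  qed
  then have "coeff Zpoly j = (\<Sum>D\<in>{D. adm D \<and> good D}. if weight D = j then (- 1) ^ (card B div 2) else 0)"
    unfolding Zpoly_good coeff_sum by (intro sum.cong refl) simp
  also have "\<dots> = (\<Sum>D\<in>{D \<in> {D. adm D \<and> good D}. weight D = j}. (- 1) ^ (card B div 2))"
    by (rule sum.inter_filter[OF fin, symmetric])
  also have "{D \<in> {D. adm D \<and> good D}. weight D = j} = {D. adm D \<and> good D \<and> weight D = j}" by auto
  finally show ?thesis by simp
qed

text \<open>Every good system contains the arcs of a packing and weighs at least as much.\<close>

lemma coeff_Zpoly_low:
  assumes "\<And>Ps. perfect_packing V E A B Ps \<Longrightarrow> (\<Sum>e\<in>edges_of Ps. we e) > j"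
  shows "coeff Zpoly j = 0"
proof -
  have "weight D \<noteq> j" if D: "adm D" "good D" for D
  proof -
    obtain Ps where "perfect_packing V E A B Ps" "(\<Union>p\<in>Ps. parcs p) \<subseteq> D" using packing_of_config[OF D] .
    then show ?thesis using weight_ge(1)[OF _ D(1), of Ps] assms[of Ps] by simp
  qed
  then have "{D. adm D \<and> good D \<and> weight D = j} = {}" by blast
  then show ?thesis unfolding coeff_Zpoly by (simp only: card.empty of_nat_0 mult_zero_right)
qed

text \<open>A good system of weight \<open>j\<close> contains a packing with the edges of
  \<open>Ps\<close> and, being no heavier, only loops besides; so it is an orientation of
  \<open>Ps\<close>. Uniqueness is expressed by edge sets because lists in opposite directions
  describe the same path.\<close>

lemma coeff_Zpoly_unique:
  assumes Ps: "perfect_packing V E A B Ps" and j: "(\<Sum>e\<in>edges_of Ps. we e) = j"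
    and min: "\<And>Qs. perfect_packing V E A B Qs \<Longrightarrow>
      (\<Sum>e\<in>edges_of Qs. we e) > j \<or> edges_of Qs = edges_of Ps"
  shows "coeff Zpoly j = (- 1) ^ (card B div 2) * 2 ^ card Ps"
proof -
  have "{D. adm D \<and> good D \<and> weight D = j} = flip_of Ps ` Pow Ps"
  proof (rule set_eqI, rule iffI)
    fix D assume "D \<in> {D. adm D \<and> good D \<and> weight D = j}"
    then have D: "adm D" "good D" "weight D = j" by auto
    obtain Qs where Qs: "perfect_packing V E A B Qs" "(\<Union>p\<in>Qs. parcs p) \<subseteq> D" using packing_of_config[OF D(1,2)] .
    note ge = weight_ge[OF Qs(1) D(1) Qs(2)]
    have eq: "edges_of Qs = edges_of Ps" using min[OF Qs(1)] ge(1) D(3) by linarith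
    have "{u, v} \<in> edges_of Ps" if "(u, v) \<in> D" "u \<noteq> v" for u v
    proof -
      have "(u, v) \<in> (\<Union>p\<in>Qs. parcs p)" using ge(2)[OF _ that] D(3) j eq by simp
      then have "{u, v} \<in> edges_of Qs" unfolding edges_of_def by (intro image_eqI[of _ _ "(u, v)"]) auto
      then show ?thesis using eq by simp
    qed
    from config_is_flip[OF Ps D(1) this] show "D \<in> flip_of Ps ` Pow Ps" by blast
  next
    fix D assume "D \<in> flip_of Ps ` Pow Ps"
    then show "D \<in> {D. adm D \<and> good D \<and> weight D = j}" using flip_ok[OF Ps] j by auto
  qed
  moreover have "card (flip_of Ps ` Pow Ps) = 2 ^ card Ps"
    using card_image[OF inj_flip[OF Ps]] card_Pow[OF pack_finite[OF Ps]] by simp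
  ultimately show ?thesis by (simp add: coeff_Zpoly)
qed

end

section \<open>Isolation\<close>

text \<open>The squared form of the bound \<open>4 ^ c / sqrt (2 * c + 1)\<close> for the central
  binomial coefficient. The induction rests on
  \<open>(2 * c + 1) * (2 * c + 3) \<le> (2 * c + 2) ^ 2\<close>.\<close>

lemma central_binomial_square: "(2 * c choose c)\<^sup>2 * (2 * c + 1) \<le> 16 ^ c"
proof (induction c)
  case (Suc c)
  let ?C = "2 * c choose c" and ?C' = "2 * Suc c choose Suc c"
  have 1: "Suc c * ?C' = 2 * Suc c * (2 * c + 1 choose c)"
    using Suc_times_binomial_eq[of "2 * c + 1" c] by simp
  have 2: "2 * c + 1 choose c = 2 * c + 1 choose Suc c"
    using binomial_symmetric[of c "2 * c + 1"] by simp
  have 3: "Suc c * (2 * c + 1 choose Suc c) = (2 * c + 1) * ?C"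
    using Suc_times_binomial_eq[of "2 * c" c] by simp
  have C': "Suc c * ?C' = 2 * ((2 * c + 1) * ?C)"
    using 1 3 unfolding 2 by (metis mult.assoc)
  have "(Suc c)\<^sup>2 * (?C'\<^sup>2 * (2 * c + 3)) = (Suc c * ?C')\<^sup>2 * (2 * c + 3)"
    by (simp only: power_mult_distrib mult.assoc)
  also have "\<dots> = (2 * ((2 * c + 1) * ?C))\<^sup>2 * (2 * c + 3)" by (simp only: C')
  also have "\<dots> = 4 * ((2 * c + 1) * (2 * c + 3)) * (?C\<^sup>2 * (2 * c + 1))"
    by (simp add: power2_eq_square algebra_simps)
  also have "\<dots> \<le> 4 * (4 * (Suc c)\<^sup>2) * 16 ^ c"
  proof (intro mult_le_mono[OF mult_le_mono] Suc.IH order_refl)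
    show "(2 * c + 1) * (2 * c + 3) \<le> 4 * (Suc c)\<^sup>2" by (simp add: power2_eq_square algebra_simps)
  qed
  also have "\<dots> = (Suc c)\<^sup>2 * 16 ^ Suc c" by simp
  finally have "?C'\<^sup>2 * (2 * c + 3) \<le> 16 ^ Suc c" by (rule mult_left_le_imp_le) simp
  moreover have "2 * Suc c + 1 = 2 * c + 3" by simp
  ultimately show ?case by (simp only:)
qed simp

text \<open>The number of heads among \<open>2 * c\<close> fair coins takes any given value with
  probability at most 1 / m, because its most likely value is \<open>c\<close>.\<close>

lemma binomial_le_power4:
  assumes "m\<^sup>2 \<le> 2 * c + 1" shows "m * (2 * c choose j) \<le> 2 ^ (2 * c)"
proof -
  have "(m * (2 * c choose c))\<^sup>2 = (2 * c choose c)\<^sup>2 * m\<^sup>2" by (simp add: power_mult_distrib)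
  also have "\<dots> \<le> (2 * c choose c)\<^sup>2 * (2 * c + 1)" using assms by (rule mult_left_mono) simp
  also have "\<dots> \<le> 16 ^ c" by (rule central_binomial_square)
  also have "(16::nat) ^ c = (2 ^ (2 * c))\<^sup>2" by (simp add: power_mult flip: power_mult_distrib power2_eq_square) (simp add: power2_eq_square flip: power_mult_distrib)
  finally have "m * (2 * c choose c) \<le> 2 ^ (2 * c)" by (rule power2_le_imp_le) simp
  moreover have "m * (2 * c choose j) \<le> m * (2 * c choose c)"
    using binomial_maximum'[of c j] by simp
  ultimately show ?thesis by linarith
qed

text \<open>Once the part of \<open>Y\<close> outside \<open>I\<close> is fixed, the threshold is a
  constant, and the part inside \<open>I\<close> is an arbitrary subset of \<open>2 * c\<close>
  elements.\<close>

lemma card_subsets_by_part: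
  assumes J: "finite J" and I: "I \<subseteq> J" "card I = 2 * c" and m: "m\<^sup>2 \<le> 2 * c + 1"
  shows "m * card {Y. Y \<subseteq> J \<and> card (Y \<inter> I) = \<theta> (Y - I)} \<le> 2 ^ card J"
proof -
  let ?S = "Sigma (Pow (J - I)) (\<lambda>Z. {X. X \<subseteq> I \<and> card X = \<theta> Z})"
  have finI: "finite I" using J I finite_subset by blast
  have finS: "finite ?S" using J finI by auto
  have "card {Y. Y \<subseteq> J \<and> card (Y \<inter> I) = \<theta> (Y - I)} \<le> card ?S"
  proof (rule card_inj_on_le[where f = "\<lambda>Y. (Y - I, Y \<inter> I)"])
    show "inj_on (\<lambda>Y. (Y - I, Y \<inter> I)) {Y. Y \<subseteq> J \<and> card (Y \<inter> I) = \<theta> (Y - I)}"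
      by (rule inj_onI) (metis Int_Diff_Un Pair_inject Int_commute Un_commute)
  qed (use finS in auto)
  also have "card ?S = (\<Sum>Z\<in>Pow (J - I). 2 * c choose \<theta> Z)"
    using J finI I(2) by (subst card_SigmaI) (auto simp: n_subsets)
  finally have "m * card {Y. Y \<subseteq> J \<and> card (Y \<inter> I) = \<theta> (Y - I)} \<le> (\<Sum>Z\<in>Pow (J - I). m * (2 * c choose \<theta> Z))"
    unfolding sum_distrib_left[symmetric] by (rule mult_left_mono) simp
  also have "\<dots> \<le> (\<Sum>Z\<in>Pow (J - I). 2 ^ (2 * c))"
    by (intro sum_mono binomial_le_power4 m)
  also have "\<dots> = 2 ^ card (J - I) * 2 ^ card I" using J by (simp add: card_Pow I)
  also have "\<dots> = 2 ^ card J"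
    using J I(1) by (simp add: card_Diff_subset finI card_mono flip: power_add)
  finally show ?thesis .
qed

text \<open>If the minimum is attained twice, some \<open>e\<close> lies in one minimiser and not in
  another one. Then the weight of \<open>e\<close> equals the gap between the minimum without
  \<open>e\<close> and the minimum with \<open>e\<close>, taken with respect to the other weights.
  This happens with probability at most \<open>1 / (2 * card U)\<close> for each \<open>e\<close>,
  and the union bound leaves 1/2.\<close>

lemma isolation:
  assumes J: "finite J" and U: "finite U" and I: "\<And>e. e \<in> U \<Longrightarrow> I e \<subseteq> J \<and> card (I e) = 2 * c"
    and disj: "\<And>e e'. e \<in> U \<Longrightarrow> e' \<in> U \<Longrightarrow> e \<noteq> e' \<Longrightarrow> I e \<inter> I e' = {}"
    and c: "(2 * card U)\<^sup>2 \<le> 2 * c + 1" and F: "\<F> \<subseteq> Pow U" "\<F> \<noteq> {}"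
  defines "W \<equiv> \<lambda>Y F. \<Sum>e\<in>F. card (Y \<inter> I e)"
  shows "2 * card {Y. Y \<subseteq> J \<and> \<not> (\<exists>F\<in>\<F>. \<forall>F'\<in>\<F>. F' \<noteq> F \<longrightarrow> W Y F < W Y F')} \<le> 2 ^ card J"
proof -
  \<comment> \<open>Subtraction of natural numbers is cut off at 0. In the case of interest the
    difference is the weight of \<open>e\<close> and therefore exact.\<close>
  define \<theta> where "\<theta> e Z = Min (W Z ` {F\<in>\<F>. e \<notin> F}) - Min (W Z ` {F\<in>\<F>. e \<in> F})" for e Z
  let ?A = "\<lambda>e. {Y. Y \<subseteq> J \<and> card (Y \<inter> I e) = \<theta> e (Y - I e)}"
  have finF: "finite \<F>" using F U finite_subset by blast
  have finJ: "finite {Y. Y \<subseteq> J \<and> P Y}" for P using J by simp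
  have "{Y. Y \<subseteq> J \<and> \<not> (\<exists>F\<in>\<F>. \<forall>F'\<in>\<F>. F' \<noteq> F \<longrightarrow> W Y F < W Y F')} \<subseteq> (\<Union>e\<in>U. ?A e)"
  proof
    fix Y assume "Y \<in> {Y. Y \<subseteq> J \<and> \<not> (\<exists>F\<in>\<F>. \<forall>F'\<in>\<F>. F' \<noteq> F \<longrightarrow> W Y F < W Y F')}"
    then have Y: "Y \<subseteq> J" and amb: "\<And>F. F \<in> \<F> \<Longrightarrow> \<exists>F'\<in>\<F>. F' \<noteq> F \<and> W Y F' \<le> W Y F" by (auto simp: not_less)
    have fw: "finite (W Y ` \<F>)" "W Y ` \<F> \<noteq> {}" using finF F by auto
    obtain F1 where F1: "F1 \<in> \<F>" "W Y F1 = Min (W Y ` \<F>)" using Min_in[OF fw] by auto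
    obtain F2 where F2: "F2 \<in> \<F>" "F2 \<noteq> F1" "W Y F2 \<le> W Y F1" using amb[OF F1(1)] by blast
    have min: "W Y F1 \<le> W Y F" "W Y F2 \<le> W Y F" if "F \<in> \<F>" for F
      using Min_le[OF fw(1), of "W Y F"] that F1 F2 by auto
    have "\<exists>e G G'. e \<in> G \<and> e \<notin> G' \<and> G \<in> \<F> \<and> G' \<in> \<F> \<and> (\<forall>F\<in>\<F>. W Y G \<le> W Y F \<and> W Y G' \<le> W Y F)"
    proof -
      have "F1 - F2 \<noteq> {} \<or> F2 - F1 \<noteq> {}" using F2(2) by blast
      then show ?thesis using F1(1) F2(1) min by blast
    qed
    then obtain e G G' where e: "e \<in> G" "e \<notin> G'" and G: "G \<in> \<F>" "G' \<in> \<F>"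
      and minG: "\<And>F. F \<in> \<F> \<Longrightarrow> W Y G \<le> W Y F" "\<And>F. F \<in> \<F> \<Longrightarrow> W Y G' \<le> W Y F" by blast
    have eU: "e \<in> U" using e G F by blast
    let ?Z = "Y - I e"
    have finFF: "finite G" if "G \<in> \<F>" for G using that F U finite_subset by blast
    have Z: "card (?Z \<inter> I e') = (if e' = e then 0 else card (Y \<inter> I e'))" if "e' \<in> U" for e'
    proof (cases "e' = e")
      case False
      have "?Z \<inter> I e' = Y \<inter> I e'" using disj[OF that eU False] by blast
      then show ?thesis using False by simp
    next
      case True
      have "?Z \<inter> I e = {}" by blast
      then show ?thesis using True by simp
    qed
    have W_out: "W ?Z F = W Y F" if "F \<in> \<F>" "e \<notin> F" for F
      unfolding W_def using that F Z by (intro sum.cong refl) (metis PowD subsetD)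
    have W_in: "W Y F = W ?Z F + card (Y \<inter> I e)" if F': "F \<in> \<F>" "e \<in> F" for F
    proof -
      have "W Y F = card (Y \<inter> I e) + (\<Sum>e'\<in>F - {e}. card (Y \<inter> I e'))"
        unfolding W_def using that finFF by (simp add: sum.remove)
      also have "(\<Sum>e'\<in>F - {e}. card (Y \<inter> I e')) = (\<Sum>e'\<in>F - {e}. card (?Z \<inter> I e'))"
      proof (intro sum.cong refl)
        fix e' assume "e' \<in> F - {e}"
        then have "e' \<in> U" "e' \<noteq> e" using F F'(1) by blast+
        then show "card (Y \<inter> I e') = card (?Z \<inter> I e')" using Z[of e'] by simp
      qed
      also have "\<dots> = W ?Z F" unfolding W_def using that finFF Z[OF eU] by (simp add: sum.remove)
      finally show ?thesis by simp
    qed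
    have "Min (W ?Z ` {F\<in>\<F>. e \<notin> F}) = W Y G'"
      by (rule Min_eqI) (use finF G e W_out minG in \<open>auto intro!: rev_image_eqI[of G']\<close>)
    moreover have "Min (W ?Z ` {F\<in>\<F>. e \<in> F}) = W ?Z G"
    proof (rule Min_eqI)
      show "W ?Z G \<in> W ?Z ` {F\<in>\<F>. e \<in> F}" using G e by blast
      fix y assume "y \<in> W ?Z ` {F\<in>\<F>. e \<in> F}"
      then obtain F' where F': "F' \<in> \<F>" "e \<in> F'" "y = W ?Z F'" by blast
      then show "W ?Z G \<le> y" using minG(1)[OF F'(1)] W_in[OF F'(1,2)] W_in[OF G(1) e(1)] by simp
    qed (use finF in simp)
    moreover have "W Y G = W Y G'" using minG G by (metis order_antisym)
    ultimately have "\<theta> e ?Z = card (Y \<inter> I e)" using W_in[OF G(1) e(1)] by (simp add: \<theta>_def)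
    then have "Y \<in> ?A e" using Y by simp
    then show "Y \<in> (\<Union>e\<in>U. ?A e)" by (rule UN_I[OF eU])
  qed
  then have "card {Y. Y \<subseteq> J \<and> \<not> (\<exists>F\<in>\<F>. \<forall>F'\<in>\<F>. F' \<noteq> F \<longrightarrow> W Y F < W Y F')} \<le> card (\<Union>e\<in>U. ?A e)"
    using finJ U by (intro card_mono finite_UN_I)
  also have "\<dots> \<le> (\<Sum>e\<in>U. card (?A e))" by (rule card_UN_le[OF U])
  finally have le: "card {Y. Y \<subseteq> J \<and> \<not> (\<exists>F\<in>\<F>. \<forall>F'\<in>\<F>. F' \<noteq> F \<longrightarrow> W Y F < W Y F')} \<le> (\<Sum>e\<in>U. card (?A e))" .
  show ?thesis
  proof (cases "U = {}")
    case True
    then show ?thesis using le by simp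
  next
    case False
    then have pos: "card U > 0" using U by (simp add: card_gt_0_iff)
    have "card U * (2 * (\<Sum>e\<in>U. card (?A e))) = (\<Sum>e\<in>U. (2 * card U) * card (?A e))"
      by (simp add: sum_distrib_left mult_ac)
    also have "\<dots> \<le> (\<Sum>e\<in>U. 2 ^ card J)"
    proof (rule sum_mono)
      fix e assume e: "e \<in> U"
      show "(2 * card U) * card (?A e) \<le> 2 ^ card J"
        by (rule card_subsets_by_part[OF J _ _ c]) (use I[OF e] in auto)
    qed
    also have "\<dots> = card U * 2 ^ card J" by simp
    finally have "2 * (\<Sum>e\<in>U. card (?A e)) \<le> 2 ^ card J" using pos by simp
    then show ?thesis using le by linarith
  qed
qed

section \<open>Random subsets\<close>

text \<open>Membership of the largest index is a fair coin that is independent of the rest.\<close>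

lemma pmf_of_set_Pow_Suc:
  "pmf_of_set (Pow {..<Suc n}) =
     bind_pmf (bernoulli_pmf (1 / 2)) (\<lambda>b. map_pmf (\<lambda>Y. if b then insert n Y else Y) (pmf_of_set (Pow {..<n})))"
proof (rule pmf_eqI)
  fix Z
  let ?P = "Pow {..<n}"
  have inj: "inj_on (insert n) ?P" by (rule inj_onI) (metis PowD insert_ident lessThan_iff less_irrefl subsetD)
  have 1: "map_pmf (insert n) (pmf_of_set ?P) = pmf_of_set (insert n ` ?P)"
    by (rule map_pmf_of_set_inj[OF inj]) auto
  have card: "card (insert n ` ?P) = 2 ^ n" using card_image[OF inj] by (simp add: card_Pow)
  have "Pow {..<Suc n} = ?P \<union> insert n ` ?P" by (simp add: lessThan_Suc Pow_insert)
  moreover have "?P \<inter> insert n ` ?P = {}" by auto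
  ultimately have *: "indicat_real (Pow {..<Suc n}) Z = indicat_real ?P Z + indicat_real (insert n ` ?P) Z"
    by (auto simp: indicator_def)
  have "pmf (bind_pmf (bernoulli_pmf (1 / 2)) (\<lambda>b. map_pmf (\<lambda>Y. if b then insert n Y else Y) (pmf_of_set ?P))) Z =
      pmf (map_pmf (insert n) (pmf_of_set ?P)) Z / 2 + pmf (pmf_of_set ?P) Z / 2"
    by (simp add: pmf_bind field_simps)
  also have "\<dots> = (indicat_real (insert n ` ?P) Z + indicat_real ?P Z) / 2 ^ Suc n"
    unfolding 1 by (subst (1 2) pmf_of_set) (auto simp: card card_Pow field_simps)
  also have "\<dots> = pmf (pmf_of_set (Pow {..<Suc n})) Z"
    by (subst pmf_of_set) (auto simp: * card_Pow)
  finally show "pmf (pmf_of_set (Pow {..<Suc n})) Z =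
    pmf (bind_pmf (bernoulli_pmf (1 / 2)) (\<lambda>b. map_pmf (\<lambda>Y. if b then insert n Y else Y) (pmf_of_set ?P))) Z" ..
qed

text \<open>The functional counterpart of the loop \<open>select_com\<close>. Because of the
  accumulator, the selected elements appear in reverse order.\<close>

fun random_select :: "'a list \<Rightarrow> 'a list \<Rightarrow> 'a list pmf" where
  "random_select [] acc = return_pmf acc"
| "random_select (x # xs) acc =
     bind_pmf (bernoulli_pmf (1 / 2)) (\<lambda>b. random_select xs (if b then x # acc else acc))"

lemma nths_insert_length: "length xs \<le> n \<Longrightarrow> nths xs (insert n Y) = nths xs Y"
  unfolding nths_def by (intro arg_cong[where f = "map fst"] filter_cong refl) (auto dest: set_zip_rightD)

text \<open>The head of the list occupies the last position of \<open>rev\<close>, so the induction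
  step adds one coin for the largest index.\<close>

lemma random_select_eq:
  "random_select xs acc = map_pmf (\<lambda>Y. nths (rev xs) Y @ acc) (pmf_of_set (Pow {..<length xs}))"
proof (induction xs arbitrary: acc)
  case Nil
  show ?case by (simp add: pmf_of_set_singleton)
next
  case (Cons x xs)
  let ?n = "length xs"
  have nths: "nths (rev (x # xs)) (if b then insert ?n Y else Y) @ acc = nths (rev xs) Y @ (if b then x # acc else acc)"
    if "Y \<in> set_pmf (pmf_of_set (Pow {..<?n}))" for Y b
  proof -
    have Y: "Y \<subseteq> {..<?n}" using that by (subst (asm) set_pmf_of_set) auto
    have "nths (rev xs) (insert ?n Y) = nths (rev xs) Y"
      by (rule nths_insert_length) simp
    then show ?thesis using Y by (auto simp: nths_append)
  qed
  have "random_select (x # xs) acc = bind_pmf (bernoulli_pmf (1 / 2)) (\<lambda>b.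
      map_pmf (\<lambda>Y. nths (rev xs) Y @ (if b then x # acc else acc)) (pmf_of_set (Pow {..<?n})))"
    by (simp add: Cons.IH)
  also have "\<dots> = bind_pmf (bernoulli_pmf (1 / 2)) (\<lambda>b.
      map_pmf (\<lambda>Y. nths (rev (x # xs)) (if b then insert ?n Y else Y) @ acc) (pmf_of_set (Pow {..<?n})))"
    using nths by (intro bind_pmf_cong map_pmf_cong refl) simp_all
  also have "\<dots> = map_pmf (\<lambda>Y. nths (rev (x # xs)) Y @ acc) (pmf_of_set (Pow {..<length (x # xs)}))"
    unfolding length_Cons pmf_of_set_Pow_Suc map_bind_pmf pmf.map_comp o_def ..
  finally show ?case .
qed

text \<open>Turns the weight of an edge, a count of selected labels, into the size of an
  intersection of index sets, the form in which \<open>isolation\<close> measures weights.\<close>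

lemma length_filter_nths:
  "length (filter P (nths xs Y)) = card (Y \<inter> {i. i < length xs \<and> P (xs ! i)})"
proof (induction xs rule: rev_induct)
  case (snoc x xs)
  let ?n = "length xs"
  have "{i. i < length (xs @ [x]) \<and> P ((xs @ [x]) ! i)} =
      {i. i < ?n \<and> P (xs ! i)} \<union> (if P x then {?n} else {})"
    by (auto simp: nth_append less_Suc_eq)
  then have "Y \<inter> {i. i < length (xs @ [x]) \<and> P ((xs @ [x]) ! i)} =
      (Y \<inter> {i. i < ?n \<and> P (xs ! i)}) \<union> (if P x \<and> ?n \<in> Y then {?n} else {})" by auto
  moreover have "card ((Y \<inter> {i. i < ?n \<and> P (xs ! i)}) \<union> {?n}) = Suc (card (Y \<inter> {i. i < ?n \<and> P (xs ! i)}))"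
    by simp
  ultimately show ?case using snoc by (simp add: nths_append)
qed simp

section \<open>Coin tosses in a program\<close>

definition select_com :: com where
  "select_com = While_Dot (Hd_of (Var 0)) (Seq (Flip 2) (If_Dot (Var 2)
     (Assign 0 (Cons_of (Tl_of (Hd_of (Var 0)))
        (Cons_of (Cons_of (Hd_of (Hd_of (Var 0))) (Hd_of (Tl_of (Var 0)))) (Tl_of (Tl_of (Var 0))))))
     (Assign 0 (Cons_of (Tl_of (Hd_of (Var 0))) (Tl_of (Var 0))))))"

definition steps :: "nat \<Rightarrow> config pmf \<Rightarrow> config pmf" where
  "steps t = (\<lambda>D. bind_pmf D step) ^^ t"

lemma steps_Suc: "steps (Suc t) D = steps t (bind_pmf D step)"
  unfolding steps_def by (simp only: funpow_Suc_right o_apply)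

lemma steps_add: "steps (t + u) D = steps u (steps t D)"
  unfolding steps_def by (subst add.commute) (simp add: funpow_add)

lemma steps_bind: "steps t (bind_pmf D f) = bind_pmf D (\<lambda>x. steps t (f x))"
proof (induction t arbitrary: f)
  case (Suc t)
  then show ?case by (simp add: steps_Suc bind_assoc_pmf)
qed (simp add: steps_def)

lemma steps_reaches: "reaches k t k' \<Longrightarrow> steps t (return_pmf k) = return_pmf k'"
  by (simp add: reaches_def steps_def)

lemma steps_final: "fst k = [] \<Longrightarrow> steps t (return_pmf k) = return_pmf k"
proof (induction t)
  case (Suc t)
  then show ?case by (cases k) (simp add: steps_Suc bind_return_pmf)
qed (simp add: steps_def)

text \<open>Each element takes five steps whatever the coin shows: the loop test, the unfolding of
  \<open>Seq\<close>, the flip, the branching and an assignment. All branches thus stay synchronous.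
  The final stores have a distribution \<open>S\<close> of their own, as variable 2 still holds a
  coin.\<close>

lemma select_com_steps:
  fixes xs acc :: "'a::enc list"
  assumes "s 0 = Dot (enc xs) (Dot (enc acc) r)"
  shows "\<exists>S. steps (5 * length xs + 1) (return_pmf (select_com # cs, s)) = map_pmf (\<lambda>s'. (cs, s')) S \<and>
     (\<forall>s'\<in>set_pmf S. s' 1 = s 1) \<and>
     map_pmf (\<lambda>s'. s' 0) S = map_pmf (\<lambda>ys. Dot Atom (Dot (enc ys) r)) (random_select xs acc)"
  using assms
proof (induction xs arbitrary: acc s)
  case Nil
  have "steps 1 (return_pmf (select_com # cs, s)) = return_pmf (cs, s)"
    using Nil by (intro steps_reaches reaches_step) (simp add: select_com_def)
  then show ?case using Nil by (intro exI[of _ "return_pmf s"]) simp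
next
  case (Cons x xs)
  define st where "st b = s(2 := (if b then Dot Atom Atom else Atom),
    0 := Dot (enc xs) (Dot (enc (if b then x # acc else acc)) r))" for b
  have flip: "steps 5 (return_pmf (select_com # cs, s)) =
      bind_pmf (bernoulli_pmf (1 / 2)) (\<lambda>b. return_pmf (select_com # cs, st b))"
  proof -
    have "steps 5 (return_pmf (select_com # cs, s)) = steps (Suc (Suc (Suc (Suc (Suc 0))))) (return_pmf (select_com # cs, s))"
      by (simp add: eval_nat_numeral)
    also have "\<dots> = bind_pmf (bernoulli_pmf (1 / 2)) (\<lambda>b. return_pmf (select_com # cs, st b))"
      using Cons.prems
      by (simp add: steps_Suc select_com_def bind_return_pmf map_pmf_def bind_assoc_pmf steps_def)
        (intro bind_pmf_cong refl, auto simp: st_def bind_return_pmf fun_eq_iff)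
    finally show ?thesis .
  qed
  have "\<exists>S. steps (5 * length xs + 1) (return_pmf (select_com # cs, st b)) = map_pmf (\<lambda>s'. (cs, s')) S \<and>
     (\<forall>s'\<in>set_pmf S. s' 1 = s 1) \<and>
     map_pmf (\<lambda>s'. s' 0) S = map_pmf (\<lambda>ys. Dot Atom (Dot (enc ys) r)) (random_select xs (if b then x # acc else acc))" for b
  proof -
    have "st b 0 = Dot (enc xs) (Dot (enc (if b then x # acc else acc)) r)" "st b 1 = s 1"
      by (simp_all add: st_def)
    then show ?thesis using Cons.IH[of "st b" "if b then x # acc else acc"] by simp
  qed
  then obtain S where S: "\<And>b. steps (5 * length xs + 1) (return_pmf (select_com # cs, st b)) = map_pmf (\<lambda>s'. (cs, s')) (S b)"
     "\<And>b s'. s' \<in> set_pmf (S b) \<Longrightarrow> s' 1 = s 1"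
     "\<And>b. map_pmf (\<lambda>s'. s' 0) (S b) = map_pmf (\<lambda>ys. Dot Atom (Dot (enc ys) r)) (random_select xs (if b then x # acc else acc))"
    by metis
  have "steps (5 * length (x # xs) + 1) (return_pmf (select_com # cs, s)) =
      steps (5 * length xs + 1) (steps 5 (return_pmf (select_com # cs, s)))"
    unfolding steps_add[symmetric] by (simp add: algebra_simps)
  also have "\<dots> = map_pmf (\<lambda>s'. (cs, s')) (bind_pmf (bernoulli_pmf (1 / 2)) S)"
    unfolding flip steps_bind S(1) map_bind_pmf ..
  finally show ?case
    using S(2) by (intro exI[of _ "bind_pmf (bernoulli_pmf (1 / 2)) S"]) (auto simp: map_bind_pmf S(3))
qed

section \<open>The algorithm\<close>

type_synonym inst = "nat list \<times> nat list \<times> nat list list"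

text \<open>The constant \<open>Suc (length S)\<close> exceeds the total random weight, so that shorter packings are lighter.\<close>

definition edge_weight :: "(nat \<times> nat) list \<Rightarrow> nat \<Rightarrow> nat \<Rightarrow> nat" where
  "edge_weight S u v = Suc (length S) +
     length (filter (\<lambda>l. fst l = u \<and> snd l = v \<or> fst l = v \<and> snd l = u) S)"

definition matrix_rows :: "(nat \<times> nat) list \<Rightarrow> nat list list \<Rightarrow> nat \<times> nat \<Rightarrow> (nat \<times> row) list" where
  "matrix_rows S adj e = map (\<lambda>x. (fst x, (fst x, 0) # map (\<lambda>v. (v, edge_weight S (fst x) v))
     (filter (\<lambda>v. \<not> (fst x = fst e \<and> v = snd e \<or> fst x = snd e \<and> v = fst e)) (snd x))))
     (zip [0..<length adj] adj)"

text \<open>Each sublist \<open>Ss\<close> is a choice of sources. The weight is the sign of the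
  choice, and the level \<open>K - 1\<close> imposes no divisibility on it.\<close>

definition initial_items :: "(nat \<times> nat) list \<Rightarrow> inst \<Rightarrow> nat \<Rightarrow> nat \<times> nat \<Rightarrow> item list" where
  "initial_items S x M e =
     map (\<lambda>Ss. (length (fst x @ fst (snd x)) - Suc 0,
         (if length (filter (\<lambda>s. s \<in> set (fst (snd x))) Ss) mod 2 = 0 then [0] else pneg1 M),
         filter (\<lambda>c. c \<notin> set Ss) [0..<length (snd (snd x))],
         filter (\<lambda>y. fst y \<notin> set (fst x @ fst (snd x)) \<or> fst y \<in> set Ss) (matrix_rows S (snd (snd x)) e)))
       (filter (\<lambda>Ss. 2 * length Ss = length (fst x @ fst (snd x))) (subseqs (fst x @ fst (snd x))))"

text \<open>
  The exponents of \<open>Z\<close> with nonzero coefficients, after deletion of the edge \<open>e\<close>. As graphs are simple,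
  \<open>e = (0, 0)\<close> deletes nothing.
\<close>

definition evaluate :: "nat \<Rightarrow> (nat \<times> nat) list \<Rightarrow> inst \<Rightarrow> nat \<times> nat \<Rightarrow> nat list" where
  "evaluate fuel S x e =
     work fuel (Suc (length (snd (snd x))) * Suc (length S)) (2 ^ length (fst x @ fst (snd x)))
       (initial_items S x (2 ^ length (fst x @ fst (snd x))) e)"

definition solution_adjacency :: "nat \<Rightarrow> (nat \<times> nat) list \<Rightarrow> inst \<Rightarrow> nat \<Rightarrow> (nat \<times> nat list) list" where
  "solution_adjacency fuel S x j =
     map (\<lambda>y. (fst y, filter (\<lambda>v. j \<notin> set (evaluate fuel S x (fst y, v))) (snd y)))
       (zip [0..<length (snd (snd x))] (snd (snd x)))"

text \<open>\<open>Fl\<close> consists of the adjacency lists of a union of disjoint paths.\<close>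

definition trace_step :: "(nat \<times> nat list) list \<Rightarrow> nat \<times> nat list \<Rightarrow> nat \<times> nat list" where
  "trace_step Fl st =
     (case filter (\<lambda>v. v \<notin> set (snd st)) (concat (map snd (filter (\<lambda>x. fst x = fst st) Fl))) of
        [] \<Rightarrow> st | v # vs \<Rightarrow> (v, v # snd st))"

definition trace :: "(nat \<times> nat list) list \<Rightarrow> nat \<Rightarrow> nat \<times> nat list" where
  "trace Fl t = foldl (\<lambda>st x. trace_step Fl st) (t, [t]) Fl"

text \<open>Every path is found from both of its ends; comparing the ends keeps one of the two
  copies.\<close>

definition trace_paths :: "(nat \<times> nat list) list \<Rightarrow> nat list \<Rightarrow> nat list list" where
  "trace_paths Fl ts = map (\<lambda>t. snd (trace Fl t)) (filter (\<lambda>t. fst (trace Fl t) < t) ts)"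

definition list_min :: "nat \<Rightarrow> nat list \<Rightarrow> nat" where
  "list_min j js = foldl (\<lambda>m i. if i < m then i else m) j js"

definition solve :: "nat \<Rightarrow> (nat \<times> nat) list \<Rightarrow> inst \<Rightarrow> nat list list option" where
  "solve fuel S x = (case evaluate fuel S x (0, 0) of [] \<Rightarrow> None
     | j # js \<Rightarrow> Some (trace_paths (solution_adjacency fuel S x (list_min j js)) (fst x @ fst (snd x))))"

section \<open>Random weights and the form of computed polynomials\<close>

definition rand_weight :: "(nat \<times> nat) list \<Rightarrow> nat set \<Rightarrow> nat" where
  "rand_weight S e = length (filter (\<lambda>l. {fst l, snd l} = e) S)"

lemma edge_weight_eq: "edge_weight S u v = Suc (length S) + rand_weight S {u, v}"
  unfolding edge_weight_def rand_weight_def by (simp add: doubleton_eq_iff)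

text \<open>Every selected label is counted for at most one edge.\<close>

lemma sum_rand_weight_le: "finite F \<Longrightarrow> (\<Sum>e\<in>F. rand_weight S e) \<le> length S"
proof (induction S)
  case (Cons l S)
  have "(\<Sum>e\<in>F. rand_weight (l # S) e) = (\<Sum>e\<in>F. (if {fst l, snd l} = e then 1 else 0) + rand_weight S e)"
    by (intro sum.cong refl) (simp add: rand_weight_def)
  also have "\<dots> = (\<Sum>e\<in>F. if {fst l, snd l} = e then 1 else 0) + (\<Sum>e\<in>F. rand_weight S e)"
    by (rule sum.distrib)
  also have "\<dots> \<le> 1 + length S"
    using Cons by (intro add_mono) (simp_all add: sum.delta')
  finally show ?case by simp
qed (simp add: rand_weight_def)

lemma list_min:
  "list_min j js \<in> set (j # js)" "i \<in> set (j # js) \<Longrightarrow> list_min j js \<le> i"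
proof -
  have "list_min j js \<in> set (j # js) \<and> (\<forall>i\<in>set (j # js). list_min j js \<le> i)"
  proof (induction js arbitrary: j)
    case (Cons a js)
    show ?case using Cons[of "if a < j then a else j"] by (auto simp: list_min_def split: if_splits)
  qed (simp add: list_min_def)
  then show "list_min j js \<in> set (j # js)" "i \<in> set (j # js) \<Longrightarrow> list_min j js \<le> i" by blast+
qed

text \<open>A normal form lists an exponent only if its coefficient is nonzero modulo
  \<open>M\<close>, so vanishing of coefficients can be read off by membership.\<close>

lemma work_is_pnorm: "\<exists>q. work fuel N M its = pnorm N M q"
proof -
  have "\<exists>q. fst (foldl (\<lambda>st u. work_step N M st) st (replicate fuel ())) = pnorm N M q"
    if "\<exists>q. fst st = pnorm N M q" for st
    using that
  proof (induction fuel arbitrary: st)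
    case (Suc fuel)
    have "\<exists>q. fst (work_step N M st) = pnorm N M q"
      using Suc.prems by (auto simp: work_step_def split: list.splits)
    from Suc.IH[OF this] show ?case by simp
  qed simp
  moreover have "[] = pnorm N M []" by (simp add: pnorm_def map_replicate_const)
  ultimately show ?thesis unfolding work_def by (metis fst_conv)
qed

lemma mem_work:
  assumes "eqm N M (poly_of (work fuel N M its)) f"
  shows "j \<in> set (work fuel N M its) \<longleftrightarrow> j < N \<and> \<not> int M dvd coeff f j"
proof -
  obtain q where q: "work fuel N M its = pnorm N M q" using work_is_pnorm by blast
  have "eqm N M (poly_of q) f"
    using eqm_trans[OF eqm_sym[OF eqm_pnorm[of N M q]]] assms unfolding q by blast
  then have "int M dvd coeff (poly_of q) j - coeff f j" if "j < N" using that by (simp add: eqm_def)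
  then show ?thesis unfolding q mem_pnorm by (metis dvd_diff_commute dvd_diffD dvd_diffD1 dvd_diff_right_iff)
qed

context path_instance begin

lemma perfect_packing_edges:
  assumes "perfect_packing V E A B Ps" shows "edges_of Ps \<subseteq> E"
  using pack_edge[OF assms] unfolding edges_of_def by auto

lemma card_edges_of:
  assumes Ps: "perfect_packing V E A B Ps"
  shows "card (edges_of Ps) = packing_size Ps" "packing_size Ps \<le> card V"
proof -
  have fin: "finite (parcs p)" for p :: "nat list"
    by (rule finite_subset[of _ "set p \<times> set p"]) (auto dest: parcs_mem)
  have card: "card (parcs p) = path_length p" if p: "p \<in> Ps" for p
  proof -
    have "parcs p = (\<lambda>i. (p ! i, p ! Suc i)) ` {i. Suc i < length p}" by (auto simp: parcs_def)
    moreover have "inj_on (\<lambda>i. (p ! i, p ! Suc i)) {i. Suc i < length p}"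
      using pack_set[OF Ps p] by (auto simp: inj_on_def nth_eq_iff_index_eq)
    moreover have "{i. Suc i < length p} = {..<length p - 1}" by auto
    ultimately show ?thesis by (simp add: card_image path_length_def)
  qed
  have "card (edges_of Ps) = card (\<Union>p\<in>Ps. parcs p)"
    unfolding edges_of_def by (rule card_image[OF inj_edges[OF Ps]])
  also have "\<dots> = (\<Sum>p\<in>Ps. card (parcs p))"
  proof (rule card_UN_disjoint)
    show "\<forall>p\<in>Ps. \<forall>q\<in>Ps. p \<noteq> q \<longrightarrow> parcs p \<inter> parcs q = {}"
    proof (intro ballI impI, rule ccontr)
      fix p q assume pq: "p \<in> Ps" "q \<in> Ps" "p \<noteq> q" "parcs p \<inter> parcs q \<noteq> {}"
      then obtain u v where "(u, v) \<in> parcs p" "(u, v) \<in> parcs q" by auto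
      then have "u \<in> set p" "u \<in> set q" using parcs_mem[of u v] by blast+
      then show False using pack_eq[OF Ps pq(1,2)] pq(3) by blast
    qed
  qed (use pack_finite[OF Ps] fin in auto)
  also have "\<dots> = packing_size Ps" unfolding packing_size_def by (intro sum.cong refl card)
  finally show "card (edges_of Ps) = packing_size Ps" .
  have "packing_size Ps \<le> (\<Sum>p\<in>Ps. card (set p))"
    unfolding packing_size_def path_length_def
    using pack_set[OF Ps] by (intro sum_mono) (simp add: distinct_card)
  also have "\<dots> = card (\<Union>p\<in>Ps. set p)"
    by (rule card_UN_disjoint[symmetric]) (use pack_finite[OF Ps] pack_eq[OF Ps] in auto)
  also have "\<dots> \<le> card V" using pack_set[OF Ps] finV by (intro card_mono) auto
  finally show "packing_size Ps \<le> card V" .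
qed

end

lemma graph_path_mono: "graph_path V E p \<Longrightarrow> E \<subseteq> E' \<Longrightarrow> graph_path V E' p"
  unfolding graph_path_def successively_conv_nth by blast

lemma perfect_packing_mono: "perfect_packing V E A B Ps \<Longrightarrow> E \<subseteq> E' \<Longrightarrow> perfect_packing V E' A B Ps"
  unfolding perfect_packing_def T_path_def using graph_path_mono[of V E _ E'] by blast

lemma perfect_packing_remove:
  assumes "perfect_packing V E A B Ps" "e \<notin> edges_of Ps"
  shows "perfect_packing V (E - {e}) A B Ps"
proof -
  have "graph_path V (E - {e}) p" if "p \<in> Ps" "graph_path V E p" for p
  proof -
    have "{p ! i, p ! Suc i} \<noteq> e" if i: "Suc i < length p" for i
    proof -
      have "(p ! i, p ! Suc i) \<in> (\<Union>p\<in>Ps. parcs p)" using i \<open>p \<in> Ps\<close> by (auto simp: parcs_def)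
      then have "{p ! i, p ! Suc i} \<in> edges_of Ps" unfolding edges_of_def by force
      then show ?thesis using assms(2) by blast
    qed
    then show ?thesis using that unfolding graph_path_def successively_conv_nth by simp
  qed
  then show ?thesis using assms(1) unfolding perfect_packing_def T_path_def by blast
qed

section \<open>Evaluation of the signed sum for fixed weights\<close>

lemma eqm_sum_list:
  "(\<And>a. a \<in> set l \<Longrightarrow> eqm N M (f a) (g a)) \<Longrightarrow> eqm N M (\<Sum>a\<leftarrow>l. f a) (\<Sum>a\<leftarrow>l. g a)"
  by (induction l) (auto intro: eqm_add)

text \<open>At least one terminal is required, since the modulus \<open>2 ^ 0\<close> would carry no
  information. The fuel bounds the total potential of the initial items.\<close>

locale instance_setup =
  fixes n :: nat and E :: "nat set set" and A B :: "nat set" and S :: "(nat \<times> nat) list" and fuel :: nat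
  assumes graph: "simple_graph {..<n} E" and AB: "A \<subseteq> {..<n}" "B \<subseteq> {..<n}" "A \<inter> B = {}" "even (card A)" "even (card B)"
    and pos: "card A + card B > 0"
    and fuel: "(n + 2) ^ (8 * (card A + card B)) \<le> fuel"
begin

definition "K = card A + card B"

definition "N = Suc n * Suc (length S)"

definition "x = (sorted_list_of_set A, sorted_list_of_set B, adjacency_lists n E)"

definition "we e = Suc (length S) + rand_weight S e"

lemma fin: "finite A" "finite B" using AB finite_subset by blast+

lemma instance_remove: "path_instance {..<n} (E - {e}) A B we"
  using graph AB by unfold_locales (auto simp: simple_graph_def we_def)

lemma instance_self: "path_instance {..<n} E A B we"
  using graph AB by unfold_locales (auto simp: simple_graph_def we_def)

abbreviation "Ts \<equiv> sorted_list_of_set A @ sorted_list_of_set B"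

lemma Ts: "set Ts = A \<union> B" "distinct Ts" "length Ts = K"
  using fin AB by (auto simp: K_def)

lemma length_adj: "length (adjacency_lists n E) = n"
  by (simp add: adjacency_lists_def)

lemma zip_adj: "zip [0..<n] (adjacency_lists n E) = map (\<lambda>u. (u, sorted_list_of_set {v. {u, v} \<in> E})) [0..<n]"
  unfolding adjacency_lists_def by (simp add: zip_map2 zip_same_conv_map)

lemma neighbours: "finite {v. {u, v} \<in> E}" "{u, v} \<in> E \<Longrightarrow> v < n \<and> u < n \<and> u \<noteq> v"
proof -
  show *: "{u, v} \<in> E \<Longrightarrow> v < n \<and> u < n \<and> u \<noteq> v" for u v
    using graph unfolding simple_graph_def by (metis doubleton_eq_iff lessThan_iff)
  show "finite {v. {u, v} \<in> E}" by (rule finite_subset[of _ "{..<n}"]) (use * in auto)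
qed

definition "mrow e u = (u, 0) # map (\<lambda>v. (v, edge_weight S u v))
  (filter (\<lambda>v. \<not> (u = fst e \<and> v = snd e \<or> u = snd e \<and> v = fst e)) (sorted_list_of_set {v. {u, v} \<in> E}))"

lemma matrix_rows_eq: "matrix_rows S (adjacency_lists n E) e = map (\<lambda>u. (u, mrow e u)) [0..<n]"
  unfolding matrix_rows_def length_adj zip_adj by (simp add: mrow_def)

lemma entry_mrow:
  "entry (mrow e u) c = path_instance.mat (E - {{fst e, snd e}}) we u c"
proof -
  interpret path_instance "{..<n}" "E - {{fst e, snd e}}" A B we by (rule instance_remove)
  let ?l = "filter (\<lambda>v. \<not> (u = fst e \<and> v = snd e \<or> u = snd e \<and> v = fst e)) (sorted_list_of_set {v. {u, v} \<in> E})"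
  have dist: "distinct ?l" by simp
  have mem: "v \<in> set ?l \<longleftrightarrow> {u, v} \<in> E - {{fst e, snd e}}" for v
    using neighbours(1)[of u] by (auto simp: doubleton_eq_iff)
  have look: "look (map (\<lambda>v. (v, edge_weight S u v)) l) c = (if c \<in> set l then [edge_weight S u c] else [])"
    if "distinct l" for l
    using that by (induction l) (auto simp: look_def)
  have "look (mrow e u) c = (if u = c then [0] else []) @ (if {u, c} \<in> E - {{fst e, snd e}} then [edge_weight S u c] else [])"
  proof -
    have cons: "look ((u, 0) # L) c = (if u = c then [0] else []) @ look L c" for L by (simp add: look_def)
    show ?thesis by (simp only: mrow_def cons look[OF dist] mem)
  qed
  moreover have "{u} \<notin> E" using neighbours(2)[of u u] by auto
  ultimately show ?thesis
    unfolding entry_def mat_def by (auto simp: monom_0 one_pCons edge_weight_eq we_def)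
qed

text \<open>Positive weights make every row odd at its own node only. The rows whose nodes are
  missing from the columns belong to \<open>Ss\<close>, which bounds the last factor of the
  potential.\<close>

lemma initial_items_ok:
  assumes e: "it \<in> set (initial_items S x (2 ^ K) e)"
  shows "item_ok n N K it" "potential n it \<le> (n + 2) ^ (7 * K)"
proof -
  interpret path_instance "{..<n}" "E - {{fst e, snd e}}" A B we by (rule instance_remove)
  obtain Ss where Ss: "Ss \<in> set (subseqs Ts)" "2 * length Ss = K"
    and it: "it = (K - 1, (if length (filter (\<lambda>s. s \<in> B) Ss) mod 2 = 0 then [0] else pneg1 (2 ^ K)),
      filter (\<lambda>c. c \<notin> set Ss) [0..<n], map (\<lambda>u. (u, mrow e u)) (filter (\<lambda>u. u \<notin> A \<union> B \<or> u \<in> set Ss) [0..<n]))"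
    using e Ts fin by (auto simp: initial_items_def x_def length_adj matrix_rows_eq filter_map o_def)
  have sub: "set Ss \<subseteq> A \<union> B" "distinct Ss"
    using Ss(1) Ts by (metis subseqs_powset PowD imageI, metis subseqs_distinctD)
  let ?R = "filter (\<lambda>u. u \<notin> A \<union> B \<or> u \<in> set Ss) [0..<n]" and ?C = "filter (\<lambda>c. c \<notin> set Ss) [0..<n]"
  have setR: "set ?R = {..<n} - ((A \<union> B) - set Ss)" and setC: "set ?C = {..<n} - set Ss" by auto
  have cardS: "2 * card (set Ss) = card (A \<union> B)"
    using Ss(2) sub(2) fin AB(3) by (simp add: distinct_card K_def card_Un_disjoint)
  have len: "length ?R = length ?C"
  proof -
    have "card (A \<union> B - set Ss) = card (A \<union> B) - card (set Ss)"
      by (rule card_Diff_subset) (use sub(1) in auto)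
    then have "card (A \<union> B - set Ss) = card (set Ss)" using cardS by linarith
    moreover have diff: "card ({..<n} - X) = n - card X" if "X \<subseteq> {..<n}" for X
      using card_Diff_subset[OF finite_subset[OF that] that] by simp
    moreover have X: "A \<union> B - set Ss \<subseteq> {..<n}" "set Ss \<subseteq> {..<n}" using AB sub(1) by blast+
    ultimately have "card (set ?R) = card (set ?C)" unfolding setR setC diff[OF X(1)] diff[OF X(2)] by simp
    moreover have "card (set ?R) = length ?R" "card (set ?C) = length ?C" by (rule distinct_card, simp)+
    ultimately show ?thesis by (simp only:)
  qed
  have odd: "odd (coeff (entry (mrow e u) c) 0) \<longleftrightarrow> u = c" for u c
    unfolding entry_mrow mat_def by (auto simp: we_def)
  have "level_ok N K (K - 1) w" for w
    using pos unfolding level_ok_def K_def by (auto intro!: exI[of _ "poly_of w"])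
  then show "item_ok n N K it"
    using len odd by (auto simp: it item_ok_def unital_def o_def distinct_map inj_on_def)
  have "card (fst ` set (map (\<lambda>u. (u, mrow e u)) ?R) - set ?C) \<le> card (set Ss)"
    by (intro card_mono) auto
  also have "\<dots> \<le> K" using Ss(2) card_length[of Ss] by linarith
  finally have c: "card (fst ` set (map (\<lambda>u. (u, mrow e u)) ?R) - set ?C) \<le> K" .
  have "length ?R \<le> n" using length_filter_le[of _ "[0..<n]"] by (metis length_upt minus_nat.diff_0)
  then have "potential n it \<le> (n + 2) ^ 1 * (n + 2) ^ (6 * (K - 1)) * (n + 2) ^ K"
    unfolding potential_def it using c by (intro mult_mono power_increasing) auto
  also have "\<dots> = (n + 2) ^ (1 + 6 * (K - 1) + K)" by (simp only: power_add)
  also have "\<dots> \<le> (n + 2) ^ (7 * K)" using pos by (intro power_increasing) (auto simp: K_def)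
  finally show "potential n it \<le> (n + 2) ^ (7 * K)" .
qed

lemma length_initial_items: "length (initial_items S x M e) \<le> (n + 2) ^ K"
proof -
  have "length (initial_items S x M e) \<le> length (subseqs Ts)"
    unfolding initial_items_def x_def by (simp only: length_map fst_conv snd_conv length_filter_le)
  also have "\<dots> = 2 ^ K" by (simp only: length_subseqs Ts(3))
  also have "\<dots> \<le> (n + 2) ^ K" by (rule power_mono) auto
  finally show ?thesis .
qed

lemma potential_initial_items: "(\<Sum>it\<leftarrow>initial_items S x (2 ^ K) e. potential n it) \<le> fuel"
proof -
  have "(\<Sum>it\<leftarrow>initial_items S x (2 ^ K) e. potential n it) \<le> (\<Sum>it\<leftarrow>initial_items S x (2 ^ K) e. (n + 2) ^ (7 * K))"
    by (intro sum_list_mono initial_items_ok(2))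
  also have "\<dots> = length (initial_items S x (2 ^ K) e) * (n + 2) ^ (7 * K)" by (simp add: sum_list_triv)
  also have "\<dots> \<le> (n + 2) ^ K * (n + 2) ^ (7 * K)"
    by (intro mult_right_mono length_initial_items) simp
  also have "\<dots> = (n + 2) ^ (8 * K)" by (simp flip: power_add)
  also have "\<dots> \<le> fuel" using fuel by (simp add: K_def)
  finally show ?thesis .
qed

text \<open>The list \<open>Ts\<close> has no duplicates, so its sublists enumerate the subsets of
  \<open>A \<union> B\<close>, and every item stands for one signed permanent.\<close>

lemma value_initial_items:
  "eqm N (2 ^ K) (\<Sum>it\<leftarrow>initial_items S x (2 ^ K) e. item_value it)
     (path_instance.Zpoly {..<n} (E - {{fst e, snd e}}) A B we)"
proof -
  interpret path_instance "{..<n}" "E - {{fst e, snd e}}" A B we by (rule instance_remove)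
  let ?G = "\<lambda>S. (- 1) ^ card (S \<inter> B) *
      (\<Sum>D\<in>graphs ({..<n} - (A \<union> B - S)) ({..<n} - S). \<Prod>p\<in>D. mat (fst p) (snd p)) :: int poly"
  let ?it = "\<lambda>Ss. (K - 1, (if length (filter (\<lambda>s. s \<in> B) Ss) mod 2 = 0 then [0] else pneg1 (2 ^ K)),
      filter (\<lambda>c. c \<notin> set Ss) [0..<n], map (\<lambda>u. (u, mrow e u)) (filter (\<lambda>u. u \<notin> A \<union> B \<or> u \<in> set Ss) [0..<n]))"
  have items: "initial_items S x (2 ^ K) e = map ?it (filter (\<lambda>Ss. 2 * length Ss = K) (subseqs Ts))"
    unfolding initial_items_def x_def fst_conv snd_conv length_adj matrix_rows_eq Ts(1,3) set_sorted_list_of_set[OF fin(2)]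
    by (simp add: filter_map o_def)
  have val: "eqm N (2 ^ K) (item_value (?it Ss)) (?G (set Ss))"
    if "Ss \<in> set (subseqs Ts)" "2 * length Ss = K" for Ss
  proof -
    have it: "?it Ss \<in> set (initial_items S x (2 ^ K) e)" using that unfolding items by auto
    let ?R = "filter (\<lambda>u. u \<notin> A \<union> B \<or> u \<in> set Ss) [0..<n]" and ?C = "filter (\<lambda>c. c \<notin> set Ss) [0..<n]"
    have len: "length ?R = length ?C" using initial_items_ok(1)[OF it] by (simp add: item_ok_def)
    have dist: "distinct Ss" using that(1) Ts(2) by (rule subseqs_distinctD)
    have setR: "set ?R = {..<n} - ((A \<union> B) - set Ss)" and setC: "set ?C = {..<n} - set Ss" by auto
    have "per (set ?C) (map (\<lambda>y. entry (snd y)) (map (\<lambda>u. (u, mrow e u)) ?R)) = per (set ?C) (map mat ?R)"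
    proof -
      have "entry (mrow e u) = mat u" for u by (rule ext) (rule entry_mrow)
      then show ?thesis by (simp add: o_def)
    qed
    also have "\<dots> = (\<Sum>D\<in>graphs (set ?R) (set ?C). \<Prod>p\<in>D. mat (fst p) (snd p))"
      using len by (intro per_eq_sum_graphs) (simp_all add: distinct_card del: set_filter)
    finally have per: "per (set ?C) (map (\<lambda>y. entry (snd y)) (map (\<lambda>u. (u, mrow e u)) ?R)) =
        (\<Sum>D\<in>graphs ({..<n} - (A \<union> B - set Ss)) ({..<n} - set Ss). \<Prod>p\<in>D. mat (fst p) (snd p))"
      unfolding setR setC .
    have "set (filter (\<lambda>s. s \<in> B) Ss) = set Ss \<inter> B" by auto
    then have c: "length (filter (\<lambda>s. s \<in> B) Ss) = card (set Ss \<inter> B)"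
      using dist by (metis distinct_card distinct_filter)
    have "eqm N (2 ^ K) (poly_of (if card (set Ss \<inter> B) mod 2 = 0 then [0] else pneg1 (2 ^ K))) ((- 1) ^ card (set Ss \<inter> B))"
    proof (cases "even (card (set Ss \<inter> B))")
      case True
      moreover have "poly_of [0] = 1" by (simp add: monom_0 one_pCons)
      ultimately show ?thesis by simp
    next
      case False
      then show ?thesis using poly_of_pneg1[of "2 ^ K" N] by (simp add: odd_iff_mod_2_eq_one)
    qed
    then show ?thesis unfolding item_value_def fst_conv snd_conv c per by (rule eqm_mult_right)
  qed
  have cardS: "2 * length Ss = K \<longleftrightarrow> 2 * card (set Ss) = card (A \<union> B)" if "Ss \<in> set (subseqs Ts)" for Ss
    using subseqs_distinctD[OF that Ts(2)] fin AB(3) by (simp add: distinct_card K_def card_Un_disjoint)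
  have val: "eqm N (2 ^ K) (\<Sum>it\<leftarrow>initial_items S x (2 ^ K) e. item_value it)
      (\<Sum>Ss\<leftarrow>subseqs Ts. if 2 * card (set Ss) = card (A \<union> B) then ?G (set Ss) else 0)"
    unfolding items map_map o_def sum_list_map_filter'
  proof (rule eqm_sum_list)
    fix Ss assume Ss: "Ss \<in> set (subseqs Ts)"
    show "eqm N (2 ^ K) (if 2 * length Ss = K then item_value (?it Ss) else 0)
        (if 2 * card (set Ss) = card (A \<union> B) then ?G (set Ss) else 0)"
    proof (cases "2 * length Ss = K")
      case True
      then show ?thesis unfolding cardS[OF Ss, symmetric] if_P[OF True] by (rule val[OF Ss])
    next
      case False
      show ?thesis unfolding cardS[OF Ss, symmetric] if_not_P[OF False] by (rule eqm_refl)
    qed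
  qed
  define h where "h S = (if 2 * card S = card (A \<union> B) then ?G S else 0)" for S
  have "(\<Sum>Ss\<leftarrow>subseqs Ts. h (set Ss)) = (\<Sum>S\<leftarrow>map set (subseqs Ts). h S)"
    unfolding map_map o_def by (rule refl)
  also have "\<dots> = sum h (set (map set (subseqs Ts)))"
    by (rule sum_list_distinct_conv_sum_set[OF distinct_set_subseqs[OF Ts(2)]])
  also have "set (map set (subseqs Ts)) = Pow (A \<union> B)" unfolding set_map subseqs_powset Ts(1) by (rule refl)
  also have "sum h (Pow (A \<union> B)) = sum ?G {S \<in> Pow (A \<union> B). 2 * card S = card (A \<union> B)}"
    unfolding h_def by (rule sum.inter_filter[symmetric]) (use finT(3) in simp)
  also have "{S \<in> Pow (A \<union> B). 2 * card S = card (A \<union> B)} = {S. S \<subseteq> A \<union> B \<and> 2 * card S = card (A \<union> B)}" by blast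
  finally have "(\<Sum>Ss\<leftarrow>subseqs Ts. h (set Ss)) = Zpoly" unfolding Zpoly_def .
  then show ?thesis using val unfolding h_def by (simp only:)
qed

lemma mem_evaluate:
  "j \<in> set (evaluate fuel S x e) \<longleftrightarrow>
     j < N \<and> \<not> 2 ^ K dvd coeff (path_instance.Zpoly {..<n} (E - {{fst e, snd e}}) A B we) j"
proof -
  have e: "evaluate fuel S x e = work fuel N (2 ^ K) (initial_items S x (2 ^ K) e)"
    unfolding evaluate_def N_def using Ts(3) by (simp add: x_def length_adj)
  have "eqm N (2 ^ K) (poly_of (evaluate fuel S x e)) (\<Sum>it\<leftarrow>initial_items S x (2 ^ K) e. item_value it)"
    unfolding e
  proof (rule work_correct[where n = n])
    show "K > 0" "N > 0" using pos by (simp_all add: K_def N_def)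
    show "item_ok n N K it" if "it \<in> set (initial_items S x (2 ^ K) e)" for it
      by (rule initial_items_ok(1)[OF that])
    show "(\<Sum>it\<leftarrow>initial_items S x (2 ^ K) e. potential n it) \<le> fuel" by (rule potential_initial_items)
  qed
  then have "eqm N (2 ^ K) (poly_of (work fuel N (2 ^ K) (initial_items S x (2 ^ K) e)))
      (path_instance.Zpoly {..<n} (E - {{fst e, snd e}}) A B we)"
    using eqm_trans value_initial_items unfolding e by blast
  from mem_work[OF this, of j] show ?thesis unfolding e by (simp only: of_nat_power of_nat_numeral)
qed

end

section \<open>Recovering the packing from isolating weights\<close>

context instance_setup begin

text \<open>Only the random parts of the weights and only packings of minimum size are compared,
  because the constant part already favours these. Packings enter by their edge sets, which do not
  depend on the directions of the lists.\<close>

definition "isolated \<longleftrightarrow> (let m = (LEAST m. \<exists>Ps. perfect_packing {..<n} E A B Ps \<and> packing_size Ps = m);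
    \<F> = {edges_of Ps |Ps. perfect_packing {..<n} E A B Ps \<and> packing_size Ps = m} in
    \<exists>F\<in>\<F>. \<forall>F'\<in>\<F>. F' \<noteq> F \<longrightarrow> (\<Sum>e\<in>F. rand_weight S e) < (\<Sum>e\<in>F'. rand_weight S e))"

lemma weight_edges_of:
  assumes Ps: "perfect_packing {..<n} E A B Ps"
  shows "(\<Sum>e\<in>edges_of Ps. we e) = packing_size Ps * Suc (length S) + (\<Sum>e\<in>edges_of Ps. rand_weight S e)"
    and "(\<Sum>e\<in>edges_of Ps. rand_weight S e) \<le> length S" "packing_size Ps \<le> n"
proof -
  interpret path_instance "{..<n}" E A B we by (rule instance_self)
  show "(\<Sum>e\<in>edges_of Ps. we e) = packing_size Ps * Suc (length S) + (\<Sum>e\<in>edges_of Ps. rand_weight S e)"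
    unfolding we_def sum.distrib sum_constant card_edges_of(1)[OF Ps] by simp
  have "finite (parcs p)" for p :: "nat list"
    by (rule finite_subset[of _ "set p \<times> set p"]) (auto dest: parcs_mem)
  then have "finite (edges_of Ps)" unfolding edges_of_def using pack_finite[OF Ps] by simp
  then show "(\<Sum>e\<in>edges_of Ps. rand_weight S e) \<le> length S" by (rule sum_rand_weight_le)
  show "packing_size Ps \<le> n" using card_edges_of(2)[OF Ps] by simp
qed

lemma evaluate_no_packing:
  assumes "\<nexists>Ps. perfect_packing {..<n} E A B Ps" shows "evaluate fuel S x e = []"
proof -
  interpret path_instance "{..<n}" "E - {{fst e, snd e}}" A B we by (rule instance_remove)
  have "\<not> perfect_packing {..<n} (E - {{fst e, snd e}}) A B Ps" for Ps
    using perfect_packing_mono[of "{..<n}" "E - {{fst e, snd e}}" A B Ps E] assms by blast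
  then have "coeff Zpoly j = 0" for j by (intro coeff_Zpoly_low) blast
  then have "j \<notin> set (evaluate fuel S x e)" for j unfolding mem_evaluate by simp
  then show ?thesis by (metis last_in_set)
qed

lemma isolated_packing:
  assumes "perfect_packing {..<n} E A B Ps0" isolated
  obtains Ps where "perfect_packing {..<n} E A B Ps"
    "\<And>Qs. perfect_packing {..<n} E A B Qs \<Longrightarrow> packing_size Ps \<le> packing_size Qs"
    "\<And>Qs. perfect_packing {..<n} E A B Qs \<Longrightarrow>
       (\<Sum>e\<in>edges_of Qs. we e) > (\<Sum>e\<in>edges_of Ps. we e) \<or> edges_of Qs = edges_of Ps"
proof -
  let ?Q = "\<lambda>m. \<exists>Ps. perfect_packing {..<n} E A B Ps \<and> packing_size Ps = m"
  define m where "m = (LEAST m. ?Q m)"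
  have "?Q (packing_size Ps0)" using assms(1) by blast
  then have m: "?Q m" unfolding m_def by (rule LeastI)
  have least: "m \<le> packing_size Qs" if "perfect_packing {..<n} E A B Qs" for Qs
    unfolding m_def using that by (intro Least_le) blast
  obtain Ps where Ps: "perfect_packing {..<n} E A B Ps" "packing_size Ps = m"
    and iso: "\<And>Qs. perfect_packing {..<n} E A B Qs \<Longrightarrow> packing_size Qs = m \<Longrightarrow> edges_of Qs \<noteq> edges_of Ps \<Longrightarrow>
      (\<Sum>e\<in>edges_of Ps. rand_weight S e) < (\<Sum>e\<in>edges_of Qs. rand_weight S e)"
    using assms(2) unfolding isolated_def Let_def m_def[symmetric] by blast
  show thesis
  proof (rule that[OF Ps(1)])
    show "packing_size Ps \<le> packing_size Qs" if "perfect_packing {..<n} E A B Qs" for Qs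
      using least[OF that] Ps(2) by simp
    show "(\<Sum>e\<in>edges_of Qs. we e) > (\<Sum>e\<in>edges_of Ps. we e) \<or> edges_of Qs = edges_of Ps"
      if Qs: "perfect_packing {..<n} E A B Qs" for Qs
    proof (cases "packing_size Qs = m")
      case True
      then show ?thesis using iso[OF Qs True] weight_edges_of(1)[OF Qs] weight_edges_of(1)[OF Ps(1)] Ps(2) by auto
    next
      case False
      \<comment> \<open>A single additional edge costs \<open>Suc (length S)\<close>, more than all
        random weights together.\<close>
      then have "Suc m \<le> packing_size Qs" using least[OF Qs] by simp
      then have "Suc m * Suc (length S) \<le> packing_size Qs * Suc (length S)" by (rule mult_right_mono) simp
      moreover have "Suc m * Suc (length S) = m * Suc (length S) + Suc (length S)" by simp
      ultimately have "(\<Sum>e\<in>edges_of Qs. we e) > (\<Sum>e\<in>edges_of Ps. we e)"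
        using weight_edges_of(1)[OF Qs] weight_edges_of(1)[OF Ps(1), unfolded Ps(2)] weight_edges_of(2)[OF Ps(1)]
        by linarith
      then show ?thesis ..
    qed
  qed
qed

context
  fixes Ps j
  assumes Ps: "perfect_packing {..<n} E A B Ps"
    and j: "j = (\<Sum>e\<in>edges_of Ps. we e)"
    and unique: "\<And>Qs. perfect_packing {..<n} E A B Qs \<Longrightarrow>
       (\<Sum>e\<in>edges_of Qs. we e) > (\<Sum>e\<in>edges_of Ps. we e) \<or> edges_of Qs = edges_of Ps"
begin

text \<open>The reason for the choice of \<open>N\<close>: a packing has at most \<open>n\<close>
  edges with the constant weight \<open>Suc (length S)\<close>, and the random weights add at most
  \<open>length S\<close>.\<close>

lemma j_less: "j < N"
proof -
  have "j \<le> n * Suc (length S) + length S"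
    unfolding j weight_edges_of(1)[OF Ps] by (intro add_mono mult_right_mono weight_edges_of[OF Ps]) simp
  then show ?thesis by (simp add: N_def)
qed

text \<open>There are half as many paths as terminals. So \<open>2 ^ card Ps\<close> does not vanish
  modulo \<open>2 ^ K\<close>.\<close>

lemma card_Ps: "card Ps < K"
  using Ps pos AB(4,5) by (auto simp: perfect_packing_def K_def)

lemma evaluate_unique:
  assumes "{fst e, snd e} \<notin> edges_of Ps" shows "j \<in> set (evaluate fuel S x e)"
proof -
  interpret path_instance "{..<n}" "E - {{fst e, snd e}}" A B we by (rule instance_remove)
  have "coeff Zpoly j = (- 1) ^ (card B div 2) * 2 ^ card Ps"
  proof (rule coeff_Zpoly_unique)
    show "perfect_packing {..<n} (E - {{fst e, snd e}}) A B Ps"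
      by (rule perfect_packing_remove[OF Ps assms])
    show "(\<Sum>e\<in>edges_of Ps. we e) = j" by (simp add: j)
    show "(\<Sum>e\<in>edges_of Qs. we e) > j \<or> edges_of Qs = edges_of Ps"
      if "perfect_packing {..<n} (E - {{fst e, snd e}}) A B Qs" for Qs
      using unique[OF perfect_packing_mono[OF that Diff_subset]] by (simp add: j)
  qed
  moreover have "\<not> (2::int) ^ K dvd (- 1) ^ (card B div 2) * 2 ^ card Ps"
  proof
    assume "(2::int) ^ K dvd (- 1) ^ (card B div 2) * 2 ^ card Ps"
    then have "(2::int) ^ K dvd 2 ^ card Ps" by (cases "even (card B div 2)") simp_all
    then have "(2::int) ^ K \<le> 2 ^ card Ps" by (intro zdvd_imp_le) simp_all
    then show False using card_Ps by simp
  qed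
  ultimately have "\<not> 2 ^ K dvd coeff Zpoly j" by (simp only: not_False_eq_True)
  then show ?thesis using mem_evaluate[of j e] j_less by blast
qed

lemma evaluate_low:
  assumes "i < j" shows "i \<notin> set (evaluate fuel S x (0, 0))"
proof -
  interpret path_instance "{..<n}" "E - {{fst (0::nat, 0::nat), snd (0::nat, 0::nat)}}" A B we by (rule instance_remove)
  have "coeff Zpoly i = 0"
  proof (rule coeff_Zpoly_low)
    fix Qs assume "perfect_packing {..<n} (E - {{fst (0::nat, 0::nat), snd (0::nat, 0::nat)}}) A B Qs"
    then have "perfect_packing {..<n} E A B Qs" by (rule perfect_packing_mono) blast
    from unique[OF this] show "i < (\<Sum>e\<in>edges_of Qs. we e)" using assms j by auto
  qed
  then show ?thesis unfolding mem_evaluate by simp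
qed

text \<open>Deleting the edge destroys the lightest packing, and all others are heavier than
  \<open>j\<close>.\<close>

lemma evaluate_edge:
  assumes "{fst e, snd e} \<in> edges_of Ps" shows "j \<notin> set (evaluate fuel S x e)"
proof -
  interpret path_instance "{..<n}" "E - {{fst e, snd e}}" A B we by (rule instance_remove)
  have "coeff Zpoly j = 0"
  proof (rule coeff_Zpoly_low)
    fix Qs assume Qs: "perfect_packing {..<n} (E - {{fst e, snd e}}) A B Qs"
    have "edges_of Qs \<subseteq> E - {{fst e, snd e}}" by (rule perfect_packing_edges[OF Qs])
    then have "edges_of Qs \<noteq> edges_of Ps" using assms by blast
    then show "j < (\<Sum>e\<in>edges_of Qs. we e)" using unique[OF perfect_packing_mono[OF Qs Diff_subset]] by (simp add: j)
  qed
  then show ?thesis unfolding mem_evaluate by simp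
qed

lemma evaluate_min: "\<exists>i is. evaluate fuel S x (0, 0) = i # is \<and> list_min i is = j"
proof -
  interpret path_instance "{..<n}" E A B we by (rule instance_self)
  have "{0, 0} \<notin> edges_of Ps"
    using perfect_packing_edges[OF Ps] neighbours(2)[of 0 0] by auto
  then have mem: "j \<in> set (evaluate fuel S x (0, 0))" by (intro evaluate_unique) simp
  then obtain i is' where e: "evaluate fuel S x (0, 0) = i # is'" by (cases "evaluate fuel S x (0, 0)") auto
  have "list_min i is' = j"
  proof (rule antisym)
    show "list_min i is' \<le> j" using list_min(2) mem e by metis
    show "j \<le> list_min i is'" using list_min(1)[of i is'] evaluate_low e by (metis not_less)
  qed
  then show ?thesis using e by blast
qed

definition "Fl = map (\<lambda>u. (u, filter (\<lambda>v. {u, v} \<in> edges_of Ps) (sorted_list_of_set {v. {u, v} \<in> E}))) [0..<n]"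

lemma solution_adjacency_eq: "solution_adjacency fuel S x j = Fl"
proof -
  have iff: "j \<notin> set (evaluate fuel S x (u, v)) \<longleftrightarrow> {u, v} \<in> edges_of Ps" for u v
    using evaluate_unique[of "(u, v)"] evaluate_edge[of "(u, v)"] by auto
  have sx: "snd (snd x) = adjacency_lists n E" by (simp add: x_def)
  show ?thesis unfolding solution_adjacency_def iff sx length_adj zip_adj Fl_def by simp
qed

lemma Fl_neighbours:
  "set (concat (map snd (filter (\<lambda>y. fst y = u) Fl))) = {v. {u, v} \<in> edges_of Ps}"
proof -
  interpret path_instance "{..<n}" E A B we by (rule instance_self)
  have "{u, v} \<in> E \<and> u < n" if "{u, v} \<in> edges_of Ps" for v
    using perfect_packing_edges[OF Ps] that neighbours(2)[of u v] by blast
  then show ?thesis using neighbours(1) by (auto simp: Fl_def)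
qed

lemma parcs_rev:
  fixes p :: "'a list"
  shows "parcs (rev p) = (parcs p)\<inverse>"
proof -
  have *: "(v, u) \<in> parcs (rev p)" if uv: "(u, v) \<in> parcs p" for u v :: 'a and p
  proof -
    obtain i where i: "Suc i < length p" "u = p ! i" "v = p ! Suc i" using uv by (auto simp: parcs_def)
    have "rev p ! (length p - 2 - i) = v" "rev p ! Suc (length p - 2 - i) = u"
      using i by (auto simp: rev_nth Suc_diff_Suc intro!: arg_cong[where f = "(!) p"])
    moreover have "Suc (length p - 2 - i) < length (rev p)" using i by simp
    ultimately show ?thesis unfolding parcs_def by blast
  qed
  have "(u, v) \<in> parcs (rev p) \<longleftrightarrow> (v, u) \<in> parcs p" for u v
    using *[of v u p] *[of u v "rev p"] by auto
  then show ?thesis by auto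
qed

text \<open>Tracing may start at either end, so \<open>q\<close> is the path in one of its two
  directions.\<close>

lemma orient_nth:
  assumes p: "p \<in> Ps" "q = p \<or> q = rev p" and i: "i < length q"
  shows "{q ! i, y} \<in> edges_of Ps \<longleftrightarrow> Suc i < length q \<and> y = q ! Suc i \<or> (\<exists>k. i = Suc k \<and> y = q ! k)"
proof -
  interpret path_instance "{..<n}" E A B we by (rule instance_self)
  have d: "distinct q" and sq: "set q = set p" using pack_set[OF Ps p(1)] p(2) by auto
  have sym: "(u, v) \<in> parcs q \<or> (v, u) \<in> parcs q \<longleftrightarrow> (u, v) \<in> parcs p \<or> (v, u) \<in> parcs p" for u v
    using p(2) by (auto simp: parcs_rev)
  have "{q ! i, y} \<in> edges_of Ps \<longleftrightarrow> (q ! i, y) \<in> parcs q \<or> (y, q ! i) \<in> parcs q"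
    unfolding sym using edges_of_path[OF Ps p(1), of "q ! i" y] edges_of_iff[OF Ps, of "q ! i" y] p(1) i sq nth_mem by blast
  also have "(q ! i, y) \<in> parcs q \<longleftrightarrow> Suc i < length q \<and> y = q ! Suc i"
  proof
    assume "(q ! i, y) \<in> parcs q"
    then obtain k where k: "Suc k < length q" "q ! i = q ! k" "y = q ! Suc k" by (auto simp: parcs_def)
    then have "i = k" using nth_eq_iff_index_eq[OF d i, of k] by simp
    then show "Suc i < length q \<and> y = q ! Suc i" using k by simp
  qed (auto simp: parcs_def)
  also have "(y, q ! i) \<in> parcs q \<longleftrightarrow> (\<exists>k. i = Suc k \<and> y = q ! k)"
  proof
    assume "(y, q ! i) \<in> parcs q"
    then obtain k where k: "Suc k < length q" "q ! i = q ! Suc k" "y = q ! k" by (auto simp: parcs_def)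
    then have "i = Suc k" using nth_eq_iff_index_eq[OF d i, of "Suc k"] by simp
    then show "\<exists>k. i = Suc k \<and> y = q ! k" using k by simp
  qed (use i in \<open>auto simp: parcs_def\<close>)
  finally show ?thesis .
qed

text \<open>The predecessor belongs to the visited prefix, so the only new neighbour is the
  successor; at the last node the state stays as it is.\<close>

lemma trace_step_path:
  assumes p: "p \<in> Ps" "q = p \<or> q = rev p" and i: "i < length q"
  shows "trace_step Fl (q ! i, rev (take (Suc i) q)) =
    (if Suc i < length q then (q ! Suc i, rev (take (Suc (Suc i)) q)) else (q ! i, rev (take (Suc i) q)))"
proof -
  interpret path_instance "{..<n}" E A B we by (rule instance_self)
  have d: "distinct q" using pack_set[OF Ps p(1)] p(2) by auto
  let ?l = "filter (\<lambda>v. v \<notin> set (snd (q ! i, rev (take (Suc i) q))))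
      (concat (map snd (filter (\<lambda>y. fst y = fst (q ! i, rev (take (Suc i) q))) Fl)))"
  have mem: "v \<in> set ?l \<longleftrightarrow> Suc i < length q \<and> v = q ! Suc i" for v
  proof -
    have "v \<in> set ?l \<longleftrightarrow> v \<notin> set (take (Suc i) q) \<and> {q ! i, v} \<in> edges_of Ps"
      using Fl_neighbours[of "q ! i"] by auto
    also have "\<dots> \<longleftrightarrow> v \<notin> set (take (Suc i) q) \<and> Suc i < length q \<and> v = q ! Suc i"
    proof -
      have "q ! k \<in> set (take (Suc i) q)" if "i = Suc k" for k
        using i that by (auto simp: in_set_conv_nth intro!: exI[of _ k])
      then show ?thesis unfolding orient_nth[OF p i] by blast
    qed
    also have "\<dots> \<longleftrightarrow> Suc i < length q \<and> v = q ! Suc i"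
      using d by (auto simp: in_set_conv_nth nth_eq_iff_index_eq)
    finally show ?thesis .
  qed
  show ?thesis
  proof (cases "Suc i < length q")
    case True
    then have "?l \<noteq> []" using mem[of "q ! Suc i"] by (metis empty_iff list.set(1))
    then obtain a as where l: "?l = a # as" by (meson list.exhaust)
    then have "a = q ! Suc i" using mem[of a] by (metis list.set_intros(1))
    then show ?thesis using True l unfolding trace_step_def by (simp add: take_Suc_conv_app_nth)
  next
    case False
    then have "?l = []" using mem by (metis last_in_set)
    then show ?thesis using False unfolding trace_step_def by simp
  qed
qed

text \<open>\<open>Fl\<close> has \<open>n\<close> entries and a path has at most \<open>n\<close>
  nodes, so the iteration reaches the end and rests there.\<close>

lemma trace_path:
  assumes p: "p \<in> Ps" "q = p \<or> q = rev p"
  shows "trace Fl (hd q) = (last q, rev q)"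
proof -
  interpret path_instance "{..<n}" E A B we by (rule instance_self)
  have q: "q \<noteq> []" "distinct q" "set q \<subseteq> {..<n}" using pack_set[OF Ps p(1)] p(2) by auto
  have step: "foldl (\<lambda>st x. trace_step Fl st) (q ! i, rev (take (Suc i) q)) l =
      (q ! min (i + length l) (length q - 1), rev (take (Suc (min (i + length l) (length q - 1))) q))"
    if "i < length q" for i and l :: "(nat \<times> nat list) list"
    using that
  proof (induction l arbitrary: i)
    case Nil
    then have "min i (length q - 1) = i" by simp
    then show ?case by simp
  next
    case (Cons a l)
    show ?case
    proof (cases "Suc i < length q")
      case True
      then show ?thesis using Cons.IH[of "Suc i"] by (simp add: trace_step_path[OF p Cons.prems])
    next
      case False
      then have "min (i + length l) (length q - 1) = min (i + length (a # l)) (length q - 1)"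
        using Cons.prems by simp
      moreover have "trace_step Fl (q ! i, rev (take (Suc i) q)) = (q ! i, rev (take (Suc i) q))"
        using trace_step_path[OF p Cons.prems] False by simp
      ultimately show ?thesis using Cons.IH[OF Cons.prems] by (simp only: foldl_Cons)
    qed
  qed
  have "length q = card (set q)" using q(2) by (simp add: distinct_card)
  also have "\<dots> \<le> n" using card_mono[OF _ q(3)] by simp
  finally have len: "length q \<le> length Fl" by (simp add: Fl_def)
  have h: "(hd q, [hd q]) = (q ! 0, rev (take (Suc 0) q))" using q(1) by (cases q) simp_all
  have "min (0 + length Fl) (length q - 1) = length q - 1" using len by simp
  then show ?thesis using step[of 0 Fl] q(1) unfolding trace_def h by (simp add: last_conv_nth)
qed

lemma T_path_rev: "T_path V E X p \<Longrightarrow> T_path V E X (rev p)"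
  unfolding T_path_def graph_path_def by (auto simp: hd_rev last_rev insert_commute)

lemma solution_correct:
  assumes min: "\<And>Qs. perfect_packing {..<n} E A B Qs \<Longrightarrow> packing_size Ps \<le> packing_size Qs"
  shows "correct_answer {..<n} E A B (Some (trace_paths Fl Ts))"
proof -
  interpret path_instance "{..<n}" E A B we by (rule instance_self)
  \<comment> \<open>A path is kept when traced from its larger end, and tracing reverses it; the
    listed version therefore starts at its smaller end.\<close>
  define f where "f p = (if last p < hd p then rev p else p)" for p :: "nat list"
  have hl: "hd p \<noteq> last p" "p \<noteq> []" if "p \<in> Ps" for p using pack_path[OF Ps that] pack_set[OF Ps that] by blast+
  have tr: "trace Fl (hd p) = (last p, rev p)" "trace Fl (last p) = (hd p, p)" if "p \<in> Ps" for p
    using trace_path[OF that, of p] trace_path[OF that, of "rev p"] hl[OF that] by (simp_all add: hd_rev last_rev)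
  have set: "set (trace_paths Fl Ts) = f ` Ps"
  proof
    show "set (trace_paths Fl Ts) \<subseteq> f ` Ps"
    proof
      fix r assume "r \<in> set (trace_paths Fl Ts)"
      then obtain t where t: "t \<in> A \<union> B" "fst (trace Fl t) < t" "r = snd (trace Fl t)"
        using Ts(1) unfolding trace_paths_def by auto
      then obtain p where p: "p \<in> Ps" "t = hd p \<or> t = last p" using pack_ends[OF Ps, of t] by blast
      then have "r = f p" using t tr[OF p(1)] by (auto simp: f_def)
      then show "r \<in> f ` Ps" using p by blast
    qed
    show "f ` Ps \<subseteq> set (trace_paths Fl Ts)"
    proof
      fix r assume "r \<in> f ` Ps"
      then obtain p where p: "p \<in> Ps" "r = f p" by blast
      have ends: "hd p \<in> set Ts" "last p \<in> set Ts" unfolding Ts(1) using pack_ends[OF Ps] p(1) by blast+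
      show "r \<in> set (trace_paths Fl Ts)"
      proof (cases "last p < hd p")
        case True
        then show ?thesis using ends(1) p tr[OF p(1)] unfolding trace_paths_def
          by (auto simp: f_def image_iff intro!: bexI[of _ "hd p"])
      next
        case False
        then have "hd p < last p" using hl[OF p(1)] by simp
        then show ?thesis using ends(2) p tr[OF p(1)] False unfolding trace_paths_def
          by (auto simp: f_def image_iff intro!: bexI[of _ "last p"])
      qed
    qed
  qed
  have distinct: "distinct (trace_paths Fl Ts)"
  proof -
    have L: "t = last (snd (trace Fl t))" if t: "t \<in> set Ts" for t
    proof -
      obtain p where p: "p \<in> Ps" "t = hd p \<or> t = last p" using pack_ends[OF Ps, of t] t Ts(1) by blast
      then show ?thesis using tr[OF p(1)] hl[OF p(1)] by (auto simp: last_rev)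
    qed
    have inj: "inj_on (\<lambda>t. snd (trace Fl t)) (set Ts)"
    proof (rule inj_onI)
      fix a b assume ab: "a \<in> set Ts" "b \<in> set Ts" and e: "snd (trace Fl a) = snd (trace Fl b)"
      show "a = b" using L[OF ab(1)] L[OF ab(2)] unfolding e by simp
    qed
    then show ?thesis
      unfolding trace_paths_def distinct_map
      using inj_on_subset[OF inj filter_is_subset] distinct_filter[OF Ts(2)] by blast
  qed
  have sf: "set (f p) = set p" for p by (simp add: f_def)
  have inj: "inj_on f Ps"
  proof (rule inj_onI)
    fix p q assume pq: "p \<in> Ps" "q \<in> Ps" "f p = f q"
    have "hd p \<in> set p" using pack_set[OF Ps pq(1)] by blast
    moreover have "set p = set q" using sf pq(3) by metis
    ultimately show "p = q" using pack_eq[OF Ps pq(1,2)] by blast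
  qed
  have "perfect_packing {..<n} E A B (f ` Ps)"
    unfolding perfect_packing_def
  proof (intro conjI ballI)
    show "finite (f ` Ps)" using pack_finite[OF Ps] by simp
    show "T_path {..<n} E A r \<or> T_path {..<n} E B r" if "r \<in> f ` Ps" for r
      using that Ps T_path_rev unfolding perfect_packing_def f_def by auto
    show "pairwise (\<lambda>p q. disjnt (set p) (set q)) (f ` Ps)"
      using Ps unfolding perfect_packing_def pairwise_def by (auto simp: sf)
    show "card (f ` Ps) = card A div 2 + card B div 2"
      using Ps card_image[OF inj] by (simp add: perfect_packing_def)
  qed
  moreover have "packing_size (f ` Ps) = packing_size Ps"
    unfolding packing_size_def sum.reindex[OF inj] by (intro sum.cong refl) (simp add: f_def path_length_def)
  ultimately show ?thesis
    using distinct set min by (auto simp: correct_answer_def shortest_perfect_packing_def is_arg_min_linorder)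
qed

end

text \<open>A wrong answer can arise only from weights that fail to isolate a packing. If no packing
  exists, all coefficients vanish whatever the weights are.\<close>

lemma solve_correct:
  assumes "(\<exists>Ps. perfect_packing {..<n} E A B Ps) \<Longrightarrow> isolated"
  shows "correct_answer {..<n} E A B (solve fuel S x)"
proof (cases "\<exists>Ps. perfect_packing {..<n} E A B Ps")
  case False
  then show ?thesis by (simp add: solve_def evaluate_no_packing correct_answer_def)
next
  case True
  then obtain Ps0 where "perfect_packing {..<n} E A B Ps0" by blast
  from isolated_packing[OF this assms[OF True]] obtain Ps where Ps: "perfect_packing {..<n} E A B Ps"
    "\<And>Qs. perfect_packing {..<n} E A B Qs \<Longrightarrow> packing_size Ps \<le> packing_size Qs"
    "\<And>Qs. perfect_packing {..<n} E A B Qs \<Longrightarrow>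
       (\<Sum>e\<in>edges_of Qs. we e) > (\<Sum>e\<in>edges_of Ps. we e) \<or> edges_of Qs = edges_of Ps"
    by blast
  obtain i is' where ev: "evaluate fuel S x (0, 0) = i # is'" "list_min i is' = (\<Sum>e\<in>edges_of Ps. we e)"
    using evaluate_min[OF Ps(1) refl Ps(3)] by blast
  have "solve fuel S x = Some (trace_paths (Fl Ps) Ts)"
  proof -
    have "fst x @ fst (snd x) = Ts" by (simp add: x_def)
    then show ?thesis using ev solution_adjacency_eq[OF Ps(1) refl Ps(3)] by (simp add: solve_def)
  qed
  then show ?thesis using solution_correct[OF Ps(1) refl Ps(3) Ps(2)] by simp
qed

end

section \<open>Running time\<close>

lemma ptime_zip [ptime_intros]:
  assumes "ptime D xs" "ptime D ys" shows "ptime D (\<lambda>a. zip (xs a) (ys a))"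
proof -
  let ?G = "\<lambda>st y. case snd st of [] \<Rightarrow> st | x # xs \<Rightarrow> (fst st @ [(x, y)], xs)"
  have "foldl ?G (acc, us) vs = (acc @ zip us vs, drop (length vs) us)" for acc :: "('b \<times> 'c) list" and us vs
    by (induction vs arbitrary: acc us) (auto split: list.splits simp: zip_Cons1 drop_Suc)
  then have eq: "fst (foldl ?G ([], us) vs) = zip us vs" for us :: "'b list" and vs :: "'c list" by simp
  have pb: "pbounded D (\<lambda>a. Suc (Suc (sz (ys a))))"
    using pbounded_add[OF pbounded_const[of _ 2] ptime_pbounded[OF assms(2)]] by simp
  have "ptime D (\<lambda>a. foldl ?G ([], xs a) (ys a))"
  proof (rule ptime_foldl_additive[OF _ _ _ pb])
    fix a and y :: "('b \<times> 'c) list \<times> 'b list" and x assume "x \<in> set (ys a)"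
    then show "sz (?G y x) \<le> sz y + Suc (Suc (sz (ys a)))"
      using sz_elem[of x "ys a"] by (cases y; cases "snd y") auto
  qed (intro ptime_intros assms)+
  then have "ptime D (\<lambda>a. fst (foldl ?G ([], xs a) (ys a)))" by (rule ptime_fst)
  then show ?thesis unfolding eq .
qed

text \<open>A function of several arguments is first treated on the tuple of its arguments and then
  composed with programs for these. In this way later proofs do not unfold it again.\<close>

lemma ptime_pmul_base: "ptime UNIV (\<lambda>a. pmul (fst a) (snd a))"
  unfolding pmul_def by (intro ptime_intros)

lemma ptime_pmul [ptime_intros]:
  assumes "ptime D f1" "ptime D f2"
  shows "ptime D (\<lambda>a. pmul (f1 a) (f2 a))"
proof -
  have "ptime D (\<lambda>a. (\<lambda>a. pmul (fst a) (snd a)) (f1 a, f2 a))"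
    by (rule ptime_comp[OF ptime_Pair[OF assms(1) assms(2)] ptime_pmul_base]) (simp)
  then show ?thesis by simp
qed

lemma ptime_pnorm_base: "ptime UNIV (\<lambda>a. pnorm (fst a) (fst (snd a)) (snd (snd a)))"
  unfolding pnorm_def by (intro ptime_intros)

lemma ptime_pnorm [ptime_intros]:
  assumes "ptime D f1" "ptime D f2" "ptime D f3"
  shows "ptime D (\<lambda>a. pnorm (f1 a) (f2 a) (f3 a))"
proof -
  have "ptime D (\<lambda>a. (\<lambda>a. pnorm (fst a) (fst (snd a)) (snd (snd a))) (f1 a, (f2 a, (f3 a))))"
    by (rule ptime_comp[OF ptime_Pair[OF assms(1) ptime_Pair[OF assms(2) assms(3)]] ptime_pnorm_base]) (simp)
  then show ?thesis by simp
qed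

lemma ptime_look_base: "ptime UNIV (\<lambda>a. look (fst a) (snd a))"
  unfolding look_def by (intro ptime_intros)

lemma ptime_look [ptime_intros]:
  assumes "ptime D f1" "ptime D f2"
  shows "ptime D (\<lambda>a. look (f1 a) (f2 a))"
proof -
  have "ptime D (\<lambda>a. (\<lambda>a. look (fst a) (snd a)) (f1 a, f2 a))"
    by (rule ptime_comp[OF ptime_Pair[OF assms(1) assms(2)] ptime_look_base]) (simp)
  then show ?thesis by simp
qed

lemma ptime_rscale_base: "ptime UNIV (\<lambda>a. rscale (fst a) (snd a))"
  unfolding rscale_def by (intro ptime_intros)

lemma ptime_rscale [ptime_intros]:
  assumes "ptime D f1" "ptime D f2"
  shows "ptime D (\<lambda>a. rscale (f1 a) (f2 a))"
proof -
  have "ptime D (\<lambda>a. (\<lambda>a. rscale (fst a) (snd a)) (f1 a, f2 a))"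
    by (rule ptime_comp[OF ptime_Pair[OF assms(1) assms(2)] ptime_rscale_base]) (simp)
  then show ?thesis by simp
qed

lemma ptime_pneg1 [ptime_intros]: "ptime D f \<Longrightarrow> ptime D (\<lambda>a. pneg1 (f a))"
  unfolding pneg1_def by (intro ptime_intros)

lemma ptime_rnorm_base: "ptime UNIV (\<lambda>a. rnorm (fst a) (fst (snd a)) (fst (snd (snd a))) (snd (snd (snd a))))"
  unfolding rnorm_def by (intro ptime_intros)

lemma ptime_rnorm [ptime_intros]:
  assumes "ptime D f1" "ptime D f2" "ptime D f3" "ptime D f4"
  shows "ptime D (\<lambda>a. rnorm (f1 a) (f2 a) (f3 a) (f4 a))"
proof -
  have "ptime D (\<lambda>a. (\<lambda>a. rnorm (fst a) (fst (snd a)) (fst (snd (snd a))) (snd (snd (snd a)))) (f1 a, (f2 a, (f3 a, (f4 a)))))"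
    by (rule ptime_comp[OF ptime_Pair[OF assms(1) ptime_Pair[OF assms(2) ptime_Pair[OF assms(3) assms(4)]]] ptime_rnorm_base]) (simp)
  then show ?thesis by simp
qed

lemma length_pnorm: "M > 0 \<Longrightarrow> length (pnorm N M p) \<le> N * M"
proof -
  assume M: "M > 0"
  have "length (pnorm N M p) = (\<Sum>e\<leftarrow>[0..<N]. length (filter (\<lambda>x. x = e) p) mod M)"
    by (simp add: pnorm_def length_concat o_def)
  also have "\<dots> \<le> (\<Sum>e\<leftarrow>[0..<N]. M)" using M by (intro sum_list_mono) (simp add: less_imp_le)
  finally show ?thesis by (simp add: sum_list_triv)
qed

lemma sz_pnorm: "M > 0 \<Longrightarrow> sz (pnorm N M p) \<le> N * M * Suc N"
proof -
  assume M: "M > 0"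
  have "sz (pnorm N M p) \<le> length (pnorm N M p) * Suc N"
    by (rule sz_list_le) (auto simp: pnorm_def)
  also have "\<dots> \<le> N * M * Suc N" by (rule mult_right_mono[OF length_pnorm[OF M]]) simp
  finally show ?thesis .
qed

text \<open>Every accumulator after the first is a normal form and thus bounded in terms of
  \<open>N\<close> and \<open>M\<close>. The domain demands \<open>M > 0\<close>, as reduction
  modulo 0 would leave coefficients unbounded.\<close>

lemma ptime_pinv_base: "ptime {a. 0 < fst (snd a)} (\<lambda>a. pinv (fst a) (fst (snd a)) (snd (snd a)))"
proof -
  let ?G = "\<lambda>(a :: nat \<times> nat \<times> nat list) acc i. pnorm (fst a) (fst (snd a)) (0 # pmul (pnorm (fst a) (fst (snd a)) (0 # pmul (pneg1 (fst (snd a))) (snd (snd a)))) acc)"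
  let ?b = "\<lambda>a :: nat \<times> nat \<times> nat list. sz a * sz a * (sz a + 1) + 1"
  have "ptime {a. 0 < fst (snd a)} (\<lambda>a. foldl (?G a) [0] [0..<fst a + fst (snd a)])"
  proof (rule ptime_foldl[where b = ?b])
    show "pbounded {a. 0 < fst (snd a)} ?b" by (intro pbounded_intros)
    fix a :: "nat \<times> nat \<times> nat list" and i assume a: "a \<in> {a. 0 < fst (snd a)}" and i: "i \<le> length [0..<fst a + fst (snd a)]"
    show "sz (foldl (?G a) [0] (take i [0..<fst a + fst (snd a)])) \<le> ?b a"
    proof (cases i)
      case 0
      then show ?thesis by simp
    next
      case (Suc k)
      then have k: "k < length [0..<fst a + fst (snd a)]" using i by simp
      have "sz (pnorm (fst a) (fst (snd a)) p) \<le> ?b a" for p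
      proof -
        have "sz (pnorm (fst a) (fst (snd a)) p) \<le> fst a * fst (snd a) * Suc (fst a)" using a by (intro sz_pnorm) simp
        also have "\<dots> \<le> sz a * sz a * (sz a + 1)" by (cases a) (intro mult_mono, auto)
        finally show ?thesis by simp
      qed
      then show ?thesis unfolding Suc nth_in_foldl_take[OF k] .
    qed
  qed (intro ptime_intros)+
  then show ?thesis by (simp add: pinv_def)
qed

lemma ptime_pinv [ptime_intros]:
  assumes "ptime D f1" "ptime D f2" "ptime D f3" "\<And>a. a \<in> D \<Longrightarrow> f2 a > 0"
  shows "ptime D (\<lambda>a. pinv (f1 a) (f2 a) (f3 a))"
proof -
  have "ptime D (\<lambda>a. (\<lambda>a. pinv (fst a) (fst (snd a)) (snd (snd a))) (f1 a, (f2 a, (f3 a))))"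
    by (rule ptime_comp[OF ptime_Pair[OF assms(1) ptime_Pair[OF assms(2) assms(3)]] ptime_pinv_base]) (use assms(4) in simp)
  then show ?thesis by simp
qed

lemma ptime_dup_items_base: "ptime UNIV (\<lambda>a. dup_items (fst a) (fst (snd a)) (fst (snd (snd a))) (fst (snd (snd (snd a)))) (fst (snd (snd (snd (snd a))))) (fst (snd (snd (snd (snd (snd a)))))) (fst (snd (snd (snd (snd (snd (snd a))))))) (snd (snd (snd (snd (snd (snd (snd a))))))))"
  unfolding dup_items_def by (intro ptime_intros)

lemma ptime_dup_items [ptime_intros]:
  assumes "ptime D f1" "ptime D f2" "ptime D f3" "ptime D f4" "ptime D f5" "ptime D f6" "ptime D f7" "ptime D f8"
  shows "ptime D (\<lambda>a. dup_items (f1 a) (f2 a) (f3 a) (f4 a) (f5 a) (f6 a) (f7 a) (f8 a))"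
proof -
  have "ptime D (\<lambda>a. (\<lambda>a. dup_items (fst a) (fst (snd a)) (fst (snd (snd a))) (fst (snd (snd (snd a)))) (fst (snd (snd (snd (snd a))))) (fst (snd (snd (snd (snd (snd a)))))) (fst (snd (snd (snd (snd (snd (snd a))))))) (snd (snd (snd (snd (snd (snd (snd a)))))))) (f1 a, (f2 a, (f3 a, (f4 a, (f5 a, (f6 a, (f7 a, (f8 a)))))))))"
    by (rule ptime_comp[OF ptime_Pair[OF assms(1) ptime_Pair[OF assms(2) ptime_Pair[OF assms(3) ptime_Pair[OF assms(4) ptime_Pair[OF assms(5) ptime_Pair[OF assms(6) ptime_Pair[OF assms(7) assms(8)]]]]]]] ptime_dup_items_base]) (simp)
  then show ?thesis by simp
qed

lemma ptime_elim_step_base: "ptime UNIV (\<lambda>a. elim_step (fst a) (fst (snd a)) (fst (snd (snd a))) (fst (snd (snd (snd a)))) (fst (snd (snd (snd (snd a))))) (fst (snd (snd (snd (snd (snd a)))))) (fst (snd (snd (snd (snd (snd (snd a))))))) (fst (snd (snd (snd (snd (snd (snd (snd a)))))))) (fst (snd (snd (snd (snd (snd (snd (snd (snd a))))))))) (snd (snd (snd (snd (snd (snd (snd (snd (snd a))))))))))"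
  unfolding elim_step_def by (intro ptime_intros)

lemma ptime_elim_step [ptime_intros]:
  assumes "ptime D f1" "ptime D f2" "ptime D f3" "ptime D f4" "ptime D f5" "ptime D f6" "ptime D f7" "ptime D f8" "ptime D f9" "ptime D f10"
  shows "ptime D (\<lambda>a. elim_step (f1 a) (f2 a) (f3 a) (f4 a) (f5 a) (f6 a) (f7 a) (f8 a) (f9 a) (f10 a))"
proof -
  have "ptime D (\<lambda>a. (\<lambda>a. elim_step (fst a) (fst (snd a)) (fst (snd (snd a))) (fst (snd (snd (snd a)))) (fst (snd (snd (snd (snd a))))) (fst (snd (snd (snd (snd (snd a)))))) (fst (snd (snd (snd (snd (snd (snd a))))))) (fst (snd (snd (snd (snd (snd (snd (snd a)))))))) (fst (snd (snd (snd (snd (snd (snd (snd (snd a))))))))) (snd (snd (snd (snd (snd (snd (snd (snd (snd a)))))))))) (f1 a, (f2 a, (f3 a, (f4 a, (f5 a, (f6 a, (f7 a, (f8 a, (f9 a, (f10 a)))))))))))"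
    by (rule ptime_comp[OF ptime_Pair[OF assms(1) ptime_Pair[OF assms(2) ptime_Pair[OF assms(3) ptime_Pair[OF assms(4) ptime_Pair[OF assms(5) ptime_Pair[OF assms(6) ptime_Pair[OF assms(7) ptime_Pair[OF assms(8) ptime_Pair[OF assms(9) assms(10)]]]]]]]]] ptime_elim_step_base]) (simp)
  then show ?thesis by simp
qed

lemma ptime_laplace_base: "ptime UNIV (\<lambda>a. laplace (fst a) (fst (snd a)) (fst (snd (snd a))) (fst (snd (snd (snd a)))) (snd (snd (snd (snd a)))))"
  unfolding laplace_def by (intro ptime_intros)

lemma ptime_laplace [ptime_intros]:
  assumes "ptime D f1" "ptime D f2" "ptime D f3" "ptime D f4" "ptime D f5"
  shows "ptime D (\<lambda>a. laplace (f1 a) (f2 a) (f3 a) (f4 a) (f5 a))"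
proof -
  have "ptime D (\<lambda>a. (\<lambda>a. laplace (fst a) (fst (snd a)) (fst (snd (snd a))) (fst (snd (snd (snd a)))) (snd (snd (snd (snd a))))) (f1 a, (f2 a, (f3 a, (f4 a, (f5 a))))))"
    by (rule ptime_comp[OF ptime_Pair[OF assms(1) ptime_Pair[OF assms(2) ptime_Pair[OF assms(3) ptime_Pair[OF assms(4) assms(5)]]]] ptime_laplace_base]) (simp)
  then show ?thesis by simp
qed

lemma ptime_leaf [ptime_intros]: "ptime D f \<Longrightarrow> ptime D (\<lambda>a. leaf (f a))"
  unfolding leaf_def by (intro ptime_intros)

section \<open>Size invariants of the elimination\<close>

definition small_row :: "nat \<Rightarrow> nat \<times> row \<Rightarrow> bool" where
  "small_row c x \<longleftrightarrow> fst x \<le> c \<and> sz (snd x) \<le> c"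

text \<open>Two bounds are kept apart so that the invariant reproduces itself. Lists of columns only
  shrink and keep the bound \<open>k\<close>; new weights and rows are normal forms, whose sizes are
  bounded by \<open>c\<close> in terms of \<open>N\<close>, \<open>M\<close> and
  \<open>k\<close>.\<close>

definition small :: "nat \<Rightarrow> nat \<Rightarrow> item \<Rightarrow> bool" where
  "small k c it \<longleftrightarrow> fst it \<le> c \<and> sz (fst (snd it)) \<le> c \<and> sz (fst (snd (snd it))) \<le> k \<and>
     length (snd (snd (snd it))) \<le> c \<and> (\<forall>x\<in>set (snd (snd (snd it))). small_row c x)"

lemma sz_filter: "sz (filter P xs) \<le> sz xs"
  by (induction xs) auto

lemma sz_rnorm:
  assumes "M > 0" "sz C \<le> k"
  shows "sz (rnorm N M C r) \<le> k * (N * M) * (k + N + 2)"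
proof -
  have "length (rnorm N M C r) = (\<Sum>c\<leftarrow>C. length (pnorm N M (look r c)))"
    by (simp add: rnorm_def length_concat o_def)
  also have "\<dots> \<le> (\<Sum>c\<leftarrow>C. N * M)" by (intro sum_list_mono length_pnorm assms(1))
  also have "\<dots> \<le> k * (N * M)"
    using assms(2) length_le_sz[of C] by (auto simp: sum_list_triv intro!: mult_right_mono)
  finally have len: "length (rnorm N M C r) \<le> k * (N * M)" .
  have "sz x \<le> k + N + 1" if x: "x \<in> set (rnorm N M C r)" for x
  proof -
    obtain c e where ce: "c \<in> set C" "e \<in> set (pnorm N M (look r c))" "x = (c, e)"
      using x unfolding rnorm_def by auto
    have "c < k" using sz_elem[OF ce(1)] assms(2) by simp
    moreover have "e < N" using ce(2) unfolding pnorm_def by auto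
    ultimately show ?thesis unfolding ce(3) by simp
  qed
  then have "sz (rnorm N M C r) \<le> length (rnorm N M C r) * Suc (k + N + 1)" by (rule sz_list_le)
  also have "\<dots> \<le> k * (N * M) * Suc (k + N + 1)" using len by (rule mult_right_mono) simp
  finally show ?thesis by simp
qed

lemma sz_rows:
  assumes "length rws \<le> c" "\<forall>x\<in>set rws. small_row c x"
  shows "sz rws \<le> c * (2 * c + 2)"
proof -
  have "sz x \<le> 2 * c + 1" if "x \<in> set rws" for x
    using assms(2) that by (cases x) (auto simp: small_row_def)
  then have "sz rws \<le> length rws * Suc (2 * c + 1)" by (rule sz_list_le)
  also have "\<dots> \<le> c * Suc (2 * c + 1)" using assms(1) by (rule mult_right_mono) simp
  finally show ?thesis by simp
qed

lemma sz_small: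
  assumes "small k c it" "k \<le> c"
  shows "sz it \<le> 2 * (c + 2) ^ 2"
proof -
  obtain l w C rws where it: "it = (l, w, C, rws)" by (metis prod.collapse)
  have "sz rws \<le> c * (2 * c + 2)" using assms(1) by (intro sz_rows) (auto simp: small_def it)
  then have "sz it \<le> 3 + 3 * c + c * (2 * c + 2)" using assms by (simp add: small_def it)
  also have "\<dots> \<le> 2 * (c + 2) ^ 2" by (simp add: power2_eq_square algebra_simps)
  finally show ?thesis .
qed

text \<open>The inequalities for \<open>c\<close> are the size bounds for the normal forms of
  polynomials and of rows.\<close>

locale size_bounds =
  fixes N M k c :: nat
  assumes M: "M > 0" and k: "k \<le> c" and c: "N * M * Suc N \<le> c" "k * (N * M) * (k + N + 2) \<le> c"
begin

lemma small_dup_items: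
  assumes "l \<le> c" "sz C \<le> k" "length rws \<le> c" "\<forall>x\<in>set rws. small_row c x"
    "it \<in> set (dup_items N M r l w k' C rws)"
  shows "small k c it"
proof -
  obtain p q e where it: "it = (l - Suc 0, pnorm N M e, filter (\<lambda>c. c \<noteq> p \<and> c \<noteq> q) C, rws)"
    using assms(5) by (auto simp: dup_items_def split: if_splits)
  have "sz (pnorm N M e) \<le> c" using sz_pnorm[OF M] c(1) by (rule order_trans)
  moreover have "sz (filter (\<lambda>c. c \<noteq> p \<and> c \<noteq> q) C) \<le> k" using sz_filter assms(2) by (rule order_trans)
  ultimately show ?thesis using assms(1,3,4) by (simp add: it small_def)
qed

lemma foldl_elim_step_small:
  assumes "l \<le> c" "sz C \<le> k" "length D + length T \<le> c" "length xs \<le> length T"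
    "\<forall>x\<in>set D \<union> set T \<union> set xs. small_row c x" "\<forall>it\<in>set Es. small k c it"
  shows "\<exists>D' T' E'. foldl (elim_step N M v r u l w C) ((D, T), Es) xs = ((D', T'), E') \<and>
     length D' + length T' \<le> c \<and> (\<forall>x\<in>set D' \<union> set T'. small_row c x) \<and> (\<forall>it\<in>set E'. small k c it) \<and>
     length E' \<le> length Es + length xs * k ^ 2"
  using assms
proof (induction xs arbitrary: D T Es)
  case (Cons x xs)
  obtain t T' where T: "T = t # T'" using Cons.prems(4) by (cases T) auto
  define k' where "k' = pnorm N M (pmul (look (snd x) v) u)"
  define x' where "x' = (fst x, rnorm N M C (snd x @ rscale (pmul (pneg1 M) k') r))"
  define E1 where "E1 = (if l = 0 then Es else Es @ dup_items N M r l w k' C (D @ T'))"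
  have step: "elim_step N M v r u l w C ((D, T), Es) x = ((D @ [x'], T'), E1)"
    by (simp add: elim_step_def T k'_def x'_def E1_def)
  have x': "small_row c x'"
    using order_trans[OF sz_rnorm[OF M Cons.prems(2)] c(2)] Cons.prems(5) by (simp add: x'_def small_row_def)
  have E1: "\<forall>it\<in>set E1. small k c it"
  proof
    fix it assume "it \<in> set E1"
    then consider "it \<in> set Es" | "it \<in> set (dup_items N M r l w k' C (D @ T'))"
      unfolding E1_def by (auto split: if_splits)
    then show "small k c it"
    proof cases
      case 2
      then show ?thesis using Cons.prems(3,5) by (intro small_dup_items[OF Cons.prems(1,2) _ _ 2]) (auto simp: T)
    qed (use Cons.prems(6) in blast)
  qed
  have "length C ^ 2 \<le> k ^ 2" using order_trans[OF length_le_sz Cons.prems(2)] by (rule power_mono) simp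
  then have lenE: "length E1 \<le> length Es + k ^ 2" using order_trans[OF length_dup_items, of C] by (simp add: E1_def)
  obtain D' T'' E' where IH: "foldl (elim_step N M v r u l w C) ((D @ [x'], T'), E1) xs = ((D', T''), E')"
     "length D' + length T'' \<le> c" "\<forall>x\<in>set D' \<union> set T''. small_row c x" "\<forall>it\<in>set E'. small k c it"
     "length E' \<le> length E1 + length xs * k ^ 2"
    using Cons.IH[of "D @ [x']" T' E1] Cons.prems x' E1 unfolding T by auto
  show ?case
    using IH lenE by (intro exI[of _ D'] exI[of _ T''] exI[of _ E']) (simp add: step)
qed auto

lemma small_pivot:
  assumes it: "small k c it" and x: "it' \<in> set (pivot N M it x)"
  shows "small k c it'"
proof -
  let ?R = "filter (\<lambda>y. fst y \<noteq> fst x) (snd (snd (snd it)))"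
  let ?f = "foldl (elim_step N M (fst x) (snd x) (pinv N M (look (snd x) (fst x))) (fst it) (fst (snd it)) (fst (snd (snd it))))
            (([], ?R), []) ?R"
  have R: "length ?R \<le> c" "\<forall>x\<in>set ?R. small_row c x"
    using it order_trans[OF length_filter_le, of "snd (snd (snd it))" c] by (auto simp: small_def)
  have "\<exists>D' T' E'. ?f = ((D', T'), E') \<and>
     length D' + length T' \<le> c \<and> (\<forall>x\<in>set D' \<union> set T'. small_row c x) \<and> (\<forall>it\<in>set E'. small k c it) \<and>
     length E' \<le> length ([] :: item list) + length ?R * k ^ 2"
    by (rule foldl_elim_step_small) (use it R in \<open>auto simp: small_def\<close>)
  then obtain D' T' E' where f: "?f = ((D', T'), E')" "length D' + length T' \<le> c"
    "\<forall>x\<in>set D' \<union> set T'. small_row c x" "\<forall>it\<in>set E'. small k c it" by blast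
  have "it' = (fst it, pnorm N M (pmul (fst (snd it)) (look (snd x) (fst x))),
        filter (\<lambda>c. c \<noteq> fst x) (fst (snd (snd it))), D') \<or> it' \<in> set E'"
    using x unfolding pivot_def f(1) by simp
  then show ?thesis
  proof
    assume "it' = (fst it, pnorm N M (pmul (fst (snd it)) (look (snd x) (fst x))),
        filter (\<lambda>c. c \<noteq> fst x) (fst (snd (snd it))), D')"
    then show ?thesis
      using it f(2,3) order_trans[OF sz_pnorm[OF M] c(1)] le_trans[OF sz_filter[of _ "fst (snd (snd it))"], of k] by (simp add: small_def)
  qed (use f(4) in blast)
qed

lemma small_expand:
  assumes it: "small k c it" and x: "it' \<in> set (expand N M it)"
  shows "small k c it'"
proof (cases "snd (snd (snd it))")
  case Nil
  then show ?thesis using x by (simp add: expand_def)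
next
  case (Cons y ys)
  show ?thesis
  proof (cases "filter (\<lambda>x. fst x \<in> set (fst (snd (snd it)))) (snd (snd (snd it)))")
    case Nil
    then have "it' \<in> set (laplace N M it (snd y) ys)" using x Cons by (simp add: expand_def)
    then obtain d where "it' = (fst it, pnorm N M (pmul (fst (snd it)) (look (snd y) d)),
       filter (\<lambda>e. e \<noteq> d) (fst (snd (snd it))), ys)" by (auto simp: laplace_def)
    then show ?thesis
      using it Cons order_trans[OF sz_pnorm[OF M] c(1)] le_trans[OF sz_filter[of _ "fst (snd (snd it))"], of k] by (simp add: small_def)
  next
    case y: (Cons y' ys')
    then have "it' \<in> set (pivot N M it y')" using x Cons by (simp add: expand_def)
    then show ?thesis by (rule small_pivot[OF it])
  qed
qed

lemma small_foldl_work_step: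
  assumes "\<forall>it\<in>set (snd st). small k c it" "sz (fst st) \<le> c"
  shows "(\<forall>it\<in>set (snd (foldl (\<lambda>st u. work_step N M st) st us)). small k c it) \<and>
     sz (fst (foldl (\<lambda>st u. work_step N M st) st us)) \<le> c"
  using assms
proof (induction us arbitrary: st)
  case (Cons u us)
  have "(\<forall>it\<in>set (snd (work_step N M st)). small k c it) \<and> sz (fst (work_step N M st)) \<le> c"
  proof (cases "snd st")
    case Nil
    then show ?thesis using Cons.prems by (simp add: work_step_def)
  next
    case (Cons it its)
    have "small k c it" using Cons.prems Cons by simp
    then show ?thesis using Cons.prems Cons small_expand[of it] order_trans[OF sz_pnorm[OF M] c(1)]
      by (auto simp: work_step_def)
  qed
  then show ?case using Cons.IH[of "work_step N M st"] by simp
qed simp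

end

lemma ptime_pivot_base:
  "ptime {a. 0 < fst (snd a)} (\<lambda>a. pivot (fst a) (fst (snd a)) (fst (snd (snd a))) (snd (snd (snd a))))"
proof -
  let ?D = "{a :: nat \<times> nat \<times> item \<times> nat \<times> row. 0 < fst (snd a)}"
  let ?R = "\<lambda>a :: nat \<times> nat \<times> item \<times> nat \<times> row.
      filter (\<lambda>y. fst y \<noteq> fst (snd (snd (snd a)))) (snd (snd (snd (fst (snd (snd a))))))"
  let ?G = "\<lambda>a :: nat \<times> nat \<times> item \<times> nat \<times> row. elim_step (fst a) (fst (snd a)) (fst (snd (snd (snd a)))) (snd (snd (snd (snd a))))
      (pinv (fst a) (fst (snd a)) (look (snd (snd (snd (snd a)))) (fst (snd (snd (snd a))))))
      (fst (fst (snd (snd a)))) (fst (snd (fst (snd (snd a))))) (fst (snd (snd (fst (snd (snd a))))))"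
  \<comment> \<open>The sum of the bounds demanded by \<open>size_bounds\<close>, with
    \<open>N\<close>, \<open>M\<close> and \<open>k\<close> replaced by \<open>sz a\<close>.\<close>
  let ?c = "\<lambda>a :: nat \<times> nat \<times> item \<times> nat \<times> row. sz a + sz a * sz a * (sz a + 1) + sz a * (sz a * sz a) * (sz a + sz a + 2)"
  let ?b = "\<lambda>a. 2 + ?c a * (2 * ?c a + 2) + sz a * sz a ^ 2 * (1 + 2 * (?c a + 2) ^ 2)"
  have "ptime ?D (\<lambda>a. foldl (?G a) (([], ?R a), []) (?R a))"
  proof (rule ptime_foldl[where b = ?b])
    show "pbounded ?D ?b" by (intro pbounded_intros)
    show "ptime ?D ?R" "ptime ?D (\<lambda>a. (([], ?R a), []))" by (intro ptime_intros)+
    show "ptime {p. fst p \<in> ?D \<and> (\<exists>i<length (?R (fst p)). fst (snd p) = foldl (?G (fst p)) (([], ?R (fst p)), []) (take i (?R (fst p))) \<and>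
               snd (snd p) = ?R (fst p) ! i)} (\<lambda>p. ?G (fst p) (fst (snd p)) (snd (snd p)))"
      by (intro ptime_intros) blast
    fix a :: "nat \<times> nat \<times> item \<times> nat \<times> row" and i assume a: "a \<in> ?D" and i: "i \<le> length (?R a)"
    obtain N M l w C rws v r where ad: "a = (N, M, (l, w, C, rws), v, r)" by (metis prod.collapse)
    interpret size_bounds N M "sz a" "?c a"
    proof
      show "0 < M" using a by (simp add: ad)
      have NM: "N \<le> sz a" "M \<le> sz a" by (simp_all add: ad)
      have "N * M * Suc N \<le> sz a * sz a * (sz a + 1)" by (intro mult_mono) (use NM in auto)
      then show "N * M * Suc N \<le> ?c a" by (rule trans_le_add1[OF trans_le_add2])
      have "sz a * (N * M) * (sz a + N + 2) \<le> sz a * (sz a * sz a) * (sz a + sz a + 2)"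
        by (intro mult_mono add_mono) (use NM in auto)
      then show "sz a * (N * M) * (sz a + N + 2) \<le> ?c a" by (rule trans_le_add2)
      show "sz a \<le> ?c a" by simp
    qed
    have lrws: "length rws \<le> sz a" using length_le_sz[of rws] by (simp add: ad)
    then have "length (?R a) \<le> sz a" using order_trans[OF length_filter_le] by (simp add: ad)
    then have lenR: "length (?R a) \<le> sz a" "length (?R a) \<le> ?c a" using k by linarith+
    have rowsm: "\<forall>x\<in>set (?R a). small_row (?c a) x"
    proof
      fix x assume "x \<in> set (?R a)"
      then have "sz x < sz rws" by (intro sz_elem) (simp add: ad)
      then have "sz x \<le> sz a" by (simp add: ad)
      then have "fst x \<le> sz a \<and> sz (snd x) \<le> sz a" by (cases x) simp
      then show "small_row (?c a) x" using order_trans[OF _ k] unfolding small_row_def by blast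
    qed
    have "\<exists>D' T' E'. foldl (elim_step N M v r (pinv N M (look r v)) l w C) (([], ?R a), []) (take i (?R a)) = ((D', T'), E') \<and>
       length D' + length T' \<le> ?c a \<and> (\<forall>x\<in>set D' \<union> set T'. small_row (?c a) x) \<and> (\<forall>it\<in>set E'. small (sz a) (?c a) it) \<and>
       length E' \<le> length ([] :: item list) + length (take i (?R a)) * sz a ^ 2"
    proof (rule foldl_elim_step_small)
      have "l \<le> sz a" by (simp add: ad)
      then show "l \<le> ?c a" using k by (rule order_trans)
      show "sz C \<le> sz a" by (simp add: ad)
      show "\<forall>x\<in>set [] \<union> set (?R a) \<union> set (take i (?R a)). small_row (?c a) x"
        unfolding list.set(1) using rowsm set_take_subset[of i "?R a"] by blast
    qed (use lenR in simp_all)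
    then obtain D' T' E' where f0: "foldl (elim_step N M v r (pinv N M (look r v)) l w C) (([], ?R a), []) (take i (?R a)) = ((D', T'), E')"
      "length D' + length T' \<le> ?c a" "\<forall>x\<in>set D' \<union> set T'. small_row (?c a) x" "\<forall>it\<in>set E'. small (sz a) (?c a) it"
      "length E' \<le> length ([] :: item list) + length (take i (?R a)) * sz a ^ 2"
      by blast
    have G: "?G a = elim_step N M v r (pinv N M (look r v)) l w C" unfolding ad fst_conv snd_conv by (rule refl)
    have f: "foldl (?G a) (([], ?R a), []) (take i (?R a)) = ((D', T'), E')"
      "length (D' @ T') \<le> ?c a" "\<forall>x\<in>set (D' @ T'). small_row (?c a) x" "\<forall>it\<in>set E'. small (sz a) (?c a) it"
      "length E' \<le> length (take i (?R a)) * sz a ^ 2"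
      unfolding G length_append set_append by (rule f0(1), rule f0(2), rule f0(3), rule f0(4), rule f0(5)[unfolded list.size(3) add_0])
    have "sz (D' @ T') \<le> ?c a * (2 * ?c a + 2)" by (rule sz_rows[OF f(2,3)])
    moreover have "sz E' \<le> sz a * sz a ^ 2 * (1 + 2 * (?c a + 2) ^ 2)"
    proof -
      have "sz E' \<le> length E' * Suc (2 * (?c a + 2) ^ 2)"
        by (rule sz_list_le) (use f(4) sz_small k in blast)
      also have "\<dots> \<le> (sz a * sz a ^ 2) * Suc (2 * (?c a + 2) ^ 2)"
      proof (rule mult_right_mono)
        have "length (take i (?R a)) * sz a ^ 2 \<le> sz a * sz a ^ 2" by (rule mult_right_mono) (use lenR in simp_all)
        then show "length E' \<le> sz a * sz a ^ 2" using f(5) by linarith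
      qed simp
      finally show ?thesis by simp
    qed
    moreover have "sz ((D', T'), E') = 2 + sz (D' @ T') + sz E'" by simp
    ultimately show "sz (foldl (?G a) (([], ?R a), []) (take i (?R a))) \<le> ?b a" unfolding f(1) by linarith
  qed
  then show ?thesis unfolding pivot_def by (intro ptime_intros)
qed

lemma ptime_pivot [ptime_intros]:
  assumes "ptime D f1" "ptime D f2" "ptime D f3" "ptime D f4" "\<And>a. a \<in> D \<Longrightarrow> f2 a > 0"
  shows "ptime D (\<lambda>a. pivot (f1 a) (f2 a) (f3 a) (f4 a))"
proof -
  have "ptime D (\<lambda>a. (\<lambda>a. pivot (fst a) (fst (snd a)) (fst (snd (snd a))) (snd (snd (snd a)))) (f1 a, (f2 a, (f3 a, f4 a))))"
    by (rule ptime_comp[OF ptime_Pair[OF assms(1) ptime_Pair[OF assms(2) ptime_Pair[OF assms(3,4)]]] ptime_pivot_base])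
      (use assms(5) in simp)
  then show ?thesis by simp
qed

lemma ptime_expand_base: "ptime {a. 0 < fst (snd a)} (\<lambda>a. expand (fst a) (fst (snd a)) (snd (snd a)))"
  unfolding expand_def by (intro ptime_intros) auto

lemma ptime_expand [ptime_intros]:
  assumes "ptime D f1" "ptime D f2" "ptime D f3" "\<And>a. a \<in> D \<Longrightarrow> f2 a > 0"
  shows "ptime D (\<lambda>a. expand (f1 a) (f2 a) (f3 a))"
proof -
  have "ptime D (\<lambda>a. (\<lambda>a. expand (fst a) (fst (snd a)) (snd (snd a))) (f1 a, (f2 a, f3 a)))"
    by (rule ptime_comp[OF ptime_Pair[OF assms(1) ptime_Pair[OF assms(2,3)]] ptime_expand_base])
      (use assms(4) in simp)
  then show ?thesis by simp
qed

lemma ptime_work_step_base: "ptime {a. 0 < fst (snd a)} (\<lambda>a. work_step (fst a) (fst (snd a)) (snd (snd a)))"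
  unfolding work_step_def by (intro ptime_intros) auto

lemma ptime_work_step [ptime_intros]:
  assumes "ptime D f1" "ptime D f2" "ptime D f3" "\<And>a. a \<in> D \<Longrightarrow> f2 a > 0"
  shows "ptime D (\<lambda>a. work_step (f1 a) (f2 a) (f3 a))"
proof -
  have "ptime D (\<lambda>a. (\<lambda>a. work_step (fst a) (fst (snd a)) (snd (snd a))) (f1 a, (f2 a, f3 a)))"
    by (rule ptime_comp[OF ptime_Pair[OF assms(1) ptime_Pair[OF assms(2,3)]] ptime_work_step_base])
      (use assms(4) in simp)
  then show ?thesis by simp
qed

section \<open>Enumeration of subsets and construction of the matrices\<close>

lemma subseqs_foldl: "foldl (\<lambda>ys x. map (\<lambda>zs. x # zs) ys @ ys) [[]] (rev xs) = subseqs xs"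
  by (induction xs) (simp_all add: Let_def)

lemma sz_subseq: "zs \<in> set (subseqs xs) \<Longrightarrow> sz zs \<le> sz xs"
proof (induction xs arbitrary: zs)
  case (Cons x xs)
  from Cons.prems obtain us where us: "us \<in> set (subseqs xs)" "zs = x # us \<or> zs = us"
    by (auto simp: Let_def)
  show ?case using Cons.IH[OF us(1)] us(2) by auto
qed simp

lemma sz_subseqs: "sz (subseqs xs) \<le> 2 ^ length xs * Suc (sz xs)"
  using sz_list_le[of "subseqs xs" "sz xs"] sz_subseq by (metis length_subseqs)

text \<open>The result is exponential in the list. A number of at least \<open>2 ^ length\<close> as
  second argument, in unary, makes the input large enough for the bound to be polynomial.\<close>

lemma ptime_subseqs_base: "ptime {a :: 'a::enc list \<times> nat. 2 ^ length (fst a) \<le> snd a} (\<lambda>a. subseqs (fst a))"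
proof -
  let ?D = "{a :: 'a::enc list \<times> nat. 2 ^ length (fst a) \<le> snd a}"
  have "ptime ?D (\<lambda>a. foldl (\<lambda>ys x. map (\<lambda>zs. x # zs) ys @ ys) [[]] (rev (fst a)))"
  proof (rule ptime_foldl[where b = "\<lambda>a. sz a * (sz a + 1)"])
    show "pbounded ?D (\<lambda>a. sz a * (sz a + 1))" by (intro pbounded_intros)
    fix a :: "'a list \<times> nat" and i assume a: "a \<in> ?D" and i: "i \<le> length (rev (fst a))"
    let ?ys = "drop (length (fst a) - i) (fst a)"
    have "sz (subseqs ?ys) \<le> 2 ^ length ?ys * Suc (sz ?ys)" by (rule sz_subseqs)
    also have "\<dots> \<le> sz a * (sz a + 1)"
    proof (rule mult_mono)
      have "(2::nat) ^ length ?ys \<le> 2 ^ length (fst a)" by (rule power_increasing) auto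
      also have "\<dots> \<le> sz a" using a by (cases a) simp
      finally show "2 ^ length ?ys \<le> sz a" .
      have "sz (take (length (fst a) - i) (fst a) @ ?ys) = sz (fst a)" by (simp only: append_take_drop_id)
      then have "sz ?ys \<le> sz (fst a)" unfolding sz_append by linarith
      then show "Suc (sz ?ys) \<le> sz a + 1" by (cases a) simp
    qed simp_all
    finally show "sz (foldl (\<lambda>ys x. map (\<lambda>zs. x # zs) ys @ ys) [[]] (take i (rev (fst a)))) \<le> sz a * (sz a + 1)"
      unfolding take_rev subseqs_foldl .
  qed (intro ptime_intros)+
  then show ?thesis unfolding subseqs_foldl .
qed

lemma ptime_subseqs:
  fixes k :: "'a::enc \<Rightarrow> nat"
  assumes "ptime D xs" "ptime D k" "\<And>a. a \<in> D \<Longrightarrow> 2 ^ length (xs a) \<le> k a"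
  shows "ptime D (\<lambda>a. subseqs (xs a))"
proof -
  have "ptime D (\<lambda>a. (\<lambda>a. subseqs (fst a)) (xs a, k a))"
    by (rule ptime_comp[OF ptime_Pair[OF assms(1,2)] ptime_subseqs_base]) (use assms(3) in simp)
  then show ?thesis by simp
qed

lemma ptime_pow2_length:
  fixes k :: "'a::enc \<Rightarrow> nat"
  assumes "ptime D xs" "ptime D k" "\<And>a. a \<in> D \<Longrightarrow> 2 ^ length (xs a) \<le> k a"
  shows "ptime D (\<lambda>a. (2 :: nat) ^ length (xs a))"
  unfolding length_subseqs[symmetric] by (rule ptime_length[OF ptime_subseqs[OF assms]])

lemma ptime_edge_weight_base: "ptime UNIV (\<lambda>a. edge_weight (fst a) (fst (snd a)) (snd (snd a)))"
  unfolding edge_weight_def by (intro ptime_intros)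

lemma ptime_edge_weight [ptime_intros]:
  assumes "ptime D f1" "ptime D f2" "ptime D f3"
  shows "ptime D (\<lambda>a. edge_weight (f1 a) (f2 a) (f3 a))"
proof -
  have "ptime D (\<lambda>a. (\<lambda>a. edge_weight (fst a) (fst (snd a)) (snd (snd a))) (f1 a, (f2 a, f3 a)))"
    by (rule ptime_comp[OF ptime_Pair[OF assms(1) ptime_Pair[OF assms(2,3)]] ptime_edge_weight_base]) simp
  then show ?thesis by simp
qed

lemma ptime_matrix_rows_base: "ptime UNIV (\<lambda>a. matrix_rows (fst a) (fst (snd a)) (snd (snd a)))"
  unfolding matrix_rows_def by (intro ptime_intros)

lemma ptime_matrix_rows [ptime_intros]:
  assumes "ptime D f1" "ptime D f2" "ptime D f3"
  shows "ptime D (\<lambda>a. matrix_rows (f1 a) (f2 a) (f3 a))"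
proof -
  have "ptime D (\<lambda>a. (\<lambda>a. matrix_rows (fst a) (fst (snd a)) (snd (snd a))) (f1 a, (f2 a, f3 a)))"
    by (rule ptime_comp[OF ptime_Pair[OF assms(1) ptime_Pair[OF assms(2,3)]] ptime_matrix_rows_base]) simp
  then show ?thesis by simp
qed

section \<open>Running time of the evaluation\<close>

type_synonym query = "nat \<times> (nat \<times> nat) list \<times> inst \<times> nat \<times> nat"

definition "terminals (x :: inst) = fst x @ fst (snd x)"

lemma ptime_initial_items:
  "ptime {a :: query. 2 ^ length (terminals (fst (snd (snd a)))) \<le> fst a}
     (\<lambda>a. initial_items (fst (snd a)) (fst (snd (snd a))) (2 ^ length (terminals (fst (snd (snd a))))) (snd (snd (snd a))))"
proof -
  let ?D = "{a :: query. 2 ^ length (terminals (fst (snd (snd a)))) \<le> fst a}"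
  \<comment> \<open>The sublists and the modulus are computed beforehand with the fuel as second
    argument. The rest is polynomial in them without a precondition.\<close>
  let ?q = "\<lambda>a :: query. (snd a, (subseqs (terminals (fst (snd (snd a)))), (2::nat) ^ length (terminals (fst (snd (snd a))))))"
  have t: "ptime ?D (\<lambda>a. terminals (fst (snd (snd a))))" unfolding terminals_def by (intro ptime_intros)
  have q: "ptime ?D ?q"
    by (intro ptime_Pair ptime_snd ptime_id ptime_subseqs[where k = fst] ptime_pow2_length[where k = fst] t ptime_fst) auto
  have "ptime UNIV (\<lambda>b :: ((nat \<times> nat) list \<times> inst \<times> nat \<times> nat) \<times> nat list list \<times> nat.
     map (\<lambda>Ss. (length (terminals (fst (snd (fst b)))) - Suc 0,
         (if length (filter (\<lambda>s. s \<in> set (fst (snd (fst (snd (fst b)))))) Ss) mod 2 = 0 then [0] else pneg1 (snd (snd b))),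
         filter (\<lambda>c. c \<notin> set Ss) [0..<length (snd (snd (fst (snd (fst b)))))],
         filter (\<lambda>y. fst y \<notin> set (terminals (fst (snd (fst b)))) \<or> fst y \<in> set Ss)
           (matrix_rows (fst (fst b)) (snd (snd (fst (snd (fst b))))) (snd (snd (fst b))))))
       (filter (\<lambda>Ss. 2 * length Ss = length (terminals (fst (snd (fst b))))) (fst (snd b))))"
    unfolding terminals_def by (intro ptime_intros)
  from ptime_comp[OF q this] show ?thesis
    unfolding initial_items_def terminals_def fst_conv snd_conv by simp
qed

definition eval_state :: "nat \<Rightarrow> query \<Rightarrow> nat list \<times> item list" where
  "eval_state i a = foldl (\<lambda>st u. work_step (Suc (length (snd (snd (fst (snd (snd a)))))) * Suc (length (fst (snd a))))
       (2 ^ length (terminals (fst (snd (snd a))))) st)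
     ([], initial_items (fst (snd a)) (fst (snd (snd a))) (2 ^ length (terminals (fst (snd (snd a))))) (snd (snd (snd a))))
     (replicate i ())"

text \<open>The length of the worklist is controlled by the potential, not by the form of the input.
  It is therefore required to stay below the fuel, which counts towards the input size in unary; the
  same holds for the modulus.\<close>

definition eval_dom :: "query set" where
  "eval_dom = {a. 2 ^ length (terminals (fst (snd (snd a)))) \<le> fst a \<and>
     (\<forall>i\<le>fst a. length (snd (eval_state i a)) \<le> fst a)}"

lemma sz_eval_state:
  assumes a: "a \<in> eval_dom" and i: "i \<le> fst a"
  defines "z \<equiv> sz a + 2"
  shows "sz (eval_state i a) \<le> 1 + z ^ 9 + z * Suc (2 * (z ^ 9 + 2) ^ 2)"
proof -
  obtain fuel S as bs adj e where ad: "a = (fuel, S, (as, bs, adj), e)" by (metis prod.collapse)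
  define n where "n = length adj"
  define M :: nat where "M = 2 ^ length (as @ bs)"
  define N where "N = Suc n * Suc (length S)"
  let ?its = "initial_items S (as, bs, adj) M e"
  have lens: "length S \<le> sz S" "n \<le> sz adj" by (simp_all add: n_def length_le_sz)
  have "M \<le> fuel" using a by (simp add: eval_dom_def ad terminals_def M_def)
  then have Mz: "M \<le> z" by (simp add: z_def ad)
  have "Suc n * Suc (length S) \<le> z * z" using lens by (intro mult_mono) (auto simp: z_def ad)
  then have Nz: "N \<le> z ^ 2" by (simp add: N_def power2_eq_square)
  have nz: "n \<le> z" using lens by (simp add: z_def ad)
  have z2: "2 \<le> z" by (simp add: z_def)
  have pw: "z ^ i \<le> z ^ j" if "i \<le> j" for i j using that z2 by (intro power_increasing) auto
  have z1: "z \<le> z ^ 9" using pw[of 1 9] by simp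
  \<comment> \<open>The exponent 9 is 2 + 3 + 4: lists of columns have size at most
    \<open>z ^ 2\<close>, the product \<open>N * M\<close> is at most \<open>z ^ 3\<close>, and the
    factor \<open>k + N + 2\<close> with \<open>k = z ^ 2\<close> is at most
    \<open>z ^ 4\<close>.\<close>
  interpret size_bounds N M "z ^ 2" "z ^ 9"
  proof
    show "0 < M" by (simp add: M_def)
    show "z ^ 2 \<le> z ^ 9" by (rule pw) simp
    have NM: "N * M \<le> z ^ 3" using mult_mono[OF Nz Mz] by (simp add: power3_eq_cube power2_eq_square)
    have two: "2 * z ^ i \<le> z ^ Suc i" for i using z2 by simp
    have "2 * z ^ 2 \<le> z ^ 3" using two[of 2] by (simp add: numeral_eq_Suc)
    moreover have "1 \<le> z ^ 2" using z2 by simp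
    ultimately have "Suc N \<le> z ^ 3" using Nz by linarith
    then have "N * M * Suc N \<le> z ^ 3 * z ^ 3" using NM by (intro mult_mono) auto
    also have "\<dots> = z ^ 6" by (simp flip: power_add)
    also have "\<dots> \<le> z ^ 9" by (rule pw) simp
    finally show "N * M * Suc N \<le> z ^ 9" .
    have "z ^ 2 + N + 2 \<le> 2 * z ^ 2 + z ^ 2" using Nz z2 pw[of 1 2] by simp
    also have "\<dots> \<le> 2 * (2 * z ^ 2)" by simp
    also have "\<dots> \<le> 2 * z ^ 3" using two[of 2] by (simp add: numeral_eq_Suc)
    also have "\<dots> \<le> z ^ 4" using two[of 3] by (simp add: numeral_eq_Suc)
    finally have "z ^ 2 * (N * M) * (z ^ 2 + N + 2) \<le> z ^ 2 * z ^ 3 * z ^ 4" using NM by (intro mult_mono) auto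
    then show "z ^ 2 * (N * M) * (z ^ 2 + N + 2) \<le> z ^ 9" by (simp flip: power_add)
  qed
  have rowsm: "small_row (z ^ 9) y" if y: "y \<in> set (matrix_rows S adj e)" for y
  proof -
    obtain u l where ul: "(u, l) \<in> set (zip [0..<length adj] adj)" "y = (u, (u, 0) # map (\<lambda>v. (v, edge_weight S u v))
     (filter (\<lambda>v. \<not> (u = fst e \<and> v = snd e \<or> u = snd e \<and> v = fst e)) l))"
      using y unfolding matrix_rows_def by auto
    have u: "u < n" using set_zip_leftD[OF ul(1)] by (simp add: n_def)
    have l: "sz l < sz adj" using set_zip_rightD[OF ul(1)] by (rule sz_elem)
    have ew: "edge_weight S u v \<le> 1 + 2 * length S" for v
      unfolding edge_weight_def using length_filter_le[of "\<lambda>l. fst l = u \<and> snd l = v \<or> fst l = v \<and> snd l = u" S] by simp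
    have "sz m \<le> 3 * z" if "m \<in> set (snd y)" for m
    proof -
      from that ul(2) consider "m = (u, 0)" | v where "v \<in> set l" "m = (v, edge_weight S u v)" by auto
      then show ?thesis
      proof cases
        case 1
        then show ?thesis using u nz z2 by simp
      next
        case 2
        have "v < sz l" using sz_elem[OF 2(1)] by simp
        then show ?thesis using ew[of v] l lens unfolding 2(2) by (simp add: z_def ad)
      qed
    qed
    then have "sz (snd y) \<le> length (snd y) * Suc (3 * z)" by (rule sz_list_le)
    also have "\<dots> \<le> z * (4 * z)"
    proof (rule mult_mono)
      have "length (snd y) \<le> Suc (length l)" unfolding ul(2) by simp
      then show "length (snd y) \<le> z" using l length_le_sz[of l] by (simp add: z_def ad)
    qed (use z2 in auto)
    also have "\<dots> \<le> z ^ 4"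
    proof -
      have "2 * (2 * (z * z)) \<le> z * (z * (z * z))" using z2 by (intro mult_mono) auto
      then show ?thesis by (simp add: numeral_eq_Suc algebra_simps)
    qed
    also have "\<dots> \<le> z ^ 9" by (rule pw) simp
    finally show ?thesis using u nz z1 by (simp add: small_row_def ul(2))
  qed
  have lenrows: "length (matrix_rows S adj e) = n" by (simp add: matrix_rows_def n_def)
  have "small (z ^ 2) (z ^ 9) it" if "it \<in> set ?its" for it
  proof -
    obtain Ss where it: "it = (length (as @ bs) - Suc 0, (if length (filter (\<lambda>s. s \<in> set bs) Ss) mod 2 = 0 then [0] else pneg1 M),
         filter (\<lambda>c. c \<notin> set Ss) [0..<n],
         filter (\<lambda>y. fst y \<notin> set (as @ bs) \<or> fst y \<in> set Ss) (matrix_rows S adj e))"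
      using \<open>it \<in> set ?its\<close> unfolding initial_items_def n_def by auto
    have "length (as @ bs) \<le> sz (as @ bs)" by (rule length_le_sz)
    then have "length (as @ bs) \<le> z" by (simp add: z_def ad)
    moreover have "sz (if length (filter (\<lambda>s. s \<in> set bs) Ss) mod 2 = 0 then [0] else pneg1 M) \<le> z"
    proof -
      have "sz (pneg1 M) = M - 1" unfolding pneg1_def by (induction M) (simp_all add: sz_list sum_list_replicate)
      then show ?thesis using Mz z2 by auto
    qed
    moreover have "sz (filter (\<lambda>c. c \<notin> set Ss) [0..<n]) \<le> z ^ 2"
    proof -
      have "sz (filter (\<lambda>c. c \<notin> set Ss) [0..<n]) \<le> sz [0..<n]" by (rule sz_filter)
      also have "\<dots> \<le> length [0..<n] * Suc n" by (rule sz_list_le) auto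
      also have "\<dots> \<le> z * z" using lens by (intro mult_mono) (auto simp: z_def ad)
      finally show ?thesis by (simp add: power2_eq_square)
    qed
    moreover have "length (filter (\<lambda>y. fst y \<notin> set (as @ bs) \<or> fst y \<in> set Ss) (matrix_rows S adj e)) \<le> n"
      unfolding lenrows[symmetric] by (rule length_filter_le)
    ultimately show ?thesis using z1 nz unfolding it small_def fst_conv snd_conv
      by - (intro conjI ballI; (linarith | erule rowsm[OF filter_is_subset[THEN subsetD]]))
  qed
  then have "(\<forall>it\<in>set (snd (eval_state i a)). small (z ^ 2) (z ^ 9) it) \<and> sz (fst (eval_state i a)) \<le> z ^ 9"
    using small_foldl_work_step[of "([], ?its)" "replicate i ()"]
    by (simp add: eval_state_def ad terminals_def M_def N_def n_def)
  then have its: "\<And>it. it \<in> set (snd (eval_state i a)) \<Longrightarrow> sz it \<le> 2 * (z ^ 9 + 2) ^ 2" and acc: "sz (fst (eval_state i a)) \<le> z ^ 9"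
    using sz_small k by blast+
  have "length (snd (eval_state i a)) \<le> fst a" using a i unfolding eval_dom_def by blast
  also have "\<dots> \<le> z" by (simp add: z_def ad)
  finally have len: "length (snd (eval_state i a)) \<le> z" .
  have "sz (snd (eval_state i a)) \<le> z * Suc (2 * (z ^ 9 + 2) ^ 2)"
    by (rule order_trans[OF sz_list_le[OF its] mult_right_mono[OF len]]) simp_all
  then show ?thesis using acc by (cases "eval_state i a") simp
qed

lemma ptime_evaluate_base: "ptime eval_dom (\<lambda>a. evaluate (fst a) (fst (snd a)) (fst (snd (snd a))) (snd (snd (snd a))))"
proof -
  let ?N = "\<lambda>a :: query. Suc (length (snd (snd (fst (snd (snd a)))))) * Suc (length (fst (snd a)))"
  let ?M = "\<lambda>a :: query. (2::nat) ^ length (terminals (fst (snd (snd a))))"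
  let ?I = "\<lambda>a :: query. initial_items (fst (snd a)) (fst (snd (snd a))) (?M a) (snd (snd (snd a)))"
  let ?b = "\<lambda>a :: query. 1 + (sz a + 2) ^ 9 + (sz a + 2) * (1 + 2 * ((sz a + 2) ^ 9 + 2) ^ 2)"
  let ?DG = "{p :: query \<times> (nat list \<times> item list) \<times> unit. fst p \<in> eval_dom \<and> (\<exists>i<length (replicate (fst (fst p)) ()).
     fst (snd p) = foldl (\<lambda>st u. work_step (?N (fst p)) (?M (fst p)) st) ([], ?I (fst p)) (take i (replicate (fst (fst p)) ())) \<and>
     snd (snd p) = replicate (fst (fst p)) () ! i)}"
  have t: "ptime D f \<Longrightarrow> ptime D (\<lambda>a. terminals (f a))" for D :: "'x::enc set" and f
    unfolding terminals_def by (intro ptime_intros)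
  have M: "ptime eval_dom ?M"
    by (intro ptime_pow2_length[where k = fst] t ptime_intros) (auto simp: eval_dom_def)
  have "ptime eval_dom (\<lambda>a. foldl (\<lambda>st u. work_step (?N a) (?M a) st) ([], ?I a) (replicate (fst a) ()))"
  proof (rule ptime_foldl[where b = ?b])
    show "pbounded eval_dom ?b" by (intro pbounded_intros)
    show "ptime eval_dom (\<lambda>a. replicate (fst a) ())" by (intro ptime_intros)
    show "ptime eval_dom (\<lambda>a. ([], ?I a))"
      by (intro ptime_intros ptime_subset[OF ptime_initial_items]) (auto simp: eval_dom_def)
    have M': "ptime ?DG (\<lambda>p. ?M (fst p))" by (rule ptime_comp[OF _ M]) (intro ptime_intros, blast)
    show "ptime ?DG (\<lambda>p. work_step (?N (fst p)) (?M (fst p)) (fst (snd p)))"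
      by (intro ptime_work_step M') (intro ptime_intros | simp)+
    fix a i assume a: "a \<in> eval_dom" and i: "i \<le> length (replicate (fst a) ())"
    have "take i (replicate (fst a) ()) = replicate i ()" using i by (simp add: min_def)
    then show "sz (foldl (\<lambda>st u. work_step (?N a) (?M a) st) ([], ?I a) (take i (replicate (fst a) ()))) \<le> ?b a"
      using sz_eval_state[OF a, of i] i by (simp add: eval_state_def)
  qed
  from ptime_fst[OF this] show ?thesis
    by (simp add: evaluate_def work_def terminals_def)
qed

lemma ptime_evaluate:
  assumes "ptime D f1" "ptime D f2" "ptime D f3" "ptime D f4" "\<And>a. a \<in> D \<Longrightarrow> (f1 a, f2 a, f3 a, f4 a) \<in> eval_dom"
  shows "ptime D (\<lambda>a. evaluate (f1 a) (f2 a) (f3 a) (f4 a))"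
proof -
  have "ptime D (\<lambda>a. (\<lambda>a. evaluate (fst a) (fst (snd a)) (fst (snd (snd a))) (snd (snd (snd a)))) (f1 a, (f2 a, (f3 a, f4 a))))"
    by (rule ptime_comp[OF ptime_Pair[OF assms(1) ptime_Pair[OF assms(2) ptime_Pair[OF assms(3,4)]]] ptime_evaluate_base])
      (use assms(5) in simp)
  then show ?thesis by simp
qed

definition solve_dom :: "(nat \<times> (nat \<times> nat) list \<times> inst) set" where
  "solve_dom = {a. \<forall>e. (fst a, fst (snd a), snd (snd a), e) \<in> eval_dom}"

lemma ptime_solution_adjacency:
  assumes "ptime D f" "ptime D g" "\<And>a. a \<in> D \<Longrightarrow> f a \<in> solve_dom"
  shows "ptime D (\<lambda>a. solution_adjacency (fst (f a)) (fst (snd (f a))) (snd (snd (f a))) (g a))"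
proof -
  have "ptime {b. fst b \<in> solve_dom} (\<lambda>b. solution_adjacency (fst (fst b)) (fst (snd (fst b))) (snd (snd (fst b))) (snd b))"
    unfolding solution_adjacency_def
    by (intro ptime_intros ptime_evaluate) (auto simp: solve_dom_def)
  from ptime_comp[OF ptime_Pair[OF assms(1,2)] this] assms(3) show ?thesis by simp
qed

lemma ptime_trace_step_base: "ptime UNIV (\<lambda>a. trace_step (fst a) (snd a))"
  unfolding trace_step_def by (intro ptime_intros)

lemma sz_trace_step: "sz (trace_step Fl st) \<le> sz st + (2 * sz Fl + 2)"
proof (cases "filter (\<lambda>v. v \<notin> set (snd st)) (concat (map snd (filter (\<lambda>x. fst x = fst st) Fl)))")
  case (Cons v vs)
  then have "v \<in> set (filter (\<lambda>v. v \<notin> set (snd st)) (concat (map snd (filter (\<lambda>x. fst x = fst st) Fl))))"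
    by (simp only: list.set_intros)
  then have "v \<in> set (concat (map snd (filter (\<lambda>x. fst x = fst st) Fl)))" by (rule filter_is_subset[THEN subsetD])
  then obtain x where x: "x \<in> set Fl" "v \<in> set (snd x)" by auto
  have "v \<le> sz Fl" using sz_elem[OF x(1)] sz_elem[OF x(2)] by (cases x) simp
  then show ?thesis using Cons by (cases st) (simp add: trace_step_def)
qed (simp add: trace_step_def)

lemma ptime_trace [ptime_intros]:
  assumes "ptime D f" "ptime D g"
  shows "ptime D (\<lambda>a. trace (f a) (g a))"
proof -
  have *: "ptime {p. fst p \<in> D \<and> snd (snd p) \<in> set (f (fst p))} (\<lambda>p. f (fst p))"
    by (rule ptime_comp[OF _ assms(1)]) (intro ptime_intros, auto)
  have "ptime D (\<lambda>a. foldl (\<lambda>st x. trace_step (f a) st) (g a, [g a]) (f a))"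
  proof (rule ptime_foldl_additive[where b = "\<lambda>a. 2 * sz (f a) + 2"])
    show "ptime {p. fst p \<in> D \<and> snd (snd p) \<in> set (f (fst p))} (\<lambda>p. trace_step (f (fst p)) (fst (snd p)))"
    proof -
      have "ptime {p. fst p \<in> D \<and> snd (snd p) \<in> set (f (fst p))}
          (\<lambda>p. (\<lambda>a. trace_step (fst a) (snd a)) (f (fst p), fst (snd p)))"
        by (rule ptime_comp[OF ptime_Pair[OF *] ptime_trace_step_base]) (intro ptime_intros, simp)
      then show ?thesis by simp
    qed
    show "pbounded D (\<lambda>a. 2 * sz (f a) + 2)" by (intro pbounded_intros ptime_pbounded[OF assms(1)])
  qed (intro ptime_intros assms sz_trace_step)+
  then show ?thesis unfolding trace_def .
qed

lemma ptime_trace_paths [ptime_intros]: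
  assumes "ptime D f" "ptime D g"
  shows "ptime D (\<lambda>a. trace_paths (f a) (g a))"
proof -
  have "ptime UNIV (\<lambda>b. trace_paths (fst b) (snd b))" unfolding trace_paths_def by (intro ptime_intros)
  from ptime_comp[OF ptime_Pair[OF assms] this] show ?thesis by simp
qed

lemma ptime_list_min [ptime_intros]:
  assumes "ptime D f" "ptime D g"
  shows "ptime D (\<lambda>a. list_min (f a) (g a))"
  unfolding list_min_def
proof (rule ptime_foldl_additive[where b = "\<lambda>a. sz (g a)"])
  fix a y x assume "x \<in> set (g a)"
  then show "sz (if x < y then x else y) \<le> sz y + sz (g a)" using sz_elem[of x "g a"] by simp
qed (intro ptime_intros assms ptime_pbounded)+

lemma ptime_solve: "ptime solve_dom (\<lambda>a. solve (fst a) (fst (snd a)) (snd (snd a)))"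
  unfolding solve_def
  by (intro ptime_case_list ptime_Some ptime_trace_paths ptime_solution_adjacency ptime_evaluate ptime_intros)
    (auto simp: solve_dom_def)

context instance_setup begin

text \<open>All items have positive potential, so the length of the worklist is at most the total
  potential, which never exceeds the fuel.\<close>

lemma solve_dom: "(fuel, S, x) \<in> solve_dom"
  unfolding solve_dom_def mem_Collect_eq fst_conv snd_conv
proof
  fix e
  let ?M = "2 ^ K :: nat"
  let ?its = "initial_items S x ?M e"
  have len: "length (terminals x) = K" using Ts(3) by (simp add: terminals_def x_def)
  have "(2::nat) ^ K \<le> (n + 2) ^ K" by (rule power_mono) auto
  also have "\<dots> \<le> (n + 2) ^ (8 * K)" by (rule power_increasing) auto
  also have "\<dots> \<le> fuel" using fuel by (simp add: K_def)
  finally have M: "2 ^ K \<le> fuel" .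
  have "length (snd (eval_state i (fuel, S, x, e))) \<le> fuel" for i
  proof -
    have K: "K > 0" and N: "N > 0" using pos by (simp_all add: K_def N_def)
    have "state_ok n N K (\<Sum>it\<leftarrow>?its. item_value it) fuel ([], ?its)"
      using initial_items_ok(1) potential_initial_items by (simp add: state_ok_def)
    from foldl_work_step_ok[OF K N this, of i]
    have ok: "state_ok n N K (\<Sum>it\<leftarrow>?its. item_value it) (fuel - i) (eval_state i (fuel, S, x, e))"
      unfolding eval_state_def fst_conv snd_conv len by (simp add: N_def x_def length_adj)
    have "length its \<le> (\<Sum>it\<leftarrow>its. potential n it)" for its
    proof (induction its)
      case (Cons it its)
      then show ?case using potential_pos[of n it] by simp
    qed simp
    then show ?thesis using ok unfolding state_ok_def by (meson diff_le_self order_trans)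
  qed
  then show "(fuel, S, x, e) \<in> eval_dom" using M by (simp add: eval_dom_def len)
qed

end

section \<open>The randomized program\<close>

text \<open>Final configurations are absorbing, so both runs can be extended to the same number of
  steps and then coincide.\<close>

lemma runs_unique:
  assumes "runs c x y t" "runs c x y' t'"
  shows "y = y'"
proof -
  let ?s = "(\<lambda>_. Atom)(0 := x) :: store"
  have s: "?s 0 = x" by simp
  obtain s1 t1 where 1: "reaches ([c], ?s) t1 ([], s1)" "s1 0 = y" using runsE[OF assms(1), where s = ?s and cs = "[]"] s by blast
  obtain s2 t2 where 2: "reaches ([c], ?s) t2 ([], s2)" "s2 0 = y'" using runsE[OF assms(2), where s = ?s and cs = "[]"] s by blast
  have "steps (t1 + t2) (return_pmf ([c], ?s)) = return_pmf ([], s1)"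
    unfolding steps_add steps_reaches[OF 1(1)] by (rule steps_final) simp
  moreover have "steps (t2 + t1) (return_pmf ([c], ?s)) = return_pmf ([], s2)"
    unfolding steps_add steps_reaches[OF 2(1)] by (rule steps_final) simp
  ultimately show ?thesis using 1(2) 2(2) by (simp add: add.commute)
qed

text \<open>The only random phase lies between two deterministic ones and takes the same number of
  steps for all coins. The last phase can be extended to exactly \<open>U\<close> steps, since final
  configurations do not change.\<close>

lemma run_select:
  fixes xs acc :: "'a::enc list"
  assumes r: "reaches (initial_config prog x0) t1 ([select_com, rest], s1)"
    and s1: "s1 0 = Dot (enc xs) (Dot (enc acc) r)"
    and rest: "\<And>ys. ys \<in> set_pmf (random_select xs acc) \<Longrightarrow> runs rest (Dot Atom (Dot (enc ys) r)) (F ys) U"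
  shows "halts_within prog x0 (t1 + (5 * length xs + 1) + U)"
    and "prob_output_within prog x0 (t1 + (5 * length xs + 1) + U) Y =
      measure_pmf.prob (random_select xs acc) {ys. F ys \<in> Y}"
proof -
  obtain S where S: "steps (5 * length xs + 1) (return_pmf (select_com # [rest], s1)) = map_pmf (\<lambda>s'. ([rest], s')) S"
    "map_pmf (\<lambda>s'. s' 0) S = map_pmf (\<lambda>ys. Dot Atom (Dot (enc ys) r)) (random_select xs acc)"
    using select_com_steps[of s1 xs acc r "[rest]", OF s1] by blast
  \<comment> \<open>The store after the selection also holds a random coin and is no function of
    \<open>ys\<close>. The output depends on variable 0 alone, and \<open>runs_unique\<close> makes
    it a function of that value.\<close>
  define out where "out v = (SOME y. runs rest v y U)" for v
  have out: "out (Dot Atom (Dot (enc ys) r)) = F ys" if "ys \<in> set_pmf (random_select xs acc)" for ys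
    unfolding out_def by (rule some_equality, rule rest[OF that], erule runs_unique, rule rest[OF that])
  have "\<exists>s''. steps U (return_pmf ([rest], s')) = return_pmf ([], s'') \<and> s'' 0 = out (s' 0)" if s': "s' \<in> set_pmf S" for s'
  proof -
    have "s' 0 \<in> set_pmf (map_pmf (\<lambda>s'. s' 0) S)" using s' by simp
    then obtain ys where ys: "ys \<in> set_pmf (random_select xs acc)" "s' 0 = Dot Atom (Dot (enc ys) r)"
      unfolding S(2) by auto
    obtain s'' t' where t': "t' \<le> U" "reaches ([rest], s') t' ([], s'')" "s'' 0 = F ys"
      using runsE[OF rest[OF ys(1)], where s = s' and cs = "[]"] ys(2) by blast
    have "steps (t' + (U - t')) (return_pmf ([rest], s')) = return_pmf ([], s'')"
      unfolding steps_add steps_reaches[OF t'(2)] by (rule steps_final) simp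
    then show ?thesis using t' ys out by auto
  qed
  then obtain h where h: "\<And>s'. s' \<in> set_pmf S \<Longrightarrow> steps U (return_pmf ([rest], s')) = return_pmf ([], h s') \<and> h s' 0 = out (s' 0)"
    by metis
  have "run prog x0 (t1 + (5 * length xs + 1) + U) = steps U (steps (5 * length xs + 1) (steps t1 (return_pmf (initial_config prog x0))))"
    unfolding steps_add[symmetric] by (simp add: run_def steps_def)
  also have "\<dots> = steps U (bind_pmf S (\<lambda>s'. return_pmf ([rest], s')))"
    unfolding steps_reaches[OF r] S(1) map_pmf_def ..
  also have "\<dots> = map_pmf (\<lambda>s'. ([], h s')) S"
    unfolding steps_bind map_pmf_def by (intro bind_pmf_cong refl) (use h in blast)
  finally have run: "run prog x0 (t1 + (5 * length xs + 1) + U) = map_pmf (\<lambda>s'. ([], h s')) S" .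
  show "halts_within prog x0 (t1 + (5 * length xs + 1) + U)" unfolding halts_within_def run by auto
  have "prob_output_within prog x0 (t1 + (5 * length xs + 1) + U) Y = measure_pmf.prob S {s'. h s' 0 \<in> Y}"
    unfolding prob_output_within_def run measure_map_pmf by (simp add: vimage_def)
  also have "\<dots> = measure_pmf.prob S {s'. out (s' 0) \<in> Y}"
    by (rule measure_pmf.finite_measure_eq_AE) (use h in \<open>auto simp: AE_measure_pmf_iff\<close>)
  also have "\<dots> = measure_pmf.prob (map_pmf (\<lambda>s'. s' 0) S) {v. out v \<in> Y}"
    unfolding measure_map_pmf by (simp add: vimage_def)
  also have "\<dots> = measure_pmf.prob (random_select xs acc) {ys. out (Dot Atom (Dot (enc ys) r)) \<in> Y}"
    unfolding S(2) measure_map_pmf by (simp add: vimage_def)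
  also have "\<dots> = measure_pmf.prob (random_select xs acc) {ys. F ys \<in> Y}"
    by (rule measure_pmf.finite_measure_eq_AE) (use out in \<open>auto simp: AE_measure_pmf_iff\<close>)
  finally show "prob_output_within prog x0 (t1 + (5 * length xs + 1) + U) Y =
      measure_pmf.prob (random_select xs acc) {ys. F ys \<in> Y}" .
qed

text \<open>An edge occurs in both orders and thus owns \<open>4 * n ^ 4\<close> positions, that is
  \<open>2 * c\<close> for \<open>c = 2 * n ^ 4\<close>. With at most \<open>n ^ 2\<close> edges
  this meets the condition \<open>(2 * card U) ^ 2 \<le> 2 * c + 1\<close> of
  \<open>isolation\<close>.\<close>

definition labels :: "nat \<Rightarrow> (nat \<times> nat) list" where
  "labels n = concat (map (\<lambda>u. concat (map (\<lambda>v. replicate (2 * n ^ 4) (u, v)) [0..<n])) [0..<n])"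

lemma length_filter_labels:
  "length (filter P (labels n)) = (\<Sum>u<n. \<Sum>v<n. if P (u, v) then 2 * n ^ 4 else 0)"
proof -
  have r: "length (filter P (replicate k y)) = (if P y then k else 0)" for k and y :: "nat \<times> nat" by simp
  show ?thesis
    unfolding labels_def filter_concat length_concat map_map o_def r
    by (simp add: interv_sum_list_conv_sum_set_nat atLeast0LessThan)
qed

lemma labels_of_edge:
  assumes "a < n" "b < n" "a \<noteq> b"
  shows "length (filter (\<lambda>l. {fst l, snd l} = {a, b}) (labels n)) = 2 * (2 * n ^ 4)"
proof -
  let ?c = "2 * n ^ 4"
  have "length (filter (\<lambda>l. {fst l, snd l} = {a, b}) (labels n)) =
      (\<Sum>u<n. \<Sum>v<n. (if u = a then if v = b then ?c else 0 else 0) + (if u = b then if v = a then ?c else 0 else 0))"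
    unfolding length_filter_labels using assms(3) by (intro sum.cong refl) (auto simp: doubleton_eq_iff)
  also have "\<dots> = (\<Sum>u<n. (if u = a then ?c else 0) + (if u = b then ?c else 0))"
    using assms by (intro sum.cong refl) (simp add: sum.distrib)
  also have "\<dots> = 2 * ?c" using assms by (simp add: sum.distrib)
  finally show ?thesis .
qed

text \<open>The coins select a uniformly distributed set of positions, and at most half of these
  sets fail to isolate a shortest packing. If there is no packing, every choice of coins
  succeeds.\<close>

lemma prob_correct:
  assumes G: "simple_graph {..<n} E" "A \<subseteq> {..<n}" "B \<subseteq> {..<n}" "A \<inter> B = {}" "even (card A)" "even (card B)"
    and pos: "card A + card B > 0" and fuel: "(n + 2) ^ (8 * (card A + card B)) \<le> fuel"
  shows "measure_pmf.prob (random_select (labels n) [])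
      {S. correct_answer {..<n} E A B (solve fuel S (sorted_list_of_set A, sorted_list_of_set B, adjacency_lists n E))} \<ge> 1 / 2"
proof -
  let ?L = "rev (labels n)" and ?J = "{..<length (labels n)}"
  let ?ok = "\<lambda>S. correct_answer {..<n} E A B (solve fuel S (sorted_list_of_set A, sorted_list_of_set B, adjacency_lists n E))"
  have inst: "instance_setup n E A B fuel" using assms by unfold_locales
  have ok: "?ok S" if "(\<exists>Ps. perfect_packing {..<n} E A B Ps) \<Longrightarrow> instance_setup.isolated n E A B S" for S
    using instance_setup.solve_correct[OF inst, of S] that unfolding instance_setup.x_def[OF inst] by blast
  have le1: "1 / 2 \<le> measure_pmf.prob (random_select (labels n) []) {S. ?ok S}" if "\<And>S. ?ok S"
  proof -
    have "{S. ?ok S} = UNIV" using that by simp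
    then show ?thesis by simp
  qed
  show ?thesis
  proof (cases "\<exists>Ps. perfect_packing {..<n} E A B Ps")
    case False
    then show ?thesis using le1 ok by blast
  next
    case True
    define m where "m = (LEAST m. \<exists>Ps. perfect_packing {..<n} E A B Ps \<and> packing_size Ps = m)"
    define \<F> where "\<F> = {edges_of Ps |Ps. perfect_packing {..<n} E A B Ps \<and> packing_size Ps = m}"
    define I where "I e = {i. i < length ?L \<and> {fst (?L ! i), snd (?L ! i)} = e}" for e
    define W where "W Y F = (\<Sum>e\<in>F. card (Y \<inter> I e))" for Y F
    have iso: "instance_setup.isolated n E A B (nths ?L Y) \<longleftrightarrow> (\<exists>F\<in>\<F>. \<forall>F'\<in>\<F>. F' \<noteq> F \<longrightarrow> W Y F < W Y F')" for Y
    proof -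
      have "rand_weight (nths ?L Y) e = card (Y \<inter> I e)" for e
        unfolding rand_weight_def length_filter_nths I_def ..
      then show ?thesis unfolding instance_setup.isolated_def[OF inst] Let_def m_def[symmetric] \<F>_def[symmetric] W_def by simp
    qed
    have edge: "\<exists>u v. u < n \<and> v < n \<and> u \<noteq> v \<and> e = {u, v}" if "e \<in> E" for e
      using G(1) that unfolding simple_graph_def by blast
    have Esub: "E \<subseteq> (\<lambda>p. {fst p, snd p}) ` ({..<n} \<times> {..<n})"
    proof
      fix e assume "e \<in> E"
      from edge[OF this] obtain u v where "u < n" "v < n" "e = {u, v}" by blast
      then show "e \<in> (\<lambda>p. {fst p, snd p}) ` ({..<n} \<times> {..<n})" by (intro image_eqI[of _ _ "(u, v)"]) auto
    qed
    have finE: "finite E" by (rule finite_subset[OF Esub]) simp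
    have "card E \<le> card ((\<lambda>p. {fst p, snd p}) ` ({..<n} \<times> {..<n}))" by (rule card_mono[OF _ Esub]) simp
    also have "\<dots> \<le> card ({..<n} \<times> {..<n})" by (rule card_image_le) simp
    finally have cardE: "card E \<le> n * n" by simp
    \<comment> \<open>Constant weights give access to the facts on packings, here that their edge
      sets lie in \<open>E\<close>.\<close>
    interpret path_instance "{..<n}" E A B "\<lambda>_. 1" using G by unfold_locales (auto simp: simple_graph_def)
    have "2 * card {Y. Y \<subseteq> ?J \<and> \<not> (\<exists>F\<in>\<F>. \<forall>F'\<in>\<F>. F' \<noteq> F \<longrightarrow> W Y F < W Y F')} \<le> 2 ^ card ?J"
      unfolding W_def
    proof (rule isolation[OF _ finE])
      show "I e \<subseteq> ?J \<and> card (I e) = 2 * (2 * n ^ 4)" if e: "e \<in> E" for e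
      proof
        obtain a b where ab: "a < n" "b < n" "a \<noteq> b" "e = {a, b}" using edge[OF e] by blast
        have "card (I e) = length (filter (\<lambda>l. {fst l, snd l} = e) ?L)"
          unfolding I_def by (rule length_filter_conv_card[symmetric])
        also have "\<dots> = 2 * (2 * n ^ 4)" using labels_of_edge[OF ab(1-3)] by (simp add: ab(4) flip: rev_filter)
        finally show "card (I e) = 2 * (2 * n ^ 4)" .
      qed (auto simp: I_def)
      show "I e \<inter> I e' = {}" if "e \<noteq> e'" for e e' using that by (auto simp: I_def)
      have "(2 * card E)\<^sup>2 \<le> (2 * (n * n))\<^sup>2" using cardE by (intro power_mono) auto
      then show "(2 * card E)\<^sup>2 \<le> 2 * (2 * n ^ 4) + 1" by (simp add: power2_eq_square numeral_eq_Suc algebra_simps)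
      show "\<F> \<subseteq> Pow E" using perfect_packing_edges unfolding \<F>_def by blast
      have "\<exists>Ps. perfect_packing {..<n} E A B Ps \<and> packing_size Ps = m"
        unfolding m_def by (rule LeastI_ex) (use True in blast)
      then show "\<F> \<noteq> {}" unfolding \<F>_def by blast
    qed simp
    moreover define Bad where "Bad = {Y. Y \<subseteq> ?J \<and> \<not> (\<exists>F\<in>\<F>. \<forall>F'\<in>\<F>. F' \<noteq> F \<longrightarrow> W Y F < W Y F')}"
    ultimately have bad: "2 * card Bad \<le> 2 ^ card ?J" by simp
    have fin: "finite (Pow ?J)" by simp
    have sub: "Bad \<subseteq> Pow ?J" by (auto simp: Bad_def)
    have "card (Pow ?J - Bad) = 2 ^ card ?J - card Bad"
      using card_Diff_subset[OF finite_subset[OF sub fin] sub] by (simp add: card_Pow)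
    then have "2 ^ card ?J \<le> 2 * card (Pow ?J - Bad)" using bad by simp
    then have "real (2 ^ card ?J) \<le> real (2 * card (Pow ?J - Bad))" by (simp only: of_nat_le_iff)
    then have "1 / 2 \<le> real (card (Pow ?J - Bad)) / real (card (Pow ?J))" by (simp add: card_Pow field_simps)
    also have "real (card (Pow ?J - Bad)) / real (card (Pow ?J)) = measure_pmf.prob (pmf_of_set (Pow ?J)) (Pow ?J - Bad)"
    proof -
      have "Pow ?J \<noteq> {}" by blast
      from measure_pmf_of_set[OF this fin] have "measure_pmf.prob (pmf_of_set (Pow ?J)) (Pow ?J - Bad) =
          real (card (Pow ?J \<inter> (Pow ?J - Bad))) / real (card (Pow ?J))" .
      moreover have "Pow ?J \<inter> (Pow ?J - Bad) = Pow ?J - Bad" by blast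
      ultimately show ?thesis by (simp only:)
    qed
    also have "\<dots> \<le> measure_pmf.prob (pmf_of_set (Pow ?J)) {Y. ?ok (nths ?L Y @ [])}"
    proof (rule measure_pmf.finite_measure_mono)
      show "Pow ?J - Bad \<subseteq> {Y. ?ok (nths ?L Y @ [])}"
      proof
        fix Y assume "Y \<in> Pow ?J - Bad"
        then have "\<exists>F\<in>\<F>. \<forall>F'\<in>\<F>. F' \<noteq> F \<longrightarrow> W Y F < W Y F'" by (auto simp: Bad_def)
        then have "?ok (nths ?L Y)" by (intro ok) (simp only: iso)
        then show "Y \<in> {Y. ?ok (nths ?L Y @ [])}" by simp
      qed
    qed simp
    also have "\<dots> = measure_pmf.prob (random_select (labels n) []) {S. ?ok S}"
      unfolding random_select_eq measure_map_pmf vimage_def by simp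
    finally show ?thesis .
  qed
qed

section \<open>The complete program and its running time\<close>

lemma ptime_runs_power:
  assumes "ptime D f"
  shows "\<exists>c d. \<forall>a\<in>D. runs c (enc a) (enc (f a)) ((sz a + 2) ^ d)"
proof -
  obtain c g where "pbounded D g" and r: "\<And>a. a \<in> D \<Longrightarrow> runs c (enc a) (enc (f a)) (g a)"
    using assms unfolding ptime_def by blast
  then obtain d where "\<And>a. a \<in> D \<Longrightarrow> g a \<le> (sz a + 2) ^ d" unfolding pbounded_def by blast
  then show ?thesis using r runs_mono by blast
qed

lemma ptime_power [ptime_intros]: "ptime D f \<Longrightarrow> ptime D (\<lambda>a. f a ^ k :: nat)"
  by (induction k) (auto intro: ptime_const[of _ "Suc 0"] ptime_mult)

lemma ptime_labels [ptime_intros]: "ptime D f \<Longrightarrow> ptime D (\<lambda>a. labels (f a))"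
proof -
  assume f: "ptime D f"
  have "ptime UNIV labels" unfolding labels_def by (intro ptime_intros)
  from ptime_comp[OF f this] show ?thesis by simp
qed

text \<open>The tenth power serves two purposes: it exceeds the sizes of the instance and of the
  selected labels together, and its K-th power exceeds the fuel
  \<open>(n + 2) ^ (8 * K)\<close>.\<close>

definition pad :: "inst \<Rightarrow> nat" where
  "pad x = (length (snd (snd x)) + 2) ^ 10"

lemma sz_nths: "sz (nths xs Y) \<le> sz xs"
  by (induction xs arbitrary: Y) (auto simp: nths_Cons intro: le_SucI trans_le_add2)

lemma length_labels: "length (labels n) = 2 * n ^ 6"
  using length_filter_labels[of "\<lambda>_. True" n] by (simp add: numeral_eq_Suc algebra_simps)

lemma sz_labels: "sz (labels n) \<le> (n + 2) ^ 9"
proof -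
  have "sz l \<le> 2 * n + 1" if l: "l \<in> set (labels n)" for l
  proof -
    obtain u v where "u < n" "v < n" "l = (u, v)" using l by (auto simp: labels_def set_replicate_conv_if split: if_splits)
    then show ?thesis by simp
  qed
  then have "sz (labels n) \<le> 2 * n ^ 6 * Suc (2 * n + 1)" unfolding length_labels[symmetric] by (rule sz_list_le)
  also have "\<dots> = n ^ 6 * (4 * (n + 1))" by (simp add: algebra_simps)
  also have "\<dots> \<le> (n + 2) ^ 6 * ((n + 2) ^ 2 * (n + 2))"
  proof (intro mult_mono power_mono)
    have "2 ^ 2 \<le> (n + 2) ^ 2" by (rule power_mono) auto
    then show "4 \<le> (n + 2) ^ 2" by simp
  qed auto
  also have "\<dots> = (n + 2) ^ (6 + (2 + 1))" by (simp only: power_add power_one_right)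
  finally show ?thesis by simp
qed

lemma sz_node_list:
  assumes "sorted xs" "distinct xs" "set xs \<subseteq> {..<n}"
  shows "sz (xs :: nat list) \<le> n * n"
proof -
  have "length xs = card (set xs)" using assms(2) by (simp add: distinct_card)
  also have "\<dots> \<le> n" using card_mono[OF _ assms(3)] by simp
  finally have len: "length xs \<le> n" .
  have "sz xs \<le> length xs * Suc (n - 1)" using assms(3) by (intro sz_list_le) auto
  also have "\<dots> \<le> n * n" using mult_right_mono[OF len, of n] len by (cases n) simp_all
  finally show ?thesis .
qed

type_synonym fuel_state = "nat list \<times> nat \<times> nat \<times> (nat \<times> nat) list \<times> inst"

text \<open>The exponent of the fuel depends on the input, so \<open>P ^ K\<close> is out of reach
  for a polynomial-time function. An explicit loop multiplies by \<open>P\<close> once for every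
  terminal, and all costs are measured against the resulting power.\<close>

lemma program_exists:
  "\<exists>c1 c2 d. \<forall>x. runs c1 (enc x) (enc (labels (length (snd (snd x))), ([] :: (nat \<times> nat) list), x)) ((sz x + 2) ^ d) \<and>
     (\<forall>S P. terminals x \<noteq> [] \<longrightarrow> sz x + sz S + 4 \<le> P \<longrightarrow> P = pad x \<longrightarrow>
        (P ^ length (terminals x), S, x) \<in> solve_dom \<longrightarrow>
        runs c2 (enc (([] :: (nat \<times> nat) list), S, x)) (enc (solve (P ^ length (terminals x)) S x))
          ((10 * P ^ length (terminals x)) ^ d))"
proof -
  let ?init = "\<lambda>a :: (nat \<times> nat) list \<times> (nat \<times> nat) list \<times> inst. (terminals (snd (snd a)), 1 :: nat, pad (snd (snd a)), snd a)"
  let ?body = "\<lambda>a :: fuel_state. (tl (fst a), fst (snd a) * fst (snd (snd a)), snd (snd a))"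
  let ?fin = "\<lambda>a :: fuel_state. (fst (snd a), snd (snd (snd a)))"
  have "ptime UNIV (\<lambda>x :: inst. (labels (length (snd (snd x))), ([] :: (nat \<times> nat) list), x))" by (intro ptime_intros)
  from ptime_runs_power[OF this] obtain c1 d1
    where r1: "\<And>x :: inst. runs c1 (enc x) (enc (labels (length (snd (snd x))), ([] :: (nat \<times> nat) list), x)) ((sz x + 2) ^ d1)"
    by blast
  have "ptime UNIV ?init" unfolding terminals_def pad_def by (intro ptime_intros)
  from ptime_runs_power[OF this] obtain ci di
    where ri: "\<And>a. runs ci (enc a) (enc (?init a)) ((sz a + 2) ^ di)" by blast
  have "ptime UNIV ?body" by (intro ptime_intros)
  from ptime_runs_power[OF this] obtain cb db
    where rb: "\<And>a. runs cb (enc a) (enc (?body a)) ((sz a + 2) ^ db)" by blast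
  have "ptime UNIV ?fin" by (intro ptime_intros)
  from ptime_runs_power[OF this] obtain cf df
    where rf: "\<And>a. runs cf (enc a) (enc (?fin a)) ((sz a + 2) ^ df)" by blast
  from ptime_runs_power[OF ptime_solve] obtain cs ds
    where rs: "\<And>a. a \<in> solve_dom \<Longrightarrow> runs cs (enc a) (enc (solve (fst a) (fst (snd a)) (snd (snd a)))) ((sz a + 2) ^ ds)" by blast
  define e where "e = di + db + df + ds"
  define d where "d = d1 + e + 3"
  let ?while = "While_Dot (Hd_of (Var 0)) cb"
  let ?c2 = "Seq ci (Seq ?while (Seq cf cs))"
  have "runs ?c2 (enc (([] :: (nat \<times> nat) list), S, x)) (enc (solve (P ^ length (terminals x)) S x))
          ((10 * P ^ length (terminals x)) ^ d)"
    if ne: "terminals x \<noteq> []" and P: "sz x + sz S + 4 \<le> P" "P = pad x" and dom: "(P ^ length (terminals x), S, x) \<in> solve_dom" for S P x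
  proof -
    define ts where "ts = terminals x"
    define k where "k = length ts"
    define F where "F = P ^ k"
    \<comment> \<open>Covers all intermediate values, since each component of a loop state has size
      at most \<open>F\<close>.\<close>
    define Z where "Z = 10 * F"
    have P4: "4 \<le> P" using P(1) by simp
    have PF: "P \<le> F" unfolding F_def k_def ts_def using ne P4 by (intro self_le_power) auto
    have Pi: "P ^ i \<le> F" if "i \<le> k" for i unfolding F_def using that P4 by (intro power_increasing) auto
    have ts: "sz ts \<le> sz x" by (cases x) (simp add: ts_def terminals_def)
    have kZ: "k \<le> Z" using ts length_le_sz[of ts] P(1) PF by (simp add: k_def Z_def)
    have Z10: "Z \<ge> 10" using P4 PF by (simp add: Z_def)
    define st :: "nat \<Rightarrow> fuel_state" where "st i = (drop i ts, P ^ i, P, S, x)" for i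
    have szst: "sz (st i) + 2 \<le> Z" if "i \<le> k" for i
    proof -
      have "sz ts = sz (take i ts) + sz (drop i ts)" by (simp flip: sz_append)
      then have "sz (drop i ts) \<le> sz x" using ts by simp
      then show ?thesis using Pi[OF that] PF P(1) by (simp add: st_def Z_def)
    qed
    have pw: "m ^ j \<le> Z ^ e" if "m \<le> Z" "j \<le> e" for m j
    proof -
      have "m ^ j \<le> Z ^ j" using that(1) by (rule power_mono) simp
      also have "\<dots> \<le> Z ^ e" using that(2) Z10 by (intro power_increasing) auto
      finally show ?thesis .
    qed
    have "runs ci (enc (([] :: (nat \<times> nat) list), S, x)) (enc (?init ([], S, x))) (Z ^ e)"
      by (rule runs_mono[OF ri pw]) (use P PF in \<open>simp_all add: e_def Z_def\<close>)
    then have 1: "runs ci (enc (([] :: (nat \<times> nat) list), S, x)) (enc (st 0)) (Z ^ e)" by (simp add: st_def ts_def P(2))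
    have 2: "runs ?while (enc (st 0)) (enc (st k)) (k * (Z ^ e + 1) + 1)"
    proof (rule runs_While_Dot[where x = "\<lambda>i. enc (st i)"])
      fix i assume i: "i < k"
      have drop: "drop i ts = ts ! i # drop (Suc i) ts" using i by (simp add: k_def Cons_nth_drop_Suc)
      show "hd_sexp (enc (st i)) \<noteq> Atom" by (simp add: st_def drop)
      have "runs cb (enc (st i)) (enc (?body (st i))) (Z ^ e)"
        by (rule runs_mono[OF rb pw]) (use i szst[of i] in \<open>simp_all add: e_def\<close>)
      moreover have "?body (st i) = st (Suc i)" by (simp add: st_def drop mult.commute)
      ultimately show "runs cb (enc (st i)) (enc (st (Suc i))) (Z ^ e)" by simp
    next
      show "hd_sexp (enc (st k)) = Atom" by (simp add: st_def k_def)
    qed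
    have "runs cf (enc (st k)) (enc (?fin (st k))) (Z ^ e)"
      by (rule runs_mono[OF rf pw]) (use szst[of k] in \<open>simp_all add: e_def\<close>)
    then have 3: "runs cf (enc (st k)) (enc (F, S, x)) (Z ^ e)" by (simp add: st_def F_def)
    have "(F, S, x) \<in> solve_dom" using dom by (simp add: F_def k_def ts_def)
    from rs[OF this] have s: "runs cs (enc (F, S, x)) (enc (solve F S x)) ((sz (F, S, x) + 2) ^ ds)"
      by (simp only: fst_conv snd_conv)
    have 4: "runs cs (enc (F, S, x)) (enc (solve F S x)) (Z ^ e)"
      by (rule runs_mono[OF s pw]) (use P PF in \<open>simp_all add: e_def Z_def\<close>)
    have total: "Z ^ e + (k * (Z ^ e + 1) + 1 + (Z ^ e + Z ^ e + 1) + 1) + 1 \<le> Z ^ d"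
    proof -
      have "k * (Z ^ e + 1) \<le> Z * Z ^ e + Z" using mult_right_mono[OF kZ, of "Z ^ e + 1"] by (simp add: distrib_left)
      moreover have "1 \<le> Z ^ e" using Z10 by simp
      moreover have "10 * Z ^ e \<le> Z * Z ^ e" using Z10 by (rule mult_right_mono) simp
      moreover have "Z * 1 \<le> Z * Z ^ e" using Z10 by (intro mult_left_mono) auto
      ultimately have "Z ^ e + (k * (Z ^ e + 1) + 1 + (Z ^ e + Z ^ e + 1) + 1) + 1 \<le> 10 * (Z * Z ^ e)"
        by linarith
      also have "\<dots> \<le> Z * (Z * Z ^ e)" using Z10 by (rule mult_right_mono) simp
      also have "\<dots> = Z ^ (e + 2)" by simp
      also have "\<dots> \<le> Z ^ d" using Z10 by (intro power_increasing) (auto simp: d_def)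
      finally show ?thesis .
    qed
    show ?thesis
      using runs_mono[OF runs_Seq[OF 1 runs_Seq[OF 2 runs_Seq[OF 3 4]]] total]
      unfolding Z_def F_def k_def ts_def .
  qed
  moreover have "runs c1 (enc x) (enc (labels (length (snd (snd x))), ([] :: (nat \<times> nat) list), x)) ((sz x + 2) ^ d)" for x :: inst
    by (rule runs_mono[OF r1 power_increasing]) (auto simp: d_def)
  ultimately show ?thesis by blast
qed

lemma shortest_perfect_packing_empty:
  "shortest_perfect_packing V E {} {} {}"
  by (simp add: shortest_perfect_packing_def is_arg_min_def packing_size_def perfect_packing_def)

lemma enc_instance:
  "encode_instance n E A B = enc (sorted_list_of_set A, sorted_list_of_set B, adjacency_lists n E)"
  by (simp add: encode_instance_def enc_prod_def enc_list_def enc_nat_def)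

lemma enc_answer: "encode_answer = enc"
  by (simp add: encode_answer_def enc_option_def enc_list_def enc_nat_def)

lemma sz_instance:
  assumes "simple_graph {..<n} E" "A \<subseteq> {..<n}" "B \<subseteq> {..<n}"
  shows "sz (sorted_list_of_set A, sorted_list_of_set B, adjacency_lists n E) \<le> (n + 2) ^ 3"
proof -
  have nodes: "sz (sorted_list_of_set X) \<le> n * n" if "X \<subseteq> {..<n}" for X
    by (rule sz_node_list) (use that finite_subset[OF that] in auto)
  have "sz (adjacency_lists n E) \<le> length (adjacency_lists n E) * Suc (n * n)"
  proof (rule sz_list_le)
    fix l assume "l \<in> set (adjacency_lists n E)"
    then obtain u where u: "u < n" "l = sorted_list_of_set {v. {u, v} \<in> E}" by (auto simp: adjacency_lists_def)
    have "v < n" if "{u, v} \<in> E" for v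
      using assms(1) that unfolding simple_graph_def by (metis doubleton_eq_iff lessThan_iff)
    then show "sz l \<le> n * n" unfolding u(2) by (intro nodes) auto
  qed
  then have "sz (adjacency_lists n E) \<le> n * Suc (n * n)" by (simp add: adjacency_lists_def)
  then have "sz (sorted_list_of_set A, sorted_list_of_set B, adjacency_lists n E) \<le> 2 + n * n + n * n + n * Suc (n * n)"
    using nodes[OF assms(2)] nodes[OF assms(3)] by simp
  also have "\<dots> \<le> (n + 2) ^ 3" by (simp add: power3_eq_cube algebra_simps)
  finally show ?thesis .
qed

lemma set_random_select: "ys \<in> set_pmf (random_select xs []) \<Longrightarrow> sz ys \<le> sz xs"
  using sz_nths[of "rev xs"] by (auto simp: random_select_eq)

lemma pad_bound:
  fixes n z w :: nat
  assumes "z \<le> (n + 2) ^ 3" "w \<le> (n + 2) ^ 9"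
  shows "z + w + 4 \<le> (n + 2) ^ 10"
proof -
  have "(2::nat) ^ 3 \<le> (n + 2) ^ 3" by (rule power_mono) auto
  then have 8: "8 \<le> (n + 2) ^ 3" by simp
  have "2 * (n + 2) ^ 3 \<le> (n + 2) ^ 3 * (n + 2) ^ 3" by (rule mult_right_mono) (use 8 in auto)
  also have "\<dots> = (n + 2) ^ 6" by (simp flip: power_add)
  also have "\<dots> \<le> (n + 2) ^ 9" by (rule power_increasing) auto
  finally have "z + w + 4 \<le> 2 * (n + 2) ^ 9" using assms 8 by linarith
  also have "\<dots> \<le> (n + 2) * (n + 2) ^ 9" by (rule mult_right_mono) auto
  also have "\<dots> = (n + 2) ^ (1 + 9)" by (simp only: power_add power_one_right)
  finally show ?thesis by simp
qed

theorem theorem1p2: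
  "\<exists>(f :: real poly) (prog :: com) (C :: real).
     \<forall>(n :: nat) (E :: nat set set) (A :: nat set) (B :: nat set).
       simple_graph {..<n} E \<and> A \<subseteq> {..<n} \<and> B \<subseteq> {..<n} \<and> A \<inter> B = {} \<and>
       even (card A) \<and> even (card B) \<longrightarrow>
       (\<exists>t :: nat.
          real t \<le> C * poly f (real (card {..<n})) ^ (card A + card B) \<and>
          halts_within prog (encode_instance n E A B) t \<and>
          prob_output_within prog (encode_instance n E A B) t
            (encode_answer ` {ans. correct_answer {..<n} E A B ans}) \<ge> 1 / 2)"
proof -
  obtain c1 c2 d
    where c1: "\<And>x :: inst. runs c1 (enc x) (enc (labels (length (snd (snd x))), ([] :: (nat \<times> nat) list), x)) ((sz x + 2) ^ d)"
      and c2: "\<And>x S P. terminals x \<noteq> [] \<Longrightarrow> sz x + sz S + 4 \<le> P \<Longrightarrow> P = pad x \<Longrightarrow>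
        (P ^ length (terminals x), S, x) \<in> solve_dom \<Longrightarrow>
        runs c2 (enc (([] :: (nat \<times> nat) list), S, x)) (enc (solve (P ^ length (terminals x)) S x))
          ((10 * P ^ length (terminals x)) ^ d)"
    using program_exists by blast
  define main where "main = Seq c1 (Seq select_com c2)"
  \<comment> \<open>The tests ask whether the list of \<open>A\<close> or that of \<open>B\<close>
    is nonempty. Without terminals the empty packing is optimal, and the assigned tree is the
    encoding of \<open>Some []\<close>.\<close>
  define prog where "prog = If_Dot (Hd_of (Var 0)) main
    (If_Dot (Hd_of (Tl_of (Var 0))) main (Assign 0 (Cons_of Quote_Atom Quote_Atom)))"
  \<comment> \<open>\<open>[:2, 1:] ^ 10\<close> evaluates to the padding \<open>P\<close>. The
    exponent exceeds that of the last phase by 2, to leave room for the other phases and for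
    numerical constants.\<close>
  define f :: "real poly" where "f = ([:10:] * [:2, 1:] ^ 10) ^ (d + 2)"
  have f: "poly f (real m) = real ((10 * (m + 2) ^ 10) ^ (d + 2))" for m by (simp add: f_def add.commute)
  have "\<exists>t. real t \<le> 3 * poly f (real (card {..<n})) ^ (card A + card B) \<and>
          halts_within prog (encode_instance n E A B) t \<and>
          prob_output_within prog (encode_instance n E A B) t
            (encode_answer ` {ans. correct_answer {..<n} E A B ans}) \<ge> 1 / 2"
    if G: "simple_graph {..<n} E" "A \<subseteq> {..<n}" "B \<subseteq> {..<n}" "A \<inter> B = {}" "even (card A)" "even (card B)"
    for n E A B
  proof -
    let ?x = "(sorted_list_of_set A, sorted_list_of_set B, adjacency_lists n E)"
    let ?s = "(\<lambda>_. Atom)(0 := enc ?x) :: store"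
    have fin: "finite A" "finite B" using G(2,3) finite_subset by blast+
    show ?thesis
    proof (cases "card A + card B = 0")
      case True
      then have AB: "A = {}" "B = {}" using fin by auto
      \<comment> \<open>Two tests and one assignment. As the power in the bound has exponent 0 here,
        its constant 3 is exactly this running time.\<close>
      have "run prog (enc ?x) 3 = return_pmf ([], ?s(0 := Dot Atom Atom))"
        by (simp add: run_def initial_config_def prog_def AB eval_nat_numeral bind_return_pmf)
      moreover have "Dot Atom Atom \<in> encode_answer ` {ans. correct_answer {..<n} E A B ans}"
      proof (rule image_eqI)
        show "Dot Atom Atom = encode_answer (Some [])" by (simp add: enc_answer)
        show "Some [] \<in> {ans. correct_answer {..<n} E A B ans}"
          using shortest_perfect_packing_empty by (simp add: correct_answer_def AB)
      qed
      ultimately show ?thesis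
        using True by (intro exI[of _ 3]) (simp add: enc_instance halts_within_def prob_output_within_def)
    next
      case False
      then have pos: "card A + card B > 0" by simp
      define k where "k = card A + card B"
      define P where "P = pad ?x"
      define F where "F = P ^ k"
      have len: "length (terminals ?x) = k" using fin by (simp add: terminals_def k_def)
      have adj: "length (adjacency_lists n E) = n" by (simp add: adjacency_lists_def)
      have P: "P = (n + 2) ^ 10" by (simp add: P_def pad_def adj)
      have fuel: "(n + 2) ^ (8 * (card A + card B)) \<le> F"
        unfolding F_def P k_def power_mult[symmetric] by (rule power_increasing) auto
      have bnd: "sz ?x + sz S + 4 \<le> P" if "sz S \<le> sz (labels n)" for S :: "(nat \<times> nat) list"
        unfolding P using order_trans[OF that sz_labels] by (rule pad_bound[OF sz_instance[OF G(1-3)]])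
      let ?rest = "c2"
      let ?F = "\<lambda>S. enc (solve F S ?x)"
      let ?Z = "10 * F"
      have PF: "P \<le> F" unfolding F_def using pos by (intro self_le_power) (auto simp: P k_def)
      obtain t1 s1 where t1: "t1 \<le> 4 + (sz ?x + 2) ^ d" "reaches ([prog], ?s) t1 ([select_com, c2], s1)"
        "s1 0 = Dot (enc (labels n)) (Dot (enc ([] :: (nat \<times> nat) list)) (enc ?x))"
      proof -
        have main: "\<exists>t \<le> 2. reaches ([prog], ?s) t ([main], ?s)"
        proof (cases "sorted_list_of_set A")
          case Nil
          then have "sorted_list_of_set B \<noteq> []" using fin pos by auto
          then obtain b bs where B: "sorted_list_of_set B = b # bs" by (cases "sorted_list_of_set B") auto
          have "reaches ([prog], ?s) 1 ([If_Dot (Hd_of (Tl_of (Var 0))) main (Assign 0 (Cons_of Quote_Atom Quote_Atom))], ?s)"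
            by (rule reaches_step) (simp add: prog_def Nil)
          also have "reaches \<dots> 1 ([main], ?s)" by (rule reaches_step) (simp add: B)
          finally show ?thesis by (intro exI[of _ "1 + 1"]) simp
        next
          case (Cons a as)
          have "reaches ([prog], ?s) 1 ([main], ?s)" by (rule reaches_step) (simp add: prog_def Cons)
          then show ?thesis by (intro exI[of _ 1]) simp
        qed
        then obtain t0 where t0: "t0 \<le> 2" "reaches ([prog], ?s) t0 ([main], ?s)" by blast
        have s0: "?s 0 = enc ?x" by simp
        obtain s1 u where u: "u \<le> (sz ?x + 2) ^ d" "reaches ([c1, Seq select_com c2], ?s) u ([Seq select_com c2], s1)"
          "s1 0 = enc (labels (length (snd (snd ?x))), ([] :: (nat \<times> nat) list), ?x)"
          using runsE[OF c1[of ?x], where s = ?s and cs = "[Seq select_com c2]"] s0 by blast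
        note t0(2)
        also have "reaches ([main], ?s) 1 ([c1, Seq select_com c2], ?s)" by (rule reaches_step) (simp add: main_def)
        also note u(2)
        also have "reaches ([Seq select_com c2], s1) 1 ([select_com, c2], s1)" by (rule reaches_step) simp
        finally show thesis by (rule that[rotated]) (use t0(1) u(1,3) in \<open>simp_all add: adj\<close>)
      qed
      have init: "reaches (initial_config prog (enc ?x)) t1 ([select_com, c2], s1)"
        using t1(2) by (simp add: initial_config_def)
      have rest: "runs c2 (Dot Atom (Dot (enc S) (enc ?x))) (?F S) (?Z ^ d)"
        if S: "S \<in> set_pmf (random_select (labels n) [])" for S
      proof -
        have inst: "instance_setup n E A B F" using G pos fuel by unfold_locales
        have "terminals ?x \<noteq> []" using len pos by (auto simp: k_def)
        moreover have "(P ^ length (terminals ?x), S, ?x) \<in> solve_dom"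
          using instance_setup.solve_dom[OF inst] unfolding instance_setup.x_def[OF inst] len F_def .
        ultimately have "runs c2 (enc (([] :: (nat \<times> nat) list), S, ?x)) (enc (solve (P ^ length (terminals ?x)) S ?x))
          ((10 * P ^ length (terminals ?x)) ^ d)"
          using bnd[OF set_random_select[OF S]] by (intro c2) (simp_all only: P_def not_False_eq_True)
        then show ?thesis unfolding len F_def[symmetric] by simp
      qed
      let ?t = "t1 + (5 * length (labels n) + 1) + ?Z ^ d"
      have halts: "halts_within prog (encode_instance n E A B) ?t"
        unfolding enc_instance by (rule run_select(1)[OF init t1(3) rest])
      have "prob_output_within prog (encode_instance n E A B) ?t (encode_answer ` {ans. correct_answer {..<n} E A B ans}) =
          measure_pmf.prob (random_select (labels n) []) {S. ?F S \<in> encode_answer ` {ans. correct_answer {..<n} E A B ans}}"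
        unfolding enc_instance by (rule run_select(2)[OF init t1(3) rest])
      moreover have "measure_pmf.prob (random_select (labels n) []) {S. correct_answer {..<n} E A B (solve F S ?x)} \<le>
          measure_pmf.prob (random_select (labels n) []) {S. ?F S \<in> encode_answer ` {ans. correct_answer {..<n} E A B ans}}"
        by (rule measure_pmf.finite_measure_mono) (auto simp: enc_answer)
      ultimately have prob: "1 / 2 \<le> prob_output_within prog (encode_instance n E A B) ?t
          (encode_answer ` {ans. correct_answer {..<n} E A B ans})"
        using prob_correct[OF G pos fuel] by linarith
      \<comment> \<open>All phases together cost at most ten times \<open>?Z * ?Z ^ d\<close>, and
        one more factor \<open>?Z\<close> absorbs the ten.\<close>
      have "?t \<le> (10 * P ^ k) ^ (d + 2)"
      proof -
        have b: "sz ?x + sz (labels n) + 4 \<le> P" by (rule bnd) simp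
        have Z10: "10 \<le> ?Z" using b PF by linarith
        have "(sz ?x + 2) ^ d \<le> ?Z ^ d" using b PF by (intro power_mono) linarith+
        moreover have "length (labels n) \<le> ?Z" using length_le_sz[of "labels n"] b PF by linarith
        moreover have "1 \<le> ?Z ^ d" using Z10 by (intro one_le_power) linarith
        moreover have "?Z * 1 \<le> ?Z * ?Z ^ d" using \<open>1 \<le> ?Z ^ d\<close> by (rule mult_left_mono) simp
        moreover have "10 * ?Z ^ d \<le> ?Z * ?Z ^ d" using Z10 by (rule mult_right_mono) simp
        ultimately have "?t \<le> 10 * (?Z * ?Z ^ d)" using t1(1) by linarith
        also have "\<dots> \<le> ?Z * (?Z * ?Z ^ d)" using Z10 by (rule mult_right_mono) simp
        finally show ?thesis by (simp add: F_def)
      qed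
      also have "\<dots> \<le> ((10 * P) ^ k) ^ (d + 2)"
      proof (rule power_mono)
        \<comment> \<open>The factor 10 can be moved under the exponent because \<open>k\<close> is
          positive.\<close>
        have "(10::nat) ^ 1 \<le> 10 ^ k" using pos by (intro power_increasing) (auto simp: k_def)
        then show "10 * P ^ k \<le> (10 * P) ^ k" by (simp add: power_mult_distrib)
      qed simp
      also have "\<dots> = ((10 * P) ^ (d + 2)) ^ k" by (simp only: power_mult[symmetric] mult.commute)
      finally have "real ?t \<le> real (((10 * P) ^ (d + 2)) ^ k)" by (simp only: of_nat_le_iff)
      also have "\<dots> = poly f (real (card {..<n})) ^ (card A + card B)"
        unfolding card_lessThan f k_def[symmetric] P by (simp only: of_nat_power)
      also have "\<dots> \<le> 3 * poly f (real (card {..<n})) ^ (card A + card B)"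
        unfolding card_lessThan f by (simp del: of_nat_power)
      finally show ?thesis using halts prob by blast
    qed
  qed
  then show ?thesis by (intro exI[of _ f] exI[of _ prog] exI[of _ 3]) blast
qed


end
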